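(* Let $\mathcal H$, $f$ (with non-smooth point $n_f$) and $J$ satisfy the assumptions listed in the context. Let $\bar\ell\in H^1(0,T;L^2(\Omega))$ be locally optimal for the optimal control problem (P), with associated states $\bar q\in H^1_0(0,T;L^2(\Omega))$ and $\bar\varphi\in L^2(0,T;H^1(\Omega))$, i.e. $(\bar q,\bar\varphi)=S(\bar\ell)$, and put $\bar z:=-\beta(\bar q-\bar\varphi)-(f\circ\mathcal H)(\bar q)$. If the set $\{(t,x)\in(0,T)\times\Omega:\mathcal H(\bar q)(t,x)=n_f\}$ has measure zero, then there exist unique adjoint states $\xi\in H^1_T(0,T;L^2(\Omega))$ and $w\in L^2(0,T;H^1(\Omega))$ and a unique multiplier $\lambda\in L^\infty(0,T;L^2(\Omega))$ such that $$-\dot\xi-\beta(w-\lambda)+[(f\circ\mathcal H)'(\bar q)]^\star(\lambda)=\partial_qj(\bar q,\bar\varphi)\ \text{ in }L^2(0,T;L^2(\Omega)),\qquad\xi(T)=0,$$ $$-\alpha\Delta w+\beta(w-\lambda)=\partial_\varphi j(\bar q,\bar\varphi)\ \text{ in }L^2(0,T;H^1(\Omega)^* ),$$ $$\lambda(t,x)=\tfrac1\epsilon\chi_{\{\bar z>0\}}(t,x)\,\xi(t,x)\ \text{ a.e. where }\bar z(t,x)\ne0,$$ $$0\le\lambda(t,x)\le\tfrac1\epsilon\xi(t,x)\ \text{ a.e. where }\bar z(t,x)=0,$$ $$(w,\delta\ell)_{L^2(0,T;L^2(\Omega))}+(\bar\ell,\delta\ell)_{H^1(0,T;L^2(\Omega))}=0\quad\forall\,\delta\ell\in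 H^1(0,T;L^2(\Omega)).$$ Moreover, this system is of strong stationary type: if $\bar\ell\in H^1(0,T;L^2(\Omega))$ together with its states $(\bar q,\bar\varphi)=S(\bar\ell)$ (such that $\{\mathcal H(\bar q)=n_f\}$ has measure zero), some adjoint states $(\xi,w)\in H^1_T(0,T;L^2(\Omega))\times L^2(0,T;H^1(\Omega))$ and a multiplier $\lambda\in L^\infty(0,T;L^2(\Omega))$ satisfies the five relations above, then it also satisfies $$j'(S(\bar\ell))S'(\bar\ell;\delta\ell)+(\bar\ell,\delta\ell)_{H^1(0,T;L^2(\Omega))}\ge0\quad\forall\,\delta\ell\in H^1(0,T;L^2(\Omega)).$$
   Context: Setting: $T>0$; $\Omega\subset\mathbb R^N$, $N\in\{2,3\}$, is a bounded Lipschitz domain; $\alpha,\beta,\epsilon>0$ are constants. $\Delta:H^1(\Omega)\to H^1(\Omega)^*$ is given by $\langle\Delta\eta,\psi\rangle=-\int_\Omega\nabla\eta\cdot\nabla\psi\,dx$. $\max(x):=\max\{x,0\}$. Scalar functions also denote their Nemytskii operators. $H^1_0(0,T;X)=\{z\in H^1(0,T;X):z(0)=0\}$, $H^1_T(0,T;X)=\{z\in H^1(0,T;X):z(T)=0\}$. A dot is the time derivative, $\chi_M$ a characteristic function, $A^\star$ the (Hilbert space) adjoint of a bounded linear operator $A$ on $L^2(0,T;L^2(\Omega))$. Assumptions on $\mathcal H$: (a) $\mathcal H:L^2(0,T;L^2(\Omega))\to L^2(0,T;L^2(\Omega))$ and there is $L_{\mathcal H}>0$ with $\|\mathcal H(q_1)(t)-\mathcal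 H(q_2)(t)\|_{L^2(\Omega)}\le L_{\mathcal H}\int_0^t\|q_1(s)-q_2(s)\|_{L^2(\Omega)}ds$ a.e. in $(0,T)$ for all $q_1,q_2$; (b) $\mathcal H$ is Gâteaux differentiable on $L^2(0,T;L^2(\Omega))$, with derivative $q\mapsto\mathcal H'(q)$ continuous on $H^1(0,T;L^2(\Omega))$; (c) $\mathcal H$ maps $L^2(0,T;L^\infty(\Omega))$ to itself and $\|\mathcal H(q_1)(t)-\mathcal H(q_2)(t)\|_{L^\infty(\Omega)}\le\widehat L_{\mathcal H}\int_0^t\|q_1(s)-q_2(s)\|_{L^\infty(\Omega)}ds$ a.e. in $(0,T)$ for all $q_1,q_2\in L^2(0,T;L^\infty(\Omega))$, with some $\widehat L_{\mathcal H}>0$. Assumptions on $f:\mathbb R\to\mathbb R$: $f$ is Lipschitz continuous with constant $L_f>0$, directionally differentiable, and has a single non-differentiable point $n_f\in\mathbb R$. When $\{\mathcal H(\bar q)=n_f\}$ has measure zero, $(f\circ\mathcal H)'(\bar q)$ is the bounded linear operator $\eta\mapsto f'(\mathcal H(\bar q))\,\mathcal H'(\bar q)(\eta)$ on $L^2(0,T;L^2(\Omega))$. State system: for every $\ell\in L^2(0,T;H^1(\Omega)^* )$ there is a unique $(q,\varphi)=:S(\ell)\in H^1_0(0,T;L^2(\Omega))\times L^2(0,T;H^1(\Omega))$ such that, a.e. in $(0,T)$, $\dot q(t)=\frac1\epsilon\max(-\beta(q(t)-\varphi(t))-(f\circ\mathcal H)(q)(t))$ in $L^2(\Omega)$, $q(0)=0$,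 and $-\alpha\Delta\varphi(t)+\beta\varphi(t)=\beta q(t)+\ell(t)$ in $H^1(\Omega)^*$. The map $S$ is directionally differentiable from $L^2(0,T;H^1(\Omega)^* )$ to $H^1_0(0,T;L^2(\Omega))\times L^2(0,T;H^1(\Omega))$, and $S'(\ell;\delta\ell)$ denotes its directional derivative. Problem (P): minimize $J(S(\ell),\ell)$ over $\ell\in H^1(0,T;L^2(\Omega))$, where $J(q,\varphi,\ell)=j(q,\varphi)+\frac12\|\ell\|^2_{H^1(0,T;L^2(\Omega))}$ and $j:L^2(0,T;L^2(\Omega))\times L^2(0,T;H^1(\Omega))\to\mathbb R$ is continuously Fréchet differentiable. Local optimality is with respect to the $H^1(0,T;L^2(\Omega))$-norm. *)

theory Defs
  imports
    "HOL-Analysis.Analysis"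
    "HOL-Library.Function_Algebras"
    "HOL-Probability.Essential_Supremum"
begin

instantiation "fun" :: (type, real_vector) real_vector
begin

definition scaleR_fun :: "real \<Rightarrow> ('a \<Rightarrow> 'b) \<Rightarrow> 'a \<Rightarrow> 'b" where
  "scaleR_fun c f = (\<lambda>x. c *\<^sub>R f x)"

instance
  by standard
    (simp_all add: fun_eq_iff scaleR_fun_def plus_fun_def scaleR_add_right scaleR_add_left)

end

section \<open>Seminormed spaces\<close>

text \<open>
  Function spaces are represented by their representatives, that is by a carrier set of functions
  together with a seminorm that vanishes exactly on the functions that are zero almost everywhere.
  Equality in such a space is equality up to seminorm zero, i.e. equality almost everywhere.
\<close>

record 'v seminormed =
  elems :: "'v set"
  nrm :: "'v \<Rightarrow> real"

definition real_space :: "real seminormed" where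
  "real_space = \<lparr>elems = UNIV, nrm = abs\<rparr>"

definition prod_space :: "'v seminormed \<Rightarrow> 'w seminormed \<Rightarrow> ('v \<times> 'w) seminormed" where
  "prod_space X Y =
    \<lparr>elems = elems X \<times> elems Y,
     nrm = (\<lambda>p. sqrt ((nrm X (fst p))\<^sup>2 + (nrm Y (snd p))\<^sup>2))\<rparr>"

text \<open>Linearity is required only up to seminorm zero, i.e. on equivalence classes.\<close>

definition bounded_linear_op ::
    "'v::real_vector seminormed \<Rightarrow> 'w::real_vector seminormed \<Rightarrow> ('v \<Rightarrow> 'w) \<Rightarrow> bool" where
  "bounded_linear_op X Y A \<longleftrightarrow>
    (\<forall>v\<in>elems X. A v \<in> elems Y) \<and>
    (\<forall>u\<in>elems X. \<forall>v\<in>elems X. nrm Y (A (u + v) - (A u + A v)) = 0) \<and>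
    (\<forall>c. \<forall>v\<in>elems X. nrm Y (A (c *\<^sub>R v) - c *\<^sub>R A v) = 0) \<and>
    (\<exists>C. \<forall>v\<in>elems X. nrm Y (A v) \<le> C * nrm X v)"

definition op_norm :: "'v seminormed \<Rightarrow> 'w seminormed \<Rightarrow> ('v \<Rightarrow> 'w) \<Rightarrow> real" where
  "op_norm X Y A = Sup {nrm Y (A v) |v. v \<in> elems X \<and> nrm X v \<le> 1}"

definition dual_space :: "'v::real_vector seminormed \<Rightarrow> ('v \<Rightarrow> real) seminormed" where
  "dual_space X =
    \<lparr>elems = {g. bounded_linear_op X real_space g}, nrm = op_norm X real_space\<rparr>"

definition has_gateaux_deriv ::
    "'v::real_vector seminormed \<Rightarrow> 'w::real_vector seminormed \<Rightarrow> ('v \<Rightarrow> 'w) \<Rightarrow> 'v \<Rightarrow> ('v \<Rightarrow> 'w) \<Rightarrow> bool"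
  where
  "has_gateaux_deriv X Y F x D \<longleftrightarrow> bounded_linear_op X Y D \<and>
    (\<forall>h\<in>elems X.
      ((\<lambda>\<tau>. nrm Y ((1 / \<tau>) *\<^sub>R (F (x + \<tau> *\<^sub>R h) - F x) - D h)) \<longlongrightarrow> 0) (at (0::real)))"

definition gateaux_deriv ::
    "'v::real_vector seminormed \<Rightarrow> 'w::real_vector seminormed \<Rightarrow> ('v \<Rightarrow> 'w) \<Rightarrow> 'v \<Rightarrow> ('v \<Rightarrow> 'w)" where
  "gateaux_deriv X Y F x = (SOME D. has_gateaux_deriv X Y F x D)"

definition has_frechet_deriv ::
    "'v::real_vector seminormed \<Rightarrow> 'w::real_vector seminormed \<Rightarrow> ('v \<Rightarrow> 'w) \<Rightarrow> 'v \<Rightarrow> ('v \<Rightarrow> 'w) \<Rightarrow> bool"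
  where
  "has_frechet_deriv X Y F x D \<longleftrightarrow> bounded_linear_op X Y D \<and>
    (\<forall>e>0. \<exists>d>0. \<forall>h\<in>elems X. nrm X h < d \<longrightarrow> nrm Y (F (x + h) - F x - D h) \<le> e * nrm X h)"

definition frechet_deriv ::
    "'v::real_vector seminormed \<Rightarrow> 'w::real_vector seminormed \<Rightarrow> ('v \<Rightarrow> 'w) \<Rightarrow> 'v \<Rightarrow> ('v \<Rightarrow> 'w)" where
  "frechet_deriv X Y F x = (SOME D. has_frechet_deriv X Y F x D)"

text \<open>
  Continuity of \<open>D\<close> on \<open>Z\<close>, in the seminorm of \<open>Z\<close>, as a map into the bounded linear operators
  from \<open>X\<close> to \<open>Y\<close> with the operator norm.
\<close>

definition continuous_op_valued ::
    "'z::real_vector seminormed \<Rightarrow> 'v seminormed \<Rightarrow> 'w::minus seminormed \<Rightarrow> ('z \<Rightarrow> 'v \<Rightarrow> 'w) \<Rightarrow> bool"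
  where
  "continuous_op_valued Z X Y D \<longleftrightarrow>
    (\<forall>x\<in>elems Z. \<forall>e>0. \<exists>d>0. \<forall>y\<in>elems Z.
      nrm Z (y - x) < d \<longrightarrow> op_norm X Y (\<lambda>v. D y v - D x v) < e)"

definition continuously_frechet_differentiable ::
    "'v::real_vector seminormed \<Rightarrow> 'w::real_vector seminormed \<Rightarrow> ('v \<Rightarrow> 'w) \<Rightarrow> bool" where
  "continuously_frechet_differentiable X Y F \<longleftrightarrow>
    (\<forall>x\<in>elems X. F x \<in> elems Y \<and> (\<exists>D. has_frechet_deriv X Y F x D)) \<and>
    continuous_op_valued X X Y (frechet_deriv X Y F)"

definition dir_deriv ::
    "'w::real_vector seminormed \<Rightarrow> ('v::real_vector \<Rightarrow> 'w) \<Rightarrow> 'v \<Rightarrow> 'v \<Rightarrow> 'w" where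
  "dir_deriv Y F x h = (SOME d. d \<in> elems Y \<and>
    ((\<lambda>\<tau>. nrm Y ((1 / \<tau>) *\<^sub>R (F (x + \<tau> *\<^sub>R h) - F x) - d)) \<longlongrightarrow> 0) (at_right (0::real)))"

section \<open>Function spaces on the spatial domain\<close>

text \<open>Near every boundary point, after a rotation taking the last unit vector to \<open>e\<close>, the set
  is the strict epigraph of a Lipschitz function on the hyperplane orthogonal to \<open>e\<close>.\<close>

definition bounded_lipschitz_domain :: "'a::euclidean_space set \<Rightarrow> bool" where
  "bounded_lipschitz_domain \<Omega> \<longleftrightarrow>
    open \<Omega> \<and> connected \<Omega> \<and> \<Omega> \<noteq> {} \<and> bounded \<Omega> \<and>
    (\<forall>p\<in>frontier \<Omega>. \<exists>e r L \<gamma>. norm e = 1 \<and> r > 0 \<and> L-lipschitz_on {y. y \<bullet> e = 0} \<gamma> \<and>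
      (\<forall>x\<in>ball p r. x \<in> \<Omega> \<longleftrightarrow> \<gamma> (x - (x \<bullet> e) *\<^sub>R e) < x \<bullet> e))"

primrec C_k :: "nat \<Rightarrow> ('a::euclidean_space \<Rightarrow> real) \<Rightarrow> bool" where
  "C_k 0 \<phi> \<longleftrightarrow> continuous_on UNIV \<phi>"
| "C_k (Suc k) \<phi> \<longleftrightarrow> (\<forall>x. \<phi> differentiable (at x)) \<and>
    (\<forall>b. C_k k (\<lambda>x. frechet_derivative \<phi> (at x) b))"

definition test_functions :: "'a::euclidean_space set \<Rightarrow> ('a \<Rightarrow> real) set" where
  "test_functions \<Omega> = {\<phi>. (\<forall>k. C_k k \<phi>) \<and>
    compact (closure {x. \<phi> x \<noteq> 0}) \<and> closure {x. \<phi> x \<noteq> 0} \<subseteq> \<Omega>}"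

definition L2_inner :: "(real^'n) set \<Rightarrow> (real^'n \<Rightarrow> real) \<Rightarrow> (real^'n \<Rightarrow> real) \<Rightarrow> real" where
  "L2_inner \<Omega> u v = (LINT x|lebesgue_on \<Omega>. u x * v x)"

definition L2 :: "(real^'n) set \<Rightarrow> (real^'n \<Rightarrow> real) seminormed" where
  "L2 \<Omega> =
    \<lparr>elems = {u \<in> borel_measurable (lebesgue_on \<Omega>). integrable (lebesgue_on \<Omega>) (\<lambda>x. (u x)\<^sup>2)},
     nrm = (\<lambda>u. sqrt (L2_inner \<Omega> u u))\<rparr>"

definition Linf :: "(real^'n) set \<Rightarrow> (real^'n \<Rightarrow> real) seminormed" where
  "Linf \<Omega> =
    \<lparr>elems = {u \<in> borel_measurable (lebesgue_on \<Omega>). \<exists>C. AE x in lebesgue_on \<Omega>. \<bar>u x\<bar> \<le> C},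
     nrm = (\<lambda>u. real_of_ereal (esssup (lebesgue_on \<Omega>) (\<lambda>x. ereal \<bar>u x\<bar>)))\<rparr>"

definition has_weak_gradient ::
    "(real^'n) set \<Rightarrow> (real^'n \<Rightarrow> real) \<Rightarrow> (real^'n \<Rightarrow> real^'n) \<Rightarrow> bool" where
  "has_weak_gradient \<Omega> u G \<longleftrightarrow> (\<forall>i. (\<lambda>x. G x $ i) \<in> elems (L2 \<Omega>)) \<and>
    (\<forall>\<phi>\<in>test_functions \<Omega>. \<forall>i.
      (LINT x|lebesgue_on \<Omega>. u x * frechet_derivative \<phi> (at x) (axis i 1)) =
      - (LINT x|lebesgue_on \<Omega>. G x $ i * \<phi> x))"

definition weak_gradient :: "(real^'n) set \<Rightarrow> (real^'n \<Rightarrow> real) \<Rightarrow> (real^'n \<Rightarrow> real^'n)" where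
  "weak_gradient \<Omega> u = (SOME G. has_weak_gradient \<Omega> u G)"

definition H1 :: "(real^'n) set \<Rightarrow> (real^'n \<Rightarrow> real) seminormed" where
  "H1 \<Omega> =
    \<lparr>elems = {u \<in> elems (L2 \<Omega>). \<exists>G. has_weak_gradient \<Omega> u G},
     nrm = (\<lambda>u. sqrt (L2_inner \<Omega> u u +
       (LINT x|lebesgue_on \<Omega>. weak_gradient \<Omega> u x \<bullet> weak_gradient \<Omega> u x)))\<rparr>"

definition Laplace :: "(real^'n) set \<Rightarrow> (real^'n \<Rightarrow> real) \<Rightarrow> ((real^'n \<Rightarrow> real) \<Rightarrow> real)" where
  "Laplace \<Omega> \<eta> = (\<lambda>\<psi>. - (LINT x|lebesgue_on \<Omega>. weak_gradient \<Omega> \<eta> x \<bullet> weak_gradient \<Omega> \<psi> x))"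

section \<open>Bochner spaces\<close>

definition strongly_measurable :: "real \<Rightarrow> 'v::minus seminormed \<Rightarrow> (real \<Rightarrow> 'v) \<Rightarrow> bool" where
  "strongly_measurable T X u \<longleftrightarrow>
    (AE t in lebesgue_on {0<..<T}. u t \<in> elems X) \<and>
    (\<exists>s. (\<forall>k::nat. simple_function (lebesgue_on {0<..<T}) (s k) \<and> s k ` {0<..<T} \<subseteq> elems X) \<and>
      (AE t in lebesgue_on {0<..<T}. (\<lambda>k. nrm X (u t - s k t)) \<longlonglongrightarrow> 0))"

definition L2_time :: "real \<Rightarrow> 'v::minus seminormed \<Rightarrow> (real \<Rightarrow> 'v) seminormed" where
  "L2_time T X =
    \<lparr>elems = {u. strongly_measurable T X u \<and>
       integrable (lebesgue_on {0<..<T}) (\<lambda>t. (nrm X (u t))\<^sup>2)},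
     nrm = (\<lambda>u. sqrt (LINT t|lebesgue_on {0<..<T}. (nrm X (u t))\<^sup>2))\<rparr>"

text \<open>
  For a space \<open>X\<close> of functions on \<open>\<Omega>\<close>, an element of \<open>L\<^sup>2(0,T;X)\<close> or \<open>L\<^sup>\<infinity>(0,T;X)\<close> is represented by
  a jointly measurable function of \<open>(t,x)\<close>. Every Bochner class has such a representative, unique up
  to null sets of the cylinder; an arbitrary choice of representatives of \<open>u(t)\<close> for each \<open>t\<close>
  would make pointwise statements on the cylinder meaningless.
\<close>

definition cylinder :: "real \<Rightarrow> (real^'n) set \<Rightarrow> (real \<times> (real^'n)) set" where
  "cylinder T \<Omega> = {0<..<T} \<times> \<Omega>"

definition jointly_measurable ::
    "real \<Rightarrow> (real^'n) set \<Rightarrow> (real \<Rightarrow> real^'n \<Rightarrow> real) \<Rightarrow> bool" where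
  "jointly_measurable T \<Omega> u \<longleftrightarrow>
    (\<lambda>(t, x). u t x) \<in> borel_measurable (lebesgue_on (cylinder T \<Omega>))"

definition L2_fun :: "real \<Rightarrow> (real^'n) set \<Rightarrow> (real^'n \<Rightarrow> real) seminormed
    \<Rightarrow> (real \<Rightarrow> real^'n \<Rightarrow> real) seminormed" where
  "L2_fun T \<Omega> X =
    \<lparr>elems = {u \<in> elems (L2_time T X). jointly_measurable T \<Omega> u}, nrm = nrm (L2_time T X)\<rparr>"

definition Linf_fun :: "real \<Rightarrow> (real^'n) set \<Rightarrow> (real^'n \<Rightarrow> real) seminormed
    \<Rightarrow> (real \<Rightarrow> real^'n \<Rightarrow> real) set" where
  "Linf_fun T \<Omega> X = {u. strongly_measurable T X u \<and> jointly_measurable T \<Omega> u \<and>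
    (\<exists>C. AE t in lebesgue_on {0<..<T}. nrm X (u t) \<le> C)}"

abbreviation L2L2 :: "real \<Rightarrow> (real^'n) set \<Rightarrow> (real \<Rightarrow> real^'n \<Rightarrow> real) seminormed" where
  "L2L2 T \<Omega> \<equiv> L2_fun T \<Omega> (L2 \<Omega>)"

abbreviation L2H1 :: "real \<Rightarrow> (real^'n) set \<Rightarrow> (real \<Rightarrow> real^'n \<Rightarrow> real) seminormed" where
  "L2H1 T \<Omega> \<equiv> L2_fun T \<Omega> (H1 \<Omega>)"

abbreviation L2Linf :: "real \<Rightarrow> (real^'n) set \<Rightarrow> (real \<Rightarrow> real^'n \<Rightarrow> real) seminormed" where
  "L2Linf T \<Omega> \<equiv> L2_fun T \<Omega> (Linf \<Omega>)"

definition L2L2_inner :: "real \<Rightarrow> (real^'n) set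
    \<Rightarrow> (real \<Rightarrow> real^'n \<Rightarrow> real) \<Rightarrow> (real \<Rightarrow> real^'n \<Rightarrow> real) \<Rightarrow> real" where
  "L2L2_inner T \<Omega> u v = (LINT t|lebesgue_on {0<..<T}. L2_inner \<Omega> (u t) (v t))"

text \<open>
  The defining identity \<open>\<integral> \<phi>'(t) y(t) dt = - \<integral> \<phi>(t) z(t) dt\<close> holds in \<open>L\<^sup>2(\<Omega>)\<close>; for jointly
  measurable representatives these Bochner integrals are the pointwise integrals for a.e. \<open>x\<close>.
\<close>

definition has_weak_time_deriv :: "real \<Rightarrow> (real^'n) set
    \<Rightarrow> (real \<Rightarrow> real^'n \<Rightarrow> real) \<Rightarrow> (real \<Rightarrow> real^'n \<Rightarrow> real) \<Rightarrow> bool" where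
  "has_weak_time_deriv T \<Omega> y z \<longleftrightarrow> z \<in> elems (L2L2 T \<Omega>) \<and>
    (\<forall>\<phi>\<in>test_functions {0<..<T}. AE x in lebesgue_on \<Omega>.
      (LINT t|lebesgue_on {0<..<T}. deriv \<phi> t * y t x) =
      - (LINT t|lebesgue_on {0<..<T}. \<phi> t * z t x))"

definition time_deriv :: "real \<Rightarrow> (real^'n) set
    \<Rightarrow> (real \<Rightarrow> real^'n \<Rightarrow> real) \<Rightarrow> (real \<Rightarrow> real^'n \<Rightarrow> real)" where
  "time_deriv T \<Omega> y = (SOME z. has_weak_time_deriv T \<Omega> y z)"

definition H1L2_inner :: "real \<Rightarrow> (real^'n) set
    \<Rightarrow> (real \<Rightarrow> real^'n \<Rightarrow> real) \<Rightarrow> (real \<Rightarrow> real^'n \<Rightarrow> real) \<Rightarrow> real" where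
  "H1L2_inner T \<Omega> u v =
    L2L2_inner T \<Omega> u v + L2L2_inner T \<Omega> (time_deriv T \<Omega> u) (time_deriv T \<Omega> v)"

definition H1L2 :: "real \<Rightarrow> (real^'n) set \<Rightarrow> (real \<Rightarrow> real^'n \<Rightarrow> real) seminormed" where
  "H1L2 T \<Omega> =
    \<lparr>elems = {y \<in> elems (L2L2 T \<Omega>). \<exists>z. has_weak_time_deriv T \<Omega> y z},
     nrm = (\<lambda>y. sqrt (H1L2_inner T \<Omega> y y))\<rparr>"

text \<open>The representative of \<open>y\<close> that is continuous from \<open>[0,T]\<close> to \<open>X\<close> vanishes at \<open>t\<^sub>0\<close>.\<close>

definition vanishes_at :: "real \<Rightarrow> 'v::minus seminormed \<Rightarrow> (real \<Rightarrow> 'v) \<Rightarrow> real \<Rightarrow> bool" where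
  "vanishes_at T X y t\<^sub>0 \<longleftrightarrow> (\<exists>yc. (\<forall>t\<in>{0..T}. yc t \<in> elems X \<and>
      ((\<lambda>s. nrm X (yc s - yc t)) \<longlongrightarrow> 0) (at t within {0..T})) \<and>
    (AE t in lebesgue_on {0<..<T}. nrm X (y t - yc t) = 0) \<and> nrm X (yc t\<^sub>0) = 0)"

definition H1L2_vanishing :: "real \<Rightarrow> (real^'n) set \<Rightarrow> real
    \<Rightarrow> (real \<Rightarrow> real^'n \<Rightarrow> real) seminormed" where
  "H1L2_vanishing T \<Omega> t\<^sub>0 =
    \<lparr>elems = {y \<in> elems (H1L2 T \<Omega>). vanishes_at T (L2 \<Omega>) y t\<^sub>0}, nrm = nrm (H1L2 T \<Omega>)\<rparr>"

text \<open>The embedding of \<open>L\<^sup>2(0,T;L\<^sup>2(\<Omega>))\<close> into \<open>L\<^sup>2(0,T;H\<^sup>1(\<Omega>)\<^sup>*)\<close>.\<close>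

definition embed_dual :: "(real^'n) set \<Rightarrow> (real \<Rightarrow> real^'n \<Rightarrow> real)
    \<Rightarrow> (real \<Rightarrow> (real^'n \<Rightarrow> real) \<Rightarrow> real)" where
  "embed_dual \<Omega> l = (\<lambda>t v. L2_inner \<Omega> (l t) v)"

definition hilbert_adjoint :: "real \<Rightarrow> (real^'n) set
    \<Rightarrow> ((real \<Rightarrow> real^'n \<Rightarrow> real) \<Rightarrow> (real \<Rightarrow> real^'n \<Rightarrow> real))
    \<Rightarrow> ((real \<Rightarrow> real^'n \<Rightarrow> real) \<Rightarrow> (real \<Rightarrow> real^'n \<Rightarrow> real))" where
  "hilbert_adjoint T \<Omega> A = (\<lambda>\<mu>. SOME \<nu>. \<nu> \<in> elems (L2L2 T \<Omega>) \<and>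
    (\<forall>\<eta>\<in>elems (L2L2 T \<Omega>). L2L2_inner T \<Omega> \<nu> \<eta> = L2L2_inner T \<Omega> \<mu> (A \<eta>)))"

text \<open>
  Bounded functionals on \<open>L\<^sup>2(0,T;L\<^sup>2(\<Omega>))\<close> and \<open>L\<^sup>2(0,T;H\<^sup>1(\<Omega>))\<close> are identified with elements of
  \<open>L\<^sup>2(0,T;L\<^sup>2(\<Omega>))\<close> and \<open>L\<^sup>2(0,T;H\<^sup>1(\<Omega>)\<^sup>*)\<close>; the following relations are equality under this
  identification.
\<close>

definition eq_in_L2L2 :: "real \<Rightarrow> (real^'n) set
    \<Rightarrow> (real \<Rightarrow> real^'n \<Rightarrow> real) \<Rightarrow> ((real \<Rightarrow> real^'n \<Rightarrow> real) \<Rightarrow> real) \<Rightarrow> bool" where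
  "eq_in_L2L2 T \<Omega> u g \<longleftrightarrow> u \<in> elems (L2L2 T \<Omega>) \<and>
    (\<forall>\<eta>\<in>elems (L2L2 T \<Omega>). L2L2_inner T \<Omega> u \<eta> = g \<eta>)"

definition eq_in_L2H1dual :: "real \<Rightarrow> (real^'n) set
    \<Rightarrow> (real \<Rightarrow> (real^'n \<Rightarrow> real) \<Rightarrow> real) \<Rightarrow> ((real \<Rightarrow> real^'n \<Rightarrow> real) \<Rightarrow> real) \<Rightarrow> bool" where
  "eq_in_L2H1dual T \<Omega> G g \<longleftrightarrow> G \<in> elems (L2_time T (dual_space (H1 \<Omega>))) \<and>
    (\<forall>\<psi>\<in>elems (L2H1 T \<Omega>). (LINT t|lebesgue_on {0<..<T}. G t (\<psi> t)) = g \<psi>)"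

section \<open>Assumptions on the data\<close>

definition history_operator :: "real \<Rightarrow> (real^'n) set \<Rightarrow> real \<Rightarrow> real
    \<Rightarrow> ((real \<Rightarrow> real^'n \<Rightarrow> real) \<Rightarrow> (real \<Rightarrow> real^'n \<Rightarrow> real)) \<Rightarrow> bool" where
  "history_operator T \<Omega> L L' \<H> \<longleftrightarrow>
    L > 0 \<and>
    (\<forall>q\<in>elems (L2L2 T \<Omega>). \<H> q \<in> elems (L2L2 T \<Omega>)) \<and>
    (\<forall>q\<^sub>1\<in>elems (L2L2 T \<Omega>). \<forall>q\<^sub>2\<in>elems (L2L2 T \<Omega>). AE t in lebesgue_on {0<..<T}.
      nrm (L2 \<Omega>) (\<H> q\<^sub>1 t - \<H> q\<^sub>2 t) \<le>
      L * (LINT s|lebesgue_on {0<..<t}. nrm (L2 \<Omega>) (q\<^sub>1 s - q\<^sub>2 s))) \<and>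
    (\<forall>q\<in>elems (L2L2 T \<Omega>). \<exists>D. has_gateaux_deriv (L2L2 T \<Omega>) (L2L2 T \<Omega>) \<H> q D) \<and>
    continuous_op_valued (H1L2 T \<Omega>) (L2L2 T \<Omega>) (L2L2 T \<Omega>)
      (gateaux_deriv (L2L2 T \<Omega>) (L2L2 T \<Omega>) \<H>) \<and>
    L' > 0 \<and>
    (\<forall>q\<in>elems (L2Linf T \<Omega>). \<H> q \<in> elems (L2Linf T \<Omega>)) \<and>
    (\<forall>q\<^sub>1\<in>elems (L2Linf T \<Omega>). \<forall>q\<^sub>2\<in>elems (L2Linf T \<Omega>). AE t in lebesgue_on {0<..<T}.
      nrm (Linf \<Omega>) (\<H> q\<^sub>1 t - \<H> q\<^sub>2 t) \<le>
      L' * (LINT s|lebesgue_on {0<..<t}. nrm (Linf \<Omega>) (q\<^sub>1 s - q\<^sub>2 s)))"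

definition nonsmooth_function :: "real \<Rightarrow> real \<Rightarrow> (real \<Rightarrow> real) \<Rightarrow> bool" where
  "nonsmooth_function L n f \<longleftrightarrow>
    L > 0 \<and> L-lipschitz_on UNIV f \<and>
    (\<forall>x h. \<exists>d. ((\<lambda>\<tau>. (f (x + \<tau> * h) - f x) / \<tau>) \<longlongrightarrow> d) (at_right 0)) \<and>
    {x. \<not> f differentiable (at x)} = {n}"

section \<open>State system and control problem\<close>

definition z_of :: "real \<Rightarrow> (real \<Rightarrow> real)
    \<Rightarrow> ((real \<Rightarrow> real^'n \<Rightarrow> real) \<Rightarrow> (real \<Rightarrow> real^'n \<Rightarrow> real))
    \<Rightarrow> (real \<Rightarrow> real^'n \<Rightarrow> real) \<Rightarrow> (real \<Rightarrow> real^'n \<Rightarrow> real) \<Rightarrow> (real \<Rightarrow> real^'n \<Rightarrow> real)" where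
  "z_of \<beta> f \<H> q \<phi> = (\<lambda>t x. - \<beta> * (q t x - \<phi> t x) - f (\<H> q t x))"

definition solves_state :: "real \<Rightarrow> (real^'n) set \<Rightarrow> real \<Rightarrow> real \<Rightarrow> real \<Rightarrow> (real \<Rightarrow> real)
    \<Rightarrow> ((real \<Rightarrow> real^'n \<Rightarrow> real) \<Rightarrow> (real \<Rightarrow> real^'n \<Rightarrow> real))
    \<Rightarrow> (real \<Rightarrow> (real^'n \<Rightarrow> real) \<Rightarrow> real)
    \<Rightarrow> (real \<Rightarrow> real^'n \<Rightarrow> real) \<times> (real \<Rightarrow> real^'n \<Rightarrow> real) \<Rightarrow> bool" where
  "solves_state T \<Omega> \<alpha> \<beta> \<epsilon> f \<H> l = (\<lambda>(q, \<phi>).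
    q \<in> elems (H1L2_vanishing T \<Omega> 0) \<and> \<phi> \<in> elems (L2H1 T \<Omega>) \<and>
    (AE t in lebesgue_on {0<..<T}. AE x in lebesgue_on \<Omega>.
      time_deriv T \<Omega> q t x = (1 / \<epsilon>) * max (z_of \<beta> f \<H> q \<phi> t x) 0) \<and>
    (AE t in lebesgue_on {0<..<T}. \<forall>v\<in>elems (H1 \<Omega>).
      - \<alpha> * Laplace \<Omega> (\<phi> t) v + \<beta> * L2_inner \<Omega> (\<phi> t) v = \<beta> * L2_inner \<Omega> (q t) v + l t v))"

text \<open>The solution is unique as an element of the solution space; the choice operator
  only selects a representative.\<close>

definition solution_map :: "real \<Rightarrow> (real^'n) set \<Rightarrow> real \<Rightarrow> real \<Rightarrow> real \<Rightarrow> (real \<Rightarrow> real)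
    \<Rightarrow> ((real \<Rightarrow> real^'n \<Rightarrow> real) \<Rightarrow> (real \<Rightarrow> real^'n \<Rightarrow> real))
    \<Rightarrow> (real \<Rightarrow> (real^'n \<Rightarrow> real) \<Rightarrow> real)
    \<Rightarrow> (real \<Rightarrow> real^'n \<Rightarrow> real) \<times> (real \<Rightarrow> real^'n \<Rightarrow> real)" where
  "solution_map T \<Omega> \<alpha> \<beta> \<epsilon> f \<H> l = (SOME p. solves_state T \<Omega> \<alpha> \<beta> \<epsilon> f \<H> l p)"

definition objective :: "real \<Rightarrow> (real^'n) set
    \<Rightarrow> ((real \<Rightarrow> real^'n \<Rightarrow> real) \<times> (real \<Rightarrow> real^'n \<Rightarrow> real) \<Rightarrow> real)
    \<Rightarrow> (real \<Rightarrow> real^'n \<Rightarrow> real) \<times> (real \<Rightarrow> real^'n \<Rightarrow> real) \<Rightarrow> (real \<Rightarrow> real^'n \<Rightarrow> real) \<Rightarrow> real" where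
  "objective T \<Omega> j p l = j p + (1 / 2) * (nrm (H1L2 T \<Omega>) l)\<^sup>2"

definition locally_optimal :: "real \<Rightarrow> (real^'n) set
    \<Rightarrow> ((real \<Rightarrow> (real^'n \<Rightarrow> real) \<Rightarrow> real)
      \<Rightarrow> (real \<Rightarrow> real^'n \<Rightarrow> real) \<times> (real \<Rightarrow> real^'n \<Rightarrow> real))
    \<Rightarrow> ((real \<Rightarrow> real^'n \<Rightarrow> real) \<times> (real \<Rightarrow> real^'n \<Rightarrow> real) \<Rightarrow> real)
    \<Rightarrow> (real \<Rightarrow> real^'n \<Rightarrow> real) \<Rightarrow> bool" where
  "locally_optimal T \<Omega> S j l \<longleftrightarrow> l \<in> elems (H1L2 T \<Omega>) \<and>
    (\<exists>r>0. \<forall>l'\<in>elems (H1L2 T \<Omega>). nrm (H1L2 T \<Omega>) (l' - l) < r \<longrightarrow>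
      objective T \<Omega> j (S (embed_dual \<Omega> l)) l \<le> objective T \<Omega> j (S (embed_dual \<Omega> l')) l')"

definition deriv_j :: "real \<Rightarrow> (real^'n) set
    \<Rightarrow> ((real \<Rightarrow> real^'n \<Rightarrow> real) \<times> (real \<Rightarrow> real^'n \<Rightarrow> real) \<Rightarrow> real)
    \<Rightarrow> (real \<Rightarrow> real^'n \<Rightarrow> real) \<times> (real \<Rightarrow> real^'n \<Rightarrow> real)
    \<Rightarrow> (real \<Rightarrow> real^'n \<Rightarrow> real) \<times> (real \<Rightarrow> real^'n \<Rightarrow> real) \<Rightarrow> real" where
  "deriv_j T \<Omega> j = frechet_deriv (prod_space (L2L2 T \<Omega>) (L2H1 T \<Omega>)) real_space j"

text \<open>The value of \<open>deriv f\<close> at the non-smooth point is irrelevant: the operator is only used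
  when \<open>\<H> q\<close> avoids that point almost everywhere.\<close>

definition deriv_f_hist :: "real \<Rightarrow> (real^'n) set \<Rightarrow> (real \<Rightarrow> real)
    \<Rightarrow> ((real \<Rightarrow> real^'n \<Rightarrow> real) \<Rightarrow> (real \<Rightarrow> real^'n \<Rightarrow> real))
    \<Rightarrow> (real \<Rightarrow> real^'n \<Rightarrow> real) \<Rightarrow> (real \<Rightarrow> real^'n \<Rightarrow> real) \<Rightarrow> (real \<Rightarrow> real^'n \<Rightarrow> real)" where
  "deriv_f_hist T \<Omega> f \<H> q \<eta> =
    (\<lambda>t x. deriv f (\<H> q t x) * gateaux_deriv (L2L2 T \<Omega>) (L2L2 T \<Omega>) \<H> q \<eta> t x)"

definition null_contact :: "real \<Rightarrow> (real^'n) set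
    \<Rightarrow> ((real \<Rightarrow> real^'n \<Rightarrow> real) \<Rightarrow> (real \<Rightarrow> real^'n \<Rightarrow> real))
    \<Rightarrow> real \<Rightarrow> (real \<Rightarrow> real^'n \<Rightarrow> real) \<Rightarrow> bool" where
  "null_contact T \<Omega> \<H> n q \<longleftrightarrow>
    {(t, x). (t, x) \<in> cylinder T \<Omega> \<and> \<H> q t x = n} \<in> null_sets lebesgue"

text \<open>The multiplier \<open>\<lambda>\<close> is called \<open>\<mu>\<close>, since \<open>\<lambda>\<close> is reserved for abstraction.\<close>

definition optimality_system :: "real \<Rightarrow> (real^'n) set \<Rightarrow> real \<Rightarrow> real \<Rightarrow> real \<Rightarrow> (real \<Rightarrow> real)
    \<Rightarrow> ((real \<Rightarrow> real^'n \<Rightarrow> real) \<Rightarrow> (real \<Rightarrow> real^'n \<Rightarrow> real))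
    \<Rightarrow> ((real \<Rightarrow> real^'n \<Rightarrow> real) \<times> (real \<Rightarrow> real^'n \<Rightarrow> real) \<Rightarrow> real)
    \<Rightarrow> (real \<Rightarrow> real^'n \<Rightarrow> real) \<Rightarrow> (real \<Rightarrow> real^'n \<Rightarrow> real) \<Rightarrow> (real \<Rightarrow> real^'n \<Rightarrow> real)
    \<Rightarrow> (real \<Rightarrow> real^'n \<Rightarrow> real) \<Rightarrow> (real \<Rightarrow> real^'n \<Rightarrow> real) \<Rightarrow> (real \<Rightarrow> real^'n \<Rightarrow> real) \<Rightarrow> bool" where
  "optimality_system T \<Omega> \<alpha> \<beta> \<epsilon> f \<H> j l q \<phi> \<xi> w \<mu> \<longleftrightarrow>
    \<xi> \<in> elems (H1L2_vanishing T \<Omega> T) \<and>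
    w \<in> elems (L2H1 T \<Omega>) \<and>
    \<mu> \<in> Linf_fun T \<Omega> (L2 \<Omega>) \<and>
    eq_in_L2L2 T \<Omega>
      (- time_deriv T \<Omega> \<xi> - \<beta> *\<^sub>R (w - \<mu>) + hilbert_adjoint T \<Omega> (deriv_f_hist T \<Omega> f \<H> q) \<mu>)
      (\<lambda>\<eta>. deriv_j T \<Omega> j (q, \<phi>) (\<eta>, 0)) \<and>
    eq_in_L2H1dual T \<Omega>
      (\<lambda>t. - (\<alpha> *\<^sub>R Laplace \<Omega> (w t)) + \<beta> *\<^sub>R embed_dual \<Omega> (w - \<mu>) t)
      (\<lambda>\<psi>. deriv_j T \<Omega> j (q, \<phi>) (0, \<psi>)) \<and>
    (AE (t, x) in lebesgue_on (cylinder T \<Omega>). z_of \<beta> f \<H> q \<phi> t x \<noteq> 0 \<longrightarrow>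
      \<mu> t x = (1 / \<epsilon>) * indicator {(t, x). z_of \<beta> f \<H> q \<phi> t x > 0} (t, x) * \<xi> t x) \<and>
    (AE (t, x) in lebesgue_on (cylinder T \<Omega>). z_of \<beta> f \<H> q \<phi> t x = 0 \<longrightarrow>
      0 \<le> \<mu> t x \<and> \<mu> t x \<le> (1 / \<epsilon>) * \<xi> t x) \<and>
    (\<forall>\<delta>l\<in>elems (H1L2 T \<Omega>). L2L2_inner T \<Omega> w \<delta>l + H1L2_inner T \<Omega> l \<delta>l = 0)"

definition eq_ae :: "real \<Rightarrow> (real^'n) set
    \<Rightarrow> (real \<Rightarrow> real^'n \<Rightarrow> real) \<Rightarrow> (real \<Rightarrow> real^'n \<Rightarrow> real) \<Rightarrow> bool" where
  "eq_ae T \<Omega> u v \<longleftrightarrow> (AE (t, x) in lebesgue_on (cylinder T \<Omega>). u t x = v t x)"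

end

theory Submission
 imports Defs
begin

text \<open>Write z for the argument of the maximum, H' for the derivative of the history operator
  and \<open>vint g\<close> for the primitive of g that vanishes at time 0.

  The state system is a Volterra fixed point equation for g, the time derivative of q:
  \<open>q = vint g\<close> and \<open>g = G l (vint g)\<close>, where \<open>G\<close> contains the
  history operator, the elliptic solution operator and the maximum. In the norms weighted by exp(-k
  t) all these operators are Lipschitz with a constant that is the same for every k \<ge> 1
  (\<open>wlip\<close>), while \<open>vint\<close> has norm at most sqrt(T/k). Hence the equation is
  contractive for large k, and the distance of two functions is controlled by the difference of
  their residuals (\<open>volterra_exists\<close>, \<open>volterra_stable\<close>). This gives the
  states, the linearized states and, by inserting g + s g' into the equation for l + s \<delta>, the
  directional derivative of the solution map (\<open>state_dir_deriv\<close>). Since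
  \<open>\<H> q\<close> avoids the kink of f almost everywhere, only the maximum contributes a
  nonlinear term: the derivative in direction \<delta> is (\<eta>, \<psi>) with \<eta> =
  \<open>vint g\<close>, g = (1/\<epsilon>) max'(z; h), h = -\<beta>(\<eta> - \<psi>) - f'(H(q))
  H'(q)\<eta>, and -\<alpha> Laplace \<psi> + \<beta> \<psi> = \<beta> \<eta> + \<delta>.

  Local optimality yields the inequality 0 \<le> j'(q, \<phi>)(\<eta>, \<psi>) + (l, \<delta>) with
  the H^1 product, for all \<delta> (\<open>optimality_inequality\<close>). Strong stationarity
  follows because its directions can be enlarged until h is arbitrary (\<open>necessary\<close>), in
  three moves. First, g is bounded by the L^2 norm of \<delta>, so \<delta> -> (l, \<delta>) is
  L^2-bounded on the dense space H^1(0,T;L^2(\<Omega>)). Riesz representation gives w, and the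
  inequality extends to all \<delta> in L^2. Second, \<psi> replaces \<delta> as the independent
  variable. As g is bounded by the L^2 norm of \<psi> alone, another Riesz argument shows that w
  minus the representer of the \<phi>-derivative of j is an elliptic solution, so w lies in
  L^2(0,T;H^1(\<Omega>)); its right-hand side is \<beta> times the multiplier \<mu>. Density of the
  elliptic solutions (\<open>ell_range_dense\<close>) then admits every \<psi> in L^2. Third, for an
  arbitrary h one sets g = (1/\<epsilon>) max'(z; h) and solves for \<psi>. With \<xi> the backward
  primitive of the remaining residual, the inequality reads (\<mu>, h) \<le> (1/\<epsilon>)(max'(z;
  h), \<xi>) for all h in L^2, which is equivalent to the pointwise relations for \<mu>
  (\<open>ineq_imp_compl\<close>, \<open>compl_imp_ineq\<close>).

  The converse reads the last computation backwards (\<open>adj_sufficient\<close>). For uniqueness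
  (\<open>adj_unique\<close>), the gradient equation determines w, then the elliptic equation \<mu>,
  then the backward equation \<xi>.

  Function spaces consist of representatives, so every identity holds up to seminorm zero. They are
  treated as complete semi-inner product spaces: L^2(0,T;L^2(\<Omega>)) is L^2 of the cylinder
  (\<open>LL_elems\<close>), while H^1(\<Omega>), L^2(0,T;H^1(\<Omega>)) and H^1(0,T;L^2(\<Omega>))
  are graph spaces of closed operators (\<open>gip_semi_hilbert\<close>, \<open>elems_H1\<close>,
  \<open>elems_L2H1\<close>, \<open>elems_H1L2\<close>).\<close>

type_synonym 'n evol = "real=>(real, 'n) vec=>real"

abbreviation "meas \<equiv> borel_measurable"
abbreviation "leb \<equiv> lebesgue_on"
abbreviation nullseq :: "(nat=>real)=>bool" where "nullseq a \<equiv> a \<longlonglongrightarrow> 0"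

lemmas integral_cong' = Bochner_Integration.integral_cong

section \<open>Iterated integrals for Lebesgue measure on a product, by way of Borel
  representatives\<close>

section \<open>Fubini for Lebesgue measure on product sets\<close>

lemma AE_leb_iff:
 assumes "S\<in>sets borel"
 shows "(AE x in leb S. P x) \<longleftrightarrow> (AE x in lborel. x\<in>S\<longrightarrow>P x)"
 using assms by (subst AE_restrict_space_iff) (auto simp: AE_completion_iff)

text \<open>Lebesgue measure on a product is only the completion of a product measure. The theorems
  on product measures therefore apply to a Borel function that agrees almost everywhere with the
  given one; setting it to zero off S allows integrals over S to be written over the whole
  space.\<close>

lemma leb_borel_rep:
 fixes u :: "'a::euclidean_space=>real"
 assumes S: "S\<in>sets borel" and u: "u\<in>meas (leb S)"
 obtains u' where "u'\<in>meas borel" "AE x in leb S. u x = u' x"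
  "\<And>x. x\<notin>S ==> u' x = 0"
proof -
 have "(%x. indicator S x *\<^sub>R u x)\<in>meas lebesgue"
  using u S by (subst (asm) borel_measurable_restrict_space_iff) auto
 from completion_ex_borel_measurable_real[OF this] obtain v where
  v: "v\<in>meas lborel" "AE x in lborel. indicator S x *\<^sub>R u x = v x" by auto
 show ?thesis
 proof (rule that[of "%x. indicator S x * v x"])
  show "(%x. indicator S x * v x)\<in>meas borel"
   using v S by (intro borel_measurable_times borel_measurable_indicator) auto
  show "AE x in leb S. u x = indicator S x * v x"
   unfolding AE_leb_iff[OF S] using v(2) by eventually_elim (auto simp: indicator_def split: if_splits)
 qed auto
qed

lemma leb_measurableI:
 fixes u :: "'a::euclidean_space=>'b::real_normed_vector"
 assumes "u\<in>meas borel"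
 shows "u\<in>meas (leb S)"
 by (rule measurable_restrict_space1) (use assms in \<open>auto intro: measurable_completion\<close>)

lemma AE_leb_Times:
 fixes A :: "'a::euclidean_space set" and B :: "'b::euclidean_space set"
 assumes A: "A\<in>sets borel" and B: "B\<in>sets borel"
  and P: "AE p in leb (A\<times>B). P (fst p) (snd p)"
 shows "AE x in leb A. AE y in leb B. P x y"
  and "AE y in leb B. AE x in leb A. P x y"
proof -
 have AB: "A\<times>B\<in>sets borel" using A B by (simp add: borel_Times)
 have *: "AE p in lborel \<Otimes>\<^sub>M lborel. p\<in>A\<times>B\<longrightarrow>P (fst p) (snd p)"
  using P unfolding AE_leb_iff[OF AB] lborel_prod .
 have "AE x in lborel. AE y in lborel. (x, y)\<in>A\<times>B\<longrightarrow>P x y"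
  using lborel_pair.AE_pair[OF *] by simp
 then show "AE x in leb A. AE y in leb B. P x y"
  unfolding AE_leb_iff[OF A] AE_leb_iff[OF B]
  by eventually_elim (auto elim!: eventually_mono)
 \<comment> \<open>Interchanging the two quantifiers requires a measurable exceptional set, so the
   exceptional set is first enlarged to a measurable null set.\<close>
 obtain N where N: "N\<in>sets (lborel \<Otimes>\<^sub>M lborel)" "emeasure (lborel \<Otimes>\<^sub>M lborel) N = 0"
   "{p\<in>space (lborel \<Otimes>\<^sub>M lborel). \<not> (p\<in>A\<times>B\<longrightarrow>P (fst p) (snd p))}\<subseteq>N"
  using * unfolding eventually_ae_filter by (force simp: null_sets_def)
 have ae: "AE p in lborel \<Otimes>\<^sub>M lborel. (fst p, snd p)\<notin>N"
  using N by (intro AE_I[of _ _ N]) auto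
 have "AE x in lborel. AE y in lborel. (x, y)\<notin>N"
  using lborel_pair.AE_pair[OF ae] by simp
 moreover have "{x\<in>space (lborel \<Otimes>\<^sub>M lborel). (fst x, snd x)\<notin>N}\<in>sets (lborel \<Otimes>\<^sub>M lborel)"
  using sets.Diff[OF sets.top N(1)] by (simp add: set_diff_eq)
 ultimately have "AE y in lborel. AE x in lborel. (x, y)\<notin>N"
  by (subst (asm) lborel_pair.AE_commute) auto
 then have "AE y in lborel. AE x in lborel. (x, y)\<in>A\<times>B\<longrightarrow>P x y"
  by (rule eventually_mono, elim eventually_mono) (use N(3) in \<open>auto simp: space_pair_measure\<close>)
 then show "AE y in leb B. AE x in leb A. P x y"
  unfolding AE_leb_iff[OF A] AE_leb_iff[OF B]
  by eventually_elim (auto elim!: eventually_mono)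
qed

lemma integrable_AE_eqI:
 fixes f g :: "'a=>real"
 assumes "integrable M f" "AE x in M. g x = f x" "g\<in>meas M"
 shows "integrable M g"
 using assms integrable_cong_AE[of g M f] by auto

lemma leb_measurable_AE:
 fixes u v :: "'a::euclidean_space=>real"
 assumes S: "S\<in>sets borel" and u: "u\<in>meas (leb S)"
  and ae: "AE x in leb S. u x = v x"
 shows "v\<in>meas (leb S)"
proof -
 have "(%x. indicator S x *\<^sub>R u x)\<in>meas lebesgue"
  using u S by (subst (asm) borel_measurable_restrict_space_iff) auto
 moreover have "AE x in lebesgue. indicator S x *\<^sub>R u x = indicator S x *\<^sub>R v x"
  using ae unfolding AE_leb_iff[OF S] AE_completion_iff
  by eventually_elim (auto simp: indicator_def)
 ultimately have "(%x. indicator S x *\<^sub>R v x)\<in>meas lebesgue"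
  by (rule borel_measurable_AE)
 then show ?thesis using S by (subst borel_measurable_restrict_space_iff) auto
qed

lemma leb_measurable_slice:
 fixes A :: "'a::euclidean_space set" and B :: "'b::euclidean_space set" and u :: "_=>real"
 assumes A: "A\<in>sets borel" and B: "B\<in>sets borel"
  and u: "u\<in>meas (leb (A\<times>B))"
 shows "AE x in leb A. (%y. u (x, y))\<in>meas (leb B)"
  and "AE y in leb B. (%x. u (x, y))\<in>meas (leb A)"
proof -
 have AB: "A\<times>B\<in>sets borel" using A B by (simp add: borel_Times)
 obtain u' where u': "u'\<in>meas borel" "AE p in leb (A\<times>B). u p = u' p"
  by (rule leb_borel_rep[OF AB u])
 have P: "AE p in leb (A\<times>B). u' (fst p, snd p) = u (fst p, snd p)"
  using u'(2) by eventually_elim simp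
 have [measurable]: "u'\<in>meas (borel \<Otimes>\<^sub>M borel)"
  using u'(1) by (simp add: borel_prod)
 have mx: "(%y. u' (x, y))\<in>meas borel" for x by measurable
 have my: "(%x. u' (x, y))\<in>meas borel" for y by measurable
 show "AE x in leb A. (%y. u (x, y))\<in>meas (leb B)"
  using AE_leb_Times(1)[OF A B P]
  by (rule eventually_mono) (rule leb_measurable_AE[OF B leb_measurableI[OF mx]])
 show "AE y in leb B. (%x. u (x, y))\<in>meas (leb A)"
  using AE_leb_Times(2)[OF A B P]
  by (rule eventually_mono) (rule leb_measurable_AE[OF A leb_measurableI[OF my]])
qed

lemma nn_integral_leb:
 assumes S: "S\<in>sets borel"
 shows "nn_integral (leb S) f = (\<integral>\<^sup>+x. f x * indicator S x\<partial>lborel)"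
 using S by (subst nn_integral_restrict_space) (auto simp: nn_integral_completion)

lemma nn_integral_leb_Times:
 fixes A :: "'a::euclidean_space set" and B :: "'b::euclidean_space set" and u :: "_=>_=>real"
 assumes A: "A\<in>sets borel" and B: "B\<in>sets borel"
  and u: "case_prod u\<in>meas (leb (A\<times>B))"
 shows "(\<integral>\<^sup>+p. ennreal (u (fst p) (snd p))\<partial>leb (A\<times>B)) =
   (\<integral>\<^sup>+x. \<integral>\<^sup>+y. ennreal (u x y)\<partial>leb B\<partial>leb A)" (is "?L = ?R1")
  and "(\<integral>\<^sup>+p. ennreal (u (fst p) (snd p))\<partial>leb (A\<times>B)) =
   (\<integral>\<^sup>+y. \<integral>\<^sup>+x. ennreal (u x y)\<partial>leb A\<partial>leb B)" (is "_ = ?R2")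
proof -
 have AB: "A\<times>B\<in>sets borel" using A B by (simp add: borel_Times)
 obtain u' where u': "u'\<in>meas borel" "AE p in leb (A\<times>B). case_prod u p = u' p"
  by (rule leb_borel_rep[OF AB u])
 have P: "AE p in leb (A\<times>B). u (fst p) (snd p) = u' (fst p, snd p)"
  using u'(2) by eventually_elim (auto simp: case_prod_unfold)
 have [measurable]: "u'\<in>meas (borel \<Otimes>\<^sub>M borel)"
  using u'(1) by (simp add: borel_prod)
 have [measurable]: "A\<in>sets borel" "B\<in>sets borel" by fact+
 let ?w = "%x y. ennreal (u' (x, y)) * indicator A x * indicator B y"
 have L: "?L = (\<integral>\<^sup>+p. ?w (fst p) (snd p)\<partial>(lborel \<Otimes>\<^sub>M lborel))"
 proof -
  have "?L = (\<integral>\<^sup>+p. ennreal (u' (fst p, snd p))\<partial>leb (A\<times>B))"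
   by (rule nn_integral_cong_AE) (use P in \<open>eventually_elim, auto\<close>)
  also have "\<dots> = (\<integral>\<^sup>+p. ?w (fst p) (snd p)\<partial>(lborel \<Otimes>\<^sub>M lborel))"
   unfolding nn_integral_leb[OF AB] lborel_prod
   by (rule nn_integral_cong) (auto simp: indicator_def)
  finally show ?thesis .
 qed
 have w: "(%p. ?w (fst p) (snd p))\<in>meas (lborel \<Otimes>\<^sub>M lborel)" by measurable
 have "?R1 = (\<integral>\<^sup>+x. \<integral>\<^sup>+y. ennreal (u' (x, y))\<partial>leb B\<partial>leb A)"
  by (rule nn_integral_cong_AE, rule eventually_mono[OF AE_leb_Times(1)[OF A B P]])
   (rule nn_integral_cong_AE, erule eventually_mono, simp)
 also have "\<dots> = (\<integral>\<^sup>+x. \<integral>\<^sup>+y. ?w x y\<partial>lborel\<partial>lborel)"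
  unfolding nn_integral_leb[OF A] nn_integral_leb[OF B]
  by (intro nn_integral_cong, subst nn_integral_multc[symmetric]) (auto intro!: nn_integral_cong simp: ac_simps)
 also have "\<dots> = ?L"
  unfolding L using lborel.nn_integral_fst[OF w] by simp
 finally show "?L = ?R1" by simp
 have "?R2 = (\<integral>\<^sup>+y. \<integral>\<^sup>+x. ennreal (u' (x, y))\<partial>leb A\<partial>leb B)"
  by (rule nn_integral_cong_AE, rule eventually_mono[OF AE_leb_Times(2)[OF A B P]])
   (rule nn_integral_cong_AE, erule eventually_mono, simp)
 also have "\<dots> = (\<integral>\<^sup>+y. \<integral>\<^sup>+x. ?w x y\<partial>lborel\<partial>lborel)"
  unfolding nn_integral_leb[OF A] nn_integral_leb[OF B]
  by (intro nn_integral_cong, subst nn_integral_multc[symmetric]) (auto intro!: nn_integral_cong simp: ac_simps)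
 also have "\<dots> = ?L"
  unfolding L using lborel_pair.nn_integral_snd[OF w] by simp
 finally show "?L = ?R2" by simp
qed

lemma leb_integral_borel:
 fixes f :: "'a::euclidean_space=>real"
 assumes S: "S\<in>sets borel" and f: "f\<in>meas borel"
 shows "integrable (leb S) f \<longleftrightarrow> integrable lborel (%x. indicator S x * f x)"
  and "integral\<^sup>L (leb S) f = (\<integral>x. indicator S x * f x\<partial>lborel)"
proof -
 have m: "(%x. indicator S x * f x)\<in>meas lborel" using S f by simp
 show "integrable (leb S) f \<longleftrightarrow> integrable lborel (%x. indicator S x * f x)"
  using S integrable_completion[OF m] by (subst integrable_restrict_space) auto
 show "integral\<^sup>L (leb S) f = (\<integral>x. indicator S x * f x\<partial>lborel)"
  using S integral_completion[OF m] by (subst integral_restrict_space) auto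
qed

text \<open>All claims are pulled back to the product of two \<open>lborel\<close> measures through
  a Borel representative. Slices and inner integrals of u agree almost everywhere with those of the
  representative and inherit their measurability and integrability.\<close>

lemma Fubini_leb:
 fixes A :: "'a::euclidean_space set" and B :: "'b::euclidean_space set" and u :: "_=>_=>real"
 assumes A: "A\<in>sets borel" and B: "B\<in>sets borel"
  and u: "integrable (leb (A\<times>B)) (case_prod u)"
 shows "AE x in leb A. integrable (leb B) (u x)"
  and "integrable (leb A) (%x. \<integral>y. u x y\<partial>leb B)"
  and "(\<integral>x. \<integral>y. u x y\<partial>leb B\<partial>leb A) = integral\<^sup>L (leb (A\<times>B)) (case_prod u)"
  and "AE y in leb B. integrable (leb A) (%x. u x y)"
  and "integrable (leb B) (%y. \<integral>x. u x y\<partial>leb A)"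
  and "(\<integral>y. \<integral>x. u x y\<partial>leb A\<partial>leb B) = integral\<^sup>L (leb (A\<times>B)) (case_prod u)"
proof -
 have AB: "A\<times>B\<in>sets borel" using A B by (simp add: borel_Times)
 have um: "case_prod u\<in>meas (leb (A\<times>B))" using u by auto
 obtain u' where u': "u'\<in>meas borel" "AE p in leb (A\<times>B). case_prod u p = u' p"
  by (rule leb_borel_rep[OF AB um])
 have P: "AE p in leb (A\<times>B). u (fst p) (snd p) = u' (fst p, snd p)"
  using u'(2) by eventually_elim (auto simp: case_prod_unfold)
 have m[measurable]: "u'\<in>meas (borel \<Otimes>\<^sub>M borel)"
  using u'(1) by (simp add: borel_prod)
 have [measurable]: "A\<in>sets borel" "B\<in>sets borel" by fact+
 have mx[measurable]: "\<And>x. (%y. u' (x, y))\<in>meas borel"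
  "\<And>y. (%x. u' (x, y))\<in>meas borel" by measurable
 let ?w = "%p. indicator (A\<times>B) p * u' p"
 have "integrable (leb (A\<times>B)) u'"
  using u integrable_cong_AE[OF um leb_measurableI[OF u'(1)] u'(2)] by simp
 then have wi: "integrable (lborel \<Otimes>\<^sub>M lborel) ?w"
  unfolding leb_integral_borel[OF AB u'(1)] lborel_prod .
 have Iw: "integral\<^sup>L (leb (A\<times>B)) (case_prod u) = (\<integral>p. ?w p\<partial>(lborel \<Otimes>\<^sub>M lborel))"
 proof -
  have "integral\<^sup>L (leb (A\<times>B)) (case_prod u) = integral\<^sup>L (leb (A\<times>B)) u'"
   by (rule integral_cong_AE[OF um]) (use u' in \<open>auto intro: leb_measurableI\<close>)
  then show ?thesis unfolding leb_integral_borel[OF AB u'(1)] lborel_prod .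
 qed
 have e1: "?w (x, y) = indicator A x * (indicator B y * u' (x, y))" for x y by (auto simp: indicator_def)
 have e2: "?w (x, y) = indicator B y * (indicator A x * u' (x, y))" for x y by (auto simp: indicator_def)
 have AE1: "AE x in leb A. AE y in leb B. u x y = u' (x, y)"
  and AE2: "AE y in leb B. AE x in leb A. u x y = u' (x, y)"
  using AE_leb_Times[OF A B P] by auto
 have sl: "AE x in leb A. (%y. u x y)\<in>meas (leb B)"
  "AE y in leb B. (%x. u x y)\<in>meas (leb A)"
  using leb_measurable_slice[OF A B um] by auto
 have "AE x in lborel. integrable lborel (%y. ?w (x, y))"
  by (rule lborel_pair.AE_integrable_fst'[OF wi])
 then have i1: "AE x in leb A. integrable (leb B) (%y. u' (x, y))"
  unfolding AE_leb_iff[OF A] by eventually_elim (auto simp: leb_integral_borel[OF B mx(1)] e1 indicator_eq_0_iff)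
 show "AE x in leb A. integrable (leb B) (u x)"
  using i1 AE1 sl(1)
  by eventually_elim (rule integrable_AE_eqI)
 have wi': "integrable (lborel \<Otimes>\<^sub>M lborel) (%(x, y). ?w (y, x))"
  using lborel_pair.integrable_product_swap[OF wi] .
 have "AE y in lborel. integrable lborel (%x. ?w (x, y))"
  using lborel_pair.AE_integrable_fst'[OF wi'] by simp
 then have i2: "AE y in leb B. integrable (leb A) (%x. u' (x, y))"
  unfolding AE_leb_iff[OF B] by eventually_elim (auto simp: leb_integral_borel[OF A mx(2)] e2 indicator_eq_0_iff)
 show "AE y in leb B. integrable (leb A) (%x. u x y)"
  using i2 AE2 sl(2)
  by eventually_elim (rule integrable_AE_eqI)
 let ?g = "%x. \<integral>y. indicator B y * u' (x, y)\<partial>lborel" and ?h = "%y. \<integral>x. indicator A x * u' (x, y)\<partial>lborel"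
 have gm: "?g\<in>meas borel" by measurable
 have hm: "?h\<in>meas borel" by measurable
 have ug: "AE x in leb A. (\<integral>y. u x y\<partial>leb B) = ?g x"
  using AE1 sl(1) unfolding leb_integral_borel(2)[OF B mx(1), symmetric]
  by eventually_elim (rule integral_cong_AE, auto intro: leb_measurableI)
 have uh: "AE y in leb B. (\<integral>x. u x y\<partial>leb A) = ?h y"
  using AE2 sl(2) unfolding leb_integral_borel(2)[OF A mx(2), symmetric]
  by eventually_elim (rule integral_cong_AE, auto intro: leb_measurableI)
 have gm': "(%x. \<integral>y. u x y\<partial>leb B)\<in>meas (leb A)"
  by (rule leb_measurable_AE[OF A leb_measurableI[OF gm]])
   (use ug in \<open>eventually_elim, simp\<close>)
 have hm': "(%y. \<integral>x. u x y\<partial>leb A)\<in>meas (leb B)"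
  by (rule leb_measurable_AE[OF B leb_measurableI[OF hm]])
   (use uh in \<open>eventually_elim, simp\<close>)
 have gi: "integrable (leb A) ?g" "integral\<^sup>L (leb A) ?g = (\<integral>p. ?w p\<partial>(lborel \<Otimes>\<^sub>M lborel))"
  using lborel_pair.integrable_fst'[OF wi] lborel_pair.integral_fst'[OF wi]
  unfolding leb_integral_borel[OF A gm] e1 integral_mult_right_zero by auto
 have hi: "integrable (leb B) ?h" "integral\<^sup>L (leb B) ?h = (\<integral>p. ?w p\<partial>(lborel \<Otimes>\<^sub>M lborel))"
  using lborel_pair.integrable_fst'[OF wi'] lborel_pair.integral_fst'[OF wi']
  unfolding lborel_pair.integral_product_swap[OF borel_measurable_integrable[OF wi]]
  unfolding leb_integral_borel[OF B hm] prod.case e2 integral_mult_right_zero by auto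
 show "integrable (leb A) (%x. \<integral>y. u x y\<partial>leb B)"
  using gi(1) ug gm' by (subst integrable_cong_AE) (auto intro: leb_measurableI[OF gm])
 show "integrable (leb B) (%y. \<integral>x. u x y\<partial>leb A)"
  using hi(1) uh hm' by (subst integrable_cong_AE) (auto intro: leb_measurableI[OF hm])
 show "(\<integral>x. \<integral>y. u x y\<partial>leb B\<partial>leb A) = integral\<^sup>L (leb (A\<times>B)) (case_prod u)"
  unfolding Iw gi(2)[symmetric] using ug gm' by (intro integral_cong_AE) (auto intro: leb_measurableI[OF gm])
 show "(\<integral>y. \<integral>x. u x y\<partial>leb A\<partial>leb B) = integral\<^sup>L (leb (A\<times>B)) (case_prod u)"
  unfolding Iw hi(2)[symmetric] using uh hm' by (intro integral_cong_AE) (auto intro: leb_measurableI[OF hm])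
qed

text \<open>Tonelli's theorem for the indicator of the exceptional set, which is why that set is
  assumed measurable.\<close>

lemma AE_leb_TimesI:
 fixes A :: "'a::euclidean_space set" and B :: "'b::euclidean_space set"
 assumes A: "A\<in>sets borel" and B: "B\<in>sets borel"
  and P: "{p\<in>A\<times>B. P (fst p) (snd p)}\<in>sets (leb (A\<times>B))"
  and ae: "AE x in leb A. AE y in leb B. P x y"
 shows "AE p in leb (A\<times>B). P (fst p) (snd p)"
proof -
 let ?N = "{p\<in>A\<times>B. \<not> P (fst p) (snd p)}"
 have "space (leb (A\<times>B)) - {p\<in>A\<times>B. P (fst p) (snd p)}\<in>sets (leb (A\<times>B))"
  using P by blast
 then have N: "?N\<in>sets (leb (A\<times>B))"
  by (rule back_subst[of "%S. S\<in>_"]) auto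
 let ?u = "%x y. indicator ?N (x, y) :: real"
 have "case_prod ?u = indicator ?N" by auto
 then have m: "case_prod ?u\<in>meas (leb (A\<times>B))" using N by simp
 have "emeasure (leb (A\<times>B)) ?N = (\<integral>\<^sup>+p. ennreal (?u (fst p) (snd p))\<partial>leb (A\<times>B))"
  using N by (simp add: ennreal_indicator)
 also have "\<dots> = (\<integral>\<^sup>+x. \<integral>\<^sup>+y. ennreal (?u x y)\<partial>leb B\<partial>leb A)"
  by (rule nn_integral_leb_Times(1)[OF A B m])
 also have "\<dots> = (\<integral>\<^sup>+x. 0\<partial>leb A)"
 proof (rule nn_integral_cong_AE, use ae in eventually_elim)
  case (elim x)
  have "(\<integral>\<^sup>+y. ennreal (?u x y)\<partial>leb B) = (\<integral>\<^sup>+y. 0\<partial>leb B)"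
   by (rule nn_integral_cong_AE, use elim in eventually_elim) auto
  then show ?case by simp
 qed
 finally have "?N\<in>null_sets (leb (A\<times>B))" using N by (auto simp: null_sets_def)
 then show ?thesis by (rule AE_I') auto
qed

text \<open>The set on which g differs from a Borel representative is null, and so is the cylinder
  over it.\<close>

lemma leb_measurable_fst:
 fixes A :: "'a::euclidean_space set" and B :: "'b::euclidean_space set" and g :: "_=>real"
 assumes A: "A\<in>sets borel" and B: "B\<in>sets borel" and g: "g\<in>meas (leb A)"
 shows "(%p. g (fst p))\<in>meas (leb (A\<times>B))"
proof -
 have AB: "A\<times>B\<in>sets borel" using A B by (simp add: borel_Times)
 obtain g' where g': "g'\<in>meas borel" "AE p in leb A. g p = g' p"
  by (rule leb_borel_rep[OF A g])
 have m: "(%p. g' (fst p))\<in>meas (borel :: ('a\<times>'b) measure)"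
  using g'(1) unfolding borel_prod[symmetric] by measurable
 have "AE x in lborel. x\<in>A\<longrightarrow>g x = g' x" using g'(2) unfolding AE_leb_iff[OF A] .
 then obtain N where N: "N\<in>null_sets lborel" "{x\<in>space lborel. \<not> (x\<in>A\<longrightarrow>g x = g' x)}\<subseteq>N"
  by (auto simp: eventually_ae_filter)
 have "N\<times>(UNIV :: 'b set)\<in>null_sets (lborel \<Otimes>\<^sub>M lborel)"
  using N(1) by (intro null_setsI) (auto simp: lborel.emeasure_pair_measure_Times null_sets_def)
 then have "AE p in lborel \<Otimes>\<^sub>M lborel. p\<in>A\<times>B\<longrightarrow>g (fst p) = g' (fst p)"
  by (rule AE_I') (use N in \<open>auto\<close>)
 then have "AE p in leb (A\<times>B). g' (fst p) = g (fst p)"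
  unfolding AE_leb_iff[OF AB] lborel_prod by eventually_elim auto
 then show ?thesis
  by (rule leb_measurable_AE[OF AB leb_measurableI[OF m]])
qed

lemma leb_measurable_snd:
 fixes A :: "'a::euclidean_space set" and B :: "'b::euclidean_space set" and g :: "_=>real"
 assumes A: "A\<in>sets borel" and B: "B\<in>sets borel" and g: "g\<in>meas (leb B)"
 shows "(%p. g (snd p))\<in>meas (leb (A\<times>B))"
proof -
 have AB: "A\<times>B\<in>sets borel" using A B by (simp add: borel_Times)
 obtain g' where g': "g'\<in>meas borel" "AE p in leb B. g p = g' p"
  by (rule leb_borel_rep[OF B g])
 have m: "(%p. g' (snd p))\<in>meas (borel :: ('a\<times>'b) measure)"
  using g'(1) unfolding borel_prod[symmetric] by measurable
 have "AE x in lborel. x\<in>B\<longrightarrow>g x = g' x" using g'(2) unfolding AE_leb_iff[OF B] .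
 then obtain N where N: "N\<in>null_sets lborel" "{x\<in>space lborel. \<not> (x\<in>B\<longrightarrow>g x = g' x)}\<subseteq>N"
  by (auto simp: eventually_ae_filter)
 have "(UNIV :: 'a set)\<times>N\<in>null_sets (lborel \<Otimes>\<^sub>M lborel)"
  using N(1) by (intro null_setsI) (auto simp: lborel.emeasure_pair_measure_Times null_sets_def)
 then have "AE p in lborel \<Otimes>\<^sub>M lborel. p\<in>A\<times>B\<longrightarrow>g (snd p) = g' (snd p)"
  by (rule AE_I') (use N in \<open>auto\<close>)
 then have "AE p in leb (A\<times>B). g' (snd p) = g (snd p)"
  unfolding AE_leb_iff[OF AB] lborel_prod by eventually_elim auto
 then show ?thesis
  by (rule leb_measurable_AE[OF AB leb_measurableI[OF m]])
qed

section \<open>Abstract Hilbert space theory for representatives: Riesz representation, density,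
  fixed points\<close>

section \<open>Complete semi-inner product spaces\<close>

text \<open>Elements are functions rather than classes, so the form may vanish on nonzero elements,
  and the space is a set inside a larger vector space. Equality in the quotient is expressed by
  \<open>nr (u - v) = 0\<close>.\<close>

locale semi_inner =
 fixes V :: "'v::real_vector set" and B :: "'v=>'v=>real"
 assumes zero_mem: "0\<in>V"
  and add_mem: "\<And>u v. u\<in>V ==> v\<in>V ==> u + v\<in>V"
  and scale_mem: "\<And>c u. u\<in>V ==> c *\<^sub>R u\<in>V"
  and B_add: "\<And>u v w. u\<in>V ==> v\<in>V ==> w\<in>V ==> B (u + v) w = B u w + B v w"
  and B_scale: "\<And>c u w. u\<in>V ==> w\<in>V ==> B (c *\<^sub>R u) w = c * B u w"
  and B_sym: "\<And>u v. u\<in>V ==> v\<in>V ==> B u v = B v u"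
  and B_pos: "\<And>u. u\<in>V ==> 0\<le>B u u"
begin

definition nr :: "'v=>real" where "nr u = sqrt (B u u)"

lemma minus_mem: "u\<in>V ==> - u\<in>V"
 using scale_mem[of u "-1"] by simp

lemma diff_mem: "u\<in>V ==> v\<in>V ==> u - v\<in>V"
 using add_mem[OF _ minus_mem, of u v] by simp

lemma B_minus: "u\<in>V ==> w\<in>V ==> B (- u) w = - B u w"
 using B_scale[of u w "-1"] by simp

lemma B_diff: "u\<in>V ==> v\<in>V ==> w\<in>V ==> B (u - v) w = B u w - B v w"
 using B_add[OF _ minus_mem, of u v w] by (simp add: B_minus)

lemma B_zero: "w\<in>V ==> B 0 w = 0"
 using B_scale[OF zero_mem, of w 0] by simp

lemma B_add_right: "u\<in>V ==> v\<in>V ==> w\<in>V ==> B w (u + v) = B w u + B w v"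
 by (metis B_add B_sym add_mem)

lemma B_diff_right: "u\<in>V ==> v\<in>V ==> w\<in>V ==> B w (u - v) = B w u - B w v"
 by (metis B_diff B_sym diff_mem)

lemma B_scale_right: "u\<in>V ==> w\<in>V ==> B w (c *\<^sub>R u) = c * B w u"
 by (metis B_scale B_sym scale_mem)

lemma B_minus_right: "u\<in>V ==> w\<in>V ==> B w (- u) = - B w u"
 using B_scale_right[of u w "-1"] by simp

lemma B_zero_right: "w\<in>V ==> B w 0 = 0"
 using B_zero B_sym zero_mem by metis

lemma nr_nonneg: "u\<in>V ==> 0\<le>nr u"
 unfolding nr_def using B_pos by simp

lemma nr_sq: "u\<in>V ==> (nr u)^2 = B u u"
 unfolding nr_def using B_pos by simp

lemma B_expand:
 assumes "u\<in>V" "v\<in>V"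
 shows "B (u + c *\<^sub>R v) (u + c *\<^sub>R v) = B u u + 2 * c * B u v + c\<^sup>2 * B v v"
proof -
 have cv: "c *\<^sub>R v\<in>V" and uv: "u + c *\<^sub>R v\<in>V" using assms by (auto intro: add_mem scale_mem)
 have "B (u + c *\<^sub>R v) (u + c *\<^sub>R v) = (B u u + c * B u v) + c * (B v u + c * B v v)"
  unfolding B_add[OF assms(1) cv uv] B_scale[OF assms(2) uv] B_add_right[OF assms(1) cv assms(1)]
   B_add_right[OF assms(1) cv assms(2)] B_scale_right[OF assms(2) assms(1)] B_scale_right[OF assms(2) assms(2)] ..
 also have "B v u = B u v" using B_sym assms by blast
 finally show ?thesis by (simp add: power2_eq_square algebra_simps)
qed

lemma cauchy_schwarz_sq:
 assumes u: "u\<in>V" and v: "v\<in>V"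
 shows "(B u v)^2\<le>B u u * B v v"
proof -
 have *: "0\<le>B u u + 2 * c * B u v + c\<^sup>2 * B v v" for c
  using B_pos[OF add_mem[OF u scale_mem[OF v]], of c] B_expand[OF u v, of c] by simp
 show ?thesis
 proof (cases "B v v = 0")
  case True
  have "B u v = 0"
  proof (rule ccontr)
   assume nz: "B u v\<noteq>0"
   \<comment> \<open>For \<open>B v v = 0\<close> the quadratic polynomial in c degenerates to an
     affine one, and this c gives it the value -1.\<close>
   have "0\<le>B u u + 2 * (- (B u u + 1) / (2 * B u v)) * B u v"
    using *[of "- (B u u + 1) / (2 * B u v)"] True by simp
   also have "\<dots> = -1" using nz by (simp add: field_simps)
   finally show False by simp
  qed
  then show ?thesis using True by simp
 next
  case False
  then have pos: "B v v > 0" using B_pos[OF v] by simp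
  have "0\<le>B u u + 2 * (- B u v / B v v) * B u v + (- B u v / B v v)^2 * B v v" by (rule *)
  also have "\<dots> = B u u - (B u v)^2 / B v v"
   using pos by (simp add: field_simps power2_eq_square)
  finally show ?thesis using pos by (simp add: field_simps)
 qed
qed

lemma cauchy_schwarz:
 assumes u: "u\<in>V" and v: "v\<in>V"
 shows "\<bar>B u v\<bar>\<le>nr u * nr v"
proof -
 have "\<bar>B u v\<bar>\<^sup>2\<le>(nr u * nr v)^2"
  using cauchy_schwarz_sq[OF assms] by (simp add: power_mult_distrib nr_sq u v)
 then show ?thesis using nr_nonneg[OF u] nr_nonneg[OF v] by (simp add: power2_le_iff_abs_le)
qed

lemma nr_triangle:
 assumes u: "u\<in>V" and v: "v\<in>V"
 shows "nr (u + v)\<le>nr u + nr v"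
proof -
 have "(nr (u + v))^2 = B u u + 2 * B u v + B v v"
  using B_expand[OF u v, of 1] nr_sq[OF add_mem[OF u v]] by simp
 also have "\<dots>\<le>(nr u)^2 + 2 * (nr u * nr v) + (nr v)^2"
  using cauchy_schwarz[OF u v] by (simp add: nr_sq u v)
 also have "\<dots> = (nr u + nr v)^2" by (simp add: power2_sum)
 finally show ?thesis using nr_nonneg[OF u] nr_nonneg[OF v] by (rule power2_le_imp_le[OF _ add_nonneg_nonneg])
qed

lemma nr_scale: "u\<in>V ==> nr (c *\<^sub>R u) = \<bar>c\<bar> * nr u"
 unfolding nr_def by (simp add: B_scale B_scale_right scale_mem real_sqrt_mult mult.assoc[symmetric])

lemma nr_zero: "nr 0 = 0"
 unfolding nr_def using B_zero[OF zero_mem] by simp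

lemma nr_minus: "u\<in>V ==> nr (- u) = nr u"
 using nr_scale[of u "-1"] by simp

lemma nr_diff_commute: "u\<in>V ==> v\<in>V ==> nr (u - v) = nr (v - u)"
 using nr_minus[OF diff_mem, of u v] by simp

lemma nr_triangle_diff: "u\<in>V ==> v\<in>V ==> nr (u - v)\<le>nr u + nr v"
 using nr_triangle[OF _ minus_mem, of u v] by (simp add: nr_minus)

lemma nr_diff_triangle: "u\<in>V ==> v\<in>V ==> w\<in>V ==> nr (u - w)\<le>nr (u - v) + nr (v - w)"
 using nr_triangle[OF diff_mem diff_mem, of u v v w] by simp

lemma nr_le_add_diff: "u\<in>V ==> v\<in>V ==> nr u\<le>nr v + nr (u - v)"
 using nr_triangle[OF _ diff_mem, of v u v] by simp

lemma B_tendsto: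
 assumes s: "\<And>n::nat. s n\<in>V" and u: "u\<in>V" and v: "v\<in>V" and lim: "nullseq (%n. nr (s n - u))"
 shows "(%n. B (s n) v) \<longlonglongrightarrow> B u v"
proof -
 have "nullseq (%n. B (s n) v - B u v)"
 proof (rule Lim_null_comparison)
  show "\<forall>\<^sub>F n in sequentially. norm (B (s n) v - B u v)\<le>nr (s n - u) * nr v"
   using cauchy_schwarz[OF diff_mem[OF s u] v] by (auto simp: B_diff s u v)
  show "nullseq (%n. nr (s n - u) * nr v)"
   using tendsto_mult_left_zero[OF lim] .
 qed
 then show ?thesis by (simp add: LIM_zero_iff)
qed

lemma nr_eq_zeroI: "u\<in>V ==> (\<And>v. v\<in>V ==> B u v = 0) ==> nr u = 0"
 unfolding nr_def by simp

lemma B_cong_left: "u\<in>V ==> u'\<in>V ==> v\<in>V ==> nr (u - u') = 0 ==> B u v = B u' v"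
 using cauchy_schwarz[of "u - u'" v] by (simp add: B_diff diff_mem)

lemma nr_cong:
 assumes "u\<in>V" "v\<in>V" "nr (u - v) = 0"
 shows "nr u = nr v"
 using nr_le_add_diff[OF assms(1,2)] nr_le_add_diff[OF assms(2,1)] nr_diff_commute[OF assms(1,2)] assms(3)
 by linarith

end

locale semi_hilbert = semi_inner V B for V :: "'v::real_vector set" and B +
 assumes complete: "\<And>s. (\<And>n::nat. s n\<in>V) ==>
  (\<And>e. e > 0 ==> \<exists>N. \<forall>m\<ge>N. \<forall>n\<ge>N. B (s m - s n) (s m - s n) < e) ==>
  \<exists>u\<in>V. nullseq (%n. B (s n - u) (s n - u))"
begin

lemma complete_nr:
 assumes s: "\<And>n::nat. s n\<in>V"
  and C: "\<And>e. e > 0 ==> \<exists>N. \<forall>m\<ge>N. \<forall>n\<ge>N. nr (s m - s n) < e"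
 shows "\<exists>u\<in>V. nullseq (%n. nr (s n - u))"
proof -
 have "\<exists>u\<in>V. nullseq (%n. B (s n - u) (s n - u))"
 proof (rule complete[of s, OF s])
  fix e :: real assume "e > 0"
  then obtain N where N: "\<forall>m\<ge>N. \<forall>n\<ge>N. nr (s m - s n) < sqrt e"
   using C[of "sqrt e"] by auto
  show "\<exists>N. \<forall>m\<ge>N. \<forall>n\<ge>N. B (s m - s n) (s m - s n) < e"
  proof (intro exI allI impI)
   fix m n assume "m\<ge>N" "n\<ge>N"
   then show "B (s m - s n) (s m - s n) < e" using N unfolding nr_def by simp
  qed
 qed
 then obtain u where u: "u\<in>V" "nullseq (%n. B (s n - u) (s n - u))" by auto
 from tendsto_real_sqrt[OF u(2)] have "nullseq (%n. nr (s n - u))" by (simp add: nr_def)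
 with u(1) show ?thesis by blast
qed

text \<open>Stated for linear relations rather than functionals on subspaces: the operators to which it is
 applied are only defined up to null sets.\<close>

theorem riesz_relation:
 fixes R :: "('v\<times>real) set"
 assumes RV: "\<And>d r. (d, r)\<in>R ==> d\<in>V"
  and R0: "(0, 0)\<in>R"
  and Radd: "\<And>d r d' r'. (d, r)\<in>R ==> (d', r')\<in>R ==> (d + d', r + r')\<in>R"
  and Rscale: "\<And>c d r. (d, r)\<in>R ==> (c *\<^sub>R d, c * r)\<in>R"
  and bound: "\<And>d r. (d, r)\<in>R ==> \<bar>r\<bar>\<le>C * nr d"
 obtains u s where "u\<in>V" "\<And>d r. (d, r)\<in>R ==> B u d = r"
  "\<And>n::nat. s n\<in>fst ` R" "nullseq (%n. nr (s n - u))"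
proof -
 \<comment> \<open>Twice the Riesz energy, |d|^2 - 2 r. Minimizing sequences are Cauchy, and their
   limit represents the functional.\<close>
 define J where "J = (%p :: 'v\<times>real. B (fst p) (fst p) - 2 * snd p)"
 have Jlow: "J p\<ge>- C\<^sup>2" if "p\<in>R" for p
 proof -
  have m: "fst p\<in>V" using RV[of "fst p" "snd p"] that by simp
  have "snd p\<le>C * nr (fst p)" using bound[of "fst p" "snd p"] that by simp
  then have "J p\<ge>(nr (fst p))^2 - 2 * (C * nr (fst p))" unfolding J_def nr_sq[OF m] by simp
  moreover have "(nr (fst p))^2 - 2 * (C * nr (fst p)) = (nr (fst p) - C)^2 - C\<^sup>2"
   by (simp add: power2_diff)
  ultimately show ?thesis using zero_le_power2[of "nr (fst p) - C"] by linarith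
 qed
 define I where "I = Inf (J ` R)"
 have bdd: "bdd_below (J ` R)" using Jlow by (intro bdd_belowI[of _ "- C\<^sup>2"]) auto
 have Ile: "I\<le>J p" if "p\<in>R" for p unfolding I_def using bdd that by (intro cInf_lower) auto
 have "\<exists>p\<in>R. J p < I + 1 / real (Suc n)" for n
  using cInf_lessD[of "J ` R" "I + 1 / real (Suc n)"] R0 unfolding I_def by force
 then obtain p where p: "\<And>n. p n\<in>R" "\<And>n. J (p n) < I + 1 / real (Suc n)" by metis
 define s where "s = (%n. fst (p n))"
 have pR: "(s n, snd (p n))\<in>R" for n using p(1)[of n] by (simp add: s_def)
 have sV: "s n\<in>V" for n using RV[OF pR] .
 \<comment> \<open>Parallelogram identity for two near-minimizers, compared with their midpoint,
   which lies in \<open>R\<close> again.\<close>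
 have gap: "B (s m - s n) (s m - s n)\<le>2 * (1 / real (Suc m) + 1 / real (Suc n))" for m n
 proof -
  let ?q = "((1/2) *\<^sub>R (s m + s n), (1/2) * (snd (p m) + snd (p n)))"
  have "?q\<in>R" by (intro Rscale Radd pR)
  then have "I\<le>J ?q" by (rule Ile)
  moreover have "4 * J ?q = 2 * J (p m) + 2 * J (p n) - B (s m - s n) (s m - s n)"
  proof -
   have e: "B (s m - s n) (s m - s n) = B (s m) (s m) - 2 * B (s m) (s n) + B (s n) (s n)"
    using B_expand[OF sV[of m] sV[of n], of "-1"] by simp
   have "B ((1/2) *\<^sub>R (s m + s n)) ((1/2) *\<^sub>R (s m + s n)) = (1/2) * ((1/2) * B (s m + s n) (s m + s n))"
    by (simp add: B_scale B_scale_right add_mem scale_mem sV)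
   also have "\<dots> = (B (s m) (s m) + 2 * B (s m) (s n) + B (s n) (s n)) / 4"
    using B_expand[OF sV[of m] sV[of n], of 1] by simp
   finally show ?thesis using e unfolding J_def fst_conv snd_conv s_def by argo
  qed
  ultimately show ?thesis using p(2)[of m] p(2)[of n] by (simp add: algebra_simps)
 qed
 have "\<exists>u\<in>V. nullseq (%n. B (s n - u) (s n - u))"
 proof (rule complete[of s, OF sV])
  fix e :: real assume e: "e > 0"
  obtain N where N: "1 / real (Suc N) < e / 4" using e nat_approx_posE[of "e / 4"] by auto
  show "\<exists>N. \<forall>m\<ge>N. \<forall>n\<ge>N. B (s m - s n) (s m - s n) < e"
  proof (intro exI allI impI)
   fix m n assume "m\<ge>N" "n\<ge>N"
   then have "1 / real (Suc m)\<le>1 / real (Suc N)" "1 / real (Suc n)\<le>1 / real (Suc N)"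
    by (auto intro!: divide_left_mono)
   with N gap[of m n] show "B (s m - s n) (s m - s n) < e" by simp
  qed
 qed
 then obtain u where u: "u\<in>V" "nullseq (%n. B (s n - u) (s n - u))" by auto
 have lim: "nullseq (%n. nr (s n - u))" using tendsto_real_sqrt[OF u(2)] by (simp add: nr_def)
 have "B u d = r" if dr: "(d, r)\<in>R" for d r
 proof -
  have d: "d\<in>V" using RV[OF dr] .
  \<comment> \<open>First variation at u in direction d. Since u is a limit that may lie outside the
    domain of the relation, the near-minimality of \<open>s n\<close> up to 1/(n+1) is used before
    passing to the limit.\<close>
  have ineq: "0\<le>2 * c * (B u d - r) + c\<^sup>2 * B d d" for c
  proof (rule LIMSEQ_le_const)
   show "(%n. 2 * c * (B (s n) d - r) + c\<^sup>2 * B d d + 1 / real (Suc n))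
    \<longlonglongrightarrow> 2 * c * (B u d - r) + c\<^sup>2 * B d d"
    using tendsto_add[OF tendsto_add[OF tendsto_mult[OF tendsto_const tendsto_diff[OF B_tendsto[OF sV u(1) d lim] tendsto_const]] tendsto_const] LIMSEQ_inverse_real_of_nat]
    by (simp add: inverse_eq_divide)
   have "0\<le>2 * c * (B (s n) d - r) + c\<^sup>2 * B d d + 1 / real (Suc n)" for n
   proof -
    have "(s n + c *\<^sub>R d, snd (p n) + c * r)\<in>R" by (intro Radd Rscale pR dr)
    from Ile[OF this] have "I\<le>B (s n) (s n) + 2 * c * B (s n) d + c\<^sup>2 * B d d - 2 * (snd (p n) + c * r)"
     unfolding J_def by (simp add: B_expand sV d)
    moreover have "B (s n) (s n) - 2 * snd (p n) < I + 1 / real (Suc n)"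
     using p(2)[of n] by (simp add: J_def s_def)
    ultimately show ?thesis by (simp add: algebra_simps)
   qed
   then show "\<exists>N. \<forall>n\<ge>N. 0\<le>2 * c * (B (s n) d - r) + c\<^sup>2 * B d d + 1 / real (Suc n)" by blast
  qed
  show ?thesis
  proof (rule ccontr)
   assume ne: "B u d\<noteq>r"
   define a where "a = B u d - r"
   \<comment> \<open>The shift by 1 keeps b positive when d has seminorm zero.\<close>
   define b where "b = B d d + 1"
   have b: "b > 0" using B_pos[OF d] by (simp add: b_def)
   have "0\<le>2 * (- a / b) * a + (- a / b)^2 * (b - 1)" using ineq[of "- a / b"] by (simp add: a_def b_def)
   also have "\<dots> = - (a\<^sup>2 / b) - (a / b)^2" using b by (simp add: field_simps power2_eq_square)
   also have "\<dots> < 0" 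
   proof -
    have "a\<^sup>2 > 0" using ne by (simp add: a_def)
    then have "a\<^sup>2 / b > 0" using b by simp
    then show ?thesis using zero_le_power2[of "a / b"] by linarith
   qed
   finally show False by simp
  qed
 qed
 moreover have "s n\<in>fst ` R" for n using pR[of n] by force
 ultimately show ?thesis using that[of u s] u(1) lim by blast
qed

lemma riesz_functional:
 assumes add: "\<And>u v. u\<in>V ==> v\<in>V ==> g (u + v) = g u + g v"
  and scale: "\<And>c u. u\<in>V ==> g (c *\<^sub>R u) = c * g u"
  and bound: "\<And>u. u\<in>V ==> \<bar>g u\<bar>\<le>C * nr u"
 obtains u where "u\<in>V" "\<And>v. v\<in>V ==> B u v = g v"
proof -
 let ?R = "(%v. (v, g v)) ` V"
 have g0: "g 0 = 0" using scale[OF zero_mem, of 0] by simp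
 obtain u s where u: "u\<in>V" "\<And>d r. (d, r)\<in>?R ==> B u d = r"
  and "\<And>n::nat. s n\<in>fst ` ?R" "nullseq (%n. nr (s n - u))"
  by (rule riesz_relation[of ?R C]) (use add scale bound zero_mem g0 in \<open>auto simp: image_iff add_mem scale_mem\<close>)
 show ?thesis by (rule that[OF u(1)]) (use u(2) in auto)
qed

text \<open>Representing \<open>B u\<close> restricted to D gives, by construction, an element that
  is a limit from D. Its difference to u is orthogonal to D and hence null.\<close>

lemma dense_subspace:
 assumes DV: "D\<subseteq>V" and D0: "0\<in>D"
  and Dadd: "\<And>u v. u\<in>D ==> v\<in>D ==> u + v\<in>D" and Dscale: "\<And>c u. u\<in>D ==> c *\<^sub>R u\<in>D"
  and orth: "\<And>u. u\<in>V ==> (\<And>d. d\<in>D ==> B u d = 0) ==> nr u = 0"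
  and u: "u\<in>V"
 obtains s where "\<And>n::nat. s n\<in>D" "nullseq (%n. nr (s n - u))"
proof -
 let ?R = "(%d. (d, B u d)) ` D"
 have dV: "d\<in>V" if "d\<in>D" for d using that DV by auto
 obtain u' s where u': "u'\<in>V" "\<And>d r. (d, r)\<in>?R ==> B u' d = r"
  and s: "\<And>n::nat. s n\<in>fst ` ?R" "nullseq (%n. nr (s n - u'))"
  by (rule riesz_relation[of ?R "nr u"])
   (use u D0 Dadd Dscale in \<open>auto simp: image_iff dV B_add_right B_scale_right B_zero_right intro!: cauchy_schwarz\<close>)
 have sD: "s n\<in>D" for n using s(1)[of n] by auto
 have z: "nr (u' - u) = 0"
  by (rule orth[OF diff_mem[OF u'(1) u]]) (use u'(2) in \<open>auto simp: B_diff u'(1) u dV\<close>)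
 have "nullseq (%n. nr (s n - u))"
 proof (rule Lim_null_comparison[OF _ s(2)])
  show "\<forall>\<^sub>F n in sequentially. norm (nr (s n - u))\<le>nr (s n - u')"
   using nr_diff_triangle[OF dV[OF sD] u'(1) u] z nr_nonneg[OF diff_mem[OF dV[OF sD] u]]
   by (auto simp: )
 qed
 then show ?thesis using that sD by blast
qed

text \<open>Banach's theorem with constant 1/2 for a seminorm; the fixed point equation then holds
  up to seminorm zero.\<close>

lemma contraction_fixed_point:
 assumes N: "\<And>u. u\<in>V ==> N u\<in>V"
  and contr: "\<And>u v. u\<in>V ==> v\<in>V ==> nr (N u - N v)\<le>1/2 * nr (u - v)"
 obtains u where "u\<in>V" "nr (N u - u) = 0"
proof -
 define x where "x = (%n. (N ^^ n) 0)"
 have xV: "x n\<in>V" for n by (induction n) (auto simp: x_def zero_mem N)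
 have xS: "x (Suc n) = N (x n)" for n by (simp add: x_def)
 define a where "a = nr (x 1 - x 0)"
 have a0: "a\<ge>0" unfolding a_def by (intro nr_nonneg diff_mem xV)
 \<comment> \<open>\<open>c n / 2\<close> bounds the n-th step, and since
   \<open>c (Suc n) = c n / 2\<close> the differences of c telescope to a bound for the distance of
   any two iterates.\<close>
 define c where "c = (%n. 2 * a * (1/2)^n)"
 have c0: "c n\<ge>0" for n using a0 by (simp add: c_def)
 have cS: "c (Suc n) = c n / 2" for n by (simp add: c_def)
 have c_lim: "nullseq c"
  unfolding c_def by (rule tendsto_mult_right_zero, rule LIMSEQ_power_zero) simp
 have step: "nr (x (Suc n) - x n)\<le>c n / 2" for n
 proof (induction n)
  case 0
  show ?case by (simp add: a_def c_def)
 next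
  case (Suc n)
  have "nr (x (Suc (Suc n)) - x (Suc n))\<le>1/2 * nr (x (Suc n) - x n)"
   using contr[OF xV[of "Suc n"] xV[of n]] unfolding xS[of "Suc n"] xS[of n] .
  then show ?case using Suc.IH unfolding cS[of n] by linarith
 qed
 have dist: "nr (x (n + k) - x n)\<le>c n - c (n + k)" for n k
 proof (induction k)
  case 0
  show ?case by (simp add: nr_zero)
 next
  case (Suc k)
  have "nr (x (Suc (n + k)) - x n)\<le>nr (x (Suc (n + k)) - x (n + k)) + nr (x (n + k) - x n)"
   by (rule nr_diff_triangle[OF xV xV xV])
  then show ?case using step[of "n + k"] Suc.IH cS[of "n + k"] unfolding add_Suc_right by linarith
 qed
 have tail: "nr (x m - x K)\<le>c K" if "m\<ge>K" for m K
  using dist[of K "m - K"] c0[of m] that by simp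
 have dist': "nr (x m - x n)\<le>2 * c K" if "m\<ge>K" "n\<ge>K" for m n K
  using nr_diff_triangle[OF xV[of m] xV[of K] xV[of n]] nr_diff_commute[OF xV[of K] xV[of n]]
   tail[OF that(1)] tail[OF that(2)] by linarith
 have "\<exists>u\<in>V. nullseq (%n. nr (x n - u))"
 proof (rule complete_nr[of x, OF xV])
  fix e :: real assume e: "e > 0"
  then have e2: "0 < e / 2" by (rule half_gt_zero)
  obtain K where "\<forall>n\<ge>K. norm (c n - 0) < e / 2" using LIMSEQ_D[OF c_lim e2] ..
  then have "norm (c K - 0) < e / 2" by blast
  then have K: "c K < e / 2" by simp
  show "\<exists>N. \<forall>m\<ge>N. \<forall>n\<ge>N. nr (x m - x n) < e"
  proof (intro exI allI impI)
   fix m n assume mn: "m\<ge>K" "n\<ge>K"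
   show "nr (x m - x n) < e" using dist'[OF mn] K by linarith
  qed
 qed
 then obtain u where u: "u\<in>V" "nullseq (%n. nr (x n - u))" by blast
 have "nr (N u - u)\<le>0"
 proof (rule LIMSEQ_le_const)
  have "(%n. nr (x n - u) + nr (x (Suc n) - u)) \<longlonglongrightarrow> 0 + 0"
   by (intro tendsto_add u(2) LIMSEQ_Suc)
  then show "nullseq (%n. nr (x n - u) + nr (x (Suc n) - u))" by simp
  have "nr (N u - u)\<le>nr (x n - u) + nr (x (Suc n) - u)" for n
  proof -
   have "nr (N u - u)\<le>nr (N u - x (Suc n)) + nr (x (Suc n) - u)"
    by (intro nr_diff_triangle N u xV)
   moreover have "nr (N u - x (Suc n))\<le>1/2 * nr (u - x n)"
    using contr[OF u(1) xV[of n]] by (simp add: xS)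
   ultimately show ?thesis
    using nr_diff_commute[OF u(1) xV, of n] nr_nonneg[OF diff_mem[OF u(1) xV[of n]]] by linarith
  qed
  then show "\<exists>K. \<forall>n\<ge>K. nr (N u - u)\<le>nr (x n - u) + nr (x (Suc n) - u)" by blast
 qed
 then have "nr (N u - u) = 0" using nr_nonneg[OF diff_mem[OF N[OF u(1)] u(1)]] by simp
 with that u(1) show ?thesis by blast
qed

end

lemma semi_inner_pullback:
 fixes \<Phi> :: "'w::real_vector=>'v::real_vector"
 assumes "semi_inner V B"
  and add: "\<And>u v. \<Phi> (u + v) = \<Phi> u + \<Phi> v" and scale: "\<And>c u. \<Phi> (c *\<^sub>R u) = c *\<^sub>R \<Phi> u"
 shows "semi_inner {w. \<Phi> w\<in>V} (%u v. B (\<Phi> u) (\<Phi> v))"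
proof -
 interpret semi_inner V B by fact
 have z: "\<Phi> 0 = 0" using scale[of 0 0] by simp
 show ?thesis
 proof
  show "B (\<Phi> u) (\<Phi> v) = B (\<Phi> v) (\<Phi> u)" if "u\<in>{w. \<Phi> w\<in>V}" "v\<in>{w. \<Phi> w\<in>V}" for u v
   using that B_sym by blast
 qed (simp_all add: add scale z zero_mem add_mem scale_mem B_add B_scale B_pos)
qed

text \<open>Transfers completeness along a linear map, with surjectivity lifting the limit. It
  serves for uncurrying and for multiplication by an exponential weight.\<close>

lemma semi_hilbert_pullback:
 fixes \<Phi> :: "'w::real_vector=>'v::real_vector"
 assumes H: "semi_hilbert V B"
  and add: "\<And>u v. \<Phi> (u + v) = \<Phi> u + \<Phi> v" and scale: "\<And>c u. \<Phi> (c *\<^sub>R u) = c *\<^sub>R \<Phi> u"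
  and surj: "\<And>v. v\<in>V ==> \<exists>w. \<Phi> w = v"
 shows "semi_hilbert {w. \<Phi> w\<in>V} (%u v. B (\<Phi> u) (\<Phi> v))"
proof -
 interpret semi_hilbert V B by fact
 have diff: "\<Phi> (u - v) = \<Phi> u - \<Phi> v" for u v
  using add[of u "-1 *\<^sub>R v"] by (simp add: scale[of "-1" v, simplified])
 show ?thesis
 proof (intro semi_hilbert.intro semi_inner_pullback semi_hilbert_axioms.intro)
  show "semi_inner V B" by unfold_locales
  fix s :: "nat=>'w"
  assume s: "\<And>n. s n\<in>{w. \<Phi> w\<in>V}"
   and C: "\<And>e. 0 < e ==> \<exists>N. \<forall>m\<ge>N. \<forall>n\<ge>N. B (\<Phi> (s m - s n)) (\<Phi> (s m - s n)) < e"
  have "\<exists>u\<in>V. nullseq (%n. B (\<Phi> (s n) - u) (\<Phi> (s n) - u))"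
   using s C by (intro complete) (auto simp: diff)
  then show "\<exists>u\<in>{w. \<Phi> w\<in>V}. nullseq (%n. B (\<Phi> (s n - u)) (\<Phi> (s n - u)))"
   using surj by (auto simp: diff)
 qed (use add scale in auto)
qed

section \<open>The L^2 spaces of finite measures and their completeness\<close>

section \<open>Square integrable functions\<close>

definition sqi :: "'a measure=>('a=>real) set" where
 "sqi M = {u\<in>meas M. integrable M (%x. (u x)^2)}"

lemma sqi_meas: "u\<in>sqi M ==> u\<in>meas M"
 and sqi_int: "u\<in>sqi M ==> integrable M (%x. (u x)^2)"
 by (auto simp: sqi_def)

lemma sqi_mult:
 assumes u: "u\<in>sqi M" and v: "v\<in>sqi M"
 shows "integrable M (%x. u x * v x)"
proof (rule Bochner_Integration.integrable_bound)
 show "integrable M (%x. (u x)^2 + (v x)^2)" using u v by (auto simp: sqi_def)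
 show "(%x. u x * v x)\<in>meas M" using u v by (auto simp: sqi_def)
 have "\<bar>a * b\<bar>\<le>a\<^sup>2 + b\<^sup>2" for a b :: real
 proof -
  have "2 * (\<bar>a\<bar> * \<bar>b\<bar>)\<le>a\<^sup>2 + b\<^sup>2" using sum_squares_bound[of "\<bar>a\<bar>" "\<bar>b\<bar>"] by simp
  moreover have "0\<le>\<bar>a\<bar> * \<bar>b\<bar>" by simp
  ultimately show ?thesis unfolding abs_mult by linarith
 qed
 then show "AE x in M. norm (u x * v x)\<le>norm ((u x)^2 + (v x)^2)"
  by (auto simp: )
qed

lemma sqi_bounded:
 assumes u: "u\<in>sqi M" and v: "v\<in>meas M" and le: "AE x in M. \<bar>v x\<bar>\<le>C * \<bar>u x\<bar>"
 shows "v\<in>sqi M"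
proof -
 have "integrable M (%x. C\<^sup>2 * (u x)^2)" using u by (auto simp: sqi_def)
 then have "integrable M (%x. (v x)^2)"
 proof (rule Bochner_Integration.integrable_bound)
  show "AE x in M. norm ((v x)^2)\<le>norm (C\<^sup>2 * (u x)^2)"
   using le
  proof eventually_elim
   case (elim x)
   then have "\<bar>v x\<bar>\<^sup>2\<le>(C * \<bar>u x\<bar>)^2" by (intro power_mono) auto
   then show ?case by (simp add: power_mult_distrib)
  qed
 qed (use v in auto)
 then show ?thesis using v by (simp add: sqi_def)
qed

lemma sqi_add: "u\<in>sqi M ==> v\<in>sqi M ==> (%x. u x + v x)\<in>sqi M"
 using sqi_mult[of u M v] by (auto simp: sqi_def power2_sum mult.assoc)

lemma sqi_scale: "u\<in>sqi M ==> (%x. c * u x)\<in>sqi M"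
 by (auto simp: sqi_def power_mult_distrib)

lemma sqi_uminus: "u\<in>sqi M ==> (%x. - u x)\<in>sqi M"
 by (auto simp: sqi_def)

lemma sqi_diff: "u\<in>sqi M ==> v\<in>sqi M ==> (%x. u x - v x)\<in>sqi M"
 using sqi_add[OF _ sqi_uminus, of u M v] by simp

lemma sqi_zero: "(%x. 0)\<in>sqi M"
 by (auto simp: sqi_def)

lemma sqi_const: "finite_measure M ==> (%x. c)\<in>sqi M"
 by (auto simp: sqi_def finite_measure.integrable_const)

lemma sqi_AE:
 assumes "u\<in>sqi M" "v\<in>meas M" "AE x in M. v x = u x"
 shows "v\<in>sqi M"
 by (rule sqi_bounded[of u M v 1]) (use assms in auto)

lemma semi_inner_sqi: "semi_inner (sqi M) (%u v. \<integral>x. u x * v x\<partial>M)"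
proof
 show "0\<in>sqi M" by (auto simp: sqi_def zero_fun_def)
 show "u + v\<in>sqi M" if "u\<in>sqi M" "v\<in>sqi M" for u v
  using sqi_add[OF that] by (simp add: plus_fun_def)
 show "c *\<^sub>R u\<in>sqi M" if "u\<in>sqi M" for c u
  using sqi_scale[OF that] by (simp add: scaleR_fun_def)
 show "(\<integral>x. (u + v) x * w x\<partial>M) = (\<integral>x. u x * w x\<partial>M) + (\<integral>x. v x * w x\<partial>M)"
  if "u\<in>sqi M" "v\<in>sqi M" "w\<in>sqi M" for u v w
  using that by (simp add: distrib_right sqi_mult)
 show "(\<integral>x. (c *\<^sub>R u) x * w x\<partial>M) = c * (\<integral>x. u x * w x\<partial>M)" for c u w
  by (simp add: scaleR_fun_def mult.assoc)
 show "(\<integral>x. u x * v x\<partial>M) = (\<integral>x. v x * u x\<partial>M)" for u v :: "'a=>real"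
  by (rule integral_cong') (simp_all add: mult.commute)
qed auto

lemma sqi_integrable: "finite_measure M ==> u\<in>sqi M ==> integrable M u"
 using sqi_mult[OF _ sqi_const, of u M 1] by simp

text \<open>Riesz-Fischer. On a finite measure space an L^2 Cauchy sequence is L^1 Cauchy, so a
  subsequence converges almost everywhere; Fatou's lemma then bounds the L^2 distance of the whole
  sequence to that limit.\<close>

lemma semi_hilbert_sqi:
 assumes fin: "finite_measure M"
 shows "semi_hilbert (sqi M) (%u v. \<integral>x. u x * v x\<partial>M)"
proof (intro semi_hilbert.intro semi_inner_sqi semi_hilbert_axioms.intro)
 interpret semi_inner "sqi M" "%u v. \<integral>x. u x * v x\<partial>M" by (rule semi_inner_sqi)
 fix s :: "nat=>'a=>real"
 let ?I = "%m n. \<integral>x. (s m - s n) x * (s m - s n) x\<partial>M"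
 assume s: "\<And>n. s n\<in>sqi M"
  and C: "\<And>e. 0 < e ==> \<exists>N. \<forall>m\<ge>N. \<forall>n\<ge>N. (?I m n) < e"
 have one: "(%x. 1)\<in>sqi M" by (rule sqi_const[OF fin])
 have L1: "(\<integral>x. \<bar>u x\<bar>\<partial>M)^2\<le>(\<integral>x. u x * u x\<partial>M) * measure M (space M)" if u: "u\<in>sqi M" for u
 proof -
  have "(%x. \<bar>u x\<bar>)\<in>sqi M" by (rule sqi_bounded[OF u, of _ 1]) (use sqi_meas[OF u] in auto)
  from cauchy_schwarz_sq[OF this one] show ?thesis by (simp add: abs_mult_self_eq)
 qed
 have [measurable]: "s n\<in>meas M" for n by (rule sqi_meas[OF s])
 have int: "integrable M (s n)" for n by (rule sqi_integrable[OF fin s])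
 \<comment> \<open>The added 1 makes division by this constant safe even for the zero
   measure.\<close>
 define \<mu> where "\<mu> = measure M (space M) + 1"
 have \<mu>: "\<mu> > 0" by (simp add: \<mu>_def add_nonneg_pos)
 obtain r where r: "strict_mono r" "AE x in M. Cauchy (%i. s (r i) x)"
 proof (rule cauchy_L1_AE_cauchy_subseq[OF int])
  fix e :: real assume e: "e > 0"
  then obtain N where N: "\<forall>m\<ge>N. \<forall>n\<ge>N. (?I m n) < e\<^sup>2 / \<mu>"
   using C[of "e\<^sup>2 / \<mu>"] \<mu> by auto
  show "\<exists>N. \<forall>i\<ge>N. \<forall>j\<ge>N. LINT x|M. norm (s i x - s j x) < e"
  proof (intro exI allI impI)
   fix i j assume ij: "i\<ge>N" "j\<ge>N"
   have "(\<integral>x. \<bar>(s i - s j) x\<bar>\<partial>M)^2\<le>(\<integral>x. (s i - s j) x * (s i - s j) x\<partial>M) * measure M (space M)"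
    by (rule L1[OF diff_mem[OF s s]])
   also have "\<dots>\<le>(\<integral>x. (s i - s j) x * (s i - s j) x\<partial>M) * \<mu>"
    by (intro mult_left_mono) (auto simp: \<mu>_def)
   also have "\<dots> < e\<^sup>2" using N ij \<mu> by (simp add: field_simps)
   finally show "LINT x|M. norm (s i x - s j x) < e" using e
    by (simp add: power_less_imp_less_base)
  qed
 qed
 define u where "u = (%x. lim (%i. s (r i) x))"
 have um[measurable]: "u\<in>meas M"
  unfolding u_def by (rule borel_measurable_lim_metric) (use s in \<open>auto simp: sqi_def\<close>)
 have ulim: "AE x in M. (%i. s (r i) x) \<longlonglongrightarrow> u x"
  using r(2) by eventually_elim (auto simp: u_def Cauchy_convergent_iff convergent_LIMSEQ_iff)
 have fatou: "(\<integral>\<^sup>+x. ennreal ((s n x - u x)^2)\<partial>M)\<le>ennreal e"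
  if N: "\<forall>m\<ge>N. \<forall>n\<ge>N. (?I m n) < e" and n: "n\<ge>N" for e N n
 proof -
  have "(\<integral>\<^sup>+x. ennreal ((s n x - u x)^2)\<partial>M) = (\<integral>\<^sup>+x. liminf (%i. ennreal ((s n x - s (r i) x)^2))\<partial>M)"
  proof (rule nn_integral_cong_AE, use ulim in eventually_elim)
   case (elim x)
   have "(%i. ennreal ((s n x - s (r i) x)^2)) \<longlonglongrightarrow> ennreal ((s n x - u x)^2)"
    by (intro tendsto_ennrealI tendsto_power tendsto_diff tendsto_const elim)
   from lim_imp_Liminf[OF trivial_limit_sequentially this] show ?case by (rule sym)
  qed
  also have "\<dots>\<le>liminf (%i. \<integral>\<^sup>+x. ennreal ((s n x - s (r i) x)^2)\<partial>M)"
   by (rule nn_integral_liminf) measurable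
  also have "\<dots>\<le>ennreal e"
  proof (rule Liminf_le)
   show "\<forall>\<^sub>F i in sequentially. (\<integral>\<^sup>+x. ennreal ((s n x - s (r i) x)^2)\<partial>M)\<le>ennreal e"
   proof (rule eventually_sequentiallyI)
    fix i assume "i\<ge>N"
    then have "r i\<ge>N" using seq_suble[OF r(1), of i] by simp
    then have "(\<integral>x. (s n x - s (r i) x)^2\<partial>M) < e" using N n by (auto simp: power2_eq_square)
    moreover have "integrable M (%x. (s n x - s (r i) x)^2)"
     using sqi_int[OF sqi_diff[OF s s]] .
    ultimately show "(\<integral>\<^sup>+x. ennreal ((s n x - s (r i) x)^2)\<partial>M)\<le>ennreal e"
     by (subst nn_integral_eq_integral) (auto intro: ennreal_leI)
   qed
  qed simp
  finally show ?thesis .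
 qed
 have sqd: "(%x. s n x - u x)\<in>sqi M" if N: "\<forall>m\<ge>N. \<forall>n\<ge>N. (?I m n) < e" and n: "n\<ge>N" for e N n
 proof -
  have "integrable M (%x. (s n x - u x)^2)"
   by (rule integrableI_nonneg) (use le_less_trans[OF fatou[OF N n]] in auto)
  then show ?thesis by (simp add: sqi_def)
 qed
 have u: "u\<in>sqi M"
 proof -
  obtain N where N: "\<forall>m\<ge>N. \<forall>n\<ge>N. (?I m n) < 1" using C[of 1] by auto
  have "(%x. s N x - (s N x - u x))\<in>sqi M" by (rule sqi_diff[OF s sqd[OF N]]) simp
  then show ?thesis by simp
 qed
 show "\<exists>u\<in>sqi M. nullseq (%n. \<integral>x. (s n - u) x * (s n - u) x\<partial>M)"
 proof (intro bexI[OF _ u] LIMSEQ_I)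
  fix e :: real assume e: "e > 0"
  then obtain N where N: "\<forall>m\<ge>N. \<forall>n\<ge>N. (?I m n) < e/2" using C[of "e/2"] by auto
  show "\<exists>N. \<forall>n\<ge>N. norm ((\<integral>x. (s n - u) x * (s n - u) x\<partial>M) - 0) < e"
  proof (intro exI allI impI)
   fix n assume n: "n\<ge>N"
   have "ennreal (\<integral>x. (s n x - u x)^2\<partial>M)\<le>ennreal (e/2)"
    using fatou[OF N n] sqi_int[OF sqd[OF N n]] by (subst nn_integral_eq_integral[symmetric]) auto
   then have "(\<integral>x. (s n x - u x)^2\<partial>M)\<le>e/2" using e by (simp add: ennreal_le_iff)
   moreover have "0\<le>(\<integral>x. (s n x - u x)^2\<partial>M)" by simp
   ultimately show "norm ((\<integral>x. (s n - u) x * (s n - u) x\<partial>M) - 0) < e"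
    using e by (simp add: power2_eq_square)
  qed
 qed
qed

section \<open>Closure properties of smooth functions and a supply of bump functions\<close>

section \<open>Smooth functions\<close>

lemma frechet_derivative_eqI:
 "(f has_derivative f') (at x) ==> frechet_derivative f (at x) = f'"
 by (metis frechet_derivative_at)

lemma C_k_continuous: "C_k k \<phi> ==> continuous_on UNIV \<phi>"
 by (cases k) (auto intro!: differentiable_imp_continuous_on simp: differentiable_on_def differentiable_at_withinI)

lemma C_k_antimono: "C_k (Suc k) \<phi> ==> C_k k \<phi>"
proof (induction k arbitrary: \<phi>)
 case 0
 then show ?case using C_k_continuous[of "Suc 0" \<phi>] by simp
next
 case (Suc k)
 then show ?case by (metis C_k.simps(2))
qed

lemma C_k_const: "C_k k (%x. c)"
proof (induction k arbitrary: c)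
 case (Suc k)
 then show ?case by simp
qed simp

lemma C_k_inner: "C_k k (%x. x \<bullet> a)"
proof (cases k)
 case (Suc m)
 have d: "((%x. x \<bullet> a) has_derivative (%h. h \<bullet> a)) (at x)" for x :: 'a
  by (auto intro!: derivative_eq_intros)
 show ?thesis
  unfolding Suc C_k.simps frechet_derivative_eqI[OF d] using d by (auto simp: C_k_const differentiable_def)
qed (auto intro!: continuous_intros)

lemma C_k_add: "C_k k f ==> C_k k g ==> C_k k (%x. f x + g x)"
proof (induction k arbitrary: f g)
 case (Suc k)
 have "frechet_derivative (%x. f x + g x) (at x) b
   = frechet_derivative f (at x) b + frechet_derivative g (at x) b" for x b
  using Suc.prems by (subst frechet_derivative_eqI[OF has_derivative_add[OF
    frechet_derivative_works[THEN iffD1] frechet_derivative_works[THEN iffD1]]]) auto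
 then show ?case using Suc by auto
qed (auto intro: continuous_on_add)

lemma C_k_mult: "C_k k f ==> C_k k g ==> C_k k (%x. f x * g x)"
proof (induction k arbitrary: f g)
 case (Suc k)
 have "frechet_derivative (%x. f x * g x) (at x) b
   = f x * frechet_derivative g (at x) b + frechet_derivative f (at x) b * g x" for x b
  using Suc.prems by (subst frechet_derivative_eqI[OF has_derivative_mult[OF
    frechet_derivative_works[THEN iffD1] frechet_derivative_works[THEN iffD1]]]) auto
 then show ?case
  using Suc.prems Suc.IH C_k_antimono[of k f] C_k_antimono[of k g] by (auto intro!: C_k_add)
qed (auto intro: continuous_on_mult)

lemma C_k_prod: "finite I ==> (\<And>i. i\<in>I ==> C_k k (f i)) ==> C_k k (%x. \<Prod>i\<in>I. f i x)"
 by (induction I rule: finite_induct) (auto intro: C_k_const C_k_mult)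

lemma C_k_compose:
 fixes g :: "real=>real"
 shows "C_k k g ==> C_k k f ==> C_k k (%x. g (f x))"
proof (induction k arbitrary: f g)
 case 0
 then show ?case using continuous_on_compose2[of UNIV g UNIV f] by auto
next
 case (Suc k)
 let ?g' = "%y. frechet_derivative g (at y) 1"
 have gl: "frechet_derivative g (at y) h = h * ?g' y" for y h
  using linear_cmul[OF linear_frechet_derivative[of g "at y"], of h 1] Suc.prems by simp
 have d0: "((%x. g (f x)) has_derivative (%h. frechet_derivative g (at (f x)) (frechet_derivative f (at x) h))) (at x)" for x
  using Suc.prems by (intro has_derivative_compose[of f _ x UNIV g]) (auto simp: frechet_derivative_works[symmetric])
 have *: "frechet_derivative (%x. g (f x)) (at x) b = frechet_derivative f (at x) b * ?g' (f x)" for x b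
  unfolding frechet_derivative_eqI[OF d0] by (rule gl)
 have d: "(%x. g (f x)) differentiable (at x)" for x
  using d0 unfolding differentiable_def by blast
 have fk: "C_k k f" "\<And>b. C_k k (%x. frechet_derivative f (at x) b)" "C_k k ?g'"
  using C_k_antimono[OF Suc.prems(2)] Suc.prems by simp_all
 have comp: "C_k k (%x. ?g' (f x))" by (rule Suc.IH[OF fk(3) fk(1)])
 show ?case
  unfolding C_k.simps * using d C_k_mult[OF fk(2) comp] by blast
qed

lemma C_k_real_deriv:
 fixes g g' :: "real=>real"
 assumes "\<And>x. (g has_real_derivative g' x) (at x)" "C_k k g'"
 shows "C_k (Suc k) g"
proof -
 have d: "(g has_derivative (%h. g' x * h)) (at x)" for x
  using assms(1)[of x] by (simp add: has_field_derivative_def)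
 show ?thesis
  unfolding C_k.simps frechet_derivative_eqI[OF d]
  using assms(2) d by (auto simp: differentiable_def intro!: C_k_mult C_k_const)
qed

lemma C_k_exp: "C_k k (exp :: real=>real)"
proof (induction k)
 case 0 show ?case by (auto intro: continuous_intros)
next
 case (Suc k) show ?case by (rule C_k_real_deriv[OF _ Suc]) simp
qed

subsection \<open>Bump functions\<close>

text \<open>The functions p(1/x) exp(-1/x), extended by zero to x \<le> 0. Differentiation maps this
  class to itself, replacing p by X^2 (p - p'), so smoothness follows by induction over all
  polynomials p at once.\<close>

definition flat :: "real poly=>real=>real" where
 "flat p x = (if x > 0 then poly p (1 / x) * exp (- (1 / x)) else 0)"

lemma poly_exp_tendsto_0: "((%y::real. poly p y * exp (- y)) \<longlongrightarrow> 0) at_top"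
proof -
 have "((%y::real. \<Sum>i\<le>degree p. coeff p i * (y ^ i / exp y)) \<longlongrightarrow> (\<Sum>i\<le>degree p. coeff p i * 0)) at_top"
  by (intro tendsto_sum tendsto_mult tendsto_const tendsto_power_div_exp_0)
 then show ?thesis by (simp add: poly_altdef sum_distrib_right exp_minus divide_inverse mult.assoc)
qed

lemma flat_has_derivative:
 "(flat p has_real_derivative flat ([:0, 0, 1:] * (p - pderiv p)) x) (at x)"
proof -
 consider "x > 0" | "x < 0" | "x = 0" by linarith
 then show ?thesis
 proof cases
  case 1
  have "((%x. poly p (1 / x) * exp (- (1 / x))) has_real_derivative
    poly p (1 / x) * (exp (- (1 / x)) * (1 / x\<^sup>2)) + (poly (pderiv p) (1 / x) * (- 1 / x\<^sup>2)) * exp (- (1 / x))) (at x)"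
   using 1 by (auto intro!: derivative_eq_intros DERIV_chain2[OF poly_DERIV] simp: field_simps power2_eq_square)
  then have "((%x. poly p (1 / x) * exp (- (1 / x))) has_real_derivative flat ([:0, 0, 1:] * (p - pderiv p)) x) (at x)"
   by (rule DERIV_cong) (use 1 in \<open>simp add: flat_def field_simps power2_eq_square\<close>)
  then show ?thesis
   by (rule DERIV_cong_ev[THEN iffD1, rotated 3])
    (use 1 eventually_nhds_in_open[of "{0<..}" x] in \<open>auto simp: flat_def elim!: eventually_mono\<close>)
 next
  case 2
  have "((%x. 0) has_real_derivative 0) (at x)" by simp
  then have "(flat p has_real_derivative 0) (at x)"
   by (rule DERIV_cong_ev[THEN iffD1, rotated 3])
    (use 2 eventually_nhds_in_open[of "{..<0}" x] in \<open>auto simp: flat_def elim!: eventually_mono\<close>)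
  then show ?thesis using 2 by (simp add: flat_def)
 next
  case 3
  \<comment> \<open>With y = 1/h the difference quotient at 0 is y p(y) exp(-y), which tends to 0 as
    y grows.\<close>
  have R: "((%h. flat p h / h) \<longlongrightarrow> 0) (at_right 0)"
  proof -
   have "((%h. poly (pCons 0 p) (inverse h) * exp (- inverse h)) \<longlongrightarrow> 0) (at_right (0::real))"
    by (rule filterlim_compose[OF poly_exp_tendsto_0 filterlim_inverse_at_top_right])
   then show ?thesis
    by (rule Lim_transform_eventually)
     (auto simp: flat_def eventually_at_right_field divide_inverse intro!: exI[of _ 1])
  qed
  have L: "((%h. flat p h / h) \<longlongrightarrow> 0) (at_left 0)"
   by (rule Lim_transform_eventually[OF tendsto_const])
    (auto simp: flat_def eventually_at_left_field intro!: exI[of _ "-1"])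
  have "((%h. flat p h / h) \<longlongrightarrow> 0) (at 0)" using L R by (simp add: filterlim_split_at)
  then show ?thesis using 3 by (simp add: DERIV_def flat_def)
 qed
qed

lemma C_k_flat: "C_k k (flat p)"
proof (induction k arbitrary: p)
 case 0
 have "isCont (flat p) x" for x using DERIV_isCont[OF flat_has_derivative] .
 then show ?case by (simp add: continuous_on_eq_continuous_at)
next
 case (Suc k)
 show ?case by (rule C_k_real_deriv[OF flat_has_derivative Suc])
qed

definition hat :: "'a::euclidean_space=>'a=>'a=>real" where
 "hat a b x = (\<Prod>i\<in>Basis. flat 1 (x \<bullet> i - a \<bullet> i) * flat 1 (b \<bullet> i - x \<bullet> i))"

text \<open>As \<open>hat\<close> is nonnegative, smooth and positive exactly on the open box, these
  functions stay between 0 and 1 and converge pointwise to the indicator of the box as m grows, as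
  dominated convergence requires.\<close>

definition bump :: "'a::euclidean_space=>'a=>nat=>'a=>real" where
 "bump a b m x = 1 - exp (- (real m * hat a b x))"

lemma flat_one: "flat 1 x\<ge>0" "flat 1 x > 0 \<longleftrightarrow> x > 0"
 by (simp_all add: flat_def)

lemma hat_nonneg: "hat a b x\<ge>0"
 unfolding hat_def by (intro prod_nonneg ballI mult_nonneg_nonneg flat_one)

lemma hat_pos_iff: "hat a b x > 0 \<longleftrightarrow> x\<in>box a b"
proof
 assume p: "hat a b x > 0"
 have "flat 1 (x \<bullet> i - a \<bullet> i) * flat 1 (b \<bullet> i - x \<bullet> i)\<noteq>0" if "i\<in>Basis" for i
 proof
  assume "flat 1 (x \<bullet> i - a \<bullet> i) * flat 1 (b \<bullet> i - x \<bullet> i) = 0"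
  then have "hat a b x = 0" unfolding hat_def using that by (intro prod_zero) auto
  with p show False by simp
 qed
 then have "flat 1 (x \<bullet> i - a \<bullet> i) > 0\<and>flat 1 (b \<bullet> i - x \<bullet> i) > 0" if "i\<in>Basis" for i
  using that flat_one(1)[of "x \<bullet> i - a \<bullet> i"] flat_one(1)[of "b \<bullet> i - x \<bullet> i"] by (metis mult_eq_0_iff order_le_less)
 then show "x\<in>box a b" unfolding flat_one(2) mem_box by simp
next
 assume "x\<in>box a b"
 then show "hat a b x > 0"
  unfolding hat_def mem_box by (intro prod_pos mult_pos_pos) (simp_all add: flat_one(2))
qed

lemma C_k_bump: "C_k k (bump a b m)"
proof -
 have d: "C_k k (%x. x \<bullet> i - a \<bullet> i)" "C_k k (%x. b \<bullet> i - x \<bullet> i)" for i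
  using C_k_add[OF C_k_inner C_k_const, of k i "- (a \<bullet> i)"]
   C_k_add[OF C_k_const C_k_mult[OF C_k_const C_k_inner], of k "b \<bullet> i" "-1" i] by simp_all
 have "C_k k (hat a b)"
  unfolding hat_def by (intro C_k_prod finite_Basis C_k_mult C_k_compose[OF C_k_flat] d)
 then have "C_k k (%x. 1 + (-1) * exp ((- real m) * hat a b x))"
  by (intro C_k_add C_k_mult C_k_const C_k_compose[OF C_k_exp])
 then show ?thesis unfolding bump_def by simp
qed

lemma bump_bounds: "0\<le>bump a b m x" "bump a b m x\<le>1"
 using hat_nonneg[of a b x] by (auto simp: bump_def)

lemma bump_outside: "x\<notin>box a b ==> bump a b m x = 0"
 using hat_pos_iff[of a b x] hat_nonneg[of a b x] by (auto simp: bump_def)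

lemma bump_tendsto: "(%m. bump a b m x) \<longlonglongrightarrow> indicator (box a b) x"
proof (cases "x\<in>box a b")
 case True
 then have "hat a b x > 0" by (simp add: hat_pos_iff)
 then have "filterlim (%m. real m * hat a b x) at_top sequentially"
  by (intro filterlim_at_top_mult_tendsto_pos[OF tendsto_const _ filterlim_real_sequentially])
 then have "(%m. 1 - exp (- (real m * hat a b x))) \<longlonglongrightarrow> 1 - 0"
  by (intro tendsto_diff tendsto_const filterlim_compose[OF exp_at_bot])
   (simp add: filterlim_uminus_at_top[symmetric])
 then show ?thesis using True by (simp add: bump_def)
qed (simp add: bump_outside)

lemma bump_test_function:
 assumes "cbox a b\<subseteq>U"
 shows "bump a b m\<in>test_functions U"
proof -
 have "{x. bump a b m x\<noteq>0}\<subseteq>cbox a b" using bump_outside[of _ a b m] box_subset_cbox by blast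
 then have c: "closure {x. bump a b m x\<noteq>0}\<subseteq>cbox a b" by (meson closed_cbox closure_minimal)
 then have "compact (closure {x. bump a b m x\<noteq>0})"
  using compact_cbox[of a b] by (meson bounded_cbox bounded_subset closed_closure compact_eq_bounded_closed)
 then show ?thesis using c assms by (auto simp: test_functions_def C_k_bump)
qed

section \<open>Test functions and integration by parts for them\<close>

section \<open>Test functions\<close>

lemma test_continuous: "\<phi>\<in>test_functions U ==> continuous_on UNIV \<phi>"
 using C_k_continuous[of 0 \<phi>] by (auto simp: test_functions_def)

lemma test_differentiable: "\<phi>\<in>test_functions U ==> \<phi> differentiable (at x)"
 unfolding test_functions_def using C_k.simps(2)[of 0 \<phi>] by blast

lemma test_deriv_zero:
 assumes "\<phi>\<in>test_functions U" "x\<notin>closure {x. \<phi> x\<noteq>0}"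
 shows "frechet_derivative \<phi> (at x) b = 0"
proof -
 have "((%x. 0) has_derivative (%h. 0)) (at x)" by simp
 then have "(\<phi> has_derivative (%h. 0)) (at x)"
  by (rule has_derivative_transform_within_open[of _ _ _ _ "- closure {x. \<phi> x\<noteq>0}"])
   (use assms(2) closure_subset[of "{x. \<phi> x\<noteq>0}"] in auto)
 then show ?thesis by (simp add: frechet_derivative_eqI)
qed

lemma test_deriv:
 assumes "\<phi>\<in>test_functions U"
 shows "(%x. frechet_derivative \<phi> (at x) b)\<in>test_functions U"
proof -
 have "{x. frechet_derivative \<phi> (at x) b\<noteq>0}\<subseteq>closure {x. \<phi> x\<noteq>0}"
  using test_deriv_zero[OF assms] by blast
 then have c: "closure {x. frechet_derivative \<phi> (at x) b\<noteq>0}\<subseteq>closure {x. \<phi> x\<noteq>0}"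
  by (meson closed_closure closure_minimal)
 have "C_k k (%x. frechet_derivative \<phi> (at x) b)" for k
  using assms C_k.simps(2)[of k \<phi>] by (auto simp: test_functions_def)
 moreover have "compact (closure {x. frechet_derivative \<phi> (at x) b\<noteq>0})"
  using c assms unfolding test_functions_def
  by (metis (no_types, lifting) Int_absorb1 closed_Int_compact closed_closure mem_Collect_eq inf.commute)
 ultimately show ?thesis using c assms by (auto simp: test_functions_def)
qed

lemma test_mult:
 assumes f: "f\<in>test_functions U" and g: "\<And>k. C_k k g"
 shows "(%x. f x * g x)\<in>test_functions U"
proof -
 have "{x. f x * g x\<noteq>0}\<subseteq>{x. f x\<noteq>0}" by auto
 then have c: "closure {x. f x * g x\<noteq>0}\<subseteq>closure {x. f x\<noteq>0}" by (rule closure_mono)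
 moreover have "compact (closure {x. f x * g x\<noteq>0})"
  using c f unfolding test_functions_def
  by (metis (no_types, lifting) Int_absorb1 closed_Int_compact closed_closure mem_Collect_eq inf.commute)
 ultimately show ?thesis using f g by (auto simp: test_functions_def intro: C_k_mult)
qed

lemma test_C_k: "\<phi>\<in>test_functions U ==> C_k k \<phi>"
 by (auto simp: test_functions_def)

lemma test_bounded:
 assumes "\<phi>\<in>test_functions U"
 obtains M where "\<And>x. \<bar>\<phi> x\<bar>\<le>M"
proof -
 let ?K = "closure {x. \<phi> x\<noteq>0}"
 have "compact (\<phi> ` ?K)"
  using assms by (intro compact_continuous_image continuous_on_subset[OF test_continuous[OF assms]])
   (auto simp: test_functions_def)
 then obtain M where M: "\<And>y. y\<in>\<phi> ` ?K ==> norm y\<le>M"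
  using compact_imp_bounded bounded_iff by metis
 have "\<bar>\<phi> x\<bar>\<le>max M 0" for x
 proof (cases "\<phi> x = 0")
  case False
  then have "x\<in>?K" using closure_subset by fastforce
  then show ?thesis using M[of "\<phi> x"] by auto
 qed simp
 then show ?thesis using that by blast
qed

lemma test_outside: "\<phi>\<in>test_functions U ==> x\<notin>U ==> \<phi> x = 0"
 using closure_subset[of "{x. \<phi> x\<noteq>0}"] by (auto simp: test_functions_def)

lemma test_measurable: "\<phi>\<in>test_functions U ==> \<phi>\<in>meas borel"
 using test_continuous by (intro borel_measurable_continuous_onI) auto

lemma test_integrable:
 assumes "\<phi>\<in>test_functions U"
 shows "integrable lborel \<phi>"
proof -
 let ?K = "closure {x. \<phi> x\<noteq>0}"
 have "compact ?K" using assms by (auto simp: test_functions_def)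
 then have "integrable lborel (%x. indicator ?K x *\<^sub>R \<phi> x)"
  using borel_integrable_compact[of ?K \<phi>] continuous_on_subset[OF test_continuous[OF assms]]
  by (simp add: set_integrable_def indicator_def if_distrib cong: if_cong)
 moreover have "(%x. indicator ?K x *\<^sub>R \<phi> x) = \<phi>"
  using closure_subset[of "{x. \<phi> x\<noteq>0}"] by (auto simp: indicator_def fun_eq_iff)
 ultimately show ?thesis by simp
qed

text \<open>Difference quotients have integral zero by translation invariance. They are bounded and
  supported in a common compact set, so dominated convergence carries this over to the
  derivative.\<close>

lemma integral_test_deriv:
 fixes F :: "'a::euclidean_space=>real"
 assumes F: "F\<in>test_functions U"
 shows "(\<integral>x. frechet_derivative F (at x) b\<partial>lborel) = 0"
proof -
 let ?D = "%x. frechet_derivative F (at x) b"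
 let ?K = "closure {x. F x\<noteq>0}"
 have cK: "compact ?K" using F by (auto simp: test_functions_def)
 obtain M where M: "\<And>x. \<bar>?D x\<bar>\<le>M" using test_bounded[OF test_deriv[OF F]] by metis
 have hd: "(F has_derivative frechet_derivative F (at x)) (at x)" for x
  using test_differentiable[OF F] by (simp add: frechet_derivative_works)
 have line: "((%s. F (x + s *\<^sub>R b)) has_real_derivative ?D (x + s *\<^sub>R b)) (at s)" for x s
 proof -
  have "((%s. F (x + s *\<^sub>R b)) has_derivative (%h. frechet_derivative F (at (x + s *\<^sub>R b)) (h *\<^sub>R b))) (at s)"
   by (rule has_derivative_compose[OF _ hd]) (auto intro!: derivative_eq_intros)
  moreover have "(%h. frechet_derivative F (at (x + s *\<^sub>R b)) (h *\<^sub>R b)) = (*) (?D (x + s *\<^sub>R b))"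
   using linear_cmul[OF linear_frechet_derivative[OF test_differentiable[OF F]], of "x + s *\<^sub>R b" _ b]
   by (auto simp: fun_eq_iff)
  ultimately show ?thesis by (simp add: has_field_derivative_def)
 qed
 define h where "h = (%n. 1 / real (Suc n))"
 have h0: "h n > 0" "h n\<le>1" for n by (auto simp: h_def)
 define Q where "Q = (%n x. (F (x + h n *\<^sub>R b) - F x) / h n)"
 \<comment> \<open>The points x for which the segment from x to x + b meets the support of F. Off
   this compact set every difference quotient with step at most 1 vanishes.\<close>
 define K' where "K' = (%(x, s). x - s *\<^sub>R b) ` (?K\<times>{0..1})"
 have cK': "compact K'"
  unfolding K'_def using cK by (auto intro!: compact_continuous_image compact_Times continuous_intros simp: case_prod_unfold)
 have Fi: "integrable lborel F" by (rule test_integrable[OF F])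
 have Fs: "integrable lborel (%x. F (x + c))" "(\<integral>x. F (x + c)\<partial>lborel) = (\<integral>x. F x\<partial>lborel)" for c
 proof -
  have d: "lborel = distr lborel borel (%x. c + x)" by (simp add: lborel_distr_plus)
  have m: "F\<in>meas borel" by (rule test_measurable[OF F])
  have "integrable (distr lborel borel (%x. c + x)) F" using Fi d by simp
  then show "integrable lborel (%x. F (x + c))"
   using m by (subst (asm) integrable_distr_eq) (auto simp: add.commute)
  have "(\<integral>x. F x\<partial>lborel) = (\<integral>x. F x\<partial>(distr lborel borel (%x. c + x)))" using d by simp
  also have "\<dots> = (\<integral>x. F (x + c)\<partial>lborel)" using m by (subst integral_distr) (auto simp: add.commute)
  finally show "(\<integral>x. F (x + c)\<partial>lborel) = (\<integral>x. F x\<partial>lborel)" by simp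
 qed
 have Q0: "(\<integral>x. Q n x\<partial>lborel) = 0" for n
  unfolding Q_def using Fi Fs[of "h n *\<^sub>R b"] by simp
 have bound: "\<bar>Q n x\<bar>\<le>M * indicator K' x" for n x
 proof (cases "x\<in>K'")
  case True
  have "\<exists>z>0. z < h n\<and>F (x + h n *\<^sub>R b) - F (x + 0 *\<^sub>R b) = (h n - 0) * ?D (x + z *\<^sub>R b)"
   by (rule MVT2[OF h0(1)]) (rule line)
  then obtain z where "F (x + h n *\<^sub>R b) - F x = h n * ?D (x + z *\<^sub>R b)" by auto
  then have "Q n x = ?D (x + z *\<^sub>R b)" using h0(1)[of n] by (simp add: Q_def)
  then show ?thesis using M True by simp
 next
  case False
  have "x\<notin>?K" "x + h n *\<^sub>R b\<notin>?K"
  proof -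
   show "x\<notin>?K"
   proof
    assume "x\<in>?K"
    then have "x\<in>K'" unfolding K'_def by (intro image_eqI[of _ _ "(x, 0)"]) auto
    with False show False by simp
   qed
   show "x + h n *\<^sub>R b\<notin>?K"
   proof
    assume "x + h n *\<^sub>R b\<in>?K"
    then have "x\<in>K'" unfolding K'_def using h0[of n]
     by (intro image_eqI[of _ _ "(x + h n *\<^sub>R b, h n)"]) auto
    with False show False by simp
   qed
  qed
  then have "F x = 0" "F (x + h n *\<^sub>R b) = 0" using closure_subset[of "{x. F x\<noteq>0}"] by auto
  then show ?thesis using False by (simp add: Q_def)
 qed
 have "(%n. \<integral>x. Q n x\<partial>lborel) \<longlonglongrightarrow> (\<integral>x. ?D x\<partial>lborel)"
 proof (rule integral_dominated_convergence[where w="%x. M * indicator K' x"])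
  show "?D\<in>meas lborel" using test_measurable[OF test_deriv[OF F]] by simp
  show "Q n\<in>meas lborel" for n
   unfolding Q_def using Fi Fs(1)[of "h n *\<^sub>R b"] by simp
  show "integrable lborel (%x. M * indicator K' x)"
   using cK' emeasure_bounded_finite[OF compact_imp_bounded[OF cK']] compact_imp_closed[OF cK']
   by (intro integrable_mult_right integrable_real_indicator) auto
  show "AE x in lborel. norm (Q n x)\<le>M * indicator K' x" for n using bound by simp
  have hl: "filterlim h (at 0) sequentially"
  proof (rule filterlim_atI)
   show "nullseq h" unfolding h_def using LIMSEQ_inverse_real_of_nat by (simp add: inverse_eq_divide)
   show "\<forall>\<^sub>F n in sequentially. h n\<noteq>0" using h0(1) by (metis (mono_tags, lifting) always_eventually less_irrefl)
  qed
  have "(%n. Q n x) \<longlonglongrightarrow> ?D x" for x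
  proof -
   have "((%s. (F (x + (0 + s) *\<^sub>R b) - F (x + 0 *\<^sub>R b)) / s) \<longlongrightarrow> ?D (x + 0 *\<^sub>R b)) (at 0)"
    using line[of x 0] by (simp only: DERIV_def)
   from filterlim_compose[OF this hl] show ?thesis by (simp add: Q_def)
  qed
  then show "AE x in lborel. (%n. Q n x) \<longlonglongrightarrow> ?D x" by simp
 qed
 then show ?thesis unfolding Q0 by (simp add: LIMSEQ_const_iff)
qed

lemma integral_lebesgue_on_test:
 fixes F :: "'a::euclidean_space=>real"
 assumes "open U" and F: "F\<in>test_functions U"
 shows "integrable (leb U) F" "integral\<^sup>L (leb U) F = (\<integral>x. F x\<partial>lborel)"
proof -
 have U: "U\<in>sets borel" using assms(1) by simp
 have "(%x. indicator U x * F x) = F" using test_outside[OF F] by (fastforce simp: indicator_def)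
 then show "integrable (leb U) F" "integral\<^sup>L (leb U) F = (\<integral>x. F x\<partial>lborel)"
  using leb_integral_borel[OF U test_measurable[OF F]] test_integrable[OF F] by auto
qed

lemma test_integration_by_parts:
 fixes f g :: "'a::euclidean_space=>real"
 assumes U: "open U" and f: "f\<in>test_functions U" and g: "g\<in>test_functions U"
 shows "(\<integral>x. f x * frechet_derivative g (at x) b\<partial>leb U) =
  - (\<integral>x. frechet_derivative f (at x) b * g x\<partial>leb U)"
proof -
 have fg: "(%x. f x * g x)\<in>test_functions U" by (rule test_mult[OF f test_C_k[OF g]])
 have 1: "(%x. f x * frechet_derivative g (at x) b)\<in>test_functions U"
  by (rule test_mult[OF f test_C_k[OF test_deriv[OF g]]])
 have 2: "(%x. frechet_derivative f (at x) b * g x)\<in>test_functions U"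
  by (rule test_mult[OF test_deriv[OF f] test_C_k[OF g]])
 have "frechet_derivative (%x. f x * g x) (at x) b = f x * frechet_derivative g (at x) b + frechet_derivative f (at x) b * g x" for x
  using test_differentiable[OF f, of x] test_differentiable[OF g, of x]
  by (subst frechet_derivative_eqI[OF has_derivative_mult[OF
    frechet_derivative_works[THEN iffD1] frechet_derivative_works[THEN iffD1]]]) auto
 then have "(\<integral>x. f x * frechet_derivative g (at x) b + frechet_derivative f (at x) b * g x\<partial>lborel) = 0"
  using integral_test_deriv[OF fg, of b] by simp
 then show ?thesis
  using test_integrable[OF 1] test_integrable[OF 2]
  by (simp add: integral_lebesgue_on_test(2)[OF U 1] integral_lebesgue_on_test(2)[OF U 2])
qed

section \<open>Integrable functions annihilated by all test functions vanish almost
  everywhere\<close>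

section \<open>The fundamental lemma of the calculus of variations\<close>

lemma box_Int_box_cbox:
 fixes a b c d :: "'a::euclidean_space"
 obtains e f where "box a b\<inter>box c d = box e f" "cbox e f\<subseteq>cbox a b"
proof
 let ?e = "\<Sum>i\<in>Basis. max (a \<bullet> i) (c \<bullet> i) *\<^sub>R i" and ?f = "\<Sum>i\<in>Basis. min (b \<bullet> i) (d \<bullet> i) *\<^sub>R i"
 show "box a b\<inter>box c d = box ?e ?f" by (rule box_Int_box)
 show "cbox ?e ?f\<subseteq>cbox a b" by (auto simp: mem_box)
qed

text \<open>Boxes form an intersection-stable generator of the Borel sets. Cut off to a box whose
  closure lies in U, g therefore has zero integral over every Borel set and is zero there as a
  density.\<close>

lemma AE_zero_if_box_integrals_zero:
 fixes g :: "'a::euclidean_space=>real"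
 assumes U: "open U" and g: "integrable (leb U) g"
  and z: "\<And>a b. cbox a b\<subseteq>U ==> (\<integral>x. g x * indicator (box a b) x\<partial>leb U) = 0"
 shows "AE x in leb U. g x = 0"
proof -
 have Ub: "U\<in>sets borel" using U by simp
 obtain g' where g': "g'\<in>meas borel" "AE x in leb U. g x = g' x" "\<And>x. x\<notin>U ==> g' x = 0"
  by (rule leb_borel_rep[OF Ub borel_measurable_integrable[OF g]]) (rule that)
 have [measurable]: "g'\<in>meas borel" by (rule g')
 have iU: "(%x. indicator U x * g' x) = g'" using g'(3) by (fastforce simp: indicator_def)
 have "integrable (leb U) g'"
  using integrable_cong_AE[OF borel_measurable_integrable[OF g] leb_measurableI[OF g'(1)] g'(2)] g by simp
 then have ig: "integrable lborel g'"
  using leb_integral_borel(1)[OF Ub g'(1)] iU by simp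
 have z': "(\<integral>x. g' x * indicator (box a b) x\<partial>lborel) = 0" if ab: "cbox a b\<subseteq>U" for a b
 proof -
  have m: "(%x. g' x * indicator (box a b) x)\<in>meas borel" by measurable
  have "0 = (\<integral>x. g x * indicator (box a b) x\<partial>leb U)" using z[OF ab] by simp
  also have "\<dots> = (\<integral>x. g' x * indicator (box a b) x\<partial>leb U)"
  proof (rule integral_cong_AE)
   show "(%x. g x * indicator (box a b) x)\<in>meas (leb U)"
    by (intro borel_measurable_times borel_measurable_integrable[OF g] leb_measurableI) auto
   show "(%x. g' x * indicator (box a b) x)\<in>meas (leb U)"
    by (rule leb_measurableI[OF m])
   show "AE x in leb U. g x * indicator (box a b) x = g' x * indicator (box a b) x"
    using g'(2) by eventually_elim simp
  qed
  also have "\<dots> = (\<integral>x. indicator U x * g' x * indicator (box a b) x\<partial>lborel)"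
   unfolding leb_integral_borel(2)[OF Ub m] by (simp add: mult.assoc)
  also have "\<dots> = (\<integral>x. g' x * indicator (box a b) x\<partial>lborel)"
   using fun_cong[OF iU] by (intro integral_cong') auto
  finally show ?thesis by simp
 qed
 have box: "AE x in lborel. x\<in>box a b\<longrightarrow>g' x = 0" if ab: "cbox a b\<subseteq>U" for a b
 proof -
  let ?f = "%x. g' x * indicator (box a b) x"
  have f: "integrable lborel ?f" by (rule Bochner_Integration.integrable_bound[OF ig]) (auto simp: indicator_def)
  let ?E = "range (%(a::'a, b). box a b)"
  have E: "sets borel = sigma_sets UNIV ?E" by (simp add: borel_eq_box)
  have i: "set_integrable lborel A ?f" if "A\<in>sets borel" for A
   using integrable_mult_indicator[OF _ f, of A] that by (simp add: set_integrable_def)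
  have "AE x in lborel. ?f x = 0"
  proof (rule sigma_finite_measure.density_zero[OF sigma_finite_lborel f])
   fix A :: "'a set" assume "A\<in>sets lborel"
   then have A: "A\<in>sigma_sets UNIV ?E" by (simp add: E)
   have st: "Int_stable ?E" "?E\<subseteq>Pow UNIV" by (auto simp: Int_stable_def box_Int_box)
   from st A show "set_lebesgue_integral lborel A ?f = 0"
   proof (induct rule: sigma_sets_induct_disjoint)
    case (basic A)
    then obtain c d where A: "A = box c d" by auto
    obtain e h where ef: "box a b\<inter>box c d = box e h" "cbox e h\<subseteq>cbox a b" by (rule box_Int_box_cbox)
    have "set_lebesgue_integral lborel A ?f = (\<integral>x. g' x * indicator (box e h) x\<partial>lborel)"
     unfolding set_lebesgue_integral_def A ef(1)[symmetric] by (intro integral_cong') (auto simp: indicator_def)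
    then show ?case using z'[of e h] ef(2) ab by auto
   next
    case (compl A)
    then have A: "A\<in>sets borel" by (simp add: E)
    have "set_lebesgue_integral lborel (UNIV - A) ?f = (\<integral>x. ?f x - indicator A x *\<^sub>R ?f x\<partial>lborel)"
     unfolding set_lebesgue_integral_def by (intro integral_cong') (auto simp: indicator_def)
    also have "\<dots> = 0" using compl(2) f i[OF A] z'[OF ab] by (simp add: set_integrable_def set_lebesgue_integral_def)
    finally show ?case .
   next
    case (union F)
    then have F: "F k\<in>sets borel" for k by (auto simp: E)
    have "set_lebesgue_integral lborel (\<Union>k. F k) ?f = (\<Sum>k. set_lebesgue_integral lborel (F k) ?f)"
     by (rule lebesgue_integral_countable_add) (use F union(1) i in \<open>auto simp: disjoint_family_on_def\<close>)
    then show ?case using union(3) by simp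
   qed (simp add: set_lebesgue_integral_def)
  qed
  then show ?thesis by eventually_elim (auto simp: indicator_def)
 qed
 \<comment> \<open>Countably many closed boxes exhaust U; replacing them by open boxes loses only
   null sets.\<close>
 obtain D where D: "countable D" "D\<subseteq>Pow U" "\<And>X. X\<in>D ==> \<exists>a b. X = cbox a b" "\<Union> D = U"
  by (rule open_countable_Union_open_cbox[OF U]) (rule that)
 have "AE x in lborel. x\<in>X\<longrightarrow>g' x = 0" if X: "X\<in>D" for X
 proof -
  obtain a b where ab: "X = cbox a b" using D(3)[OF X] by auto
  have "cbox a b - box a b\<in>null_sets lebesgue"
   using negligible_frontier_interval[of a b] by (simp add: negligible_iff_null_sets)
  then have "cbox a b - box a b\<in>null_sets lborel" by (subst (asm) null_sets_completion_iff) auto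
  then have "AE x in lborel. x\<notin>cbox a b - box a b" by (rule AE_not_in)
  moreover have "AE x in lborel. x\<in>box a b\<longrightarrow>g' x = 0" using D(2) X ab by (intro box) auto
  ultimately show ?thesis unfolding ab by eventually_elim auto
 qed
 then have "AE x in lborel. \<forall>X\<in>D. x\<in>X\<longrightarrow>g' x = 0"
  using D(1) by (subst AE_ball_countable) auto
 then have "AE x in lborel. x\<in>U\<longrightarrow>g' x = 0" using D(4) by (auto elim!: eventually_mono)
 then have "AE x in leb U. g' x = 0" unfolding AE_leb_iff[OF Ub] .
 then show ?thesis using g'(2) by eventually_elim simp
qed

lemma integral_bump_tendsto:
 assumes Ub: "U\<in>sets borel" and g: "integrable (leb U) g"
 shows "(%m. \<integral>x. g x * bump a b m x\<partial>leb U) \<longlonglongrightarrow> (\<integral>x. g x * indicator (box a b) x\<partial>leb U)"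
proof (rule integral_dominated_convergence[where w="%x. \<bar>g x\<bar>"])
 have bm: "bump a b m\<in>meas borel" for m
  using C_k_continuous[OF C_k_bump] by (rule borel_measurable_continuous_onI)
 have gm: "g\<in>meas (leb U)" using g by simp
 show "(%x. g x * indicator (box a b) x)\<in>meas (leb U)"
  by (intro borel_measurable_times gm leb_measurableI) auto
 show "(%x. g x * bump a b m x)\<in>meas (leb U)" for m
  by (intro borel_measurable_times gm leb_measurableI bm)
 show "integrable (leb U) (%x. \<bar>g x\<bar>)" using g by simp
 show "AE x in leb U. (%m. g x * bump a b m x) \<longlonglongrightarrow> g x * indicator (box a b) x"
  by (intro AE_I2 tendsto_mult tendsto_const bump_tendsto)
 show "AE x in leb U. norm (g x * bump a b m x)\<le>\<bar>g x\<bar>" for m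
  using bump_bounds[of a b m] by (auto simp: abs_mult intro!: mult_left_le)
qed

lemma fundamental_lemma:
 fixes g :: "'a::euclidean_space=>real"
 assumes U: "open U" and g: "integrable (leb U) g"
  and z: "\<And>\<phi>. \<phi>\<in>test_functions U ==> (\<integral>x. g x * \<phi> x\<partial>leb U) = 0"
 shows "AE x in leb U. g x = 0"
proof (rule AE_zero_if_box_integrals_zero[OF U g])
 fix a b :: 'a assume "cbox a b\<subseteq>U"
 then have "(\<integral>x. g x * bump a b m x\<partial>leb U) = 0" for m by (intro z bump_test_function)
 then show "(\<integral>x. g x * indicator (box a b) x\<partial>leb U) = 0"
  using integral_bump_tendsto[OF borel_open[OF U] g, of a b] by (simp add: LIMSEQ_const_iff)
qed

text \<open>The indicator of a box in the product is approximated by products of bumps in the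
  separate variables, so tensor products of test functions already suffice.\<close>

lemma fundamental_lemma_Times:
 fixes g :: "'a::euclidean_space\<times>'b::euclidean_space=>real"
 assumes U: "open U" and V: "open V" and g: "integrable (leb (U\<times>V)) g"
  and z: "\<And>\<theta> \<phi>. \<theta>\<in>test_functions U ==> \<phi>\<in>test_functions V ==>
   (\<integral>p. g p * (\<theta> (fst p) * \<phi> (snd p))\<partial>leb (U\<times>V)) = 0"
 shows "AE p in leb (U\<times>V). g p = 0"
proof (rule AE_zero_if_box_integrals_zero[OF open_Times[OF U V] g])
 fix p q :: "'a\<times>'b" assume pq: "cbox p q\<subseteq>U\<times>V"
 obtain a c b d where p: "p = (a, c)" and q: "q = (b, d)" by fastforce
 have bx: "box p q = box a b\<times>box c d" unfolding p q by (auto simp: mem_box Basis_prod_def ball_Un)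
 have cbx: "cbox p q = cbox a b\<times>cbox c d" unfolding p q by (rule cbox_Pair_eq)
 have gm: "g\<in>meas (leb (U\<times>V))" using g by simp
 have bm: "(%p :: 'a\<times>'b. bump a b m (fst p))\<in>meas borel"
  "(%p :: 'a\<times>'b. bump c d m (snd p))\<in>meas borel" for m
 proof -
  have [measurable]: "bump a b m\<in>meas borel" "bump c d m\<in>meas borel"
   by (rule borel_measurable_continuous_onI, rule C_k_continuous[OF C_k_bump])+
  have "(%p. bump a b m (fst p))\<in>meas (borel \<Otimes>\<^sub>M (borel :: 'b measure))"
   "(%p. bump c d m (snd p))\<in>meas ((borel :: 'a measure) \<Otimes>\<^sub>M borel)" by measurable
  then show "(%p :: 'a\<times>'b. bump a b m (fst p))\<in>meas borel"
   "(%p :: 'a\<times>'b. bump c d m (snd p))\<in>meas borel"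
   by (simp_all add: borel_prod)
 qed
 show "(\<integral>x. g x * indicator (box p q) x\<partial>leb (U\<times>V)) = 0"
 \<comment> \<open>If one factor is empty, the inclusion of the product says nothing about the other
   one, whose bumps might not be test functions.\<close>
 proof (cases "cbox a b = {} \<or> cbox c d = {}")
  case True
  then have "cbox p q = {}" unfolding cbx by auto
  then have "box p q = {}" using box_subset_cbox[of p q] by auto
  then show ?thesis by simp
 next
  case False
  then have sub: "cbox a b\<subseteq>U" "cbox c d\<subseteq>V" using pq unfolding cbx by auto
  have "(%m. \<integral>x. g x * (bump a b m (fst x) * bump c d m (snd x))\<partial>leb (U\<times>V))
    \<longlonglongrightarrow> (\<integral>x. g x * indicator (box p q) x\<partial>leb (U\<times>V))"
  proof (rule integral_dominated_convergence[where w="%x. \<bar>g x\<bar>"])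
   show "(%x. g x * indicator (box p q) x)\<in>meas (leb (U\<times>V))"
    by (intro borel_measurable_times gm leb_measurableI) auto
   show "(%x. g x * (bump a b m (fst x) * bump c d m (snd x)))\<in>meas (leb (U\<times>V))" for m
    by (intro borel_measurable_times gm leb_measurableI bm)
   show "integrable (leb (U\<times>V)) (%x. \<bar>g x\<bar>)" using g by simp
   have "indicator (box p q) x = indicator (box a b) (fst x) * (indicator (box c d) (snd x) :: real)" for x
    unfolding bx by (cases x) (auto simp: indicator_def)
   then show "AE x in leb (U\<times>V). (%m. g x * (bump a b m (fst x) * bump c d m (snd x))) \<longlonglongrightarrow> g x * indicator (box p q) x"
    by (auto intro!: tendsto_mult tendsto_const bump_tendsto)
   show "AE x in leb (U\<times>V). norm (g x * (bump a b m (fst x) * bump c d m (snd x)))\<le>\<bar>g x\<bar>" for m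
    using bump_bounds[of a b m] bump_bounds[of c d m]
    by (auto simp: abs_mult intro!: mult_left_le mult_le_one)
  qed
  moreover have "(\<integral>x. g x * (bump a b m (fst x) * bump c d m (snd x))\<partial>leb (U\<times>V)) = 0" for m
   by (intro z bump_test_function sub)
  ultimately show ?thesis by (simp add: LIMSEQ_const_iff)
 qed
qed

section \<open>The identification of L^2(0,T;L^2(\<Omega>)) with L^2 of the cylinder\<close>

section \<open>Square integrable functions on the cylinder\<close>

lemma box_Pair_eq: "box (a, c) (b, d) = box a b\<times>box c d"
 by (auto simp: mem_box Basis_prod_def ball_Un)

locale bounded_cylinder =
 fixes T :: real and \<Omega> :: "(real^'n) set"
 assumes T_pos: "T > 0" and open_dom: "open \<Omega>" and bounded_dom: "bounded \<Omega>"
begin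

abbreviation "MT \<equiv> leb {0<..<T}"
abbreviation "MX \<equiv> leb \<Omega>"
abbreviation "MC \<equiv> leb ({0<..<T}\<times>\<Omega>)"
abbreviation "DT \<equiv> test_functions {0<..<T}"
abbreviation "DX \<equiv> test_functions \<Omega>"

lemma IT: "{0<..<T}\<in>sets borel" by simp

lemma OX: "\<Omega>\<in>sets borel" using open_dom by simp

lemma OC: "open ({0<..<T}\<times>\<Omega>)" using open_dom by (intro open_Times) auto

lemma CX: "{0<..<T}\<times>\<Omega>\<in>sets borel" using OC by simp

lemma finite_lebesgue_on_open_bounded:
 fixes S :: "'a::euclidean_space set"
 assumes "open S" "bounded S"
 shows "finite_measure (leb S)"
proof
 have "emeasure lborel S < \<infinity>" by (rule emeasure_bounded_finite[OF assms(2)])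
 then show "emeasure (leb S) (space (leb S))\<noteq>\<infinity>"
  using assms(1) by (simp add: emeasure_restrict_space)
qed

lemma fin_MT: "finite_measure MT" by (rule finite_lebesgue_on_open_bounded) auto
lemma fin_MX: "finite_measure MX" by (rule finite_lebesgue_on_open_bounded[OF open_dom bounded_dom])
lemma fin_MC: "finite_measure MC"
 by (rule finite_lebesgue_on_open_bounded[OF OC]) (intro bounded_Times bounded_dom, simp)

lemma elems_L2: "elems (L2 \<Omega>) = sqi MX"
 by (simp add: L2_def sqi_def)

lemma nrm_L2: "nrm (L2 \<Omega>) u = sqrt (\<integral>x. u x * u x\<partial>MX)"
 by (simp add: L2_def L2_inner_def)

lemma nrm_L2_sq: "(nrm (L2 \<Omega>) u)^2 = (\<integral>x. u x * u x\<partial>MX)"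
 unfolding nrm_L2 by (simp add: integral_nonneg_AE)

text \<open>The inner product of L^2 of the cylinder. Working on the cylinder makes Fubini
  available; that \<open>LL\<close> is the Bochner space is \<open>LL_elems\<close>.\<close>

definition lip :: "'n evol=>'n evol=>real" where
 "lip u v = (\<integral>p. case_prod u p * case_prod v p\<partial>MC)"

definition LL :: "'n evol set" where
 "LL = {u. case_prod u\<in>sqi MC}"

lemma semi_hilbert_LL: "semi_hilbert LL lip"
proof -
 have "semi_hilbert {w. case_prod w\<in>sqi MC} (%u v. \<integral>p. case_prod u p * case_prod v p\<partial>MC)"
 proof (rule semi_hilbert_pullback[OF semi_hilbert_sqi[OF fin_MC]])
  show "\<exists>w. case_prod w = v" for v :: "real\<times>(real^'n)=>real" by (rule exI[of _ "curry v"]) simp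
 qed (auto simp: fun_eq_iff scaleR_fun_def)
 then show ?thesis unfolding LL_def lip_def[abs_def] .
qed

sublocale LL: semi_hilbert LL lip by (rule semi_hilbert_LL)

lemma LL_D: "u\<in>LL ==> case_prod u\<in>sqi MC" by (simp add: LL_def)

lemma LL_integrable: "u\<in>LL ==> v\<in>LL ==> integrable MC (%(t, x). u t x * v t x)"
 using sqi_mult[OF LL_D LL_D, of u v] by (simp add: case_prod_unfold)

lemma lip_eq: "lip u v = (\<integral>(t, x). u t x * v t x\<partial>MC)"
 by (simp add: lip_def case_prod_unfold)

lemma LL_slice:
 assumes "u\<in>LL" shows "AE t in MT. u t\<in>sqi MX"
proof -
 have "AE t in MT. integrable MX (%x. u t x * u t x)"
  by (rule Fubini_leb(1)[OF IT OX LL_integrable[OF assms assms]])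
 moreover have "AE t in MT. (%x. case_prod u (t, x))\<in>meas MX"
  by (rule leb_measurable_slice(1)[OF IT OX sqi_meas[OF LL_D[OF assms]]])
 ultimately show ?thesis by eventually_elim (simp add: sqi_def power2_eq_square)
qed

lemma lip_iterated:
 assumes "u\<in>LL" "v\<in>LL"
 shows "lip u v = (\<integral>t. \<integral>x. u t x * v t x\<partial>MX\<partial>MT)" "integrable MT (%t. \<integral>x. u t x * v t x\<partial>MX)"
 using Fubini_leb(2,3)[OF IT OX LL_integrable[OF assms]] by (auto simp: lip_eq)

lemma L2L2_inner_eq: "u\<in>LL ==> v\<in>LL ==> L2L2_inner T \<Omega> u v = lip u v"
 by (simp add: lip_iterated L2L2_inner_def L2_inner_def)

lemma nr_eq_zero_iff:
 assumes "u\<in>LL"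
 shows "LL.nr u = 0 \<longleftrightarrow> (AE p in MC. case_prod u p = 0)"
proof -
 have "lip u u = 0 \<longleftrightarrow> (AE p in MC. (case_prod u p)^2 = 0)"
  using integral_nonneg_eq_0_iff_AE[OF sqi_int[OF LL_D[OF assms]]] by (simp add: lip_def power2_eq_square)
 then show ?thesis by (simp add: LL.nr_def)
qed

subsection \<open>Simple functions with values in \<open>L\<^sup>2(\<Omega>)\<close>\<close>

definition simple_L2 :: "'n evol set" where
 "simple_L2 = {s. simple_function MT s\<and>s ` {0<..<T}\<subseteq>sqi MX}"

lemma sqi_snd: "b\<in>sqi MX ==> (%p. b (snd p))\<in>sqi MC"
proof -
 assume b: "b\<in>sqi MX"
 have m: "(%p. b (snd p))\<in>meas MC"
  by (rule leb_measurable_snd[OF IT OX sqi_meas[OF b]])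
 have "(\<integral>\<^sup>+p. ennreal ((b (snd p))^2)\<partial>MC) = (\<integral>\<^sup>+t. \<integral>\<^sup>+x. ennreal ((b x)^2)\<partial>MX\<partial>MT)"
  using m by (intro nn_integral_leb_Times(1)[OF IT OX, of "%t x. (b x)^2"]) (auto simp: case_prod_unfold)
 also have "\<dots> = ennreal (\<integral>x. (b x)^2\<partial>MX) * emeasure MT (space MT)"
  by (simp add: nn_integral_eq_integral[OF sqi_int[OF b]] del: space_restrict_space)
 also have "\<dots> < \<infinity>"
  using finite_measure.emeasure_finite[OF fin_MT] by (simp add: ennreal_mult_less_top top.not_eq_extremum del: space_restrict_space)
 finally have "integrable MC (%p. (b (snd p))^2)" using m by (intro integrableI_nonneg) auto
 with m show ?thesis by (simp add: sqi_def)
qed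

lemma LL_bounded_mult:
 assumes u: "u\<in>LL" and th: "(%(t, x). \<theta> t x)\<in>meas MC" and b: "AE p in MC. \<bar>case_prod \<theta> p\<bar>\<le>C"
 shows "(%t x. \<theta> t x * u t x)\<in>LL"
proof -
 have "(%p. case_prod \<theta> p * case_prod u p)\<in>sqi MC"
 proof (rule sqi_bounded[OF LL_D[OF u]])
  show "(%p. case_prod \<theta> p * case_prod u p)\<in>meas MC"
   using th sqi_meas[OF LL_D[OF u]] by simp
  show "AE p in MC. \<bar>case_prod \<theta> p * case_prod u p\<bar>\<le>C * \<bar>case_prod u p\<bar>"
   using b by eventually_elim (simp add: abs_mult mult_right_mono)
 qed
 then show ?thesis by (simp add: LL_def case_prod_unfold)
qed

lemma LL_time_mult:
 assumes th: "\<theta>\<in>meas MT" and b: "\<And>t. t\<in>{0<..<T} ==> \<bar>\<theta> t\<bar>\<le>C" and u: "u\<in>LL"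
 shows "(%t x. \<theta> t * u t x)\<in>LL"
 by (rule LL_bounded_mult[OF u, of "%t x. \<theta> t" C])
  (use leb_measurable_fst[OF IT OX th] b in \<open>auto simp: case_prod_unfold\<close>)

lemma LL_tensor:
 assumes th: "\<theta>\<in>meas MT" and bd: "\<And>t. t\<in>{0<..<T} ==> \<bar>\<theta> t\<bar>\<le>C" and b: "b\<in>sqi MX"
 shows "(%t x. \<theta> t * b x)\<in>LL"
proof (rule LL_time_mult[OF th])
 show "(%t. b)\<in>LL" using sqi_snd[OF b] by (simp add: LL_def case_prod_unfold)
qed (rule bd)

text \<open>A simple function is the finite sum of the tensor products 1_A(t) b(x), where b runs
  through its values and A is the set of times at which b is taken. This makes it jointly measurable
  whatever representatives its values are.\<close>

lemma simple_L2_LL: "s\<in>simple_L2 ==> s\<in>LL"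
proof -
 assume s: "s\<in>simple_L2"
 then have sf: "simple_function MT s" and r: "s ` {0<..<T}\<subseteq>sqi MX" by (auto simp: simple_L2_def)
 have fin: "finite (s ` {0<..<T})" using simple_functionD(1)[OF sf] by simp
 let ?A = "%b. s -` {b}\<inter>{0<..<T}"
 have A: "?A b\<in>sets MT" for b using simple_functionD(2)[OF sf, of "{b}"] by simp
 define h where "h = (%b p. indicator (?A b) (fst p) * b (snd p) :: real)"
 let ?f = "%p. \<Sum>b\<in>s ` {0<..<T}. h b p"
 have "(%t x. indicator (?A b) t * b x)\<in>LL" if "b\<in>s ` {0<..<T}" for b
  by (rule LL_tensor[of _ 1, OF borel_measurable_indicator[OF A]]) (use that r in \<open>auto simp: indicator_def\<close>)
 then have t: "h b\<in>sqi MC" if "b\<in>s ` {0<..<T}" for b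
  using that unfolding h_def LL_def case_prod_unfold by blast
 have F: "?f\<in>sqi MC"
 proof -
  have "(%p. \<Sum>b\<in>F. h b p)\<in>sqi MC" if "F\<subseteq>s ` {0<..<T}" for F
   using finite_subset[OF that fin] that
  proof (induction F rule: finite_induct)
   case empty
   show ?case by (simp add: sqi_zero)
  next
   case (insert b F)
   have "(%p. h b p + (\<Sum>b\<in>F. h b p))\<in>sqi MC"
    by (rule sqi_add[OF t insert.IH]) (use insert.prems in auto)
   then show ?case using insert.hyps by simp
  qed
  then show ?thesis by blast
 qed
 have eq: "case_prod s p = ?f p" if "p\<in>space MC" for p
 proof -
  obtain t x where p: "p = (t, x)" by fastforce
  have tI: "t\<in>{0<..<T}" using that by (auto simp: p)
  have "?f p = (\<Sum>b\<in>s ` {0<..<T}. if b = s t then b x else 0)"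
   unfolding p by (rule sum.cong) (use tI in \<open>auto simp: indicator_def h_def\<close>)
  also have "\<dots> = s t x" using fin tI by simp
  finally show ?thesis by (simp add: p)
 qed
 have "case_prod s\<in>meas MC"
  using sqi_meas[OF F] by (rule measurable_cong[THEN iffD2, rotated]) (rule eq)
 then have "case_prod s\<in>sqi MC" by (rule sqi_AE[OF F]) (use eq in auto)
 then show ?thesis by (simp add: LL_def)
qed

lemma simple_L2_add: "s\<in>simple_L2 ==> r\<in>simple_L2 ==> s + r\<in>simple_L2"
proof -
 interpret X: semi_inner "sqi MX" "%u v. \<integral>x. u x * v x\<partial>MX" by (rule semi_inner_sqi)
 assume "s\<in>simple_L2" "r\<in>simple_L2"
 then show ?thesis
  using simple_function_compose2[of MT s r "(+)"] by (auto simp: simple_L2_def plus_fun_def[of s r] intro: X.add_mem)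
qed

lemma simple_L2_scale: "s\<in>simple_L2 ==> c *\<^sub>R s\<in>simple_L2"
proof -
 interpret X: semi_inner "sqi MX" "%u v. \<integral>x. u x * v x\<partial>MX" by (rule semi_inner_sqi)
 assume "s\<in>simple_L2"
 then show ?thesis
  using simple_function_compose1[of MT s "(*\<^sub>R) c"] by (auto simp: simple_L2_def scaleR_fun_def[of c s] intro: X.scale_mem)
qed

lemma simple_L2_indicator:
 assumes "A\<in>sets MT" "b\<in>sqi MX"
 shows "(%t x. indicator A t * b x)\<in>simple_L2"
proof -
 interpret X: semi_inner "sqi MX" "%u v. \<integral>x. u x * v x\<partial>MX" by (rule semi_inner_sqi)
 have "simple_function MT (%t. (indicator A t :: real))" using assms(1) by (rule simple_function_indicator)
 from simple_function_compose1[OF this, of "%c. c *\<^sub>R b"]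
 have "simple_function MT (%t. (indicator A t :: real) *\<^sub>R b)" .
 moreover have "(%t x. indicator A t * b x) = (%t. (indicator A t :: real) *\<^sub>R b)"
  by (simp add: scaleR_fun_def)
 ultimately show ?thesis using assms(2) by (auto simp: simple_L2_def intro: X.scale_mem)
qed

text \<open>Indicators of rectangles are simple, so a function orthogonal to all simple ones has
  zero integral over every box.\<close>

lemma simple_L2_dense:
 assumes u: "u\<in>LL"
 obtains s where "\<And>n::nat. s n\<in>simple_L2" "nullseq (%n. LL.nr (s n - u))"
proof (rule LL.dense_subspace[of simple_L2 u])
 show "simple_L2\<subseteq>LL" using simple_L2_LL by blast
 show "0\<in>simple_L2" using simple_L2_indicator[of "{}" 0] by (simp add: zero_fun_def sqi_zero)
 fix v assume v: "v\<in>LL" and orth: "\<And>d. d\<in>simple_L2 ==> lip v d = 0"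
 have "AE p in MC. case_prod v p = 0"
 proof (rule AE_zero_if_box_integrals_zero[OF OC])
  show "integrable MC (case_prod v)" by (rule sqi_integrable[OF fin_MC LL_D[OF v]])
  fix p q :: "real\<times>(real^'n)"
  obtain a b c d where pq: "p = (a, c)" "q = (b, d)" by fastforce
  have "{0<..<T}\<inter>box a b\<in>sets MT" by (intro sets_restrict_space_iff[THEN iffD2]) auto
  moreover have "indicator (box c d)\<in>sqi MX"
   by (rule sqi_bounded[OF sqi_const[OF fin_MX, of 1], of _ 1])
    (auto intro!: leb_measurableI simp: indicator_def)
  ultimately have "lip v (%t x. indicator ({0<..<T}\<inter>box a b) t * indicator (box c d) x) = 0"
   by (intro orth simple_L2_indicator)
  moreover have "lip v (%t x. indicator ({0<..<T}\<inter>box a b) t * indicator (box c d) x)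
    = (\<integral>x. case_prod v x * indicator (box p q) x\<partial>MC)"
   unfolding lip_def by (rule integral_cong') (auto simp: pq box_Pair_eq indicator_def)
  ultimately show "(\<integral>x. case_prod v x * indicator (box p q) x\<partial>MC) = 0" by simp
 qed
 then show "LL.nr v = 0" using nr_eq_zero_iff[OF v] by simp
qed (use u simple_L2_add simple_L2_scale that in auto)

text \<open>The sum over the family of the squared slice distances tends to 0 in L^1(0,T), so a
  subsequence converges for almost every t. Treating a finite family at once yields one subsequence
  common to all members.\<close>

lemma LL_tendsto_slices_family:
 assumes I: "finite I" and s: "\<And>i n. i\<in>I ==> s i n\<in>LL" and u: "\<And>i. i\<in>I ==> u i\<in>LL"
  and lim: "\<And>i. i\<in>I ==> nullseq (%n. LL.nr (s i n - u i))"
 obtains r :: "nat=>nat" where "strict_mono r"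
  "AE t in MT. \<forall>i\<in>I. nullseq (%n. nrm (L2 \<Omega>) (s i (r n) t - u i t))"
proof -
 have d: "s i n - u i\<in>LL" if "i\<in>I" for i n using that by (intro LL.diff_mem s u)
 let ?g = "%i n t. \<integral>x. (s i n - u i) t x * (s i n - u i) t x\<partial>MX"
 let ?h = "%n t. \<Sum>i\<in>I. ?g i n t"
 have nn: "?g i n t\<ge>0" for i n t by (simp add: integral_nonneg_AE)
 have hn: "?h n t\<ge>0" for n t by (rule sum_nonneg) (rule nn)
 have int: "integrable MT (?g i n)" if "i\<in>I" for i n using lip_iterated(2)[OF d[OF that] d[OF that]] .
 have "(%n. \<Sum>i\<in>I. (LL.nr (s i n - u i))^2) \<longlonglongrightarrow> (\<Sum>i\<in>I. 0\<^sup>2)"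
  by (intro tendsto_sum tendsto_power lim)
 moreover have "(\<Sum>i\<in>I. (LL.nr (s i n - u i))^2) = (\<integral>t. norm (?h n t)\<partial>MT)" for n
 proof -
  have "(\<integral>t. norm (?h n t)\<partial>MT) = (\<integral>t. ?h n t\<partial>MT)" using hn by simp
  also have "\<dots> = (\<Sum>i\<in>I. \<integral>t. ?g i n t\<partial>MT)" by (rule Bochner_Integration.integral_sum) (rule int)
  also have "\<dots> = (\<Sum>i\<in>I. (LL.nr (s i n - u i))^2)"
   by (rule sum.cong) (simp_all add: LL.nr_sq[OF d] lip_iterated(1)[OF d d])
  finally show ?thesis by simp
 qed
 ultimately have L1: "nullseq (%n. \<integral>t. norm (?h n t)\<partial>MT)" by simp
 have "integrable MT (?h n)" for n by (rule Bochner_Integration.integrable_sum) (rule int)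
 from tendsto_L1_AE_subseq[OF this L1]
 obtain r where r: "strict_mono r" "AE t in MT. nullseq (%n. ?h (r n) t)" by auto
 have "AE t in MT. \<forall>i\<in>I. nullseq (%n. nrm (L2 \<Omega>) (s i (r n) t - u i t))"
  using r(2)
 proof eventually_elim
  case (elim t)
  show ?case
  proof
   fix i assume i: "i\<in>I"
   have "nullseq (%n. ?g i (r n) t)"
   proof (rule Lim_null_comparison[OF _ elim])
    show "\<forall>\<^sub>F n in sequentially. norm (?g i (r n) t)\<le>?h (r n) t"
    proof (rule always_eventually, rule allI)
     fix n
     have "?g i (r n) t\<le>?h (r n) t" by (rule member_le_sum[OF i _ I]) (rule nn)
     then show "norm (?g i (r n) t)\<le>?h (r n) t" using nn[of i "r n" t] by simp
    qed
   qed
   from tendsto_real_sqrt[OF this] show "nullseq (%n. nrm (L2 \<Omega>) (s i (r n) t - u i t))"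
    by (simp add: nrm_L2)
  qed
 qed
 with r(1) that show ?thesis by blast
qed

lemma LL_tendsto_slices:
 assumes s: "\<And>n::nat. s n\<in>LL" and u: "u\<in>LL" and lim: "nullseq (%n. LL.nr (s n - u))"
 obtains r :: "nat=>nat" where "strict_mono r" "AE t in MT. nullseq (%n. nrm (L2 \<Omega>) (s (r n) t - u t))"
proof -
 obtain r :: "nat=>nat" where "strict_mono r"
  "AE t in MT. \<forall>i\<in>{()}. nullseq (%n. nrm (L2 \<Omega>) (s (r n) t - u t))"
  by (rule LL_tendsto_slices_family[of "{()}" "%_. s" "%_. u"]) (use assms in auto)
 then show ?thesis using that by simp
qed

lemma LL_slicesI:
 assumes m: "case_prod u\<in>meas MC" and sl: "AE t in MT. u t\<in>sqi MX"
  and le: "AE t in MT. (nrm (L2 \<Omega>) (u t))^2\<le>g t" and g: "integrable MT g"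
 shows "u\<in>LL"
proof -
 have "(\<integral>\<^sup>+p. ennreal ((u (fst p) (snd p))^2) \<partial>MC) = (\<integral>\<^sup>+t. \<integral>\<^sup>+x. ennreal ((u t x)^2) \<partial>MX \<partial>MT)"
  using m by (intro nn_integral_leb_Times(1)[OF IT OX, of "%t x. (u t x)^2"]) (auto simp: case_prod_unfold)
 also have "\<dots>\<le>(\<integral>\<^sup>+t. ennreal (g t) \<partial>MT)"
  by (rule nn_integral_mono_AE, use sl le in eventually_elim)
   (auto simp: nrm_L2_sq nn_integral_eq_integral sqi_int power2_eq_square[symmetric] intro: ennreal_leI)
 also have "\<dots> < \<infinity>"
  using integrableD(2)[OF g] by (simp add: less_top)
 finally have "integrable MC (%p. (case_prod u p)^2)"
  using m by (intro integrableI_nonneg) (auto simp: case_prod_unfold)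
 with m show ?thesis by (simp add: LL_def sqi_def)
qed

text \<open>One inclusion is Tonelli's theorem. For the other, simple functions are dense in L^2 of
  the cylinder, and a subsequence converges on almost every time slice, which is strong
  measurability.\<close>

lemma LL_elems: "elems (L2L2 T \<Omega>) = LL"
proof (intro set_eqI iffI)
 fix u assume "u\<in>elems (L2L2 T \<Omega>)"
 then have sm: "strongly_measurable T (L2 \<Omega>) u" and jm: "jointly_measurable T \<Omega> u"
  and i: "integrable MT (%t. (nrm (L2 \<Omega>) (u t))^2)"
  by (auto simp: L2_fun_def L2_time_def)
 have m: "case_prod u\<in>meas MC" using jm by (simp add: jointly_measurable_def cylinder_def)
 have sl: "AE t in MT. u t\<in>sqi MX" using sm by (simp add: strongly_measurable_def elems_L2)
 show "u\<in>LL" by (rule LL_slicesI[OF m sl _ i]) simp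
next
 fix u assume u: "u\<in>LL"
 obtain s where s: "\<And>n::nat. s n\<in>simple_L2" "nullseq (%n. LL.nr (s n - u))"
  by (rule simple_L2_dense[OF u]) (rule that)
 obtain r where r: "AE t in MT. nullseq (%n. nrm (L2 \<Omega>) (s (r n) t - u t))"
  by (rule LL_tendsto_slices[OF simple_L2_LL[OF s(1)] u s(2)])
 have c: "nrm (L2 \<Omega>) (a - b) = nrm (L2 \<Omega>) (b - a)" for a b
  unfolding nrm_L2 by (rule arg_cong[where f=sqrt], rule integral_cong') (auto simp: algebra_simps)
 have "strongly_measurable T (L2 \<Omega>) u"
  unfolding strongly_measurable_def elems_L2
 proof (intro conjI exI[of _ "%n. s (r n)"])
  show "AE t in MT. u t\<in>sqi MX" by (rule LL_slice[OF u])
  show "\<forall>k. simple_function MT (s (r k))\<and>s (r k) ` {0<..<T}\<subseteq>sqi MX"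
   using s(1) by (auto simp: simple_L2_def)
  show "AE t in MT. nullseq (%k. nrm (L2 \<Omega>) (u t - s (r k) t))" using r by (simp add: c)
 qed
 then show "u\<in>elems (L2L2 T \<Omega>)"
  using lip_iterated(2)[OF u u] sqi_meas[OF LL_D[OF u]]
  by (simp add: L2_fun_def L2_time_def nrm_L2_sq jointly_measurable_def cylinder_def)
qed

lemma LL_nrm: "u\<in>LL ==> nrm (L2L2 T \<Omega>) u = LL.nr u"
 by (simp add: L2_fun_def L2_time_def nrm_L2_sq LL.nr_def lip_iterated)

lemma LL_strongly_measurable: "u\<in>LL ==> strongly_measurable T (L2 \<Omega>) u"
 using LL_elems by (auto simp: L2_fun_def L2_time_def)

lemma eq_ae_iff: "eq_ae T \<Omega> u v \<longleftrightarrow> (AE p in MC. case_prod u p = case_prod v p)"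
 unfolding eq_ae_def cylinder_def by (simp add: case_prod_unfold)

lemma eq_ae_iff_nr:
 assumes "u\<in>LL" "v\<in>LL"
 shows "eq_ae T \<Omega> u v \<longleftrightarrow> LL.nr (u - v) = 0"
 unfolding eq_ae_iff nr_eq_zero_iff[OF LL.diff_mem[OF assms]] by (simp add: case_prod_unfold)

lemma LL_eqI_test:
 assumes v: "v\<in>LL"
  and z: "\<And>\<theta> \<phi>. \<theta>\<in>DT ==> \<phi>\<in>DX ==> lip v (%t x. \<theta> t * \<phi> x) = 0"
 shows "LL.nr v = 0"
proof -
 have "AE p in MC. case_prod v p = 0"
  by (rule fundamental_lemma_Times[OF _ open_dom sqi_integrable[OF fin_MC LL_D[OF v]]])
   (use z in \<open>auto simp: lip_def case_prod_unfold\<close>)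
 then show ?thesis by (simp add: nr_eq_zero_iff[OF v])
qed

lemma test_sqi_MX: "\<phi>\<in>DX ==> \<phi>\<in>sqi MX"
proof -
 assume p: "\<phi>\<in>DX"
 obtain M where "\<And>x. \<bar>\<phi> x\<bar>\<le>M" by (rule test_bounded[OF p]) (rule that)
 then show ?thesis
  by (intro sqi_bounded[OF sqi_const[OF fin_MX, of 1], of _ M] leb_measurableI test_measurable[OF p]) auto
qed

lemma LL_test_tensor:
 assumes "\<theta>\<in>DT" "b\<in>sqi MX"
 shows "(%t x. \<theta> t * b x)\<in>LL"
proof -
 obtain M where "\<And>x. \<bar>\<theta> x\<bar>\<le>M" by (rule test_bounded[OF assms(1)]) (rule that)
 then show ?thesis
  by (intro LL_tensor[of \<theta> M b] leb_measurableI test_measurable[OF assms(1)] assms(2))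
qed

end

section \<open>Hilbert spaces made from the domain of a closed operator with finitely many
  components\<close>

section \<open>Graph spaces of closed operators\<close>

text \<open>\<open>rel u g\<close> says that \<open>g i\<close> is the i-th component of the
  operator applied to u. Weak derivatives are determined only up to null sets, so the operator is
  given as a relation that is single-valued up to seminorm zero. The instances are the weak gradient
  on \<Omega>, the slicewise gradient on the cylinder and the weak time derivative.\<close>

locale closed_relation = semi_hilbert V B for V :: "'v::real_vector set" and B +
 fixes I :: "'i set" and rel :: "'v=>('i=>'v)=>bool"
 assumes fin: "finite I"
  and rel_mem: "\<And>u g. rel u g ==> u\<in>V" "\<And>u g i. rel u g ==> i\<in>I ==> g i\<in>V"
  and rel_zero: "rel 0 (%i. 0)"
  and rel_add: "\<And>u g v h. rel u g ==> rel v h ==> rel (u + v) (%i. g i + h i)"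
  and rel_scale: "\<And>c u g. rel u g ==> rel (c *\<^sub>R u) (%i. c *\<^sub>R g i)"
  and rel_unique: "\<And>u g h i. rel u g ==> rel u h ==> i\<in>I ==> nr (g i - h i) = 0"
  and rel_closed: "\<And>(s :: nat=>'v) g u h. (\<And>n. rel (s n) (g n)) ==> u\<in>V ==> (\<And>i. i\<in>I ==> h i\<in>V) ==>
   (%n. nr (s n - u)) \<longlonglongrightarrow> 0 ==> (\<And>i. i\<in>I ==> nullseq (%n. nr (g n i - h i))) ==> rel u h"
begin

definition gdom :: "'v set" where "gdom = {u. \<exists>g. rel u g}"

definition op :: "'v=>'i=>'v" where "op u = (SOME g. rel u g)"

text \<open>Weights 1 and 1 give the Sobolev inner product, weights \<alpha> and \<beta> the form of
  the elliptic operator.\<close>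

definition gip :: "real=>real=>'v=>'v=>real" where
 "gip a b u v = a * (\<Sum>i\<in>I. B (op u i) (op v i)) + b * B u v"

lemma op_rel: "u\<in>gdom ==> rel u (op u)"
 unfolding op_def by (rule someI_ex[of "rel u"]) (simp add: gdom_def)

lemma gdomI: "rel u g ==> u\<in>gdom" by (auto simp: gdom_def)

lemma gdom_V: "u\<in>gdom ==> u\<in>V" by (auto simp: gdom_def rel_mem)

lemma rel_diff: "rel u g ==> rel v h ==> rel (u - v) (%i. g i - h i)"
 using rel_add[OF _ rel_scale, of u g v h "-1"] by simp

text \<open>Frees the inner product from the choice of derivative made by \<open>op\<close>.\<close>

lemma gip_rel:
 assumes "rel u g" "rel v h"
 shows "gip a b u v = a * (\<Sum>i\<in>I. B (g i) (h i)) + b * B u v"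
proof -
 have ou: "rel u (op u)" and ov: "rel v (op v)" using assms by (auto intro: op_rel gdomI)
 have "B (op u i) (op v i) = B (g i) (h i)" if i: "i\<in>I" for i
 proof -
  have m: "op u i\<in>V" "op v i\<in>V" "g i\<in>V" "h i\<in>V" using rel_mem(2) ou ov assms i by blast+
  have "B (op u i) (op v i) = B (g i) (op v i)"
   by (rule B_cong_left[OF m(1) m(3) m(2) rel_unique[OF ou assms(1) i]])
  also have "\<dots> = B (op v i) (g i)" by (rule B_sym[OF m(3) m(2)])
  also have "\<dots> = B (h i) (g i)"
   by (rule B_cong_left[OF m(2) m(4) m(3) rel_unique[OF ov assms(2) i]])
  also have "\<dots> = B (g i) (h i)" by (rule B_sym[OF m(4) m(3)])
  finally show ?thesis .
 qed
 then show ?thesis by (simp add: gip_def)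
qed

lemma gip_semi_inner:
 assumes "a > 0" "b > 0"
 shows "semi_inner gdom (gip a b)"
proof
 show "0\<in>gdom" by (rule gdomI[OF rel_zero])
 show "u + v\<in>gdom" if "u\<in>gdom" "v\<in>gdom" for u v
  by (rule gdomI[OF rel_add[OF op_rel[OF that(1)] op_rel[OF that(2)]]])
 show "c *\<^sub>R u\<in>gdom" if "u\<in>gdom" for c u by (rule gdomI[OF rel_scale[OF op_rel[OF that]]])
 show "gip a b (u + v) w = gip a b u w + gip a b v w" if m: "u\<in>gdom" "v\<in>gdom" "w\<in>gdom" for u v w
 proof -
  note r = op_rel[OF m(1)] op_rel[OF m(2)] op_rel[OF m(3)]
  have "(\<Sum>i\<in>I. B (op u i + op v i) (op w i)) = (\<Sum>i\<in>I. B (op u i) (op w i)) + (\<Sum>i\<in>I. B (op v i) (op w i))"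
   unfolding sum.distrib[symmetric] by (rule sum.cong) (auto simp: B_add rel_mem(2)[OF r(1)] rel_mem(2)[OF r(2)] rel_mem(2)[OF r(3)])
  then show ?thesis
   unfolding gip_rel[OF rel_add[OF r(1,2)] r(3)] gip_rel[OF r(1) r(3)] gip_rel[OF r(2) r(3)]
   using m by (simp add: B_add gdom_V algebra_simps)
 qed
 show "gip a b (c *\<^sub>R u) w = c * gip a b u w" if m: "u\<in>gdom" "w\<in>gdom" for c u w
 proof -
  note r = op_rel[OF m(1)] op_rel[OF m(2)]
  have "(\<Sum>i\<in>I. B (c *\<^sub>R op u i) (op w i)) = c * (\<Sum>i\<in>I. B (op u i) (op w i))"
   unfolding sum_distrib_left by (rule sum.cong) (auto simp: B_scale rel_mem(2)[OF r(1)] rel_mem(2)[OF r(2)])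
  then show ?thesis
   unfolding gip_rel[OF rel_scale[OF r(1)] r(2)] gip_rel[OF r(1) r(2)]
   using m by (simp add: B_scale gdom_V algebra_simps)
 qed
 show "gip a b u v = gip a b v u" if m: "u\<in>gdom" "v\<in>gdom" for u v
 proof -
  have "(\<Sum>i\<in>I. B (op u i) (op v i)) = (\<Sum>i\<in>I. B (op v i) (op u i))"
   by (rule sum.cong) (use rel_mem(2)[OF op_rel[OF m(1)]] rel_mem(2)[OF op_rel[OF m(2)]] in \<open>auto intro: B_sym\<close>)
  then show ?thesis unfolding gip_def using B_sym[OF gdom_V[OF m(1)] gdom_V[OF m(2)]] by simp
 qed
 show "0\<le>gip a b u u" if m: "u\<in>gdom" for u
  unfolding gip_def using assms rel_mem(2)[OF op_rel[OF m]] gdom_V[OF m]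
  by (intro add_nonneg_nonneg mult_nonneg_nonneg sum_nonneg B_pos) auto
qed

lemma gip_bounds:
 assumes ab: "a > 0" "b > 0" and r: "rel u g"
 shows "b * B u u\<le>gip a b u u" "i\<in>I ==> a * B (g i) (g i)\<le>gip a b u u"
proof -
 have nn: "B (g i) (g i)\<ge>0" if "i\<in>I" for i by (rule B_pos[OF rel_mem(2)[OF r that]])
 have s: "(\<Sum>i\<in>I. B (g i) (g i))\<ge>0" by (rule sum_nonneg) (rule nn)
 have u: "B u u\<ge>0" by (rule B_pos[OF rel_mem(1)[OF r]])
 show "b * B u u\<le>gip a b u u" unfolding gip_rel[OF r r] using s ab by simp
 assume i: "i\<in>I"
 have "B (g i) (g i)\<le>(\<Sum>i\<in>I. B (g i) (g i))" by (rule member_le_sum[OF i _ fin]) (use nn in auto)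
 then have "a * B (g i) (g i)\<le>a * (\<Sum>i\<in>I. B (g i) (g i))" using ab by simp
 then show "a * B (g i) (g i)\<le>gip a b u u" unfolding gip_rel[OF r r] using u ab by (simp add: add_increasing2)
qed

text \<open>A Cauchy sequence in the graph norm is Cauchy together with each derivative; the limits
  belong to each other because the relation is closed.\<close>

theorem gip_semi_hilbert:
 assumes ab: "a > 0" "b > 0"
 shows "semi_hilbert gdom (gip a b)"
proof (intro semi_hilbert.intro gip_semi_inner[OF ab] semi_hilbert_axioms.intro)
 fix s :: "nat=>'v"
 assume s: "\<And>n. s n\<in>gdom"
  and C: "\<And>e. 0 < e ==> \<exists>N. \<forall>m\<ge>N. \<forall>n\<ge>N. gip a b (s m - s n) (s m - s n) < e"
 have r: "rel (s n) (op (s n))" for n by (rule op_rel[OF s])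
 have rd: "rel (s m - s n) (%i. op (s m) i - op (s n) i)" for m n by (rule rel_diff[OF r r])
 have lim1: "\<exists>u\<in>V. nullseq (%n. B (s n - u) (s n - u))"
 proof (rule complete[of s])
  show "s n\<in>V" for n by (rule gdom_V[OF s])
  fix e :: real assume "e > 0"
  then obtain N where N: "\<forall>m\<ge>N. \<forall>n\<ge>N. gip a b (s m - s n) (s m - s n) < b * e"
   using C[of "b * e"] ab by auto
  show "\<exists>N. \<forall>m\<ge>N. \<forall>n\<ge>N. B (s m - s n) (s m - s n) < e"
  proof (intro exI allI impI)
   fix m n assume "m\<ge>N" "n\<ge>N"
   then have "b * B (s m - s n) (s m - s n) < b * e" using N gip_bounds(1)[OF ab rd] by (meson le_less_trans)
   then show "B (s m - s n) (s m - s n) < e" using ab by simp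
  qed
 qed
 have lim2: "\<exists>h\<in>V. nullseq (%n. B (op (s n) i - h) (op (s n) i - h))" if i: "i\<in>I" for i
 proof (rule complete[of "%n. op (s n) i"])
  show "op (s n) i\<in>V" for n by (rule rel_mem(2)[OF r i])
  fix e :: real assume "e > 0"
  then obtain N where N: "\<forall>m\<ge>N. \<forall>n\<ge>N. gip a b (s m - s n) (s m - s n) < a * e"
   using C[of "a * e"] ab by auto
  show "\<exists>N. \<forall>m\<ge>N. \<forall>n\<ge>N. B (op (s m) i - op (s n) i) (op (s m) i - op (s n) i) < e"
  proof (intro exI allI impI)
   fix m n assume "m\<ge>N" "n\<ge>N"
   then have "a * B (op (s m) i - op (s n) i) (op (s m) i - op (s n) i) < a * e"
    using N gip_bounds(2)[OF ab rd i] by (meson le_less_trans)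
   then show "B (op (s m) i - op (s n) i) (op (s m) i - op (s n) i) < e" using ab by simp
  qed
 qed
 obtain u where u: "u\<in>V" "nullseq (%n. B (s n - u) (s n - u))" using lim1 by blast
 obtain h where h: "\<And>i. i\<in>I ==> h i\<in>V"
  "\<And>i. i\<in>I ==> nullseq (%n. B (op (s n) i - h i) (op (s n) i - h i))" using lim2 by metis
 have ru: "rel u h"
  by (rule rel_closed[OF r u(1) h(1)])
   (use tendsto_real_sqrt[OF u(2)] tendsto_real_sqrt[OF h(2)] in \<open>auto simp: nr_def\<close>)
 have "(%n. a * (\<Sum>i\<in>I. B (op (s n) i - h i) (op (s n) i - h i)) + b * B (s n - u) (s n - u))
   \<longlonglongrightarrow> a * (\<Sum>i\<in>I. 0) + b * 0"
  by (intro tendsto_add tendsto_mult tendsto_const tendsto_sum h u)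
 then have "nullseq (%n. gip a b (s n - u) (s n - u))"
  unfolding gip_rel[OF rel_diff[OF r ru] rel_diff[OF r ru]] by simp
 then show "\<exists>u\<in>gdom. nullseq (%n. gip a b (s n - u) (s n - u))" using gdomI[OF ru] by blast
qed

end

section \<open>H^1(\<Omega>) as the graph space of the weak gradient\<close>

section \<open>The Sobolev space \<open>H\<^sup>1(\<Omega>)\<close>\<close>

context bounded_cylinder
begin

abbreviation "ipX u v \<equiv> (\<integral>x. u x * v x\<partial>MX)"

sublocale X: semi_hilbert "sqi MX" ipX by (rule semi_hilbert_sqi[OF fin_MX])

lemma nrm_L2_X: "nrm (L2 \<Omega>) u = X.nr u"
 by (simp add: nrm_L2 X.nr_def)

lemma X_nr_eq_zero: "u\<in>sqi MX ==> X.nr u = 0 \<longleftrightarrow> (AE x in MX. u x = 0)"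
 using integral_nonneg_eq_0_iff_AE[OF sqi_int, of u MX] by (simp add: X.nr_def power2_eq_square)

text \<open>The componentwise form of \<open>has_weak_gradient\<close>, which places the derivatives
  in the same space as the function.\<close>

definition wrel :: "(real^'n=>real)=>('n=>real^'n=>real)=>bool" where
 "wrel u g \<longleftrightarrow> u\<in>sqi MX\<and>(\<forall>i. g i\<in>sqi MX) \<and>
  (\<forall>\<phi>\<in>DX. \<forall>i. ipX u (%x. frechet_derivative \<phi> (at x) (axis i 1)) = - ipX (g i) \<phi>)"

lemma has_weak_gradient_wrel:
 "u\<in>sqi MX ==> has_weak_gradient \<Omega> u G \<longleftrightarrow> wrel u (%i x. G x $ i)"
 by (auto simp: has_weak_gradient_def wrel_def elems_L2)

lemma wrel_has_weak_gradient: "wrel u g ==> has_weak_gradient \<Omega> u (%x. \<chi> i. g i x)"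
 by (subst has_weak_gradient_wrel) (auto simp: wrel_def)

lemma test_deriv_sqi: "\<phi>\<in>DX ==> (%x. frechet_derivative \<phi> (at x) b)\<in>sqi MX"
 by (intro test_sqi_MX test_deriv)

sublocale W: closed_relation "sqi MX" ipX "UNIV :: 'n set" wrel
proof
 let ?d = "%\<phi> i x. frechet_derivative \<phi> (at x) (axis i 1)"
 show "finite (UNIV :: 'n set)" by simp
 show "wrel u g ==> u\<in>sqi MX" "wrel u g ==> g i\<in>sqi MX" for u g i by (auto simp: wrel_def)
 show "wrel 0 (%i. 0)" by (auto simp: wrel_def X.zero_mem)
 show "wrel (u + v) (%i. g i + h i)" if "wrel u g" "wrel v h" for u g v h
  unfolding wrel_def
 proof (intro conjI allI ballI)
  show "u + v\<in>sqi MX" "g i + h i\<in>sqi MX" for i using that by (auto simp: wrel_def intro: X.add_mem)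
  fix \<phi> i assume p: "\<phi>\<in>DX"
  show "ipX (u + v) (?d \<phi> i) = - ipX (g i + h i) \<phi>"
  proof -
   have m: "u\<in>sqi MX" "v\<in>sqi MX" "g i\<in>sqi MX" "h i\<in>sqi MX" using that by (auto simp: wrel_def)
   have e: "ipX u (?d \<phi> i) = - ipX (g i) \<phi>"
    "ipX v (?d \<phi> i) = - ipX (h i) \<phi>"
    using that p unfolding wrel_def by blast+
   show ?thesis
    unfolding X.B_add[OF m(1,2) test_deriv_sqi[OF p]] X.B_add[OF m(3,4) test_sqi_MX[OF p]]
    by (simp add: e)
  qed
 qed
 show "wrel (c *\<^sub>R u) (%i. c *\<^sub>R g i)" if "wrel u g" for c u g
  unfolding wrel_def
 proof (intro conjI allI ballI)
  show "c *\<^sub>R u\<in>sqi MX" "c *\<^sub>R g i\<in>sqi MX" for i using that by (auto simp: wrel_def intro: X.scale_mem)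
  fix \<phi> i assume p: "\<phi>\<in>DX"
  show "ipX (c *\<^sub>R u) (?d \<phi> i) = - ipX (c *\<^sub>R g i) \<phi>"
  proof -
   have m: "u\<in>sqi MX" "g i\<in>sqi MX" using that by (auto simp: wrel_def)
   have "ipX u (?d \<phi> i) = - ipX (g i) \<phi>"
    using that p unfolding wrel_def by blast
   then show ?thesis
    unfolding X.B_scale[OF m(1) test_deriv_sqi[OF p]] X.B_scale[OF m(2) test_sqi_MX[OF p]] by simp
  qed
 qed
 show "X.nr (g i - h i) = 0" if r: "wrel u g" "wrel u h" for u g h i
 proof -
  have m: "g i\<in>sqi MX" "h i\<in>sqi MX" using r by (auto simp: wrel_def)
  have d: "g i - h i\<in>sqi MX" by (rule X.diff_mem[OF m])
  have "AE x in MX. (g i - h i) x = 0"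
  proof (rule fundamental_lemma[OF open_dom sqi_integrable[OF fin_MX d]])
   fix \<phi> assume p: "\<phi>\<in>DX"
   have "ipX u (?d \<phi> i) = - ipX (g i) \<phi>"
    "ipX u (?d \<phi> i) = - ipX (h i) \<phi>"
    using r p unfolding wrel_def by blast+
   then show "ipX (g i - h i) \<phi> = 0" unfolding X.B_diff[OF m test_sqi_MX[OF p]] by simp
  qed
  then show ?thesis by (simp add: X_nr_eq_zero[OF d])
 qed
 show "wrel u h" if r: "\<And>n. wrel (s n) (g n)" and u: "u\<in>sqi MX" and h: "\<And>i. i\<in>UNIV ==> h i\<in>sqi MX"
  and l: "nullseq (%n. X.nr (s n - u))" "\<And>i. i\<in>UNIV ==> nullseq (%n. X.nr (g n i - h i))"
  for s :: "nat=>_" and g u h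
  unfolding wrel_def
 proof (intro conjI allI ballI)
  fix \<phi> i assume p: "\<phi>\<in>DX"
  have sm: "s n\<in>sqi MX" "g n i\<in>sqi MX" for n using r[of n] by (auto simp: wrel_def)
  have "(%n. ipX (s n) (?d \<phi> i))
    \<longlonglongrightarrow> ipX u (?d \<phi> i)"
   by (rule X.B_tendsto[OF sm(1) u test_deriv_sqi[OF p] l(1)])
  moreover have "ipX (s n) (?d \<phi> i) = - ipX (g n i) \<phi>" for n
   using r[of n] p unfolding wrel_def by blast
  moreover have "(%n. - ipX (g n i) \<phi>) \<longlonglongrightarrow> - ipX (h i) \<phi>"
   by (intro tendsto_minus X.B_tendsto[OF sm(2) h test_sqi_MX[OF p] l(2)]) auto
  ultimately show "ipX u (?d \<phi> i) = - ipX (h i) \<phi>"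
   by (simp only: LIMSEQ_unique)
 qed (use u h in auto)
qed

lemma elems_H1: "elems (H1 \<Omega>) = W.gdom"
proof -
 have "(\<exists>G. has_weak_gradient \<Omega> u G) \<longleftrightarrow> (\<exists>g. wrel u g)" if "u\<in>sqi MX" for u
  using has_weak_gradient_wrel[OF that] wrel_has_weak_gradient by metis
 then show ?thesis by (auto simp: H1_def elems_L2 W.gdom_def W.rel_mem(1))
qed

lemma wrel_weak_gradient:
 assumes "u\<in>W.gdom" shows "wrel u (%i x. weak_gradient \<Omega> u x $ i)"
proof -
 have u: "u\<in>sqi MX" by (rule W.gdom_V[OF assms])
 have "has_weak_gradient \<Omega> u (weak_gradient \<Omega> u)"
  unfolding weak_gradient_def by (rule someI_ex[of "has_weak_gradient \<Omega> u"], rule exI, rule wrel_has_weak_gradient[OF W.op_rel[OF assms]])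
 then show ?thesis by (simp add: has_weak_gradient_wrel[OF u])
qed

lemma gradient_ip:
 assumes u: "u\<in>W.gdom" and v: "v\<in>W.gdom"
 shows "(\<integral>x. weak_gradient \<Omega> u x \<bullet> weak_gradient \<Omega> v x\<partial>MX)
  = (\<Sum>i\<in>UNIV. ipX (%x. weak_gradient \<Omega> u x $ i) (%x. weak_gradient \<Omega> v x $ i))"
proof -
 have "integrable MX (%x. weak_gradient \<Omega> u x $ i * weak_gradient \<Omega> v x $ i)" for i
  using wrel_weak_gradient[OF u] wrel_weak_gradient[OF v]
  by (intro sqi_mult) (auto simp: wrel_def)
 then show ?thesis by (simp add: inner_vec_def Bochner_Integration.integral_sum)
qed

lemma gip_weak_gradient:
 assumes u: "u\<in>W.gdom" and v: "v\<in>W.gdom"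
 shows "W.gip a b u v = a * (\<integral>x. weak_gradient \<Omega> u x \<bullet> weak_gradient \<Omega> v x\<partial>MX) + b * L2_inner \<Omega> u v"
 unfolding W.gip_rel[OF wrel_weak_gradient[OF u] wrel_weak_gradient[OF v]] gradient_ip[OF u v] L2_inner_def ..

text \<open>The elliptic form is a graph inner product, so solving the elliptic equation is Riesz
  representation.\<close>

lemma gip_Laplace:
 "u\<in>W.gdom ==> v\<in>W.gdom ==> - a * Laplace \<Omega> u v + b * L2_inner \<Omega> u v = W.gip a b u v"
 by (simp add: gip_weak_gradient Laplace_def)

lemma nrm_H1: "u\<in>W.gdom ==> nrm (H1 \<Omega>) u = sqrt (W.gip 1 1 u u)"
 by (simp add: gip_weak_gradient H1_def add.commute)

lemma test_wrel:
 assumes "\<phi>\<in>DX"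
 shows "wrel \<phi> (%i x. frechet_derivative \<phi> (at x) (axis i 1))"
 unfolding wrel_def
 using test_integration_by_parts[OF open_dom assms] test_sqi_MX[OF assms] test_deriv_sqi[OF assms] by blast

end

section \<open>L^2(0,T;H^1(\<Omega>)) as the graph space of the slicewise gradient\<close>

section \<open>The Bochner space \<open>L\<^sup>2(0,T;H\<^sup>1(\<Omega>))\<close>\<close>

lemma (in closed_relation) rel_cong:
 assumes "rel v g" "u\<in>V" "nr (v - u) = 0"
 shows "rel u g"
 by (rule rel_closed[of "%_. v" "%_. g"]) (use assms rel_mem in \<open>auto simp: nr_zero\<close>)

context bounded_cylinder
begin

lemma lip_self: "u\<in>LL ==> lip u u = (\<integral>t. (X.nr (u t))^2\<partial>MT)"
 by (simp add: lip_iterated(1) X.nr_def integral_nonneg_AE)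

lemma slice_integrable: "u\<in>LL ==> integrable MT (%t. (X.nr (u t))^2)"
 using lip_iterated(2)[of u u] by (simp add: X.nr_def integral_nonneg_AE)

text \<open>Here the derivatives are jointly measurable by definition. That every Bochner function
  possesses such derivatives is the content of \<open>L2H1_subset_J\<close>.\<close>

definition jrel :: "'n evol=>('n=>real=>real^'n=>real)=>bool" where
 "jrel u g \<longleftrightarrow> u\<in>LL\<and>(\<forall>i. g i\<in>LL)\<and>(AE t in MT. wrel (u t) (%i. g i t))"

sublocale J: closed_relation LL lip "UNIV :: 'n set" jrel
proof
 show "finite (UNIV :: 'n set)" by simp
 show "jrel u g ==> u\<in>LL" "jrel u g ==> g i\<in>LL" for u g i by (auto simp: jrel_def)
 show "jrel 0 (%i. 0)" using W.rel_zero by (auto simp: jrel_def LL.zero_mem)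
 show "jrel (u + v) (%i. g i + h i)" if "jrel u g" "jrel v h" for u g v h
 proof -
  have "AE t in MT. wrel (u t) (%i. g i t)" "AE t in MT. wrel (v t) (%i. h i t)"
   using that by (auto simp: jrel_def)
  then have "AE t in MT. wrel ((u + v) t) (%i. (g i + h i) t)"
   by eventually_elim (simp add: W.rel_add)
  then show ?thesis using that by (auto simp: jrel_def intro: LL.add_mem)
 qed
 show "jrel (c *\<^sub>R u) (%i. c *\<^sub>R g i)" if "jrel u g" for c u g
 proof -
  have "AE t in MT. wrel (u t) (%i. g i t)" using that by (auto simp: jrel_def)
  then have "AE t in MT. wrel ((c *\<^sub>R u) t) (%i. (c *\<^sub>R g i) t)"
   by eventually_elim (simp add: W.rel_scale scaleR_fun_def[of c "_ :: real=>_"])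
  then show ?thesis using that by (auto simp: jrel_def intro: LL.scale_mem)
 qed
 show "LL.nr (g i - h i) = 0" if r: "jrel u g" "jrel u h" for u g h i
 proof -
  have d: "g i - h i\<in>LL" using r by (auto simp: jrel_def intro: LL.diff_mem)
  have "AE t in MT. wrel (u t) (%i. g i t)" "AE t in MT. wrel (u t) (%i. h i t)"
   using r by (auto simp: jrel_def)
  then have "AE t in MT. (X.nr ((g i - h i) t))^2 = 0"
  proof eventually_elim
   case (elim t)
   then have "X.nr (g i t - h i t) = 0" by (rule W.rel_unique) simp
   then show ?case by simp
  qed
  then have "(\<integral>t. (X.nr ((g i - h i) t))^2\<partial>MT) = 0" by (rule integral_eq_zero_AE)
  then have "lip (g i - h i) (g i - h i) = 0" unfolding lip_self[OF d] .
  then show ?thesis by (simp add: LL.nr_def)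
 qed
 show "jrel u h" if r: "\<And>n. jrel (s n) (g n)" and u: "u\<in>LL" and h: "\<And>i. i\<in>UNIV ==> h i\<in>LL"
  and l: "nullseq (%n. LL.nr (s n - u))" "\<And>i. i\<in>UNIV ==> nullseq (%n. LL.nr (g n i - h i))"
  for s :: "nat=>_" and g u h
 proof -
  have sg: "s n\<in>LL" "g n i\<in>LL" for n i using r[of n] by (auto simp: jrel_def)
  \<comment> \<open>The functions (index \<open>None\<close>) and their partial derivatives form one
    finite family, so a single subsequence converges on almost every slice and closedness of the
    weak gradient applies there.\<close>
  define S where "S = (%k n. case k of None=>s n | Some i=>g n i)"
  define U where "U = (%k. case k of None=>u | Some i=>h i)"
  obtain \<rho> where \<rho>: "AE t in MT. \<forall>k\<in>UNIV. nullseq (%n. nrm (L2 \<Omega>) (S k (\<rho> n) t - U k t))"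
   by (rule LL_tendsto_slices_family[of "UNIV :: 'n option set" S U])
    (use sg u h l in \<open>auto simp: S_def U_def split: option.splits\<close>)
  have "AE t in MT. \<forall>n. wrel (s n t) (%i. g n i t)"
   using r by (auto simp: jrel_def AE_all_countable)
  moreover have "AE t in MT. \<forall>i. h i t\<in>sqi MX"
   unfolding AE_all_countable using h LL_slice by simp
  ultimately have "AE t in MT. wrel (u t) (%i. h i t)"
   using \<rho> LL_slice[OF u]
  proof eventually_elim
   case (elim t)
   have lim: "nullseq (%n. X.nr (S k (\<rho> n) t - U k t))" for k
    using elim(3) by (simp add: nrm_L2_X)
   show ?case
   proof (rule W.rel_closed[of "%n. s (\<rho> n) t" "%n i. g (\<rho> n) i t"])
    show "nullseq (%n. X.nr (s (\<rho> n) t - u t))" using lim[of None] by (simp add: S_def U_def)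
    show "nullseq (%n. X.nr (g (\<rho> n) i t - h i t))" for i using lim[of "Some i"] by (simp add: S_def U_def)
   qed (use elim in auto)
  qed
  then show ?thesis using u h by (auto simp: jrel_def)
 qed
qed

lemma J_gip_slice:
 assumes "u\<in>J.gdom" "v\<in>J.gdom"
 shows "integrable MT (%t. W.gip a b (u t) (v t))" "J.gip a b u v = (\<integral>t. W.gip a b (u t) (v t)\<partial>MT)"
proof -
 note r = J.op_rel[OF assms(1)] J.op_rel[OF assms(2)]
 note m = J.rel_mem(2)[OF r(1)] J.rel_mem(2)[OF r(2)] J.rel_mem(1)[OF r(1)] J.rel_mem(1)[OF r(2)]
 let ?f = "%t. a * (\<Sum>i\<in>UNIV. ipX (J.op u i t) (J.op v i t)) + b * ipX (u t) (v t)"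
 have ae: "AE t in MT. W.gip a b (u t) (v t) = ?f t"
 proof -
  have "AE t in MT. wrel (u t) (%i. J.op u i t)" "AE t in MT. wrel (v t) (%i. J.op v i t)"
   using r by (auto simp: jrel_def)
  then show ?thesis by eventually_elim (rule W.gip_rel)
 qed
 have i: "integrable MT (%t. ipX (J.op u i t) (J.op v i t))" "integrable MT (%t. ipX (u t) (v t))" for i
  using lip_iterated(2) m by auto
 then have fi: "integrable MT ?f" by (intro Bochner_Integration.integrable_add integrable_mult_right Bochner_Integration.integrable_sum)
 have gm: "(%t. W.gip a b (u t) (v t))\<in>meas MT"
  by (rule leb_measurable_AE[OF IT borel_measurable_integrable[OF fi]])
   (use ae in \<open>eventually_elim, simp\<close>)
 show "integrable MT (%t. W.gip a b (u t) (v t))" by (rule integrable_AE_eqI[OF fi ae gm])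
 have "J.gip a b u v = (\<integral>t. ?f t\<partial>MT)"
  unfolding J.gip_rel[OF r] using i by (simp add: lip_iterated(1) m Bochner_Integration.integral_sum)
 also have "\<dots> = (\<integral>t. W.gip a b (u t) (v t)\<partial>MT)"
  by (rule integral_cong_AE[OF borel_measurable_integrable[OF fi] gm]) (use ae in \<open>eventually_elim, simp\<close>)
 finally show "J.gip a b u v = (\<integral>t. W.gip a b (u t) (v t)\<partial>MT)" .
qed

lemma J_slice: "u\<in>J.gdom ==> AE t in MT. u t\<in>W.gdom"
 using J.op_rel[of u] by (auto simp: jrel_def elim!: eventually_mono intro: W.gdomI)

sublocale W1: semi_hilbert W.gdom "W.gip 1 1" by (rule W.gip_semi_hilbert) auto
sublocale J1: semi_hilbert J.gdom "J.gip 1 1" by (rule J.gip_semi_hilbert) auto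

lemma nrm_H1_W1: "u\<in>W.gdom ==> nrm (H1 \<Omega>) u = W1.nr u"
 by (simp add: nrm_H1 W1.nr_def)

lemma X_nr_le_W1: "u\<in>W.gdom ==> X.nr u\<le>W1.nr u"
 using W.gip_bounds(1)[OF _ _ W.op_rel, of 1 1 u] by (simp add: X.nr_def W1.nr_def)

definition simple_H1 :: "'n evol set" where
 "simple_H1 = {s. simple_function MT s\<and>s ` {0<..<T}\<subseteq>W.gdom}"

lemma simple_H1_jrel:
 assumes "s\<in>simple_H1"
 shows "jrel s (%i t x. weak_gradient \<Omega> (s t) x $ i)"
proof -
 have sf: "simple_function MT s" and v: "t\<in>{0<..<T} ==> s t\<in>W.gdom" for t
  using assms by (auto simp: simple_H1_def)
 have w: "wrel (s t) (%i x. weak_gradient \<Omega> (s t) x $ i)" if "t\<in>{0<..<T}" for t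
  by (rule wrel_weak_gradient[OF v[OF that]])
 have "s\<in>simple_L2" using sf w unfolding simple_L2_def wrel_def by blast
 moreover have "(%t x. weak_gradient \<Omega> (s t) x $ i)\<in>simple_L2" for i
  using simple_function_compose1[OF sf, of "%u x. weak_gradient \<Omega> u x $ i"] w
  unfolding simple_L2_def wrel_def by blast
 moreover have "AE t in MT. wrel (s t) (%i x. weak_gradient \<Omega> (s t) x $ i)"
  by (rule AE_I2) (use w in simp)
 ultimately show ?thesis by (simp add: jrel_def simple_L2_LL)
qed

lemma simple_H1_J: "s\<in>simple_H1 ==> s\<in>J.gdom"
 using simple_H1_jrel J.gdomI by blast

text \<open>Truncating the approximating simple functions where they are large compared with the limit makes
 dominated convergence applicable.\<close>

lemma J_time_mult:
 assumes th: "\<theta>\<in>meas MT" and b: "\<And>t. t\<in>{0<..<T} ==> \<bar>\<theta> t\<bar>\<le>C" and u: "u\<in>J.gdom"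
 shows "(%t x. \<theta> t * u t x)\<in>J.gdom"
proof (rule J.gdomI)
 have r: "jrel u (J.op u)" by (rule J.op_rel[OF u])
 have "AE t in MT. wrel (u t) (%i. J.op u i t)" using r by (simp add: jrel_def)
 then have "AE t in MT. wrel (%x. \<theta> t * u t x) (%i x. \<theta> t * J.op u i t x)"
 proof eventually_elim
  case (elim t)
  from W.rel_scale[OF this, of "\<theta> t"] show ?case by (simp add: scaleR_fun_def)
 qed
 then show "jrel (%t x. \<theta> t * u t x) (%i t x. \<theta> t * J.op u i t x)"
  using r by (auto simp: jrel_def intro: LL_time_mult[OF th b])
qed

text \<open>Almost every slice of u has a weak gradient, but its joint measurability is not given.
  Riesz representation of the functional that integrates the H^1 inner product of u(t) and \<psi>(t)
  produces some v which has a jointly measurable gradient, and v is then shown to equal u slice by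
  slice.\<close>

lemma L2H1_subset_J:
 assumes u: "u\<in>elems (L2H1 T \<Omega>)"
 shows "u\<in>J.gdom"
proof -
 have sm: "strongly_measurable T (H1 \<Omega>) u" and jm: "jointly_measurable T \<Omega> u"
  and i: "integrable MT (%t. (nrm (H1 \<Omega>) (u t))^2)"
  using u by (auto simp: L2_fun_def L2_time_def)
 have m: "case_prod u\<in>meas MC" using jm by (simp add: jointly_measurable_def cylinder_def)
 have sl: "AE t in MT. u t\<in>W.gdom" using sm by (simp add: strongly_measurable_def elems_H1)
 obtain s where s: "\<And>k::nat. s k\<in>simple_H1" and s0: "AE t in MT. nullseq (%k. nrm (H1 \<Omega>) (u t - s k t))"
  using sm by (auto simp: strongly_measurable_def simple_H1_def elems_H1)
 have sW: "s k t\<in>W.gdom" if "t\<in>{0<..<T}" for k t using s[of k] that by (auto simp: simple_H1_def)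
 have tT: "AE t in MT. t\<in>{0<..<T}" by (rule AE_I2) simp
 have slim: "AE t in MT. nullseq (%k. W1.nr (s k t - u t))"
  using s0 sl tT
 proof eventually_elim
  case (elim t)
  have "nrm (H1 \<Omega>) (u t - s k t) = W1.nr (s k t - u t)" for k
   using W1.nr_diff_commute[OF elim(2) sW[OF elim(3)]] nrm_H1_W1[OF W1.diff_mem[OF elim(2) sW[OF elim(3)]]] by simp
  then show ?case using elim(1) by simp
 qed
 have uL: "u\<in>LL"
 proof (rule LL_slicesI[OF m _ _ i])
  show "AE t in MT. u t\<in>sqi MX" using sl by eventually_elim (rule W.gdom_V)
  show "AE t in MT. (nrm (L2 \<Omega>) (u t))^2\<le>(nrm (H1 \<Omega>) (u t))^2"
   using sl by eventually_elim (auto simp: nrm_L2_X nrm_H1_W1 intro!: power_mono X_nr_le_W1 X.nr_nonneg W.gdom_V)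
 qed
 let ?g = "%\<psi> t. W.gip 1 1 (u t) (\<psi> t)"
 interpret S: semi_inner "sqi MT" "%u v. \<integral>s. u s * v s \<partial>MT" by (rule semi_inner_sqi)
 have nS: "(%t. nrm (H1 \<Omega>) (u t))\<in>sqi MT"
 proof -
  have "(%t. sqrt ((nrm (H1 \<Omega>) (u t))^2))\<in>meas MT" using borel_measurable_integrable[OF i] by measurable
  moreover have "AE t in MT. sqrt ((nrm (H1 \<Omega>) (u t))^2) = nrm (H1 \<Omega>) (u t)"
   using sl by eventually_elim (simp add: nrm_H1_W1 W1.nr_nonneg)
  ultimately have "(%t. nrm (H1 \<Omega>) (u t))\<in>meas MT" by (rule leb_measurable_AE[OF IT])
  then show ?thesis using i by (simp add: sqi_def)
 qed
 have pS: "(%t. W1.nr (\<psi> t))\<in>sqi MT" "S.nr (%t. W1.nr (\<psi> t)) = J1.nr \<psi>" if p: "\<psi>\<in>J.gdom" for \<psi>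
 proof -
  note g = J_gip_slice[OF p p, of 1 1]
  have ae: "AE t in MT. W.gip 1 1 (\<psi> t) (\<psi> t) = (W1.nr (\<psi> t))^2"
   using J_slice[OF p] by eventually_elim (simp add: W1.nr_sq)
  have m1: "(%t. W1.nr (\<psi> t))\<in>meas MT" unfolding W1.nr_def using g(1) by measurable
  then show "(%t. W1.nr (\<psi> t))\<in>sqi MT"
   using integrable_AE_eqI[OF g(1), of "%t. (W1.nr (\<psi> t))^2"] AE_symmetric[OF ae] by (auto simp: sqi_def)
  have "J.gip 1 1 \<psi> \<psi> = (\<integral>t. (W1.nr (\<psi> t))^2 \<partial>MT)"
   unfolding g(2) by (rule integral_cong_AE) (use g(1) m1 ae in auto)
  then show "S.nr (%t. W1.nr (\<psi> t)) = J1.nr \<psi>" by (simp add: S.nr_def J1.nr_def power2_eq_square)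
 qed
 have gb: "AE t in MT. \<bar>?g \<psi> t\<bar>\<le>nrm (H1 \<Omega>) (u t) * W1.nr (\<psi> t)" if "\<psi>\<in>J.gdom" for \<psi>
  using sl J_slice[OF that] by eventually_elim (simp add: nrm_H1_W1 W1.cauchy_schwarz)
 have gi: "integrable MT (?g \<psi>)" if p: "\<psi>\<in>J.gdom" for \<psi>
 proof (rule Bochner_Integration.integrable_bound[OF sqi_mult[OF nS pS(1)[OF p]]])
  show "?g \<psi>\<in>meas MT"
  \<comment> \<open>Measurability in t comes from the simple approximants, whose gradients are
    jointly measurable.\<close>
  proof (rule leb_measurable_AE[OF IT])
   show "(%t. lim (%k. W.gip 1 1 (s k t) (\<psi> t)))\<in>meas MT"
    by (intro borel_measurable_lim_metric borel_measurable_integrable J_gip_slice(1) simple_H1_J s p)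
   show "AE t in MT. lim (%k. W.gip 1 1 (s k t) (\<psi> t)) = ?g \<psi> t"
    using slim sl J_slice[OF p] tT by eventually_elim (intro limI W1.B_tendsto sW)
  qed
  show "AE t in MT. norm (?g \<psi> t)\<le>norm (nrm (H1 \<Omega>) (u t) * W1.nr (\<psi> t))" using gb[OF p] by eventually_elim simp
 qed
 obtain v where v: "v\<in>J.gdom" and vg: "\<And>\<psi>. \<psi>\<in>J.gdom ==> J.gip 1 1 v \<psi> = (\<integral>t. ?g \<psi> t \<partial>MT)"
 proof (rule J1.riesz_functional[of "%\<psi>. \<integral>t. ?g \<psi> t \<partial>MT" "S.nr (%t. nrm (H1 \<Omega>) (u t))"])
  fix \<psi> assume p: "\<psi>\<in>J.gdom"
  show "(\<integral>t. ?g (\<psi> + \<psi>') t \<partial>MT) = (\<integral>t. ?g \<psi> t \<partial>MT) + (\<integral>t. ?g \<psi>' t \<partial>MT)" if p': "\<psi>'\<in>J.gdom" for \<psi>'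
  proof -
   have "AE t in MT. ?g (\<psi> + \<psi>') t = ?g \<psi> t + ?g \<psi>' t"
    using sl J_slice[OF p] J_slice[OF p'] by eventually_elim (simp add: W1.B_add_right)
   then have "(\<integral>t. ?g (\<psi> + \<psi>') t \<partial>MT) = (\<integral>t. ?g \<psi> t + ?g \<psi>' t \<partial>MT)"
    using gi[OF J1.add_mem[OF p p']] gi[OF p] gi[OF p'] by (intro integral_cong_AE) auto
   then show ?thesis using gi[OF p] gi[OF p'] by simp
  qed
  show "(\<integral>t. ?g (c *\<^sub>R \<psi>) t \<partial>MT) = c * (\<integral>t. ?g \<psi> t \<partial>MT)" for c
  proof -
   have "AE t in MT. ?g (c *\<^sub>R \<psi>) t = c * ?g \<psi> t"
    using sl J_slice[OF p] by eventually_elim (simp add: W1.B_scale_right scaleR_fun_def[of c \<psi>])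
   then have "(\<integral>t. ?g (c *\<^sub>R \<psi>) t \<partial>MT) = (\<integral>t. c * ?g \<psi> t \<partial>MT)"
    using gi[OF J1.scale_mem[OF p]] gi[OF p] by (intro integral_cong_AE) auto
   then show ?thesis by simp
  qed
  have "\<bar>\<integral>t. ?g \<psi> t \<partial>MT\<bar>\<le>(\<integral>t. nrm (H1 \<Omega>) (u t) * W1.nr (\<psi> t) \<partial>MT)"
   by (rule order_trans[OF integral_abs_bound integral_mono_AE[OF integrable_abs[OF gi[OF p]] sqi_mult[OF nS pS(1)[OF p]] gb[OF p]]])
  also have "\<dots>\<le>S.nr (%t. nrm (H1 \<Omega>) (u t)) * J1.nr \<psi>" using S.cauchy_schwarz[OF nS pS(1)[OF p]] pS(2)[OF p] by simp
  finally show "\<bar>\<integral>t. ?g \<psi> t \<partial>MT\<bar>\<le>S.nr (%t. nrm (H1 \<Omega>) (u t)) * J1.nr \<psi>" .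
 qed (rule that)
 \<comment> \<open>Equality of the integrals becomes equality on almost every slice by testing with
   \<psi> times the sign of the integrand.\<close>
 have orth: "AE t in MT. ?g \<psi> t - W.gip 1 1 (v t) (\<psi> t) = 0" if p: "\<psi>\<in>J.gdom" for \<psi>
 proof -
  let ?F = "%t. ?g \<psi> t - W.gip 1 1 (v t) (\<psi> t)"
  have Fi: "integrable MT ?F" using gi[OF p] J_gip_slice(1)[OF v p] by simp
  let ?p = "%t x. sgn (?F t) * \<psi> t x"
  have sm: "(%t. sgn (?F t))\<in>meas MT"
   unfolding sgn_real_def using borel_measurable_integrable[OF Fi] by measurable
  have q: "?p\<in>J.gdom" by (rule J_time_mult[OF sm _ p, of 1]) (simp add: abs_sgn_eq)
  have "(\<integral>t. \<bar>?F t\<bar> \<partial>MT) = (\<integral>t. ?g ?p t - W.gip 1 1 (v t) (?p t) \<partial>MT)"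
  proof (rule integral_cong_AE)
   show "AE t in MT. \<bar>?F t\<bar> = ?g ?p t - W.gip 1 1 (v t) (?p t)"
    using sl J_slice[OF p] J_slice[OF v]
   proof eventually_elim
    case (elim t)
    have "?p t = sgn (?F t) *\<^sub>R \<psi> t" by (simp add: scaleR_fun_def)
    then show ?case using elim by (simp add: W1.B_scale_right abs_sgn[of "?F t"] flip: right_diff_distrib)
   qed
  qed (use Fi gi[OF q] J_gip_slice(1)[OF v q] in auto)
  also have "\<dots> = 0" using vg[OF q] J_gip_slice[OF v q, of 1 1] gi[OF q] by simp
  finally show ?thesis using integral_nonneg_eq_0_iff_AE[OF integrable_abs[OF Fi]] by simp
 qed
 \<comment> \<open>Testing with the countably many approximants of u and with v itself makes v(t) -
   u(t) orthogonal to both u(t) and v(t), hence to itself.\<close>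
 have "AE t in MT. \<forall>k. ?g (s k) t - W.gip 1 1 (v t) (s k t) = 0"
  unfolding AE_all_countable by (intro allI orth simple_H1_J s)
 then have z: "AE t in MT. X.nr ((v - u) t) = 0"
  using orth[OF v] slim sl J_slice[OF v] tT
 proof eventually_elim
  case (elim t)
  note vu = W1.diff_mem[OF elim(5,4)]
  have "W.gip 1 1 (s k t) (v t - u t) = 0" for k
   using elim(1) W1.B_diff[OF elim(5,4) sW[OF elim(6)], of k] W1.B_sym[OF vu sW[OF elim(6)], of k] by simp
  then have "W.gip 1 1 (u t) (v t - u t) = 0"
   using W1.B_tendsto[OF sW[OF elim(6)] elim(4) vu elim(3)] LIMSEQ_unique[OF _ tendsto_const] by simp
  moreover have "W.gip 1 1 (v t) (v t - u t) = 0"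
   using elim(2) W1.B_diff_right[OF elim(5,4,5)] W1.B_sym[OF elim(4,5)] by simp
  ultimately have "W1.nr (v t - u t) = 0" using W1.B_diff[OF elim(5,4) vu] by (simp add: W1.nr_def)
  then show ?case using X_nr_le_W1[OF vu] X.nr_nonneg[OF W.gdom_V[OF vu]] by simp
 qed
 have d: "v - u\<in>LL" by (rule LL.diff_mem[OF J.gdom_V[OF v] uL])
 have "lip (v - u) (v - u) = 0"
  unfolding lip_self[OF d] using z by (intro integral_eq_zero_AE) auto
 then have "LL.nr (v - u) = 0" by (simp add: LL.nr_def)
 from J.rel_cong[OF J.op_rel[OF v] uL this] show ?thesis by (rule J.gdomI)
qed

end

context bounded_cylinder
begin

text \<open>The components of the isometric embedding of v as (v, grad v) into a product of copies
  of L^2(\<Omega>); \<open>None\<close> is the function itself.\<close>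

definition part :: "'n option=>(real^'n=>real)=>real^'n=>real" where
 "part k v = (case k of None=>v | Some i=>(%x. weak_gradient \<Omega> v x $ i))"

lemma part_sqi: "v\<in>W.gdom ==> part k v\<in>sqi MX"
 using wrel_weak_gradient[of v] W.gdom_V[of v] by (auto simp: part_def wrel_def split: option.split)

lemma sum_option:
 fixes f :: "'n option=>real"
 shows "(\<Sum>k\<in>UNIV. f k) = f None + (\<Sum>i\<in>UNIV. f (Some i))"
proof -
 have "(\<Sum>k\<in>UNIV. f k) = f None + sum f (range Some)"
  unfolding UNIV_option_conv by (subst sum.insert) auto
 also have "sum f (range Some) = (\<Sum>i\<in>UNIV. f (Some i))"
  by (subst sum.reindex) (auto simp: o_def)
 finally show ?thesis .
qed

lemma gip_part:
 assumes "u\<in>W.gdom" "v\<in>W.gdom"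
 shows "W.gip 1 1 u v = (\<Sum>k\<in>UNIV. ipX (part k u) (part k v))"
 unfolding W.gip_rel[OF wrel_weak_gradient[OF assms(1)] wrel_weak_gradient[OF assms(2)]] sum_option
 by (simp add: part_def)

lemma part_add:
 assumes "u\<in>W.gdom" "v\<in>W.gdom" shows "X.nr (part k (u + v) - (part k u + part k v)) = 0"
proof (cases k)
 case None
 then show ?thesis by (simp add: part_def X.nr_zero)
next
 case (Some i)
 have "X.nr ((%x. weak_gradient \<Omega> (u + v) x $ i) - ((%x. weak_gradient \<Omega> u x $ i) + (%x. weak_gradient \<Omega> v x $ i))) = 0"
  by (rule W.rel_unique[OF wrel_weak_gradient[OF W1.add_mem[OF assms]]
    W.rel_add[OF wrel_weak_gradient[OF assms(1)] wrel_weak_gradient[OF assms(2)]]]) simp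
 then show ?thesis by (simp add: Some part_def)
qed

lemma part_scale:
 assumes "u\<in>W.gdom" shows "X.nr (part k (c *\<^sub>R u) - c *\<^sub>R part k u) = 0"
proof (cases k)
 case None
 then show ?thesis by (simp add: part_def X.nr_zero)
next
 case (Some i)
 have "X.nr ((%x. weak_gradient \<Omega> (c *\<^sub>R u) x $ i) - c *\<^sub>R (%x. weak_gradient \<Omega> u x $ i)) = 0"
  by (rule W.rel_unique[OF wrel_weak_gradient[OF W1.scale_mem[OF assms]]
    W.rel_scale[OF wrel_weak_gradient[OF assms]]]) simp
 then show ?thesis by (simp add: Some part_def)
qed

lemma part_nr_le:
 assumes "v\<in>W.gdom" shows "X.nr (part k v)\<le>W1.nr v"
proof -
 have "ipX (part k v) (part k v)\<le>(\<Sum>k\<in>UNIV. ipX (part k v) (part k v))"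
  by (rule member_le_sum) (use X.B_pos[OF part_sqi[OF assms]] in auto)
 then show ?thesis unfolding X.nr_def W1.nr_def gip_part[OF assms assms] by simp
qed

lemma part_representer:
 assumes b: "b\<in>sqi MX"
 shows "\<exists>p\<in>W.gdom. \<forall>v\<in>W.gdom. W.gip 1 1 p v = ipX b (part k v)"
proof -
 obtain p where p: "p\<in>W.gdom" "\<And>v. v\<in>W.gdom ==> W.gip 1 1 p v = ipX b (part k v)"
 proof (rule W1.riesz_functional[of "%v. ipX b (part k v)" "X.nr b"])
  fix u v assume uv: "u\<in>W.gdom" "v\<in>W.gdom"
  note m = part_sqi[OF uv(1)] part_sqi[OF uv(2)] part_sqi[OF W1.add_mem[OF uv]]
  have "ipX (part k (u + v)) b = ipX (part k u + part k v) b"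
   by (rule X.B_cong_left[OF m(3) X.add_mem[OF m(1,2)] b part_add[OF uv]])
  also have "\<dots> = ipX (part k u) b + ipX (part k v) b" by (rule X.B_add[OF m(1,2) b])
  finally show "ipX b (part k (u + v)) = ipX b (part k u) + ipX b (part k v)"
   by (simp only: mult.commute[of "b _"])
 next
  fix c u assume u: "u\<in>W.gdom"
  have "ipX (part k (c *\<^sub>R u)) b = ipX (c *\<^sub>R part k u) b"
   by (rule X.B_cong_left[OF part_sqi[OF W1.scale_mem[OF u]] X.scale_mem[OF part_sqi[OF u]] b part_scale[OF u]])
  also have "\<dots> = c * ipX (part k u) b" by (rule X.B_scale[OF part_sqi[OF u] b])
  finally show "ipX b (part k (c *\<^sub>R u)) = c * ipX b (part k u)"
   by (simp only: mult.commute[of "b _"])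
 next
  fix u assume u: "u\<in>W.gdom"
  have "\<bar>ipX b (part k u)\<bar>\<le>X.nr b * X.nr (part k u)" by (rule X.cauchy_schwarz[OF b part_sqi[OF u]])
  also have "\<dots>\<le>X.nr b * W1.nr u" by (intro mult_left_mono part_nr_le u X.nr_nonneg b)
  finally show "\<bar>ipX b (part k u)\<bar>\<le>X.nr b * W1.nr u" .
 qed (rule that)
 then show ?thesis by blast
qed

text \<open>The adjoint of \<open>part k\<close>. Summed over k these maps are the adjoint of the
  isometry v -> (v, grad v): the orthogonal projection onto the graph, followed by its first
  coordinate.\<close>

definition repr :: "'n option=>(real^'n=>real)=>real^'n=>real" where
 "repr k b = (SOME p. p\<in>W.gdom\<and>(\<forall>v\<in>W.gdom. W.gip 1 1 p v = ipX b (part k v)))"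

lemma repr: "b\<in>sqi MX ==> repr k b\<in>W.gdom"
  "b\<in>sqi MX ==> v\<in>W.gdom ==> W.gip 1 1 (repr k b) v = ipX b (part k v)"
 using someI_ex[of "%p. p\<in>W.gdom\<and>(\<forall>v\<in>W.gdom. W.gip 1 1 p v = ipX b (part k v))"]
  part_representer[of b k] unfolding repr_def by blast+

lemma W1_sum_mem: "finite K ==> (\<And>k. k\<in>K ==> f k\<in>W.gdom) ==> (\<Sum>k\<in>K. f k)\<in>W.gdom"
 by (induction K rule: finite_induct) (auto intro: W1.add_mem W1.zero_mem)

lemma W1_sum_B:
 "finite K ==> (\<And>k. k\<in>K ==> f k\<in>W.gdom) ==> v\<in>W.gdom ==> W.gip 1 1 (\<Sum>k\<in>K. f k) v = (\<Sum>k\<in>K. W.gip 1 1 (f k) v)"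
proof (induction K rule: finite_induct)
 case empty
 then show ?case by (simp only: sum.empty W1.B_zero)
next
 case (insert k K)
 have m: "f k\<in>W.gdom" "(\<Sum>k\<in>K. f k)\<in>W.gdom" using insert W1_sum_mem by auto
 have "W.gip 1 1 (\<Sum>k\<in>K. f k) v = (\<Sum>k\<in>K. W.gip 1 1 (f k) v)" using insert by auto
 then show ?case
  unfolding sum.insert[OF insert.hyps] W1.B_add[OF m insert.prems(2)] by simp
qed

lemma simple_function_sum_fun:
 fixes f :: "'k=>'b=>'c::comm_monoid_add"
 shows "finite K ==> (\<And>k. k\<in>K ==> simple_function M (f k)) ==> simple_function M (%t. \<Sum>k\<in>K. f k t)"
 by (induction K rule: finite_induct) (auto intro: simple_function_compose2[where h="(+)"])

text \<open>Orthogonal projection of \<open>L\<^sup>2(\<Omega>)\<^bsup>1+N\<^esup>\<close> onto the graph of the gradient turns simple approximations of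
 \<open>(u, \<nabla>u)\<close> into simple approximations of \<open>u\<close> in \<open>H\<^sup>1(\<Omega>)\<close>.\<close>

lemma simple_H1_approx:
 assumes u: "u\<in>J.gdom"
 obtains p where "\<And>n::nat. p n\<in>simple_H1" "AE t in MT. nullseq (%n. W1.nr (p n t - u t))"
proof -
 define U where "U = (%k. case k of None=>u | Some i=>J.op u i)"
 have ju: "jrel u (J.op u)" by (rule J.op_rel[OF u])
 have UL: "U k\<in>LL" for k using ju by (auto simp: U_def jrel_def split: option.split)
 have "\<exists>s. (\<forall>n::nat. s n\<in>simple_L2)\<and>nullseq (%n. LL.nr (s n - U k))" for k
  by (rule simple_L2_dense[OF UL[of k]]) blast
 then obtain S where S: "\<And>k (n::nat). S k n\<in>simple_L2" "\<And>k. nullseq (%n. LL.nr (S k n - U k))" by metis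
 obtain \<rho> where \<rho>: "AE t in MT. \<forall>k\<in>UNIV. nullseq (%n. nrm (L2 \<Omega>) (S k (\<rho> n) t - U k t))"
  by (rule LL_tendsto_slices_family[of "UNIV :: 'n option set" S U]) (use S UL simple_L2_LL in auto)
 define p where "p = (%n t. \<Sum>k\<in>UNIV. repr k (S k (\<rho> n) t))"
 have Sx: "S k n t\<in>sqi MX" if "t\<in>{0<..<T}" for k n t using S(1)[of k n] that by (auto simp: simple_L2_def)
 have pW: "p n t\<in>W.gdom" if "t\<in>{0<..<T}" for n t
  unfolding p_def by (rule W1_sum_mem) (use repr(1)[OF Sx[OF that]] in auto)
 have ps: "p n\<in>simple_H1" for n
 proof -
  have "simple_function MT (%t. repr k (S k (\<rho> n) t))" for k
   using S(1)[of k "\<rho> n"] simple_function_compose1[of MT "S k (\<rho> n)" "repr k"] by (auto simp: simple_L2_def)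
  then have "simple_function MT (p n)" unfolding p_def by (intro simple_function_sum_fun) auto
  then show ?thesis using pW by (auto simp: simple_H1_def)
 qed
 have tT: "AE t in MT. t\<in>{0<..<T}" by (rule AE_I2) simp
 have "AE t in MT. wrel (u t) (%i. J.op u i t)" using ju by (simp add: jrel_def)
 then have "AE t in MT. nullseq (%n. W1.nr (p n t - u t))"
  using \<rho> tT
 proof eventually_elim
  case (elim t)
  have uW: "u t\<in>W.gdom" using elim(1) by (rule W.gdomI)
  have Ux: "U k t\<in>sqi MX" for k
   using elim(1) by (auto simp: U_def wrel_def split: option.split)
  have Uv: "W.gip 1 1 (u t) v = (\<Sum>k\<in>UNIV. ipX (U k t) (part k v))" if v: "v\<in>W.gdom" for v
   unfolding W.gip_rel[OF elim(1) wrel_weak_gradient[OF v]] sum_option by (simp add: part_def U_def)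
  \<comment> \<open>Testing with the difference itself. The pair (u(t), grad u(t)) is projected to
    u(t), so only the L^2 errors of the approximations \<open>S\<close> remain.\<close>
  have est: "W1.nr (p n t - u t)\<le>(\<Sum>k\<in>UNIV. X.nr (S k (\<rho> n) t - U k t))" for n
  proof -
   let ?v = "p n t - u t" and ?d = "%k. S k (\<rho> n) t - U k t"
   have v: "?v\<in>W.gdom" by (rule W1.diff_mem[OF pW[OF elim(3)] uW])
   have dm: "?d k\<in>sqi MX" for k by (rule X.diff_mem[OF Sx[OF elim(3)] Ux])
   have "W.gip 1 1 (p n t) ?v = (\<Sum>k\<in>UNIV. ipX (S k (\<rho> n) t) (part k ?v))"
    unfolding p_def[of] using W1_sum_B[of UNIV "%k. repr k (S k (\<rho> n) t)" ?v] v repr[OF Sx[OF elim(3)]]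
    by (simp add: p_def)
   then have "W.gip 1 1 ?v ?v = (\<Sum>k\<in>UNIV. ipX (S k (\<rho> n) t) (part k ?v)) - (\<Sum>k\<in>UNIV. ipX (U k t) (part k ?v))"
    using W1.B_diff[OF pW[OF elim(3)] uW v] Uv[OF v] by simp
   also have "\<dots> = (\<Sum>k\<in>UNIV. ipX (?d k) (part k ?v))"
    unfolding X.B_diff[OF Sx[OF elim(3)] Ux part_sqi[OF v]] by (simp add: sum_subtractf)
   also have "\<dots>\<le>(\<Sum>k\<in>UNIV. X.nr (?d k) * W1.nr ?v)"
   proof (rule sum_mono)
    fix k
    have "ipX (?d k) (part k ?v)\<le>X.nr (?d k) * X.nr (part k ?v)"
     using X.cauchy_schwarz[OF dm[of k] part_sqi[OF v, of k]] by linarith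
    also have "\<dots>\<le>X.nr (?d k) * W1.nr ?v" by (intro mult_left_mono part_nr_le v X.nr_nonneg dm)
    finally show "ipX (?d k) (part k ?v)\<le>X.nr (?d k) * W1.nr ?v" .
   qed
   also have "\<dots> = (\<Sum>k\<in>UNIV. X.nr (?d k)) * W1.nr ?v" by (simp add: sum_distrib_right)
   finally have le: "W1.nr ?v * W1.nr ?v\<le>(\<Sum>k\<in>UNIV. X.nr (?d k)) * W1.nr ?v"
    using W1.nr_sq[OF v] by (simp add: power2_eq_square)
   show ?thesis
   proof (cases "W1.nr ?v = 0")
    case True
    then show ?thesis by (simp add: sum_nonneg X.nr_nonneg[OF dm])
   next
    case False
    then have "W1.nr ?v > 0" using W1.nr_nonneg[OF v] by linarith
    then show ?thesis using le by simp
   qed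
  qed
  show ?case
  proof (rule Lim_null_comparison[OF always_eventually[OF allI]])
   fix n show "norm (W1.nr (p n t - u t))\<le>(\<Sum>k\<in>UNIV. X.nr (S k (\<rho> n) t - U k t))"
    using est[of n] W1.nr_nonneg[OF W1.diff_mem[OF pW[OF elim(3)] uW], of n] by simp
  next
   have "(%n. \<Sum>k\<in>UNIV. X.nr (S k (\<rho> n) t - U k t)) \<longlonglongrightarrow> (\<Sum>k\<in>(UNIV :: 'n option set). 0)"
    by (rule tendsto_sum) (use elim(2) in \<open>simp add: nrm_L2_X\<close>)
   then show "nullseq (%n. \<Sum>k\<in>UNIV. X.nr (S k (\<rho> n) t - U k t))" by simp
  qed
 qed
 with ps that show ?thesis by blast
qed

lemma J_nrm_sq:
 assumes "u\<in>J.gdom"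
 shows "integrable MT (%t. (nrm (H1 \<Omega>) (u t))^2)" "(\<integral>t. (nrm (H1 \<Omega>) (u t))^2\<partial>MT) = J.gip 1 1 u u"
proof -
 note g = J_gip_slice[OF assms assms, of 1 1]
 have ae: "AE t in MT. (nrm (H1 \<Omega>) (u t))^2 = W.gip 1 1 (u t) (u t)"
  using J_slice[OF assms] by eventually_elim (simp add: nrm_H1_W1 W1.nr_sq)
 have m: "(%t. (nrm (H1 \<Omega>) (u t))^2)\<in>meas MT"
  by (rule leb_measurable_AE[OF IT borel_measurable_integrable[OF g(1)]])
   (use ae in \<open>eventually_elim, simp\<close>)
 show "integrable MT (%t. (nrm (H1 \<Omega>) (u t))^2)" by (rule integrable_AE_eqI[OF g(1) ae m])
 show "(\<integral>t. (nrm (H1 \<Omega>) (u t))^2\<partial>MT) = J.gip 1 1 u u"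
  unfolding g(2) by (rule integral_cong_AE[OF m borel_measurable_integrable[OF g(1)] ae])
qed

lemma elems_L2H1: "elems (L2H1 T \<Omega>) = J.gdom"
proof (intro set_eqI iffI)
 fix u assume u: "u\<in>J.gdom"
 obtain p where p: "\<And>n::nat. p n\<in>simple_H1" "AE t in MT. nullseq (%n. W1.nr (p n t - u t))"
  by (rule simple_H1_approx[OF u]) (rule that)
 have tT: "AE t in MT. t\<in>{0<..<T}" by (rule AE_I2) simp
 have "AE t in MT. nullseq (%k. nrm (H1 \<Omega>) (u t - p k t))"
  using p(2) J_slice[OF u] tT
 proof eventually_elim
  case (elim t)
  have pW: "p k t\<in>W.gdom" for k using p(1)[of k] elim(3) by (auto simp: simple_H1_def)
  have "nrm (H1 \<Omega>) (u t - p k t) = W1.nr (p k t - u t)" for k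
   using nrm_H1_W1[OF W1.diff_mem[OF elim(2) pW]] W1.nr_diff_commute[OF elim(2) pW] by simp
  then show ?case using elim(1) by simp
 qed
 then have "strongly_measurable T (H1 \<Omega>) u"
  unfolding strongly_measurable_def elems_H1 using J_slice[OF u] p(1) by (auto simp: simple_H1_def)
 then show "u\<in>elems (L2H1 T \<Omega>)"
  using J_nrm_sq(1)[OF u] sqi_meas[OF LL_D[OF J.gdom_V[OF u]]]
  by (simp add: L2_fun_def L2_time_def jointly_measurable_def cylinder_def)
qed (rule L2H1_subset_J)

lemma nrm_L2H1: "u\<in>J.gdom ==> nrm (L2H1 T \<Omega>) u = J1.nr u"
 by (simp add: L2_fun_def L2_time_def J_nrm_sq(2) J1.nr_def)

lemma test_tensor_J:
 assumes th: "\<theta>\<in>DT" and p: "\<phi>\<in>DX"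
 shows "(%t x. \<theta> t * \<phi> x)\<in>J.gdom"
proof (rule J.gdomI)
 show "jrel (%t x. \<theta> t * \<phi> x) (%i t x. \<theta> t * frechet_derivative \<phi> (at x) (axis i 1))"
  unfolding jrel_def
 proof (intro conjI allI AE_I2 LL_test_tensor th test_sqi_MX test_deriv p)
  fix t
  have "wrel (\<theta> t *\<^sub>R \<phi>) (%i. \<theta> t *\<^sub>R (%x. frechet_derivative \<phi> (at x) (axis i 1)))"
   by (rule W.rel_scale[OF test_wrel[OF p]])
  then show "wrel (%x. \<theta> t * \<phi> x) (%i x. \<theta> t * frechet_derivative \<phi> (at x) (axis i 1))"
   by (simp add: scaleR_fun_def)
 qed
qed

end

section \<open>The elliptic equation with time as a parameter, its solution operator and the density
  of its range\<close>

section \<open>The elliptic equation\<close>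

context bounded_cylinder
begin

end

locale elliptic = bounded_cylinder T \<Omega> for T and \<Omega> :: "(real^'n) set" +
 fixes \<alpha> \<beta> :: real
 assumes \<alpha>_pos: "\<alpha> > 0" and \<beta>_pos: "\<beta> > 0"
begin

sublocale WA: semi_hilbert W.gdom "W.gip \<alpha> \<beta>" by (rule W.gip_semi_hilbert[OF \<alpha>_pos \<beta>_pos])
sublocale JA: semi_hilbert J.gdom "J.gip \<alpha> \<beta>" by (rule J.gip_semi_hilbert[OF \<alpha>_pos \<beta>_pos])

abbreviation "ipA \<equiv> W.gip \<alpha> \<beta>"
abbreviation "ipE \<equiv> J.gip \<alpha> \<beta>"

text \<open>\<open>ell \<phi> g\<close> expresses -\<alpha> Laplace \<phi> + \<beta> \<phi> = g on
  almost every slice. It is a relation because \<phi> is determined only up to null sets.\<close>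

definition ell :: "'n evol=>'n evol=>bool" where
 "ell \<phi> g \<longleftrightarrow> \<phi>\<in>J.gdom\<and>g\<in>LL\<and>(AE t in MT. \<forall>v\<in>W.gdom. ipA (\<phi> t) v = ipX (g t) v)"

lemma ell_J: "ell \<phi> g ==> \<phi>\<in>J.gdom" and ell_LL: "ell \<phi> g ==> g\<in>LL" by (auto simp: ell_def)

lemma ell_LL': "ell \<phi> g ==> \<phi>\<in>LL" using ell_J J.gdom_V by blast

lemma ell_test:
 assumes e: "ell \<phi> g" and p: "\<psi>\<in>J.gdom"
 shows "ipE \<phi> \<psi> = lip g \<psi>"
proof -
 note i = J_gip_slice[OF ell_J[OF e] p, of \<alpha> \<beta>] and l = lip_iterated[OF ell_LL[OF e] J.gdom_V[OF p]]
 have "AE t in MT. \<forall>v\<in>W.gdom. ipA (\<phi> t) v = ipX (g t) v" using e by (simp add: ell_def)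
 then have "AE t in MT. ipA (\<phi> t) (\<psi> t) = ipX (g t) (\<psi> t)"
  using J_slice[OF p] by eventually_elim blast
 then show ?thesis
  unfolding i(2) l(1) by (intro integral_cong_AE borel_measurable_integrable i(1) l(2))
qed

lemma ell_add:
 assumes e: "ell \<phi> g" "ell \<psi> h"
 shows "ell (\<phi> + \<psi>) (g + h)"
proof -
 have "AE t in MT. \<forall>v\<in>W.gdom. ipA (\<phi> t) v = ipX (g t) v"
  "AE t in MT. \<forall>v\<in>W.gdom. ipA (\<psi> t) v = ipX (h t) v" using e by (auto simp: ell_def)
 then have "AE t in MT. \<forall>v\<in>W.gdom. ipA ((\<phi> + \<psi>) t) v = ipX ((g + h) t) v"
  using J_slice[OF ell_J[OF e(1)]] J_slice[OF ell_J[OF e(2)]] LL_slice[OF ell_LL[OF e(1)]] LL_slice[OF ell_LL[OF e(2)]]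
 proof eventually_elim
  case (elim t)
  show ?case
  proof
   fix v assume v: "v\<in>W.gdom"
   have "ipA (\<phi> t + \<psi> t) v = ipX (g t) v + ipX (h t) v"
    using WA.B_add[OF elim(3,4) v] elim(1,2) v by simp
   also have "\<dots> = ipX (g t + h t) v" using X.B_add[OF elim(5,6) W.gdom_V[OF v]] by simp
   finally show "ipA ((\<phi> + \<psi>) t) v = ipX ((g + h) t) v" by simp
  qed
 qed
 then show ?thesis using e by (auto simp: ell_def intro: JA.add_mem LL.add_mem)
qed

text \<open>Time is only a parameter in the elliptic equation. Constant multipliers give
  homogeneity, exponential ones the weighted estimates.\<close>

lemma ell_time_mult:
 assumes th: "\<theta>\<in>meas MT" and b: "\<And>t. t\<in>{0<..<T} ==> \<bar>\<theta> t\<bar>\<le>C" and e: "ell \<phi> g"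
 shows "ell (%t x. \<theta> t * \<phi> t x) (%t x. \<theta> t * g t x)"
proof -
 have "AE t in MT. \<forall>v\<in>W.gdom. ipA (\<phi> t) v = ipX (g t) v" using e by (auto simp: ell_def)
 then have "AE t in MT. \<forall>v\<in>W.gdom. ipA (%x. \<theta> t * \<phi> t x) v = ipX (%x. \<theta> t * g t x) v"
  using J_slice[OF ell_J[OF e]] LL_slice[OF ell_LL[OF e]]
 proof eventually_elim
  case (elim t)
  show ?case
  proof
   fix v assume v: "v\<in>W.gdom"
   have "ipA (\<theta> t *\<^sub>R \<phi> t) v = ipX (\<theta> t *\<^sub>R g t) v"
    using WA.B_scale[OF elim(2) v] X.B_scale[OF elim(3) W.gdom_V[OF v]] elim(1) v by simp
   then show "ipA (%x. \<theta> t * \<phi> t x) v = ipX (%x. \<theta> t * g t x) v" by (simp add: scaleR_fun_def)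
  qed
 qed
 then show ?thesis using e J_time_mult[OF th b] LL_time_mult[OF th b] by (auto simp: ell_def)
qed

lemma ell_scale: "ell \<phi> g ==> ell (c *\<^sub>R \<phi>) (c *\<^sub>R g)"
 using ell_time_mult[of "%_. c" "\<bar>c\<bar>" \<phi> g] by (simp add: scaleR_fun_def)

lemma ell_diff: "ell \<phi> g ==> ell \<psi> h ==> ell (\<phi> - \<psi>) (g - h)"
 using ell_add[OF _ ell_scale, of \<phi> g \<psi> h "-1"] by simp

lemma ell_zero: "ell 0 0"
proof -
 have "AE t in MT. \<forall>v\<in>W.gdom. ipA ((0 :: real=>real^'n=>real) t) v = ipX ((0 :: real=>real^'n=>real) t) v"
  using WA.B_zero by (intro AE_I2) simp
 then show ?thesis by (simp add: ell_def JA.zero_mem LL.zero_mem)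
qed

lemma LL_nr_le_JA: "u\<in>J.gdom ==> \<beta> * (LL.nr u)^2\<le>(JA.nr u)^2"
 using J.gip_bounds(1)[OF \<alpha>_pos \<beta>_pos J.op_rel] by (simp add: JA.nr_sq LL.nr_sq J.gdom_V)

text \<open>The equation tested with \<phi>; the energy norm dominates sqrt \<beta> times the L^2
  norm.\<close>

lemma ell_bound:
 assumes e: "ell \<phi> g"
 shows "\<beta> * LL.nr \<phi>\<le>LL.nr g" "sqrt \<beta> * JA.nr \<phi>\<le>LL.nr g"
proof -
 have p: "LL.nr \<phi>\<ge>0" "LL.nr g\<ge>0" "JA.nr \<phi>\<ge>0"
  by (intro LL.nr_nonneg JA.nr_nonneg ell_LL'[OF e] ell_LL[OF e] ell_J[OF e])+
 have s: "(JA.nr \<phi>)^2\<le>LL.nr g * LL.nr \<phi>"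
  using ell_test[OF e ell_J[OF e]] LL.cauchy_schwarz[OF ell_LL[OF e] ell_LL'[OF e]] by (simp add: JA.nr_sq[OF ell_J[OF e]])
 have b: "\<beta> * (LL.nr \<phi>)^2\<le>(JA.nr \<phi>)^2" by (rule LL_nr_le_JA[OF ell_J[OF e]])
 show 1: "\<beta> * LL.nr \<phi>\<le>LL.nr g"
 proof (cases "LL.nr \<phi> = 0")
  case False
  then have pos: "LL.nr \<phi> > 0" using p by simp
  have "(\<beta> * LL.nr \<phi>) * LL.nr \<phi>\<le>LL.nr g * LL.nr \<phi>" using s b by (simp add: power2_eq_square mult.assoc)
  then show ?thesis using pos by simp
 qed (use p in simp)
 have "(sqrt \<beta> * JA.nr \<phi>)^2 = \<beta> * (JA.nr \<phi>)^2" using \<beta>_pos by (simp add: power_mult_distrib)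
 also have "\<dots>\<le>\<beta> * (LL.nr g * LL.nr \<phi>)" using s \<beta>_pos by simp
 also have "\<dots> = LL.nr g * (\<beta> * LL.nr \<phi>)" by simp
 also have "\<dots>\<le>LL.nr g * LL.nr g" using 1 p by (intro mult_left_mono) auto
 finally have "(sqrt \<beta> * JA.nr \<phi>)^2\<le>(LL.nr g)^2" by (simp add: power2_eq_square)
 then show "sqrt \<beta> * JA.nr \<phi>\<le>LL.nr g" by (rule power2_le_imp_le) (rule p)
qed

lemma ell_unique:
 assumes "ell \<phi> g" "ell \<psi> h" "LL.nr (g - h) = 0"
 shows "LL.nr (\<phi> - \<psi>) = 0" "JA.nr (\<phi> - \<psi>) = 0"
proof -
 have e: "ell (\<phi> - \<psi>) (g - h)" by (rule ell_diff[OF assms(1,2)])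
 have n: "LL.nr (\<phi> - \<psi>)\<ge>0" "JA.nr (\<phi> - \<psi>)\<ge>0"
  by (intro LL.nr_nonneg JA.nr_nonneg ell_LL'[OF e] ell_J[OF e])+
 show "LL.nr (\<phi> - \<psi>) = 0" "JA.nr (\<phi> - \<psi>) = 0"
  using ell_bound[OF e] assms(3) \<beta>_pos n by (simp_all add: mult_le_0_iff)
qed

text \<open>Self-adjointness of the solution operator, from the symmetry of the elliptic
  form.\<close>

lemma ell_sym:
 assumes "ell \<phi> g" "ell \<psi> h"
 shows "lip g \<psi> = lip h \<phi>"
 using ell_test[OF assms(1) ell_J[OF assms(2)]] ell_test[OF assms(2) ell_J[OF assms(1)]]
  JA.B_sym[OF ell_J[OF assms(1)] ell_J[OF assms(2)]] by simp

lemma J1_le_JA: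
 assumes "u\<in>J.gdom"
 shows "min \<alpha> \<beta> * (J1.nr u)^2\<le>(JA.nr u)^2" "(JA.nr u)^2\<le>max \<alpha> \<beta> * (J1.nr u)^2"
proof -
 let ?s = "\<Sum>i\<in>UNIV. lip (J.op u i) (J.op u i)" and ?t = "lip u u"
 have s: "?s\<ge>0" using J.rel_mem(2)[OF J.op_rel[OF assms]] by (intro sum_nonneg LL.B_pos) auto
 have t: "?t\<ge>0" by (rule LL.B_pos[OF J.gdom_V[OF assms]])
 have "min \<alpha> \<beta> * ?s\<le>\<alpha> * ?s" "min \<alpha> \<beta> * ?t\<le>\<beta> * ?t" "\<alpha> * ?s\<le>max \<alpha> \<beta> * ?s" "\<beta> * ?t\<le>max \<alpha> \<beta> * ?t"
  using s t by (intro mult_right_mono; simp)+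
 then show "min \<alpha> \<beta> * (J1.nr u)^2\<le>(JA.nr u)^2" "(JA.nr u)^2\<le>max \<alpha> \<beta> * (J1.nr u)^2"
  unfolding J1.nr_sq[OF assms] JA.nr_sq[OF assms] J.gip_def by (simp_all add: distrib_left)
qed

lemma J1_JA_const:
 obtains C where "C > 0" "\<And>u. u\<in>J.gdom ==> J1.nr u\<le>C * JA.nr u" "\<And>u. u\<in>J.gdom ==> JA.nr u\<le>C * J1.nr u"
proof -
 define C where "C = max (1 / sqrt (min \<alpha> \<beta>)) (sqrt (max \<alpha> \<beta>))"
 have m: "min \<alpha> \<beta> > 0" "max \<alpha> \<beta> > 0" using \<alpha>_pos \<beta>_pos by auto
 have C: "C > 0" unfolding C_def using m by (simp add: less_max_iff_disj)
 have A: "J1.nr u\<le>C * JA.nr u" if u: "u\<in>J.gdom" for u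
 proof -
  have "(sqrt (min \<alpha> \<beta>) * J1.nr u)^2\<le>(JA.nr u)^2" using J1_le_JA(1)[OF u] m by (simp add: power_mult_distrib)
  then have "sqrt (min \<alpha> \<beta>) * J1.nr u\<le>JA.nr u" by (rule power2_le_imp_le) (rule JA.nr_nonneg[OF u])
  then have "J1.nr u\<le>(1 / sqrt (min \<alpha> \<beta>)) * JA.nr u" using m by (simp add: field_simps)
  also have "\<dots>\<le>C * JA.nr u" unfolding C_def by (intro mult_right_mono JA.nr_nonneg u) simp
  finally show ?thesis .
 qed
 have B: "JA.nr u\<le>C * J1.nr u" if u: "u\<in>J.gdom" for u
 proof -
  have "(JA.nr u)^2\<le>(sqrt (max \<alpha> \<beta>) * J1.nr u)^2" using J1_le_JA(2)[OF u] m by (simp add: power_mult_distrib)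
  then have "JA.nr u\<le>sqrt (max \<alpha> \<beta>) * J1.nr u"
   by (rule power2_le_imp_le) (use J1.nr_nonneg[OF u] m in simp)
  also have "\<dots>\<le>C * J1.nr u" unfolding C_def by (intro mult_right_mono J1.nr_nonneg u) simp
  finally show ?thesis .
 qed
 show ?thesis using that C A B by blast
qed

lemma elliptic_point:
 assumes b: "b\<in>sqi MX"
 shows "\<exists>p\<in>W.gdom. \<forall>v\<in>W.gdom. ipA p v = ipX b v"
proof -
 obtain p where "p\<in>W.gdom" "\<And>v. v\<in>W.gdom ==> ipA p v = ipX b v"
 proof (rule WA.riesz_functional[of "%v. ipX b v" "X.nr b / sqrt \<beta>"])
  show "ipX b (u + v) = ipX b u + ipX b v" if "u\<in>W.gdom" "v\<in>W.gdom" for u v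
   by (rule X.B_add_right[OF W.gdom_V[OF that(1)] W.gdom_V[OF that(2)] b])
  show "ipX b (c *\<^sub>R u) = c * ipX b u" if "u\<in>W.gdom" for c u
   by (rule X.B_scale_right[OF W.gdom_V[OF that] b])
  show "\<bar>ipX b u\<bar>\<le>X.nr b / sqrt \<beta> * WA.nr u" if u: "u\<in>W.gdom" for u
  proof -
   have "sqrt \<beta> * X.nr u\<le>WA.nr u"
    using W.gip_bounds(1)[OF \<alpha>_pos \<beta>_pos W.op_rel[OF u]] unfolding X.nr_def WA.nr_def real_sqrt_mult[symmetric]
    by (rule real_sqrt_le_mono)
   then have "X.nr u\<le>WA.nr u / sqrt \<beta>" using \<beta>_pos by (simp add: field_simps)
   then have "X.nr b * X.nr u\<le>X.nr b * (WA.nr u / sqrt \<beta>)" by (intro mult_left_mono X.nr_nonneg b)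
   then show ?thesis using X.cauchy_schwarz[OF b W.gdom_V[OF u]] by (simp add: mult.commute)
  qed
 qed (rule that)
 then show ?thesis by blast
qed

text \<open>Solving value by value keeps a function simple, which settles measurability in
  time.\<close>

lemma ell_simple:
 assumes s: "s\<in>simple_L2"
 shows "\<exists>\<phi>. ell \<phi> s"
proof -
 have "\<forall>b\<in>sqi MX. \<exists>p. p\<in>W.gdom\<and>(\<forall>v\<in>W.gdom. ipA p v = ipX b v)"
  using elliptic_point by blast
 from bchoice[OF this] obtain A where
  A0: "\<forall>b\<in>sqi MX. A b\<in>W.gdom\<and>(\<forall>v\<in>W.gdom. ipA (A b) v = ipX b v)" by blast
 then have A: "A b\<in>W.gdom" "v\<in>W.gdom ==> ipA (A b) v = ipX b v" if "b\<in>sqi MX" for b v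
  using that by blast+
 have sx: "s t\<in>sqi MX" if "t\<in>{0<..<T}" for t using s that by (auto simp: simple_L2_def)
 have "simple_function MT (%t. A (s t))"
  using s simple_function_compose1[of MT s A] by (auto simp: simple_L2_def)
 then have "(%t. A (s t))\<in>simple_H1" using A(1) sx by (auto simp: simple_H1_def)
 then have "(%t. A (s t))\<in>J.gdom" by (rule simple_H1_J)
 moreover have "AE t in MT. \<forall>v\<in>W.gdom. ipA (A (s t)) v = ipX (s t) v"
  by (rule AE_I2) (use A(2) sx in auto)
 ultimately show ?thesis using simple_L2_LL[OF s] by (auto simp: ell_def)
qed

text \<open>Solutions for simple right-hand sides converging to g are Cauchy in the energy norm by
  \<open>ell_bound\<close>; the equation passes to the limit on almost every slice along a
  subsequence.\<close>

lemma ell_exists: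
 assumes g: "g\<in>LL"
 obtains \<phi> where "ell \<phi> g"
proof -
 obtain s where s: "\<And>n::nat. s n\<in>simple_L2" "nullseq (%n. LL.nr (s n - g))"
  by (rule simple_L2_dense[OF g]) (rule that)
 have sL: "s n\<in>LL" for n by (rule simple_L2_LL[OF s(1)])
 have "\<forall>n. \<exists>\<phi>. ell \<phi> (s n)" using ell_simple[OF s(1)] by blast
 from choice[OF this] obtain \<phi> where e: "ell (\<phi> n) (s n)" for n by blast
 have sb: "sqrt \<beta> > 0" using \<beta>_pos by simp
 have "\<exists>u\<in>J.gdom. nullseq (%n. JA.nr (\<phi> n - u))"
 proof (rule JA.complete_nr[of \<phi>, OF ell_J[OF e]])
  fix r :: real assume r: "r > 0"
  have "\<forall>\<^sub>F n in sequentially. LL.nr (s n - g) < r * sqrt \<beta> / 2"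
   by (rule order_tendstoD(2)[OF s(2)]) (use r sb in simp)
  then obtain N where N: "\<And>n. n\<ge>N ==> LL.nr (s n - g) < r * sqrt \<beta> / 2" by (auto simp: eventually_sequentially)
  show "\<exists>N. \<forall>m\<ge>N. \<forall>n\<ge>N. JA.nr (\<phi> m - \<phi> n) < r"
  proof (intro exI allI impI)
   fix m n assume mn: "m\<ge>N" "n\<ge>N"
   have "sqrt \<beta> * JA.nr (\<phi> m - \<phi> n)\<le>LL.nr (s m - s n)" by (rule ell_bound(2)[OF ell_diff[OF e e]])
   also have "\<dots>\<le>LL.nr (s m - g) + LL.nr (g - s n)" by (rule LL.nr_diff_triangle[OF sL g sL])
   also have "\<dots> < r * sqrt \<beta>" using N[OF mn(1)] N[OF mn(2)] LL.nr_diff_commute[OF g sL[of n]] by linarith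
   finally show "JA.nr (\<phi> m - \<phi> n) < r" using sb by (simp add: mult.commute)
  qed
 qed
 then obtain u where u: "u\<in>J.gdom" "nullseq (%n. JA.nr (\<phi> n - u))" by blast
 have du: "\<phi> n - u\<in>J.gdom" for n by (rule JA.diff_mem[OF ell_J[OF e] u(1)])
 have ds: "s n - g\<in>LL" for n by (rule LL.diff_mem[OF sL g])
 \<comment> \<open>Both slice errors in one integrable function, so that one subsequence serves the
   solutions and the right-hand sides.\<close>
 let ?h = "%n t. ipA ((\<phi> n - u) t) ((\<phi> n - u) t) + (X.nr ((s n - g) t))^2"
 have hi: "integrable MT (?h n)" for n
  by (intro Bochner_Integration.integrable_add J_gip_slice(1)[OF du du] slice_integrable[OF ds])
 have hI: "(\<integral>t. ?h n t\<partial>MT) = (JA.nr (\<phi> n - u))^2 + (LL.nr (s n - g))^2" for n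
  using J_gip_slice[OF du du, of \<alpha> \<beta> n n] slice_integrable[OF ds, of n]
  by (simp add: JA.nr_sq[OF du] LL.nr_sq[OF ds] lip_self[OF ds])
 have hn: "AE t in MT. ?h n t\<ge>0" for n
  using J_slice[OF du[of n]] by eventually_elim (intro add_nonneg_nonneg WA.B_pos, auto)
 have "nullseq (%n. \<integral>t. norm (?h n t)\<partial>MT)"
 proof -
  have "(\<integral>t. norm (?h n t)\<partial>MT) = (JA.nr (\<phi> n - u))^2 + (LL.nr (s n - g))^2" for n
   unfolding hI[symmetric]
   by (rule integral_cong_AE) (use hn[of n] hi[of n] in \<open>auto elim!: eventually_mono\<close>)
  moreover have "(%n. (JA.nr (\<phi> n - u))^2 + (LL.nr (s n - g))^2) \<longlonglongrightarrow> 0\<^sup>2 + 0\<^sup>2"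
   by (intro tendsto_add tendsto_power u s)
  ultimately show ?thesis by simp
 qed
 from tendsto_L1_AE_subseq[OF hi this]
 obtain r :: "nat=>nat" where r: "AE t in MT. nullseq (%n. ?h (r n) t)" by auto
 have "AE t in MT. \<forall>n. \<forall>v\<in>W.gdom. ipA (\<phi> n t) v = ipX (s n t) v"
  unfolding AE_all_countable using e by (simp add: ell_def)
 moreover have "AE t in MT. \<forall>n. \<phi> n t\<in>W.gdom" "AE t in MT. \<forall>n. s n t\<in>sqi MX"
  unfolding AE_all_countable using J_slice[OF ell_J[OF e]] LL_slice[OF sL] by auto
 ultimately have "AE t in MT. \<forall>v\<in>W.gdom. ipA (u t) v = ipX (g t) v"
  using r J_slice[OF u(1)] LL_slice[OF g]
 proof eventually_elim
  case (elim t)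
  have p: "ipA (\<phi> (r n) t - u t) (\<phi> (r n) t - u t) = (WA.nr (\<phi> (r n) t - u t))^2" for n
   using WA.nr_sq[OF WA.diff_mem[OF elim(2)[rule_format] elim(5)]] by simp
  have l: "nullseq (%n. (WA.nr (\<phi> (r n) t - u t))^2 + (X.nr (s (r n) t - g t))^2)"
   using elim(4) by (simp add: p)
  have "nullseq (%n. (WA.nr (\<phi> (r n) t - u t))^2)" "nullseq (%n. (X.nr (s (r n) t - g t))^2)"
   by (rule Lim_null_comparison[OF always_eventually[OF allI] l], simp)+
  from this[THEN tendsto_real_sqrt]
  have l1: "nullseq (%n. WA.nr (\<phi> (r n) t - u t))" and l2: "nullseq (%n. X.nr (s (r n) t - g t))"
   by (simp_all add: WA.nr_nonneg[OF WA.diff_mem[OF elim(2)[rule_format] elim(5)]]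
     X.nr_nonneg[OF X.diff_mem[OF elim(3)[rule_format] elim(6)]])
  show ?case
  proof
   fix v assume v: "v\<in>W.gdom"
   have "(%n. ipA (\<phi> (r n) t) v) \<longlonglongrightarrow> ipA (u t) v"
    by (rule WA.B_tendsto[OF elim(2)[rule_format] elim(5) v l1])
   moreover have "(%n. ipX (s (r n) t) v) \<longlonglongrightarrow> ipX (g t) v"
    by (rule X.B_tendsto[OF elim(3)[rule_format] elim(6) W.gdom_V[OF v] l2])
   ultimately show "ipA (u t) v = ipX (g t) v" using elim(1) v by (simp add: LIMSEQ_unique)
  qed
 qed
 then have "ell u g" using u(1) g by (simp add: ell_def)
 then show ?thesis by (rule that)
qed

text \<open>Write A for the solution operator. If v is orthogonal to its range, then 0 = (v, A(A v))
  = (A v, A v) by symmetry. Hence A v = 0 in L^2, then in the energy norm, and testing the equation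
  for A v with tensor products of test functions gives v = 0.\<close>

lemma ell_range_dense:
 assumes u: "u\<in>LL"
 obtains s where "\<And>n::nat. \<exists>g. ell (s n) g" "nullseq (%n. LL.nr (s n - u))"
proof (rule LL.dense_subspace[of "{\<phi>. \<exists>g. ell \<phi> g}" u])
 fix v assume v: "v\<in>LL" and orth: "\<And>d. d\<in>{\<phi>. \<exists>g. ell \<phi> g} ==> lip v d = 0"
 obtain \<psi> where p: "ell \<psi> v" by (rule ell_exists[OF v])
 obtain \<zeta> where c: "ell \<zeta> \<psi>" by (rule ell_exists[OF ell_LL'[OF p]])
 have "lip v \<zeta> = 0" by (rule orth) (use c in blast)
 then have "lip \<psi> \<psi> = 0" using ell_sym[OF p c] by simp
 then have n0: "LL.nr \<psi> = 0" by (simp add: LL.nr_def)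
 have "ipE \<psi> \<psi> = 0"
  using ell_test[OF p ell_J[OF p]] LL.cauchy_schwarz[OF v ell_LL'[OF p]] n0 by simp
 then have nJ: "JA.nr \<psi> = 0" by (simp add: JA.nr_def)
 show "LL.nr v = 0"
 proof (rule LL_eqI_test[OF v])
  fix \<theta> \<phi> assume t: "\<theta>\<in>DT" "\<phi>\<in>DX"
  have J: "(%t x. \<theta> t * \<phi> x)\<in>J.gdom" by (rule test_tensor_J[OF t])
  show "lip v (%t x. \<theta> t * \<phi> x) = 0"
   using ell_test[OF p J] JA.cauchy_schwarz[OF ell_J[OF p] J] nJ by simp
 qed
qed (use u ell_zero ell_add ell_scale ell_LL' that in blast)+

end

section \<open>Primitives in time and exponentially weighted norms\<close>

section \<open>Integration in time\<close>

lemma AE_leb_snd: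
 fixes A :: "'a::euclidean_space set" and B :: "'b::euclidean_space set"
 assumes A: "A\<in>sets borel" and B: "B\<in>sets borel" and P: "AE y in leb B. P y"
 shows "AE p in leb (A\<times>B). P (snd p)"
proof -
 have AB: "A\<times>B\<in>sets borel" using A B by (simp add: borel_Times)
 have "AE x in lborel. x\<in>B\<longrightarrow>P x" using P unfolding AE_leb_iff[OF B] .
 then obtain N where N: "N\<in>null_sets lborel" "{x\<in>space lborel. \<not> (x\<in>B\<longrightarrow>P x)}\<subseteq>N"
  by (auto simp: eventually_ae_filter)
 have "(UNIV :: 'a set)\<times>N\<in>null_sets (lborel \<Otimes>\<^sub>M lborel)"
  using N(1) by (intro null_setsI) (auto simp: lborel.emeasure_pair_measure_Times null_sets_def)
 then have "AE p in lborel \<Otimes>\<^sub>M lborel. p\<in>A\<times>B\<longrightarrow>P (snd p)"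
  by (rule AE_I') (use N in \<open>auto\<close>)
 then show ?thesis unfolding AE_leb_iff[OF AB] lborel_prod .
qed

lemma integrable_leb_snd:
 fixes A :: "'a::euclidean_space set" and B :: "'b::euclidean_space set" and d :: "_=>real"
 assumes A: "A\<in>sets borel" and B: "B\<in>sets borel" and fin: "finite_measure (leb A)"
  and d: "integrable (leb B) d"
 shows "integrable (leb (A\<times>B)) (%p. d (snd p))"
proof (rule integrableI_bounded)
 show m: "(%p. d (snd p))\<in>meas (leb (A\<times>B))"
  by (rule leb_measurable_snd[OF A B borel_measurable_integrable[OF d]])
 have "(\<integral>\<^sup>+p. ennreal (norm (d (snd p)))\<partial>leb (A\<times>B))
   = (\<integral>\<^sup>+x. \<integral>\<^sup>+y. ennreal (norm (d y))\<partial>leb B\<partial>leb A)"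
  using m by (intro nn_integral_leb_Times(1)[OF A B, of "%x y. norm (d y)"]) (auto simp: case_prod_unfold)
 also have "\<dots> = (\<integral>\<^sup>+y. ennreal (norm (d y))\<partial>leb B) * emeasure (leb A) (space (leb A))"
  by (simp del: space_restrict_space)
 also have "\<dots> < \<infinity>"
  using finite_measure.emeasure_finite[OF fin] d unfolding integrable_iff_bounded
  by (simp add: ennreal_mult_less_top top.not_eq_extremum del: space_restrict_space)
 finally show "(\<integral>\<^sup>+p. ennreal (norm (d (snd p)))\<partial>leb (A\<times>B)) < \<infinity>" .
qed

lemma square_norm_le: "(a::real)^2\<le>b ==> norm (a\<^sup>2)\<le>norm b"
 using abs_ge_self[of b] by simp

context bounded_cylinder
begin

subsection \<open>Integrals over sets of times\<close>

text \<open>Arbitrary Borel sets of times allow one estimate to cover \<open>{..<t}\<close>,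
  \<open>{s..<t}\<close> and \<open>UNIV\<close>.\<close>

definition aint :: "real set=>'n evol=>real^'n=>real" where
 "aint A z x = (\<integral>s. indicator A s * z s x\<partial>MT)"

definition vint :: "'n evol=>real=>real^'n=>real" where
 "vint z t = aint {..<t} z"

lemma ind_meas: "A\<in>sets borel ==> (indicator A :: real=>real)\<in>meas MT"
 by (intro leb_measurableI) auto

lemma ind_sqi: "A\<in>sets borel ==> (indicator A :: real=>real)\<in>sqi MT"
 by (rule sqi_bounded[OF sqi_const[OF fin_MT, of 1] ind_meas, of _ 1]) (auto simp: indicator_def)

lemma ind_LL: "A\<in>sets borel ==> z\<in>LL ==> (%t x. indicator A t * z t x)\<in>LL"
 by (rule LL_time_mult[OF ind_meas, of _ 1]) (auto simp: indicator_def)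

lemma LL_slice_x:
 assumes "u\<in>LL" shows "AE x in MX. (%t. u t x)\<in>sqi MT"
proof -
 have "AE x in MX. integrable MT (%t. u t x * u t x)"
  by (rule Fubini_leb(4)[OF IT OX LL_integrable[OF assms assms]])
 moreover have "AE x in MX. (%t. case_prod u (t, x))\<in>meas MT"
  by (rule leb_measurable_slice(2)[OF IT OX sqi_meas[OF LL_D[OF assms]]])
 ultimately show ?thesis by eventually_elim (simp add: sqi_def power2_eq_square)
qed

lemma aint_sq_le:
 assumes A: "A\<in>sets borel" and z: "z\<in>LL"
 shows "AE x in MX. (aint A z x)^2\<le>(\<integral>s. indicator A s\<partial>MT) * (\<integral>s. indicator A s * (z s x * z s x)\<partial>MT)"
 using LL_slice_x[OF z]
proof eventually_elim
 case (elim x)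
 interpret S: semi_inner "sqi MT" "%u v. \<integral>s. u s * v s\<partial>MT" by (rule semi_inner_sqi)
 let ?i = "indicator A :: real=>real"
 have m: "(%s. ?i s * z s x)\<in>sqi MT"
 proof (rule sqi_bounded[OF elim, of _ 1])
  show "(%s. ?i s * z s x)\<in>meas MT" by (intro borel_measurable_times ind_meas A sqi_meas[OF elim])
 qed (auto simp: indicator_def)
 have i: "?i s * ?i s = ?i s" "?i s * (?i s * c) = ?i s * c" "(?i s * c) * (?i s * c) = ?i s * (c * c)" for s c
  by (auto simp: indicator_def)
 have "(\<integral>s. ?i s * (?i s * z s x)\<partial>MT)^2\<le>(\<integral>s. ?i s * ?i s\<partial>MT) * (\<integral>s. (?i s * z s x) * (?i s * z s x)\<partial>MT)"
  by (rule S.cauchy_schwarz_sq[OF ind_sqi[OF A] m])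
 then show ?case unfolding i aint_def .
qed

lemma aint_int:
 assumes A: "A\<in>sets borel" and z: "z\<in>LL"
 shows "integrable MX (%x. \<integral>s. indicator A s * (z s x * z s x)\<partial>MT)"
  "(\<integral>x. \<integral>s. indicator A s * (z s x * z s x)\<partial>MT\<partial>MX) = (\<integral>s. indicator A s * (X.nr (z s))^2\<partial>MT)"
proof -
 let ?f = "%s x. (indicator A s * z s x) * z s x"
 have i: "integrable MC (case_prod ?f)"
  using LL_integrable[OF ind_LL[OF A z] z] by simp
 note F = Fubini_leb[OF IT OX i]
 show "integrable MX (%x. \<integral>s. indicator A s * (z s x * z s x)\<partial>MT)" using F(5) by (simp add: mult.assoc)
 have "(\<integral>x. \<integral>s. indicator A s * (z s x * z s x)\<partial>MT\<partial>MX) = (\<integral>s. \<integral>x. ?f s x\<partial>MX\<partial>MT)"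
  using F(3,6) by (simp add: mult.assoc)
 also have "\<dots> = (\<integral>s. indicator A s * (X.nr (z s))^2\<partial>MT)"
  by (simp add: mult.assoc X.nr_def integral_nonneg_AE)
 finally show "(\<integral>x. \<integral>s. indicator A s * (z s x * z s x)\<partial>MT\<partial>MX) = (\<integral>s. indicator A s * (X.nr (z s))^2\<partial>MT)" .
qed

lemma aint_sqi:
 assumes A: "A\<in>sets borel" and z: "z\<in>LL"
 shows "aint A z\<in>sqi MX"
  and "(X.nr (aint A z))^2\<le>(\<integral>s. indicator A s\<partial>MT) * (\<integral>s. indicator A s * (X.nr (z s))^2\<partial>MT)"
proof -
 have "integrable MC (case_prod (%s x. indicator A s * z s x))"
  by (rule sqi_integrable[OF fin_MC LL_D[OF ind_LL[OF A z]]])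
 from borel_measurable_integrable[OF Fubini_leb(5)[OF IT OX this]]
 have m: "aint A z\<in>meas MX" by (simp add: aint_def[abs_def])
 have i: "integrable MX (%x. (\<integral>s. indicator A s\<partial>MT) * (\<integral>s. indicator A s * (z s x * z s x)\<partial>MT))"
  by (intro integrable_mult_right aint_int(1) assms)
 have "integrable MX (%x. (aint A z x)^2)"
 proof (rule Bochner_Integration.integrable_bound[OF i])
  show "AE x in MX. norm ((aint A z x)^2)\<le>norm ((\<integral>s. indicator A s\<partial>MT) * (\<integral>s. indicator A s * (z s x * z s x)\<partial>MT))"
   using aint_sq_le[OF A z] by eventually_elim (rule square_norm_le)
 qed (use m in simp)
 then show s: "aint A z\<in>sqi MX" using m by (simp add: sqi_def)
 have "(X.nr (aint A z))^2 = (\<integral>x. (aint A z x)^2\<partial>MX)" using X.nr_sq[OF s] by (simp add: power2_eq_square)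
 also have "\<dots>\<le>(\<integral>x. (\<integral>s. indicator A s\<partial>MT) * (\<integral>s. indicator A s * (z s x * z s x)\<partial>MT)\<partial>MX)"
  by (rule integral_mono_AE[OF sqi_int[OF s] i aint_sq_le[OF A z]])
 also have "\<dots> = (\<integral>s. indicator A s\<partial>MT) * (\<integral>s. indicator A s * (X.nr (z s))^2\<partial>MT)"
  by (simp add: aint_int(2)[OF A z])
 finally show "(X.nr (aint A z))^2\<le>(\<integral>s. indicator A s\<partial>MT) * (\<integral>s. indicator A s * (X.nr (z s))^2\<partial>MT)" .
qed

lemma ind_slice_int: "A\<in>sets borel ==> z\<in>LL ==> integrable MT (%s. indicator A s * (X.nr (z s))^2)"
proof (rule Bochner_Integration.integrable_bound[OF slice_integrable[of z]])
 assume "A\<in>sets borel" "z\<in>LL"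
 then show "(%s. indicator A s * (X.nr (z s))^2)\<in>meas MT"
  by (intro borel_measurable_times ind_meas borel_measurable_integrable[OF slice_integrable])
qed (auto simp: indicator_def)

lemma ind_length:
 assumes "a\<le>b" shows "(\<integral>s. indicator {a..<b} s\<partial>MT)\<le>b - a"
proof -
 have "(\<integral>s. indicator {a..<b} s\<partial>MT) = (\<integral>s. indicator {0<..<T} s * indicator {a..<b} s\<partial>lborel :: real)"
  by (rule leb_integral_borel(2)[OF IT]) simp
 also have "\<dots>\<le>(\<integral>s. indicator {a..<b} s\<partial>lborel :: real)"
 proof (rule integral_mono)
  show "integrable lborel (indicator {a..<b} :: real=>real)"
   using assms by (intro integrable_real_indicator) auto
  show "integrable lborel (%s. indicator {0<..<T} s * indicator {a..<b} s :: real)"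
   by (rule Bochner_Integration.integrable_bound[of _ "indicator {a..<b} :: real=>real"])
    (use assms in \<open>auto simp: indicator_def intro!: integrable_real_indicator\<close>)
 qed (auto simp: indicator_def)
 also have "\<dots> = b - a" using assms by simp
 finally show ?thesis .
qed

lemma ind_le_T: "A\<in>sets borel ==> (\<integral>s. indicator A s\<partial>MT)\<le>T"
proof -
 assume A: "A\<in>sets borel"
 have "(\<integral>s. indicator A s\<partial>MT)\<le>(\<integral>s. indicator {0..<T} s\<partial>MT :: real)"
 proof (rule integral_mono_AE)
  show "integrable MT (indicator A :: real=>real)" "integrable MT (indicator {0..<T} :: real=>real)"
   by (intro sqi_integrable[OF fin_MT ind_sqi] A; simp)+
 qed (auto simp: indicator_def intro!: AE_I2)
 then show ?thesis using ind_length[of 0 T] T_pos by linarith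
qed

lemma aint_bound:
 assumes A: "A\<in>sets borel" and z: "z\<in>LL"
 shows "(X.nr (aint A z))^2\<le>T * (\<integral>s. indicator A s * (X.nr (z s))^2\<partial>MT)"
  and "(X.nr (aint A z))^2\<le>(\<integral>s. indicator A s\<partial>MT) * (LL.nr z)^2"
proof -
 have nn: "0\<le>(\<integral>s. indicator A s * (X.nr (z s))^2\<partial>MT)" by (intro integral_nonneg_AE AE_I2) simp
 show "(X.nr (aint A z))^2\<le>T * (\<integral>s. indicator A s * (X.nr (z s))^2\<partial>MT)"
  using aint_sqi(2)[OF A z] mult_right_mono[OF ind_le_T[OF A] nn] by linarith
 have "(\<integral>s. indicator A s * (X.nr (z s))^2\<partial>MT)\<le>(\<integral>s. (X.nr (z s))^2\<partial>MT)"
  by (rule integral_mono_AE[OF ind_slice_int[OF A z] slice_integrable[OF z]])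
   (auto simp: indicator_def intro!: AE_I2)
 then have "(\<integral>s. indicator A s * (X.nr (z s))^2\<partial>MT)\<le>(LL.nr z)^2" by (simp add: LL.nr_sq[OF z] lip_self[OF z])
 moreover have "0\<le>(\<integral>s. indicator A s\<partial>MT :: real)" by (intro integral_nonneg_AE AE_I2) simp
 ultimately show "(X.nr (aint A z))^2\<le>(\<integral>s. indicator A s\<partial>MT) * (LL.nr z)^2"
  using aint_sqi(2)[OF A z] by (meson mult_left_mono order_trans)
qed

text \<open>With a Borel representative the primitive is a parameter integral of a jointly Borel
  function; for almost every x the two primitives agree at all times.\<close>

lemma vint_measurable:
 assumes z: "z\<in>LL" shows "case_prod (vint z)\<in>meas MC"
proof -
 obtain z' where z': "z'\<in>meas borel" "AE p in MC. case_prod z p = z' p" "\<And>p. p\<notin>{0<..<T}\<times>\<Omega> ==> z' p = 0"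
  by (rule leb_borel_rep[OF CX sqi_meas[OF LL_D[OF z]]]) (rule that)
 have [measurable]: "z'\<in>meas (borel \<Otimes>\<^sub>M borel)" using z'(1) by (simp add: borel_prod)
 define w where "w = (%p. \<integral>s. (if s < fst p then z' (s, snd p) else 0)\<partial>lborel)"
 have "w\<in>meas (borel \<Otimes>\<^sub>M borel)" unfolding w_def by measurable
 then have wm: "w\<in>meas borel" by (simp add: borel_prod)
 have "AE p in MC. z (fst p) (snd p) = z' (fst p, snd p)" using z'(2) by eventually_elim (simp add: case_prod_unfold)
 from AE_leb_Times(2)[OF IT OX this]
 have "AE x in MX. \<forall>t. vint z t x = w (t, x)"
  using LL_slice_x[OF z] AE_space[of MX]
 proof eventually_elim
  case (elim x)
  show ?case
  proof
   fix t
   have m: "(%s. (if s < t then z' (s, x) else 0))\<in>meas borel" by measurable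
   have "vint z t x = (\<integral>s. (if s < t then z' (s, x) else 0)\<partial>MT)"
    unfolding vint_def aint_def
   proof (rule integral_cong_AE)
    show "(%s. indicator {..<t} s * z s x)\<in>meas MT"
     using sqi_meas[OF elim(2)] by (intro borel_measurable_times ind_meas) auto
    show "(%s. (if s < t then z' (s, x) else 0))\<in>meas MT" by (rule leb_measurableI[OF m])
    show "AE s in MT. indicator {..<t} s * z s x = (if s < t then z' (s, x) else 0)"
     using elim(1) by eventually_elim (auto simp: indicator_def)
   qed
   also have "\<dots> = w (t, x)"
    unfolding leb_integral_borel(2)[OF IT m] w_def
   proof (rule integral_cong'[OF refl])
    fix s
    show "indicator {0<..<T} s * (if s < t then z' (s, x) else 0) = (if s < fst (t, x) then z' (s, snd (t, x)) else 0)"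
     using z'(3)[of "(s, x)"] by (auto simp: indicator_def)
   qed
   finally show "vint z t x = w (t, x)" .
  qed
 qed
 from AE_leb_snd[OF IT OX this]
 have "AE p in MC. w p = case_prod (vint z) p" by eventually_elim (auto simp: case_prod_unfold)
 then show ?thesis by (rule leb_measurable_AE[OF CX leb_measurableI[OF wm]])
qed

lemma vint_LL:
 assumes z: "z\<in>LL" shows "vint z\<in>LL"
proof -
 let ?W = "%x. T * (\<integral>s. indicator {0<..<T} s * (z s x * z s x)\<partial>MT)"
 have "integrable MX ?W" by (intro integrable_mult_right aint_int(1) z) simp
 then have i: "integrable MC (%p. ?W (snd p))" by (rule integrable_leb_snd[OF IT OX fin_MT])
 have "AE x in MX. \<forall>t. (vint z t x)^2\<le>?W x"
  using LL_slice_x[OF z]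
 proof eventually_elim
  case (elim x)
  interpret S: semi_inner "sqi MT" "%u v. \<integral>s. u s * v s\<partial>MT" by (rule semi_inner_sqi)
  show ?case
  proof
   fix t
   let ?i = "indicator {..<t} :: real=>real"
   have isq: "?i\<in>sqi MT" by (rule ind_sqi) simp
   have "(vint z t x)^2\<le>(\<integral>s. ?i s * ?i s\<partial>MT) * (\<integral>s. z s x * z s x\<partial>MT)"
    unfolding vint_def aint_def by (rule S.cauchy_schwarz_sq[OF isq elim])
   also have "(\<integral>s. ?i s * ?i s\<partial>MT) = (\<integral>s. ?i s\<partial>MT)"
    by (rule integral_cong') (auto simp: indicator_def)
   also have "\<dots> * (\<integral>s. z s x * z s x\<partial>MT)\<le>T * (\<integral>s. z s x * z s x\<partial>MT)"
    by (intro mult_right_mono ind_le_T integral_nonneg_AE AE_I2) auto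
   also have "(\<integral>s. z s x * z s x\<partial>MT) = (\<integral>s. indicator {0<..<T} s * (z s x * z s x)\<partial>MT)"
    by (rule integral_cong') auto
   finally show "(vint z t x)^2\<le>?W x" .
  qed
 qed
 from AE_leb_snd[OF IT OX this]
 have le: "AE p in MC. norm ((case_prod (vint z) p)^2)\<le>norm (?W (snd p))"
  by eventually_elim (rule square_norm_le, simp add: case_prod_unfold)
 have "integrable MC (%p. (case_prod (vint z) p)^2)"
  by (rule Bochner_Integration.integrable_bound[OF i _ le]) (use vint_measurable[OF z] in simp)
 then show ?thesis using vint_measurable[OF z] by (simp add: LL_def sqi_def)
qed

text \<open>The exceptional null set of points x does not depend on A, so the identity can be
  applied to \<open>{..<t}\<close> for all t simultaneously.\<close>

lemma aint_add:
 assumes A: "A\<in>sets borel" and u: "u\<in>LL" and v: "v\<in>LL"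
 shows "AE x in MX. \<forall>A\<in>sets borel. aint A (u + v) x = aint A u x + aint A v x"
 using LL_slice_x[OF u] LL_slice_x[OF v]
proof eventually_elim
 case (elim x)
 show ?case
 proof
  fix A :: "real set" assume A: "A\<in>sets borel"
  have i: "integrable MT (%s. indicator A s * u s x)" "integrable MT (%s. indicator A s * v s x)"
   using sqi_mult[OF ind_sqi[OF A] elim(1)] sqi_mult[OF ind_sqi[OF A] elim(2)] by auto
  show "aint A (u + v) x = aint A u x + aint A v x"
   unfolding aint_def using i by (simp add: distrib_left)
 qed
qed

lemma vint_add:
 assumes u: "u\<in>LL" and v: "v\<in>LL"
 shows "LL.nr (vint (u + v) - (vint u + vint v)) = 0"
proof -
 have d: "vint (u + v) - (vint u + vint v)\<in>LL" by (intro LL.diff_mem LL.add_mem vint_LL u v)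
 have "AE x in MX. \<forall>t. vint (u + v) t x = vint u t x + vint v t x"
  using aint_add[OF _ u v, of UNIV] by (auto simp: vint_def elim!: eventually_mono)
 from AE_leb_snd[OF IT OX this] show ?thesis
  unfolding nr_eq_zero_iff[OF d] by eventually_elim (simp add: case_prod_unfold)
qed

lemma vint_scale: "vint (c *\<^sub>R u) = c *\<^sub>R vint u"
 by (auto simp: vint_def aint_def scaleR_fun_def fun_eq_iff mult.left_commute[of _ c])

lemma vint_diff:
 assumes u: "u\<in>LL" and v: "v\<in>LL"
 shows "LL.nr (vint (u - v) - (vint u - vint v)) = 0"
 using vint_add[OF u LL.scale_mem[OF v], of "-1"] unfolding vint_scale by simp

lemma vint_zero: "vint z 0 = 0"
proof
 fix x
 have "vint z 0 x = (\<integral>s. 0\<partial>MT)"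
  unfolding vint_def aint_def by (rule integral_cong') auto
 then show "vint z 0 x = 0 x" by simp
qed

lemma vint_continuous:
 assumes z: "z\<in>LL" and st: "s\<le>t"
 shows "(X.nr (vint z t - vint z s))^2\<le>(t - s) * (LL.nr z)^2"
proof -
 let ?A = "{s..<t}"
 have m: "vint z t\<in>sqi MX" "vint z s\<in>sqi MX" "aint ?A z\<in>sqi MX"
  unfolding vint_def by (intro aint_sqi(1) z; simp)+
 have "AE x in MX. (vint z t - vint z s - aint ?A z) x = 0"
  using LL_slice_x[OF z]
 proof eventually_elim
  case (elim x)
  have i: "integrable MT (%r. indicator A r * z r x)" if "A\<in>sets borel" for A
   using sqi_mult[OF ind_sqi[OF that] elim] .
  have "vint z t x - vint z s x = (\<integral>r. indicator {..<t} r * z r x - indicator {..<s} r * z r x\<partial>MT)"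
   unfolding vint_def aint_def using i by simp
  also have "\<dots> = aint ?A z x"
   unfolding aint_def by (rule integral_cong') (use st in \<open>auto simp: indicator_def\<close>)
  finally show ?case by simp
 qed
 then have "X.nr (vint z t - vint z s - aint ?A z) = 0"
  using X_nr_eq_zero[OF X.diff_mem[OF X.diff_mem[OF m(1,2)] m(3)]] by simp
 then have "X.nr (vint z t - vint z s) = X.nr (aint ?A z)"
  by (rule X.nr_cong[OF X.diff_mem[OF m(1,2)] m(3)])
 moreover have "(X.nr (aint ?A z))^2\<le>(\<integral>s. indicator ?A s\<partial>MT) * (LL.nr z)^2"
  by (rule aint_bound(2)[OF _ z]) simp
 moreover have "(\<integral>s. indicator ?A s\<partial>MT) * (LL.nr z)^2\<le>(t - s) * (LL.nr z)^2"
  using ind_length[OF st] by (intro mult_right_mono) auto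
 ultimately show ?thesis by simp
qed

subsection \<open>Weighted norms\<close>

text \<open>Multiplication by exp(-k t / 2), so that \<open>nrw\<close> is the L^2 norm with weight
  exp(-k t), equivalent to the unweighted norm for each k. Large k turns Volterra operators into
  contractions.\<close>

definition wt :: "real=>'n evol=>real=>real^'n=>real" where
 "wt k u t = exp (- (k * t) / 2) *\<^sub>R u t"

definition lipw :: "real=>'n evol=>'n evol=>real" where
 "lipw k u v = lip (wt k u) (wt k v)"

definition nrw :: "real=>'n evol=>real" where
 "nrw k u = LL.nr (wt k u)"

lemma wt_bound: "t\<in>{0<..<T} ==> \<bar>exp (- (k * t) / 2)\<bar>\<le>exp (\<bar>k\<bar> * T / 2)"
proof -
 assume t: "t\<in>{0<..<T}"
 have "- (k * t)\<le>\<bar>k\<bar> * t" using mult_right_mono[OF abs_ge_minus_self[of k], of t] t by simp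
 also have "\<dots>\<le>\<bar>k\<bar> * T" using t by (intro mult_left_mono) auto
 finally show ?thesis by simp
qed

lemma wt_meas: "(%t. exp (- (k * t) / 2))\<in>meas MT"
 by (intro leb_measurableI) measurable

lemma wt_LL: "u\<in>LL ==> wt k u\<in>LL"
proof -
 assume u: "u\<in>LL"
 have "(%t x. exp (- (k * t) / 2) * u t x)\<in>LL" by (rule LL_time_mult[OF wt_meas wt_bound u])
 then show ?thesis by (simp add: wt_def[abs_def] scaleR_fun_def[of _ "_ :: real^'n=>real"])
qed

lemma wt_inverse: "wt (- k) (wt k u) = u"
 by (auto simp: wt_def fun_eq_iff exp_add[symmetric])

lemma wt_add: "wt k (u + v) = wt k u + wt k v"
 by (auto simp: wt_def fun_eq_iff scaleR_add_right)

lemma wt_scale: "wt k (c *\<^sub>R u) = c *\<^sub>R wt k u"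
 by (auto simp: wt_def fun_eq_iff scaleR_fun_def[of c "_ :: real=>_"] mult.commute)

lemma wt_diff: "wt k (u - v) = wt k u - wt k v"
 by (auto simp: wt_def fun_eq_iff scaleR_diff_right)

lemma wt_LL_iff: "wt k u\<in>LL \<longleftrightarrow> u\<in>LL"
 using wt_LL[of u k] wt_LL[of "wt k u" "- k"] wt_inverse[of k u] by auto

lemma semi_hilbert_lipw: "semi_hilbert LL (lipw k)"
proof -
 have "semi_hilbert {w. wt k w\<in>LL} (%u v. lip (wt k u) (wt k v))"
 proof (rule semi_hilbert_pullback[OF semi_hilbert_LL])
  show "wt k (u + v) = wt k u + wt k v" "wt k (c *\<^sub>R u) = c *\<^sub>R wt k u" for u v c
   by (rule wt_add, rule wt_scale)
  show "\<exists>w. wt k w = v" for v using wt_inverse[of "- k" v] by auto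
 qed
 then show ?thesis by (simp add: wt_LL_iff lipw_def[abs_def])
qed

lemma LL_nr_mono:
 assumes u: "u\<in>LL" and v: "v\<in>LL" and C: "C\<ge>0" and le: "AE p in MC. \<bar>case_prod u p\<bar>\<le>C * \<bar>case_prod v p\<bar>"
 shows "LL.nr u\<le>C * LL.nr v"
proof -
 have "lip u u\<le>(\<integral>p. C\<^sup>2 * (case_prod v p)^2\<partial>MC)"
  unfolding lip_def power2_eq_square[of "case_prod v _"]
 proof (rule integral_mono_AE)
  show "integrable MC (%p. case_prod u p * case_prod u p)" by (rule sqi_mult[OF LL_D[OF u] LL_D[OF u]])
  show "integrable MC (%p. C\<^sup>2 * (case_prod v p * case_prod v p))"
   by (intro integrable_mult_right sqi_mult[OF LL_D[OF v] LL_D[OF v]])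
  show "AE p in MC. case_prod u p * case_prod u p\<le>C\<^sup>2 * (case_prod v p * case_prod v p)"
   using le
  proof eventually_elim
   case (elim p)
   then have "\<bar>case_prod u p\<bar>\<^sup>2\<le>(C * \<bar>case_prod v p\<bar>)^2" by (intro power_mono) auto
   then have "(case_prod u p)^2\<le>C\<^sup>2 * (case_prod v p)^2" by (simp add: power_mult_distrib)
   then show ?case by (simp only: power2_eq_square)
  qed
 qed
 also have "\<dots> = C\<^sup>2 * lip v v" by (simp add: lip_def power2_eq_square)
 finally have "(LL.nr u)^2\<le>(C * LL.nr v)^2" by (simp add: LL.nr_sq[OF u] LL.nr_sq[OF v] power_mult_distrib)
 then show ?thesis by (rule power2_le_imp_le) (use C LL.nr_nonneg[OF v] in simp)
qed

lemma nrw_le: "u\<in>LL ==> k\<ge>0 ==> nrw k u\<le>LL.nr u"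
proof -
 assume u: "u\<in>LL" and k: "k\<ge>0"
 have "LL.nr (wt k u)\<le>1 * LL.nr u"
 proof (rule LL_nr_mono[OF wt_LL[OF u] u])
  show "AE p in MC. \<bar>case_prod (wt k u) p\<bar>\<le>1 * \<bar>case_prod u p\<bar>"
  proof (rule AE_I2)
   fix p assume "p\<in>space MC"
   then have "exp (- (k * fst p) / 2)\<le>1" using k by auto
   then show "\<bar>case_prod (wt k u) p\<bar>\<le>1 * \<bar>case_prod u p\<bar>"
    by (auto simp: wt_def case_prod_unfold scaleR_fun_def abs_mult intro!: mult_left_le_one_le)
  qed
 qed simp
 then show ?thesis by (simp add: nrw_def)
qed

lemma LL_nr_le_nrw: "u\<in>LL ==> LL.nr u\<le>exp (\<bar>k\<bar> * T / 2) * nrw k u"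
proof -
 assume u: "u\<in>LL"
 have w: "wt k u\<in>LL" by (rule wt_LL[OF u])
 have "LL.nr (wt (- k) (wt k u))\<le>exp (\<bar>k\<bar> * T / 2) * LL.nr (wt k u)"
 proof (rule LL_nr_mono[OF wt_LL[OF w] w])
  show "AE p in MC. \<bar>case_prod (wt (- k) (wt k u)) p\<bar>\<le>exp (\<bar>k\<bar> * T / 2) * \<bar>case_prod (wt k u) p\<bar>"
  proof (rule AE_I2)
   fix p assume "p\<in>space MC"
   then have "\<bar>exp (- ((- k) * fst p) / 2)\<bar>\<le>exp (\<bar>- k\<bar> * T / 2)" by (intro wt_bound) auto
   then show "\<bar>case_prod (wt (- k) (wt k u)) p\<bar>\<le>exp (\<bar>k\<bar> * T / 2) * \<bar>case_prod (wt k u) p\<bar>"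
    unfolding wt_def[of "- k"] by (auto simp: case_prod_unfold scaleR_fun_def abs_mult intro!: mult_right_mono)
  qed
 qed simp
 then show ?thesis by (simp add: nrw_def wt_inverse)
qed

lemma nrw_sq: "u\<in>LL ==> (nrw k u)^2 = (\<integral>t. exp (- (k * t)) * (X.nr (u t))^2\<partial>MT)"
proof -
 assume u: "u\<in>LL"
 have "(nrw k u)^2 = (\<integral>t. (X.nr (wt k u t))^2\<partial>MT)"
  by (simp add: nrw_def LL.nr_sq lip_self wt_LL u)
 also have "\<dots> = (\<integral>t. exp (- (k * t)) * (X.nr (u t))^2\<partial>MT)"
 proof (rule integral_cong_AE)
  show "(%t. (X.nr (wt k u t))^2)\<in>meas MT"
   by (rule borel_measurable_integrable[OF slice_integrable[OF wt_LL[OF u]]])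
  show "(%t. exp (- (k * t)) * (X.nr (u t))^2)\<in>meas MT"
   by (intro borel_measurable_times borel_measurable_integrable[OF slice_integrable[OF u]] leb_measurableI) measurable
  show "AE t in MT. (X.nr (wt k u t))^2 = exp (- (k * t)) * (X.nr (u t))^2"
   using LL_slice[OF u]
  proof eventually_elim
   case (elim t)
   have "(exp (- (k * t) / 2))^2 = exp (- (k * t))" by (simp add: exp_double[symmetric])
   then show ?case unfolding wt_def X.nr_scale[OF elim] by (simp add: power_mult_distrib)
  qed
 qed
 finally show ?thesis .
qed

lemma exp_tail:
 assumes k: "k > 0" and s: "s\<in>{0<..<T}"
 shows "(\<integral>t. exp (- (k * t)) * indicator {..<t} s\<partial>MT)\<le>exp (- (k * s)) / k"
proof -
 have m: "(%t. exp (- (k * t)) * indicator {..<t} s)\<in>meas borel"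
  unfolding indicator_def lessThan_iff by measurable
 have e: "(\<integral>t. exp (- (k * t)) * indicator {..<t} s\<partial>MT) = (\<integral>t. indicator {0<..<T} t * (exp (- (k * t)) * indicator {..<t} s)\<partial>lborel)"
  by (rule leb_integral_borel(2)[OF IT m])
 let ?F = "%t. - exp (- (k * t)) / k"
 have sT: "s\<le>T" using s by simp
 have D: "(?F has_real_derivative exp (- (k * t))) (at t within {s..T})" for t
  using k by (auto intro!: derivative_eq_intros)
 have c: "continuous_on {s..T} (%t. exp (- (k * t)))" by (intro continuous_intros)
 have I: "(\<integral>t. exp (- (k * t)) * indicator {s..T} t\<partial>lborel) = ?F T - ?F s"
  by (rule integral_FTC_Icc_real[OF sT]) (use D in \<open>auto intro!: derivative_eq_intros continuous_intros simp: k[THEN less_imp_neq, symmetric]\<close>)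
 have i: "integrable lborel (%t. exp (- (k * t)) * indicator {s..T} t)"
  using borel_integrable_compact[OF compact_Icc c] by (simp add: set_integrable_def mult.commute)
 have "(\<integral>t. indicator {0<..<T} t * (exp (- (k * t)) * indicator {..<t} s)\<partial>lborel)\<le>(\<integral>t. exp (- (k * t)) * indicator {s..T} t\<partial>lborel)"
 proof (rule integral_mono)
  show "integrable lborel (%t. indicator {0<..<T} t * (exp (- (k * t)) * indicator {..<t} s))"
   by (rule Bochner_Integration.integrable_bound[OF i]) (use m in \<open>auto simp: indicator_def\<close>)
 qed (use i in \<open>auto simp: indicator_def\<close>)
 also have "\<dots>\<le>exp (- (k * s)) / k" unfolding I using k by (simp add: field_simps)
 finally show ?thesis unfolding e .
qed

text \<open>Exchanging the order of integration, the weight is integrated over t > s and contributes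
  at most exp(-k s)/k: each integration in time gains a factor 1/k.\<close>

lemma volterra:
 assumes u: "u\<in>LL" and v: "v\<in>LL" and c: "c\<ge>0" and k: "k > 0"
  and le: "AE t in MT. (X.nr (u t))^2\<le>c * (\<integral>s. indicator {..<t} s * (X.nr (v s))^2\<partial>MT)"
 shows "(nrw k u)^2\<le>c / k * (nrw k v)^2"
proof -
 let ?d = "%s. (X.nr (v s))^2"
 let ?f = "%t s. exp (- (k * t)) * (indicator {..<t} s * ?d s)"
 have di: "integrable MT ?d" by (rule slice_integrable[OF v])
 have fm: "case_prod ?f\<in>meas (leb ({0<..<T}\<times>{0<..<T}))"
 proof -
  have "(%p. exp (- (k * fst p)) * indicator {..<fst p} (snd p) :: real)\<in>meas (borel \<Otimes>\<^sub>M borel)"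
   unfolding indicator_def lessThan_iff by measurable
  then have "(%p :: real\<times>real. exp (- (k * fst p)) * indicator {..<fst p} (snd p) :: real)\<in>meas borel"
   by (simp add: borel_prod)
  from borel_measurable_times[OF leb_measurableI[OF this]
    leb_measurable_snd[OF IT IT borel_measurable_integrable[OF di]]]
  show ?thesis by (simp add: case_prod_unfold mult.assoc)
 qed
 have fi: "integrable (leb ({0<..<T}\<times>{0<..<T})) (case_prod ?f)"
 proof (rule Bochner_Integration.integrable_bound[OF integrable_leb_snd[OF IT IT fin_MT di] fm], rule AE_I2)
  fix p assume "p\<in>space (leb ({0<..<T}\<times>{0<..<T}))"
  then have "exp (- (k * fst p))\<le>1" using k by auto
  then show "norm (case_prod ?f p)\<le>norm (?d (snd p))"
   by (auto simp: case_prod_unfold indicator_def abs_mult intro!: mult_left_le_one_le)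
 qed
 note F = Fubini_leb[OF IT IT fi]
 have g: "(\<integral>s. ?f t s\<partial>MT) = exp (- (k * t)) * (\<integral>s. indicator {..<t} s * ?d s\<partial>MT)" for t by simp
 have "(nrw k u)^2 = (\<integral>t. exp (- (k * t)) * (X.nr (u t))^2\<partial>MT)" by (rule nrw_sq[OF u])
 also have "\<dots>\<le>(\<integral>t. c * (\<integral>s. ?f t s\<partial>MT)\<partial>MT)"
 proof (rule integral_mono_AE)
  show "integrable MT (%t. c * (\<integral>s. ?f t s\<partial>MT))" using F(2) by (rule integrable_mult_right)
  have em: "(%t. exp (- (k * t)) * (X.nr (u t))^2)\<in>meas MT"
   by (intro borel_measurable_times borel_measurable_integrable[OF slice_integrable[OF u]] leb_measurableI) measurable
  show "integrable MT (%t. exp (- (k * t)) * (X.nr (u t))^2)"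
  proof (rule Bochner_Integration.integrable_bound[OF slice_integrable[OF u] em], rule AE_I2)
   fix t assume "t\<in>space MT"
   then have "exp (- (k * t))\<le>1" using k by auto
   then show "norm (exp (- (k * t)) * (X.nr (u t))^2)\<le>norm ((X.nr (u t))^2)"
    by (auto simp: abs_mult intro!: mult_left_le_one_le)
  qed
  show "AE t in MT. exp (- (k * t)) * (X.nr (u t))^2\<le>c * (\<integral>s. ?f t s\<partial>MT)"
   using le unfolding g
  proof eventually_elim
   case (elim t)
   from mult_left_mono[OF this, of "exp (- (k * t))"] show ?case by (simp add: mult.left_commute)
  qed
 qed
 also have "\<dots> = c * (\<integral>s. \<integral>t. ?f t s\<partial>MT\<partial>MT)" using F(3,6) by simp
 also have "\<dots>\<le>c * (\<integral>s. exp (- (k * s)) / k * ?d s\<partial>MT)"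
 proof (rule mult_left_mono[OF integral_mono_AE[OF F(5)] c])
  have "integrable MT (%s. exp (- (k * s)) * ?d s)"
  proof (rule Bochner_Integration.integrable_bound[OF di], goal_cases)
   case 1
   show ?case by (intro borel_measurable_times borel_measurable_integrable[OF di] leb_measurableI) measurable
   case 2
   show ?case
   proof (rule AE_I2)
    fix t assume "t\<in>space MT"
    then have "exp (- (k * t))\<le>1" using k by auto
    then show "norm (exp (- (k * t)) * ?d t)\<le>norm (?d t)"
     by (auto simp: abs_mult intro!: mult_left_le_one_le)
   qed
  qed
  from integrable_mult_right[OF this, of "1 / k"]
  show "integrable MT (%s. exp (- (k * s)) / k * ?d s)" by simp
  show "AE s in MT. (\<integral>t. ?f t s\<partial>MT)\<le>exp (- (k * s)) / k * ?d s"
  proof (rule AE_I2)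
   fix s assume "s\<in>space MT"
   then have s: "s\<in>{0<..<T}" by simp
   have "(\<integral>t. ?f t s\<partial>MT) = (\<integral>t. exp (- (k * t)) * indicator {..<t} s\<partial>MT) * ?d s"
    by (simp add: mult.assoc[symmetric])
   also have "\<dots>\<le>exp (- (k * s)) / k * ?d s" by (intro mult_right_mono exp_tail k s) simp
   finally show "(\<integral>t. ?f t s\<partial>MT)\<le>exp (- (k * s)) / k * ?d s" .
  qed
 qed
 also have "(\<integral>s. exp (- (k * s)) / k * ?d s\<partial>MT) = (nrw k v)^2 / k"
  unfolding nrw_sq[OF v] by simp
 finally show ?thesis by simp
qed

lemma vint_weighted:
 assumes z: "z\<in>LL" and k: "k > 0"
 shows "nrw k (vint z)\<le>sqrt (T / k) * nrw k z"
proof -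
 have "(nrw k (vint z))^2\<le>T / k * (nrw k z)^2"
  by (rule volterra[OF vint_LL[OF z] z _ k]) (use T_pos aint_bound(1)[OF _ z] in \<open>auto simp: vint_def\<close>)
 also have "\<dots> = (sqrt (T / k) * nrw k z)^2" using T_pos k by (simp add: power_mult_distrib)
 finally show ?thesis
  by (rule power2_le_imp_le) (use T_pos k LL.nr_nonneg[OF wt_LL[OF z]] in \<open>simp add: nrw_def\<close>)
qed

end

section \<open>H^1(0,T;L^2(\<Omega>)), primitives, and initial and terminal values\<close>

section \<open>Weak time derivatives\<close>

lemma deriv_test_eq: "\<phi>\<in>test_functions U ==> deriv \<phi> t = frechet_derivative \<phi> (at t) 1"
proof -
 assume p: "\<phi>\<in>test_functions U"
 have "\<phi> differentiable (at t)" by (rule test_differentiable[OF p])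
 then obtain D where D: "(\<phi> has_real_derivative D) (at t)" by (auto simp: real_differentiable_def)
 from frechet_derivative_eqI[OF D[unfolded has_field_derivative_def]] show ?thesis
  using DERIV_imp_deriv[OF D] by simp
qed

lemma deriv_test: "\<phi>\<in>test_functions U ==> deriv \<phi>\<in>test_functions (U :: real set)"
 using test_deriv[of \<phi> U 1] deriv_test_eq[of \<phi> U] by (metis (no_types, lifting) ext)

lemma test_DERIV: "\<phi>\<in>test_functions U ==> (\<phi> has_real_derivative deriv \<phi> t) (at t)"
 using test_differentiable[of \<phi> U t] by (metis DERIV_deriv_iff_real_differentiable)

lemma integral_deriv_test:
 fixes U :: "real set"
 assumes "open U" "\<phi>\<in>test_functions U"
 shows "(\<integral>t. deriv \<phi> t\<partial>leb U) = 0"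
proof -
 have "(%t. frechet_derivative \<phi> (at t) 1) = deriv \<phi>" using deriv_test_eq[OF assms(2)] by auto
 then show ?thesis
  using integral_test_deriv[OF assms(2), of 1] integral_lebesgue_on_test(2)[OF assms(1) deriv_test[OF assms(2)]] by simp
qed

lemma compact_subset_Ioo:
 fixes K :: "real set"
 assumes K: "compact K" and sub: "K\<subseteq>{c<..<d}" and cd: "c < d"
 obtains a b where "c < a" "a\<le>b" "b < d" "K\<subseteq>{a..b}"
proof (cases "K = {}")
 case True
 then show ?thesis using that[of "(c + d) / 2" "(c + d) / 2"] cd by (simp add: field_simps)
next
 case False
 obtain a where a: "a\<in>K" "\<And>t. t\<in>K ==> a\<le>t" using compact_attains_inf[OF K False] by blast
 obtain b where b: "b\<in>K" "\<And>t. t\<in>K ==> t\<le>b" using compact_attains_sup[OF K False] by blast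
 show ?thesis using that[of a b] a b sub by force
qed

text \<open>The primitive starting at 0 is constant on either side of the support of g: zero to the
  left, and equal to the vanishing total integral to the right.\<close>

lemma test_primitive:
 assumes T: "T > 0" and g: "g\<in>test_functions {0<..<T}" and z: "(\<integral>t. g t\<partial>leb {0<..<T}) = 0"
 obtains \<psi> where "\<psi>\<in>test_functions {0<..<T}" "deriv \<psi> = g"
proof -
 let ?K = "closure {t. g t\<noteq>0}"
 have cg: "continuous_on UNIV g" by (rule test_continuous[OF g])
 have K: "compact ?K" "?K\<subseteq>{0<..<T}" using g by (auto simp: test_functions_def)
 obtain a b where ab: "0 < a" "a\<le>b" "b < T" "?K\<subseteq>{a..b}" by (rule compact_subset_Ioo[OF K T]) (rule that)
 have out: "g t = 0" if "t\<notin>{a..b}" for t using ab(4) that closure_subset[of "{t. g t\<noteq>0}"] by auto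
 have "\<exists>F. \<forall>x::real. - \<infinity> < ereal x\<longrightarrow>ereal x < \<infinity>\<longrightarrow>(F has_vector_derivative g x) (at x)"
  by (rule einterval_antiderivative) (use cg in \<open>auto simp: continuous_on_eq_continuous_at\<close>)
 then obtain F where F: "\<And>x. (F has_real_derivative g x) (at x)"
  by (auto simp: has_real_derivative_iff_has_vector_derivative)
 define \<psi> where "\<psi> = (%t. F t - F 0)"
 have D: "(\<psi> has_real_derivative g t) (at t)" for t
  unfolding \<psi>_def by (auto intro!: derivative_eq_intros F)
 have cont: "continuous_on S \<psi>" for S
  using D by (meson DERIV_continuous_on has_field_derivative_at_within)
 have const: "\<psi> y = \<psi> x" if "x\<le>y" "y\<le>a \<or> b\<le>x" for x y
 proof (cases "x = y")
  case False
  have "(\<psi> has_real_derivative 0) (at u)" if u: "x < u" "u < y" for u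
   using D[of u] out[of u] u \<open>y \<le> a \<or> b \<le> x\<close> by force
  then show ?thesis
   using DERIV_isconst_end[of x y \<psi>] False \<open>x \<le> y\<close> cont by auto
 qed simp
 have "(\<integral>t. g t * indicator {0..T} t\<partial>lborel) = \<psi> T - \<psi> 0"
  by (rule integral_FTC_Icc_real) (use T D cg in \<open>auto intro: has_field_derivative_at_within simp: continuous_on_eq_continuous_at\<close>)
 moreover have "(%t. g t * indicator {0..T} t) = g"
 proof
  fix t show "g t * indicator {0..T} t = g t"
   by (cases "t\<in>{0..T}") (use test_outside[OF g, of t] in auto)
 qed
 ultimately have \<psi>T: "\<psi> T = 0"
  using z integral_lebesgue_on_test(2)[OF _ g] by (simp add: \<psi>_def)
 have zero: "\<psi> t = 0" if "t\<notin>{a..b}" for t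
 proof -
  have \<psi>0: "\<psi> 0 = 0" by (simp add: \<psi>_def)
  consider "t\<le>0" | "0\<le>t" "t\<le>a" | "b\<le>t" "t\<le>T" | "T\<le>t" using \<open>t \<notin> {a..b}\<close> by force
  then show ?thesis
  proof cases
   case 1
   then show ?thesis using const[of t 0] ab \<psi>0 by simp
  next
   case 2
   then show ?thesis using const[of 0 t] \<psi>0 by simp
  next
   case 3
   then show ?thesis using const[of t T] \<psi>T by simp
  next
   case 4
   then show ?thesis using const[of T t] ab \<psi>T by simp
  qed
 qed
 then have "{t. \<psi> t\<noteq>0}\<subseteq>{a..b}" by blast
 then have c: "closure {t. \<psi> t\<noteq>0}\<subseteq>{a..b}" by (rule closure_minimal) simp
 then have "compact (closure {t. \<psi> t\<noteq>0})"
  by (metis bounded_closed_interval bounded_subset closed_closure compact_eq_bounded_closed)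
 moreover have "C_k k \<psi>" for k by (rule C_k_antimono[OF C_k_real_deriv[OF D test_C_k[OF g]]])
 ultimately have "\<psi>\<in>test_functions {0<..<T}" using c ab by (force simp: test_functions_def)
 moreover have "deriv \<psi> = g" using DERIV_imp_deriv[OF D] by auto
 ultimately show ?thesis by (rule that)
qed

context bounded_cylinder
begin

lemma lip_swapped:
 assumes "u\<in>LL" "v\<in>LL"
 shows "lip u v = (\<integral>x. \<integral>t. u t x * v t x\<partial>MT\<partial>MX)"
 using Fubini_leb(6)[OF IT OX LL_integrable[OF assms]] by (simp add: lip_eq)

lemma test_sqi_MT: "\<phi>\<in>DT ==> \<phi>\<in>sqi MT"
proof -
 assume p: "\<phi>\<in>DT"
 obtain M where "\<And>x. \<bar>\<phi> x\<bar>\<le>M" by (rule test_bounded[OF p]) (rule that)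
 then show ?thesis
  by (intro sqi_bounded[OF sqi_const[OF fin_MT, of 1], of _ M] leb_measurableI test_measurable[OF p]) auto
qed

text \<open>The weak time derivative tested with tensor products, so that it becomes a family of
  inner product identities in \<open>LL\<close>, which pass to limits.\<close>

definition trel :: "'n evol=>'n evol=>bool" where
 "trel y z \<longleftrightarrow> y\<in>LL\<and>z\<in>LL\<and>(\<forall>\<phi>\<in>DT. \<forall>b\<in>DX.
  lip y (%t x. deriv \<phi> t * b x) = - lip z (%t x. \<phi> t * b x))"

text \<open>For fixed \<phi> the defining identity is an equation between two integrable functions
  of x; by the fundamental lemma it holds almost everywhere exactly when it holds after integration
  against every b.\<close>

lemma weak_time_deriv_iff:
 assumes y: "y\<in>LL"
 shows "has_weak_time_deriv T \<Omega> y z \<longleftrightarrow> trel y z"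
proof (cases "z\<in>LL")
 case False
 then show ?thesis by (auto simp: has_weak_time_deriv_def trel_def LL_elems)
next
 case z: True
 let ?Y = "%\<phi> x. \<integral>t. deriv \<phi> t * y t x\<partial>MT" and ?Z = "%\<phi> x. \<integral>t. \<phi> t * z t x\<partial>MT"
 have key: "(\<forall>b\<in>DX. lip y (%t x. deriv \<phi> t * b x) = - lip z (%t x. \<phi> t * b x)) \<longleftrightarrow>
   (AE x in MX. (?Y \<phi> x) = - (?Z \<phi> x))"
  if p: "\<phi>\<in>DT" for \<phi>
 proof -
  have one: "(%x. 1)\<in>sqi MX" by (rule sqi_const[OF fin_MX])
  have L1: "(%t x. deriv \<phi> t * 1)\<in>LL" "(%t x. \<phi> t * 1)\<in>LL"
   by (rule LL_test_tensor[OF deriv_test[OF p] one], rule LL_test_tensor[OF p one])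
  let ?g = "%x. (?Y \<phi> x) + (?Z \<phi> x)"
  have i: "integrable MX (%x. \<integral>t. deriv \<phi> t * y t x\<partial>MT)" "integrable MX (%x. \<integral>t. \<phi> t * z t x\<partial>MT)"
   using Fubini_leb(5)[OF IT OX LL_integrable[OF L1(1) y]]
    Fubini_leb(5)[OF IT OX LL_integrable[OF L1(2) z]] by simp_all
  then have gi: "integrable MX ?g" by simp
  have e: "lip y (%t x. deriv \<phi> t * b x) + lip z (%t x. \<phi> t * b x) = (\<integral>x. ?g x * b x\<partial>MX)"
   if b: "b\<in>DX" for b
  proof -
   have L: "(%t x. deriv \<phi> t * b x)\<in>LL" "(%t x. \<phi> t * b x)\<in>LL"
    by (rule LL_test_tensor[OF deriv_test[OF p] test_sqi_MX[OF b]], rule LL_test_tensor[OF p test_sqi_MX[OF b]])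
   have s: "lip y (%t x. deriv \<phi> t * b x) = (\<integral>x. (?Y \<phi> x) * b x\<partial>MX)"
    "lip z (%t x. \<phi> t * b x) = (\<integral>x. (?Z \<phi> x) * b x\<partial>MX)"
    unfolding lip_swapped[OF y L(1)] lip_swapped[OF z L(2)] integral_mult_left_zero[symmetric]
    by (simp_all add: ac_simps)
   have bi: "integrable MX (%x. (?Y \<phi> x) * b x)" "integrable MX (%x. (?Z \<phi> x) * b x)"
    using Fubini_leb(5)[OF IT OX LL_integrable[OF L(1) y]]
     Fubini_leb(5)[OF IT OX LL_integrable[OF L(2) z]]
    unfolding integral_mult_left_zero[symmetric] by (simp_all add: ac_simps)
   show ?thesis unfolding s using bi by (simp add: distrib_right)
  qed
  show ?thesis
  proof
   assume A: "\<forall>b\<in>DX. lip y (%t x. deriv \<phi> t * b x) = - lip z (%t x. \<phi> t * b x)"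
   have "AE x in MX. ?g x = 0"
    by (rule fundamental_lemma[OF open_dom gi]) (use A e in force)
   then show "AE x in MX. (?Y \<phi> x) = - (?Z \<phi> x)"
    by eventually_elim simp
  next
   assume A: "AE x in MX. (?Y \<phi> x) = - (?Z \<phi> x)"
   have "(\<integral>x. ?g x * b x\<partial>MX) = 0" for b
    by (rule integral_eq_zero_AE) (use A in \<open>eventually_elim, simp\<close>)
   then show "\<forall>b\<in>DX. lip y (%t x. deriv \<phi> t * b x) = - lip z (%t x. \<phi> t * b x)"
    using e by (simp add: eq_neg_iff_add_eq_0)
  qed
 qed
 show ?thesis unfolding has_weak_time_deriv_def trel_def LL_elems using y z key by blast
qed

lemma test_LL:
 assumes "\<phi>\<in>DT" "b\<in>DX"
 shows "(%t x. \<phi> t * b x)\<in>LL" "(%t x. deriv \<phi> t * b x)\<in>LL"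
 by (rule LL_test_tensor[OF assms(1) test_sqi_MX[OF assms(2)]],
   rule LL_test_tensor[OF deriv_test[OF assms(1)] test_sqi_MX[OF assms(2)]])

text \<open>There is a single derivative, hence the index type \<open>unit\<close>; the graph space
  is H^1(0,T;L^2(\<Omega>)).\<close>

sublocale Tr: closed_relation LL lip "UNIV :: unit set" "%y g. trel y (g ())"
proof
 show "finite (UNIV :: unit set)" by simp
 show "trel y (g ()) ==> y\<in>LL" "trel y (g ()) ==> g i\<in>LL" for y and g :: "unit=>_" and i
  by (auto simp: trel_def)
 show "trel 0 0" by (auto simp: trel_def LL.zero_mem LL.B_zero test_LL)
 show "trel (u + v) (g () + h ())" if "trel u (g ())" "trel v (h ())" for u v and g h :: "unit=>_"
  using that by (auto simp: trel_def LL.add_mem LL.B_add test_LL)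
 show "trel (c *\<^sub>R u) (c *\<^sub>R g ())" if "trel u (g ())" for c u and g :: "unit=>_"
  using that by (auto simp: trel_def LL.scale_mem LL.B_scale test_LL)
 show "LL.nr (g i - h i) = 0" if r: "trel u (g ())" "trel u (h ())" for u and g h :: "unit=>_" and i
 proof (rule LL_eqI_test)
  have m: "g i\<in>LL" "h i\<in>LL" using r by (auto simp: trel_def)
  show "g i - h i\<in>LL" by (rule LL.diff_mem[OF m])
  fix \<theta> \<phi> assume t: "\<theta>\<in>DT" "\<phi>\<in>DX"
  have "lip u (%t x. deriv \<theta> t * \<phi> x) = - lip (g i) (%t x. \<theta> t * \<phi> x)"
   "lip u (%t x. deriv \<theta> t * \<phi> x) = - lip (h i) (%t x. \<theta> t * \<phi> x)"
   using r t unfolding trel_def by auto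
  then show "lip (g i - h i) (%t x. \<theta> t * \<phi> x) = 0"
   unfolding LL.B_diff[OF m test_LL(1)[OF t]] by simp
 qed
 show "trel u (h ())" if r: "\<And>n. trel (s n) (g n ())" and u: "u\<in>LL" and h: "\<And>i. i\<in>UNIV ==> h i\<in>LL"
  and l: "nullseq (%n. LL.nr (s n - u))" "\<And>i. i\<in>UNIV ==> nullseq (%n. LL.nr (g n i - h i))"
  for s :: "nat=>_" and g :: "nat=>unit=>_" and u and h :: "unit=>_"
  unfolding trel_def
 proof (intro conjI ballI u h UNIV_I)
  fix \<phi> b assume t: "\<phi>\<in>DT" "b\<in>DX"
  have m: "s n\<in>LL" "g n ()\<in>LL" for n using r[of n] by (auto simp: trel_def)
  have "(%n. lip (s n) (%t x. deriv \<phi> t * b x)) \<longlonglongrightarrow> lip u (%t x. deriv \<phi> t * b x)"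
   by (rule LL.B_tendsto[OF m(1) u test_LL(2)[OF t] l(1)])
  moreover have "(%n. - lip (g n ()) (%t x. \<phi> t * b x)) \<longlonglongrightarrow> - lip (h ()) (%t x. \<phi> t * b x)"
   by (intro tendsto_minus LL.B_tendsto[OF m(2) h test_LL(1)[OF t] l(2)]) auto
  moreover have "lip (s n) (%t x. deriv \<phi> t * b x) = - lip (g n ()) (%t x. \<phi> t * b x)" for n
   using r[of n] t unfolding trel_def by auto
  ultimately show "lip u (%t x. deriv \<phi> t * b x) = - lip (h ()) (%t x. \<phi> t * b x)"
   by (simp only: LIMSEQ_unique)
 qed
qed

sublocale T1: semi_hilbert Tr.gdom "Tr.gip 1 1" by (rule Tr.gip_semi_hilbert) auto

lemma Tr_gdomI: "trel y z ==> y\<in>Tr.gdom"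
 using Tr.gdomI[of y "%_. z"] by simp

lemma elems_H1L2: "elems (H1L2 T \<Omega>) = Tr.gdom"
proof -
 have "(\<exists>z. has_weak_time_deriv T \<Omega> y z) \<longleftrightarrow> y\<in>Tr.gdom" if "y\<in>LL" for y
  unfolding weak_time_deriv_iff[OF that] using Tr.op_rel[of y] Tr_gdomI[of y] by blast
 then show ?thesis using Tr.gdom_V by (auto simp: H1L2_def LL_elems)
qed

lemma trel_time_deriv:
 assumes "y\<in>Tr.gdom" shows "trel y (time_deriv T \<Omega> y)"
proof -
 have y: "y\<in>LL" by (rule Tr.gdom_V[OF assms])
 have "has_weak_time_deriv T \<Omega> y (Tr.op y ())"
  using Tr.op_rel[OF assms] by (simp add: weak_time_deriv_iff[OF y])
 then have "has_weak_time_deriv T \<Omega> y (time_deriv T \<Omega> y)"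
  unfolding time_deriv_def by (rule someI[of "has_weak_time_deriv T \<Omega> y"])
 then show ?thesis by (simp add: weak_time_deriv_iff[OF y])
qed

lemma trel_unique: "trel y z ==> trel y z' ==> LL.nr (z - z') = 0"
 using Tr.rel_unique[of y "%_. z" "%_. z'"] by simp

lemma trel_LL: "trel y z ==> y\<in>LL" "trel y z ==> z\<in>LL"
 by (auto simp: trel_def)

lemma trel_diff: "trel y z ==> trel y' z' ==> trel (y - y') (z - z')"
 using Tr.rel_diff[of y "%_. z" y' "%_. z'"] by simp

lemma trel_scale: "trel y z ==> trel (c *\<^sub>R y) (c *\<^sub>R z)"
 using Tr.rel_scale[of y "%_. z" c] by simp

lemma H1L2_inner_eq:
 assumes "u\<in>Tr.gdom" "v\<in>Tr.gdom"
 shows "H1L2_inner T \<Omega> u v = Tr.gip 1 1 u v"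
proof -
 note r = trel_time_deriv[OF assms(1)] trel_time_deriv[OF assms(2)]
 show ?thesis
  using Tr.gip_rel[of u "%_. time_deriv T \<Omega> u" v "%_. time_deriv T \<Omega> v" 1 1] r trel_LL[OF r(1)] trel_LL[OF r(2)]
  by (simp add: H1L2_inner_def L2L2_inner_eq add.commute)
qed

lemma nrm_H1L2: "u\<in>Tr.gdom ==> nrm (H1L2 T \<Omega>) u = T1.nr u"
 by (simp add: H1L2_def H1L2_inner_eq T1.nr_def)

lemma Tr_nr_sq: "trel y z ==> (T1.nr y)^2 = (LL.nr z)^2 + (LL.nr y)^2"
 using Tr.gip_rel[of y "%_. z" y "%_. z" 1 1] T1.nr_sq[OF Tr_gdomI[of y z]]
 by (simp add: LL.nr_sq trel_LL)

subsection \<open>Primitives\<close>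

lemma const_LL: "c\<in>sqi MX ==> (%t. c)\<in>LL"
 using LL_tensor[of "%_. 1" 1 c] by simp

lemma const_nr: "c\<in>sqi MX ==> X.nr c = 0 ==> LL.nr (%t. c) = 0"
 using lip_self[OF const_LL, of c] by (simp add: LL.nr_def)

lemma const_trel:
 assumes c: "c\<in>sqi MX" shows "trel (%t. c) 0"
 unfolding trel_def
proof (intro conjI ballI const_LL c LL.zero_mem)
 fix \<phi> b assume t: "\<phi>\<in>DT" "b\<in>DX"
 have "lip (%t. c) (%t x. deriv \<phi> t * b x) = (\<integral>t. deriv \<phi> t * ipX c b\<partial>MT)"
  unfolding lip_iterated(1)[OF const_LL[OF c] test_LL(2)[OF t]] by (simp add: mult.left_commute[of _ "deriv \<phi> _"])
 also have "\<dots> = 0" using integral_deriv_test[OF _ t(1)] by simp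
 finally show "lip (%t. c) (%t x. deriv \<phi> t * b x) = - lip 0 (%t x. \<phi> t * b x)"
  by (simp add: LL.B_zero[OF test_LL(1)[OF t]])
qed

text \<open>The integral of z from t to T.\<close>

definition vintR :: "'n evol=>real=>real^'n=>real" where
 "vintR z t = aint UNIV z - vint z t"

lemma aint_UNIV_sqi: "z\<in>LL ==> aint UNIV z\<in>sqi MX"
 by (rule aint_sqi(1)) auto

lemma vintR_eq: "vintR z = (%t. aint UNIV z) - vint z"
 by (auto simp: vintR_def fun_eq_iff)

lemma vintR_LL: "z\<in>LL ==> vintR z\<in>LL"
 unfolding vintR_eq by (intro LL.diff_mem const_LL aint_UNIV_sqi vint_LL)

text \<open>Fubini over the triangle s < t; the diagonal is a null set and may be moved between the
  two parts.\<close>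

lemma volterra_adjoint:
 fixes u v :: "real=>real"
 assumes u: "u\<in>sqi MT" and v: "v\<in>sqi MT"
 shows "(\<integral>t. v t * (\<integral>s. indicator {..<t} s * u s\<partial>MT)\<partial>MT)
  = (\<integral>s. u s * ((\<integral>t. v t\<partial>MT) - (\<integral>t. indicator {..<s} t * v t\<partial>MT))\<partial>MT)"
proof -
 let ?f = "%t s. v t * (indicator {..<t} s * u s)"
 have ui: "integrable MT u" and vi: "integrable MT v" using u v by (auto intro: sqi_integrable[OF fin_MT])
 have um: "(%p. u (snd p))\<in>meas (leb ({0<..<T}\<times>{0<..<T}))"
  by (rule leb_measurable_snd[OF IT IT sqi_meas[OF u]])
 have vm: "(%p. v (fst p))\<in>meas (leb ({0<..<T}\<times>{0<..<T}))"
  by (rule leb_measurable_fst[OF IT IT sqi_meas[OF v]])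
 have im: "(%p. indicator {..<fst p} (snd p) :: real)\<in>meas (leb ({0<..<T}\<times>{0<..<T}))"
 proof -
  have "(%p :: real\<times>real. indicator {..<fst p} (snd p) :: real)\<in>meas (borel \<Otimes>\<^sub>M borel)"
   unfolding indicator_def lessThan_iff by measurable
  then show ?thesis by (intro leb_measurableI) (simp add: borel_prod)
 qed
 have fm: "case_prod ?f\<in>meas (leb ({0<..<T}\<times>{0<..<T}))"
  using borel_measurable_times[OF vm borel_measurable_times[OF im um]] by (simp add: case_prod_unfold)
 have "(\<integral>\<^sup>+p. ennreal (norm (v (fst p) * u (snd p)))\<partial>leb ({0<..<T}\<times>{0<..<T}))
   = (\<integral>\<^sup>+t. \<integral>\<^sup>+s. ennreal (norm (v t * u s))\<partial>MT\<partial>MT)"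
  using um vm by (intro nn_integral_leb_Times(1)[OF IT IT, of "%t s. norm (v t * u s)"]) (auto simp: case_prod_unfold)
 also have "\<dots> = (\<integral>\<^sup>+t. ennreal (norm (v t)) * (\<integral>\<^sup>+s. ennreal (norm (u s))\<partial>MT)\<partial>MT)"
  using sqi_meas[OF u] by (intro nn_integral_cong, subst nn_integral_cmult[symmetric]) (auto simp: abs_mult ennreal_mult)
 also have "\<dots> = (\<integral>\<^sup>+t. ennreal (norm (v t))\<partial>MT) * (\<integral>\<^sup>+s. ennreal (norm (u s))\<partial>MT)"
  using sqi_meas[OF v] by (subst nn_integral_multc) auto
 also have "\<dots> < \<infinity>"
  using ui vi unfolding integrable_iff_bounded by (simp add: ennreal_mult_less_top)
 finally have "integrable (leb ({0<..<T}\<times>{0<..<T})) (%p. v (fst p) * u (snd p))"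
  using um vm by (intro integrableI_bounded) auto
 then have fi: "integrable (leb ({0<..<T}\<times>{0<..<T})) (case_prod ?f)"
  by (rule Bochner_Integration.integrable_bound[OF _ fm]) (auto simp: case_prod_unfold indicator_def)
 note F = Fubini_leb[OF IT IT fi]
 have "(\<integral>t. v t * (\<integral>s. indicator {..<t} s * u s\<partial>MT)\<partial>MT) = (\<integral>t. \<integral>s. ?f t s\<partial>MT\<partial>MT)" by simp
 also have "\<dots> = (\<integral>s. \<integral>t. ?f t s\<partial>MT\<partial>MT)" using F(3,6) by simp
 also have "\<dots> = (\<integral>s. u s * ((\<integral>t. v t\<partial>MT) - (\<integral>t. indicator {..<s} t * v t\<partial>MT))\<partial>MT)"
 proof (rule integral_cong'[OF refl])
  fix s
  have i: "integrable MT (%t. indicator {..<s} t * v t)"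
   by (rule sqi_mult[OF ind_sqi v]) simp
  have n: "AE t in MT. t\<noteq>s"
   unfolding AE_leb_iff[OF IT] using AE_lborel_singleton[of s] by eventually_elim simp
  have "(\<integral>t. indicator {..<t} s * v t\<partial>MT) = (\<integral>t. v t - indicator {..<s} t * v t\<partial>MT)"
  proof (rule integral_cong_AE)
   have "(%t. indicator {..<t} s :: real)\<in>meas borel" unfolding indicator_def lessThan_iff by measurable
   then show "(%t. indicator {..<t} s * v t)\<in>meas MT"
    by (intro borel_measurable_times leb_measurableI sqi_meas[OF v])
   show "(%t. v t - indicator {..<s} t * v t)\<in>meas MT" using i vi by auto
   show "AE t in MT. indicator {..<t} s * v t = v t - indicator {..<s} t * v t"
    using n by eventually_elim (auto simp: indicator_def)
  qed
  also have "\<dots> = (\<integral>t. v t\<partial>MT) - (\<integral>t. indicator {..<s} t * v t\<partial>MT)" using i vi by simp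
  finally have e: "(\<integral>t. indicator {..<t} s * v t\<partial>MT) = (\<integral>t. v t\<partial>MT) - (\<integral>t. indicator {..<s} t * v t\<partial>MT)" .
  have "(\<integral>t. ?f t s\<partial>MT) = (\<integral>t. u s * (indicator {..<t} s * v t)\<partial>MT)"
   by (rule integral_cong') auto
  also have "\<dots> = u s * (\<integral>t. indicator {..<t} s * v t\<partial>MT)" by simp
  finally show "(\<integral>t. ?f t s\<partial>MT) = u s * ((\<integral>t. v t\<partial>MT) - (\<integral>t. indicator {..<s} t * v t\<partial>MT))"
   unfolding e .
 qed
 finally show ?thesis .
qed

text \<open>Integration backwards from T is adjoint to integration forwards from 0. This is how the
  adjoint equation comes to run backwards with terminal value zero.\<close>

lemma vint_adjoint:
 assumes u: "u\<in>LL" and v: "v\<in>LL"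
 shows "lip v (vint u) = lip u (vintR v)"
proof -
 have ae: "AE x in MX. (\<integral>t. v t x * vint u t x\<partial>MT) = (\<integral>t. u t x * vintR v t x\<partial>MT)"
  using LL_slice_x[OF u] LL_slice_x[OF v]
  by eventually_elim (simp add: vint_def vintR_def aint_def volterra_adjoint)
 show ?thesis
  unfolding lip_swapped[OF v vint_LL[OF u]] lip_swapped[OF u vintR_LL[OF v]]
  by (rule integral_cong_AE[OF _ _ ae])
   (use Fubini_leb(5)[OF IT OX LL_integrable[OF v vint_LL[OF u]]]
    Fubini_leb(5)[OF IT OX LL_integrable[OF u vintR_LL[OF v]]] in auto)
qed

lemma integral_test_primitive:
 assumes p: "\<phi>\<in>DT" and s: "s\<in>{0<..<T}"
 shows "(\<integral>t. indicator {..<s} t * deriv \<phi> t\<partial>MT) = \<phi> s"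
proof -
 have cd: "continuous_on UNIV (deriv \<phi>)" by (rule test_continuous[OF deriv_test[OF p]])
 have m: "(%t. indicator {..<s} t * deriv \<phi> t)\<in>meas borel"
  using test_measurable[OF deriv_test[OF p]] by measurable
 have "(\<integral>t. indicator {..<s} t * deriv \<phi> t\<partial>MT) = (\<integral>t. indicator {0<..<T} t * (indicator {..<s} t * deriv \<phi> t)\<partial>lborel)"
  by (rule leb_integral_borel(2)[OF IT m])
 also have "\<dots> = (\<integral>t. deriv \<phi> t * indicator {0..s} t\<partial>lborel)"
 proof (rule integral_cong_AE)
  show "AE t in lborel. indicator {0<..<T} t * (indicator {..<s} t * deriv \<phi> t) = deriv \<phi> t * indicator {0..s} t"
   using AE_lborel_singleton[of s] AE_lborel_singleton[of 0] by eventually_elim (use s in \<open>auto simp: indicator_def\<close>)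
  show "(%t. indicator {0<..<T} t * (indicator {..<s} t * deriv \<phi> t))\<in>meas lborel"
   using m by measurable
  show "(%t. deriv \<phi> t * indicator {0..s} t)\<in>meas lborel"
   using test_measurable[OF deriv_test[OF p]] by measurable
 qed
 also have "\<dots> = \<phi> s - \<phi> 0"
  by (rule integral_FTC_Icc_real)
   (use s test_DERIV[OF p] cd in \<open>auto intro: has_field_derivative_at_within simp: continuous_on_eq_continuous_at\<close>)
 also have "\<phi> 0 = 0" by (rule test_outside[OF p]) simp
 finally show ?thesis by simp
qed

text \<open>By \<open>vint_adjoint\<close> the primitive moves onto the derivative of the test
  function, whose backward primitive is minus the test function.\<close>

lemma vint_trel:
 assumes z: "z\<in>LL" shows "trel (vint z) z"
 unfolding trel_def
proof (intro conjI ballI vint_LL z)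
 fix \<phi> b assume t: "\<phi>\<in>DT" "b\<in>DX"
 let ?d = "%t x. deriv \<phi> t * b x"
 have "lip (vint z) ?d = lip ?d (vint z)" by (rule LL.B_sym[OF vint_LL[OF z] test_LL(2)[OF t]])
 also have "\<dots> = lip z (vintR ?d)" by (rule vint_adjoint[OF z test_LL(2)[OF t]])
 also have "\<dots> = lip z (%t x. - (\<phi> t * b x))"
  unfolding lip_def
 proof (rule integral_cong'[OF refl])
  fix p assume "p\<in>space MC"
  then have p: "fst p\<in>{0<..<T}" by auto
  have "vintR ?d (fst p) x = - (\<phi> (fst p) * b x)" for x
   using integral_test_primitive[OF t(1) p] integral_deriv_test[OF _ t(1)]
   by (simp add: vintR_def vint_def aint_def mult.assoc[symmetric])
  then show "case_prod z p * case_prod (vintR ?d) p = case_prod z p * (case p of (t, x)=>- (\<phi> t * b x))"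
   by (simp add: case_prod_unfold)
 qed
 also have "\<dots> = - lip z (%t x. \<phi> t * b x)" by (simp add: lip_def case_prod_unfold)
 finally show "lip (vint z) ?d = - lip z (%t x. \<phi> t * b x)" .
qed

lemma vintR_trel: "z\<in>LL ==> trel (vintR z) (- z)"
 unfolding vintR_eq using trel_diff[OF const_trel[OF aint_UNIV_sqi] vint_trel, of z z] by simp

text \<open>The du Bois-Reymond lemma in the Bochner space \<open>L\<^sup>2(0,T;L\<^sup>2(\<Omega>))\<close>.\<close>

lemma trel_zero_const:
 assumes v: "trel v 0"
 obtains c where "c\<in>sqi MX" "LL.nr (v - (%t. c)) = 0"
proof -
 have vL: "v\<in>LL" by (rule trel_LL(1)[OF v])
 have one: "(%x. 1)\<in>sqi MX" by (rule sqi_const[OF fin_MX])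
 \<comment> \<open>A test function with integral 1; the constant c will be the mean of v weighted
   with it.\<close>
 obtain \<theta> where th: "\<theta>\<in>DT" and th1: "(\<integral>t. \<theta> t\<partial>MT) = 1"
 proof -
  let ?a = "T / 3" and ?b = "2 * T / 3"
  let ?h = "bump ?a ?b 1"
  have h: "?h\<in>DT" using T_pos by (intro bump_test_function) auto
  have hi: "integrable MT ?h" by (rule sqi_integrable[OF fin_MT test_sqi_MT[OF h]])
  have pos: "(\<integral>t. ?h t\<partial>MT)\<noteq>0"
  proof
   assume "(\<integral>t. ?h t\<partial>MT) = 0"
   then have "AE t in MT. ?h t = 0"
    using integral_nonneg_eq_0_iff_AE[OF hi] bump_bounds(1)[of ?a ?b 1] by simp
   then have "AE t in lborel. t\<in>{0<..<T}\<longrightarrow>?h t = 0" unfolding AE_leb_iff[OF IT] .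
   then have "AE t in lborel. t\<notin>{?a<..<?b}"
   proof eventually_elim
    case (elim t)
    show ?case
    proof
     assume "t\<in>{?a<..<?b}"
     then have "t\<in>box ?a ?b" "t\<in>{0<..<T}" using T_pos by (auto simp: box_real)
     then have "hat ?a ?b t > 0" "?h t = 0" using elim by (auto simp: hat_pos_iff)
     then show False by (simp add: bump_def)
    qed
   qed
   then have "emeasure lborel {?a<..<?b} = 0"
    by (subst (asm) AE_iff_measurable[of "{?a<..<?b}"]) auto
   then show False using T_pos by simp
  qed
  have "(%t. ?h t * (1 / (\<integral>t. ?h t\<partial>MT)))\<in>DT" by (rule test_mult[OF h C_k_const])
  moreover have "(\<integral>t. ?h t * (1 / (\<integral>t. ?h t\<partial>MT))\<partial>MT) = 1" using pos by simp
  ultimately show ?thesis by (rule that)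
 qed
 have L: "(%t x. \<theta> t * 1)\<in>LL" by (rule LL_test_tensor[OF th one])
 define c where "c = (%x. \<integral>t. \<theta> t * v t x\<partial>MT)"
 have cm: "c\<in>meas MX"
  using borel_measurable_integrable[OF Fubini_leb(5)[OF IT OX LL_integrable[OF L vL]]] by (simp add: c_def)
 have cs: "c\<in>sqi MX"
 proof -
  have i: "integrable MX (%x. (\<integral>t. \<theta> t * \<theta> t\<partial>MT) * (\<integral>t. v t x * v t x\<partial>MT))"
   by (intro integrable_mult_right Fubini_leb(5)[OF IT OX LL_integrable[OF vL vL]])
  have "integrable MX (%x. (c x)^2)"
  proof (rule Bochner_Integration.integrable_bound[OF i])
   interpret S: semi_inner "sqi MT" "%u v. \<integral>s. u s * v s\<partial>MT" by (rule semi_inner_sqi)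
   show "AE x in MX. norm ((c x)^2)\<le>norm ((\<integral>t. \<theta> t * \<theta> t\<partial>MT) * (\<integral>t. v t x * v t x\<partial>MT))"
    using LL_slice_x[OF vL]
    by eventually_elim (rule square_norm_le, unfold c_def, rule S.cauchy_schwarz_sq[OF test_sqi_MT[OF th]])
  qed (use cm in simp)
  then show ?thesis using cm by (simp add: sqi_def)
 qed
 have cb: "ipX c b = lip v (%t x. \<theta> t * b x)" if b: "b\<in>DX" for b
 proof -
  have "ipX c b = (\<integral>x. \<integral>t. v t x * (\<theta> t * b x)\<partial>MT\<partial>MX)"
   unfolding c_def integral_mult_left_zero[symmetric] by (simp add: ac_simps)
  then show ?thesis using lip_swapped[OF vL test_LL(1)[OF th b]] by simp
 qed
 have "LL.nr (v - (%t. c)) = 0"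
 proof (rule LL_eqI_test[OF LL.diff_mem[OF vL const_LL[OF cs]]])
  fix \<eta> b assume e: "\<eta>\<in>DT" and b: "b\<in>DX"
  let ?I = "\<integral>t. \<eta> t\<partial>MT"
  \<comment> \<open>Subtracting the multiple of \<theta> with the same integral leaves a test
    function of mean zero, that is, the derivative of a test function, which v annihilates.\<close>
  let ?g = "%t. \<eta> t - ?I * \<theta> t"
  have eg: "integrable MT \<eta>" "integrable MT \<theta>" by (intro sqi_integrable[OF fin_MT] test_sqi_MT e th)+
  have g: "?g\<in>DT"
  proof -
   have C: "C_k k (%t. \<eta> t + (- ?I) * \<theta> t)" for k
    by (intro C_k_add C_k_mult C_k_const test_C_k[OF e] test_C_k[OF th])
   have "{t. ?g t\<noteq>0}\<subseteq>{t. \<eta> t\<noteq>0}\<union>{t. \<theta> t\<noteq>0}" by auto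
   then have "closure {t. ?g t\<noteq>0}\<subseteq>closure {t. \<eta> t\<noteq>0}\<union>closure {t. \<theta> t\<noteq>0}"
    unfolding closure_Un[symmetric] by (rule closure_mono)
   moreover have "compact (closure {t. \<eta> t\<noteq>0}\<union>closure {t. \<theta> t\<noteq>0})"
    "closure {t. \<eta> t\<noteq>0}\<union>closure {t. \<theta> t\<noteq>0}\<subseteq>{0<..<T}"
    using e th by (auto simp: test_functions_def)
   ultimately have "compact (closure {t. ?g t\<noteq>0})" "closure {t. ?g t\<noteq>0}\<subseteq>{0<..<T}"
    by (meson bounded_subset closed_closure compact_eq_bounded_closed, blast)
   then show ?thesis using C by (simp add: test_functions_def)
  qed
  have "(\<integral>t. ?g t\<partial>MT) = 0" using eg th1 by simp
  then obtain \<psi> where p: "\<psi>\<in>DT" "deriv \<psi> = ?g" by (rule test_primitive[OF T_pos g])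
  have "lip v (%t x. deriv \<psi> t * b x) = - lip 0 (%t x. \<psi> t * b x)"
   using v p(1) b unfolding trel_def by blast
  then have "lip v (%t x. ?g t * b x) = 0" unfolding p(2) LL.B_zero[OF test_LL(1)[OF p(1) b]] by simp
  moreover have "(%t x. ?g t * b x) = (%t x. \<eta> t * b x) - ?I *\<^sub>R (%t x. \<theta> t * b x)"
   by (auto simp: fun_eq_iff scaleR_fun_def algebra_simps)
  ultimately have 1: "lip v (%t x. \<eta> t * b x) = ?I * lip v (%t x. \<theta> t * b x)"
   using LL.B_diff_right[OF test_LL(1)[OF e b] LL.scale_mem[OF test_LL(1)[OF th b]] vL]
    LL.B_scale_right[OF test_LL(1)[OF th b] vL] by simp
  have "lip (%t. c) (%t x. \<eta> t * b x) = (\<integral>t. \<eta> t * ipX c b\<partial>MT)"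
   unfolding lip_iterated(1)[OF const_LL[OF cs] test_LL(1)[OF e b]] by (simp add: mult.left_commute[of _ "\<eta> _"])
  then have "lip (%t. c) (%t x. \<eta> t * b x) = ?I * lip v (%t x. \<theta> t * b x)" using cb[OF b] by simp
  with 1 show "lip (v - (%t. c)) (%t x. \<eta> t * b x) = 0"
   by (simp add: LL.B_diff[OF vL const_LL[OF cs] test_LL(1)[OF e b]])
 qed
 with cs show ?thesis by (rule that)
qed

lemma LL_nr_zero_slices: "u\<in>LL ==> LL.nr u = 0 ==> AE t in MT. X.nr (u t) = 0"
 using integral_nonneg_eq_0_iff_AE[OF slice_integrable[of u]] lip_self[of u] LL.nr_sq[of u] by simp

lemma vint_sqi: "z\<in>LL ==> vint z t\<in>sqi MX"
 unfolding vint_def by (rule aint_sqi(1)) auto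

lemma vint_modulus: "z\<in>LL ==> X.nr (vint z t - vint z s)\<le>sqrt \<bar>t - s\<bar> * LL.nr z"
proof -
 assume z: "z\<in>LL"
 have A: "X.nr (vint z t - vint z s)\<le>sqrt (t - s) * LL.nr z" if "s\<le>t" for s t
 proof -
  have "(X.nr (vint z t - vint z s))^2\<le>(sqrt (t - s) * LL.nr z)^2"
   using vint_continuous[OF z that] that by (simp add: power_mult_distrib)
  then show ?thesis by (rule power2_le_imp_le) (use that LL.nr_nonneg[OF z] in simp)
 qed
 show ?thesis
  using A[of s t] A[of t s] X.nr_diff_commute[OF vint_sqi[OF z] vint_sqi[OF z], of t s] by (cases "s\<le>t") auto
qed

lemma vint_tendsto:
 assumes z: "z\<in>LL" shows "((%s. X.nr (vint z s - vint z t)) \<longlongrightarrow> 0) (at t within S)"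
proof (rule Lim_null_comparison)
 show "\<forall>\<^sub>F s in at t within S. norm (X.nr (vint z s - vint z t))\<le>sqrt \<bar>s - t\<bar> * LL.nr z"
  using vint_modulus[OF z] X.nr_nonneg[OF X.diff_mem[OF vint_sqi[OF z] vint_sqi[OF z]]] by simp
 have "((%s. sqrt \<bar>s - t\<bar> * LL.nr z) \<longlongrightarrow> sqrt \<bar>t - t\<bar> * LL.nr z) (at t within S)"
  by (intro tendsto_intros)
 then show "((%s. sqrt \<bar>s - t\<bar> * LL.nr z) \<longlongrightarrow> 0) (at t within S)" by simp
qed

text \<open>The continuous representative hidden in \<open>vanishes_at\<close> and the explicit
  continuous function c + \<open>vint z\<close> agree at almost every time. Times of agreement
  accumulate at t_0, so both have the same value there.\<close>

lemma vanishes_at_value: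
 assumes y: "y\<in>LL" and c: "c\<in>sqi MX" and z: "z\<in>LL" and eq: "LL.nr (y - ((%t. c) + vint z)) = 0"
  and t0: "t0\<in>{0..T}" and van: "vanishes_at T (L2 \<Omega>) y t0"
 shows "X.nr (c + vint z t0) = 0"
proof -
 obtain yc where yc: "\<And>t. t\<in>{0..T} ==> yc t\<in>sqi MX"
  "\<And>t. t\<in>{0..T} ==> ((%s. X.nr (yc s - yc t)) \<longlongrightarrow> 0) (at t within {0..T})"
  "AE t in MT. X.nr (y t - yc t) = 0" "X.nr (yc t0) = 0"
  using van unfolding vanishes_at_def elems_L2 nrm_L2_X by blast
 have L: "(%t. c) + vint z\<in>LL" by (intro LL.add_mem const_LL vint_LL c z)
 define w where "w = (%t. c + vint z t)"
 have wx: "w t\<in>sqi MX" for t unfolding w_def by (intro X.add_mem c vint_sqi z)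
 have tT: "AE t in MT. t\<in>{0<..<T}" by (rule AE_I2) simp
 have "AE t in MT. X.nr (yc t - w t) = 0"
  using LL_nr_zero_slices[OF LL.diff_mem[OF y L] eq] yc(3) LL_slice[OF y] tT
 proof eventually_elim
  case (elim t)
  have ycx: "yc t\<in>sqi MX" using elim(4) by (intro yc(1)) auto
  have "X.nr (yc t - w t)\<le>X.nr (yc t - y t) + X.nr (y t - w t)" by (rule X.nr_diff_triangle[OF ycx elim(3) wx])
  then show ?case
   using elim(1,2) X.nr_diff_commute[OF ycx elim(3)] X.nr_nonneg[OF X.diff_mem[OF ycx wx[of t]]] by (simp add: w_def)
 qed
 then have good: "AE t in lborel. t\<in>{0<..<T}\<longrightarrow>X.nr (yc t - w t) = 0" unfolding AE_leb_iff[OF IT] .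
 have "X.nr (w t0)\<le>0 + e" if e: "e > 0" for e
 proof -
  have "\<forall>\<^sub>F s in at t0 within {0..T}. X.nr (yc s - yc t0) < e / 2"
   using e by (intro order_tendstoD(2)[OF yc(2)[OF t0]]) simp
  then obtain d1 where d1: "d1 > 0" "\<And>s. s\<in>{0..T} ==> s\<noteq>t0 ==> dist s t0 < d1 ==> X.nr (yc s - yc t0) < e / 2"
   unfolding eventually_at by blast
  have "\<forall>\<^sub>F s in at t0 within {0..T}. X.nr (vint z s - vint z t0) < e / 2"
   using e by (intro order_tendstoD(2)[OF vint_tendsto[OF z]]) simp
  then obtain d2 where d2: "d2 > 0" "\<And>s. s\<in>{0..T} ==> s\<noteq>t0 ==> dist s t0 < d2 ==> X.nr (vint z s - vint z t0) < e / 2"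
   unfolding eventually_at by blast
  \<comment> \<open>An interval around t_0, cut off at 0 and T. It has positive length even if t_0
    is an end point, hence contains a time of agreement other than t_0.\<close>
  define l where "l = max 0 (t0 - min d1 d2)"
  define r where "r = min T (t0 + min d1 d2)"
  have lr: "l < r" using t0 T_pos d1(1) d2(1) by (auto simp: l_def r_def)
  have "\<exists>s\<in>{l<..<r} - {t0}. X.nr (yc s - w s) = 0"
  proof (rule ccontr)
   assume *: "\<not> ?thesis"
   have "AE t in lborel. t\<notin>{l<..<r}"
    using good AE_lborel_singleton[of t0]
    by eventually_elim (use * in \<open>auto simp: l_def r_def\<close>)
   then have "emeasure lborel {l<..<r} = 0"
    by (subst (asm) AE_iff_measurable[of "{l<..<r}"]) auto
   then show False using lr by simp
  qed
  then obtain s where s: "s\<in>{l<..<r}" "s\<noteq>t0" "X.nr (yc s - w s) = 0" by blast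
  have sT: "s\<in>{0..T}" "dist s t0 < d1" "dist s t0 < d2"
   using s(1) t0 by (auto simp: l_def r_def dist_real_def)
  have wd: "w s - w t0 = vint z s - vint z t0" by (simp add: w_def)
  have "X.nr (w t0)\<le>X.nr (w s) + X.nr (w t0 - w s)" by (rule X.nr_le_add_diff[OF wx wx])
  moreover have "X.nr (w s)\<le>X.nr (yc s) + X.nr (w s - yc s)" by (rule X.nr_le_add_diff[OF wx yc(1)[OF sT(1)]])
  moreover have "X.nr (yc s)\<le>X.nr (yc t0) + X.nr (yc s - yc t0)"
   by (rule X.nr_le_add_diff[OF yc(1)[OF sT(1)] yc(1)[OF t0]])
  ultimately show ?thesis
   using d1(2)[OF sT(1) s(2) sT(2)] d2(2)[OF sT(1) s(2) sT(3)] s(3) yc(4)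
    X.nr_diff_commute[OF wx yc(1)[OF sT(1)], of s] X.nr_diff_commute[OF wx wx, of t0 s] wd by simp
 qed
 then have "X.nr (w t0)\<le>0" by (rule field_le_epsilon)
 then show ?thesis using X.nr_nonneg[OF wx[of t0]] by (simp add: w_def)
qed

lemma elems_vanishing: "elems (H1L2_vanishing T \<Omega> t0) = {y\<in>Tr.gdom. vanishes_at T (L2 \<Omega>) y t0}"
 by (simp add: H1L2_vanishing_def elems_H1L2)

text \<open>The difference of y and the primitive of its derivative has derivative zero, hence is
  constant in time.\<close>

lemma trel_structure:
 assumes "trel y z"
 obtains c where "c\<in>sqi MX" "LL.nr (y - ((%t. c) + vint z)) = 0"
proof -
 have "trel (y - vint z) 0" using trel_diff[OF assms vint_trel[OF trel_LL(2)[OF assms]]] by simp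
 then obtain c where c: "c\<in>sqi MX" "LL.nr (y - vint z - (%t. c)) = 0" by (rule trel_zero_const)
 show ?thesis by (rule that[OF c(1)]) (use c(2) in \<open>simp add: algebra_simps\<close>)
qed

lemma vanishing_zero:
 assumes y: "trel y z" and van: "vanishes_at T (L2 \<Omega>) y 0"
 shows "LL.nr (y - vint z) = 0"
proof -
 note m = trel_LL[OF y]
 obtain c where c: "c\<in>sqi MX" "LL.nr (y - ((%t. c) + vint z)) = 0" by (rule trel_structure[OF y])
 have "X.nr (c + vint z 0) = 0" by (rule vanishes_at_value[OF m(1) c(1) m(2) c(2) _ van]) (use T_pos in simp)
 then have "LL.nr (%t. c) = 0" using const_nr[OF c(1)] by (simp add: vint_zero)
 moreover have "LL.nr (y - vint z)\<le>LL.nr (%t. c) + LL.nr (y - vint z - (%t. c))"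
  by (intro LL.nr_le_add_diff LL.diff_mem m(1) vint_LL m(2) const_LL c)
 moreover have "y - vint z - (%t. c) = y - ((%t. c) + vint z)" by (simp add: algebra_simps)
 ultimately show ?thesis using c(2) LL.nr_nonneg[OF LL.diff_mem[OF m(1) vint_LL[OF m(2)]]] by simp
qed

lemma vint_T: "vint z T = aint UNIV z"
proof
 fix x show "vint z T x = aint UNIV z x"
  unfolding vint_def aint_def by (rule integral_cong') auto
qed

text \<open>The terminal condition fixes the constant of integration, so y is minus the backward
  primitive of its derivative.\<close>

lemma vanishing_T:
 assumes y: "trel y z" and van: "vanishes_at T (L2 \<Omega>) y T"
 shows "LL.nr (y + vintR z) = 0"
proof -
 note m = trel_LL[OF y]
 obtain c where c: "c\<in>sqi MX" "LL.nr (y - ((%t. c) + vint z)) = 0" by (rule trel_structure[OF y])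
 have "X.nr (c + vint z T) = 0" by (rule vanishes_at_value[OF m(1) c(1) m(2) c(2) _ van]) (use T_pos in simp)
 then have n: "LL.nr (%t. c + aint UNIV z) = 0"
  using const_nr[OF X.add_mem[OF c(1) aint_UNIV_sqi[OF m(2)]]] by (simp add: vint_T)
 have d: "y + vintR z - (%t. c + aint UNIV z) = y - ((%t. c) + vint z)"
  by (auto simp: vintR_def fun_eq_iff)
 have "LL.nr (y + vintR z)\<le>LL.nr (%t. c + aint UNIV z) + LL.nr (y + vintR z - (%t. c + aint UNIV z))"
  by (intro LL.nr_le_add_diff LL.add_mem m(1) vintR_LL m(2) const_LL X.add_mem c(1) aint_UNIV_sqi)
 then show ?thesis
  using n c(2) LL.nr_nonneg[OF LL.add_mem[OF m(1) vintR_LL[OF m(2)]]] unfolding d by simp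
qed

lemma vint_vanishing: "z\<in>LL ==> vint z\<in>elems (H1L2_vanishing T \<Omega> 0)"
 unfolding elems_vanishing
proof (intro CollectI conjI)
 assume z: "z\<in>LL"
 show "vint z\<in>Tr.gdom" by (rule Tr_gdomI[OF vint_trel[OF z]])
 show "vanishes_at T (L2 \<Omega>) (vint z) 0"
  unfolding vanishes_at_def elems_L2 nrm_L2_X
  by (rule exI[of _ "vint z"]) (auto simp: vint_sqi[OF z] vint_tendsto[OF z] vint_zero X.nr_zero)
qed

lemma vintR_vanishing: "z\<in>LL ==> vintR z\<in>elems (H1L2_vanishing T \<Omega> T)"
 unfolding elems_vanishing
proof (intro CollectI conjI)
 assume z: "z\<in>LL"
 show "vintR z\<in>Tr.gdom" by (rule Tr_gdomI[OF vintR_trel[OF z]])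
 have x: "vintR z t\<in>sqi MX" for t unfolding vintR_def by (intro X.diff_mem aint_UNIV_sqi vint_sqi z)
 have d: "X.nr (vintR z s - vintR z t) = X.nr (vint z s - vint z t)" for s t
  using X.nr_diff_commute[OF vint_sqi[OF z] vint_sqi[OF z], of s t] by (simp add: vintR_def)
 have v0: "vintR z T = 0" by (simp add: vintR_def vint_T)
 show "vanishes_at T (L2 \<Omega>) (vintR z) T"
  unfolding vanishes_at_def elems_L2 nrm_L2_X
  by (rule exI[of _ "vintR z"]) (auto simp: x d vint_tendsto[OF z] v0 X.nr_zero)
qed

text \<open>The bound is uniform in t; it puts the multiplier, dominated by \<xi>/\<epsilon>, into
  L^\<infinity>(0,T;L^2(\<Omega>)).\<close>

lemma vintR_bounded:
 assumes z: "z\<in>LL" shows "X.nr (vintR z t)\<le>2 * (sqrt T * LL.nr z)"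
proof -
 have A: "X.nr (aint A z)\<le>sqrt T * LL.nr z" if A: "A\<in>sets borel" for A
 proof -
  have "(X.nr (aint A z))^2\<le>T * (LL.nr z)^2"
   using aint_bound(2)[OF A z] mult_right_mono[OF ind_le_T[OF A], of "(LL.nr z)^2"] by simp
  also have "\<dots> = (sqrt T * LL.nr z)^2" using T_pos by (simp add: power_mult_distrib)
  finally show ?thesis by (rule power2_le_imp_le) (use T_pos LL.nr_nonneg[OF z] in simp)
 qed
 have "X.nr (vintR z t)\<le>X.nr (aint UNIV z) + X.nr (vint z t)"
  unfolding vintR_def by (intro X.nr_triangle_diff aint_UNIV_sqi vint_sqi z)
 then show ?thesis using A[of UNIV] A[of "{..<t}"] by (simp add: vint_def)
qed

end

section \<open>Directional derivatives of Nemytskii operators and of the maximum\<close>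

section \<open>Superposition operators\<close>

context bounded_cylinder
begin

lemma LL_meas: "u\<in>LL ==> case_prod u\<in>meas MC"
 by (rule sqi_meas[OF LL_D])

lemma LL_dominated:
 assumes u: "u\<in>LL" and v: "case_prod v\<in>meas MC" and le: "AE p in MC. \<bar>case_prod v p\<bar>\<le>C * \<bar>case_prod u p\<bar>"
 shows "v\<in>LL"
 unfolding LL_def using sqi_bounded[OF LL_D[OF u] v le] by simp

lemma const_fun_LL: "(%t x. c)\<in>LL"
 unfolding LL_def using sqi_const[OF fin_MC, of c] by (simp add: case_prod_unfold)

lemma comp_meas: "g\<in>meas borel ==> case_prod u\<in>meas MC ==>
  case_prod (%t x. g (u t x))\<in>meas MC"
 using measurable_compose[of "case_prod u" MC borel g borel] by (simp add: case_prod_unfold)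

lemma lipschitz_borel: "L-lipschitz_on UNIV g ==> (g :: real=>real)\<in>meas borel"
 by (intro borel_measurable_continuous_onI lipschitz_on_continuous_on)

lemma lipschitz_comp_LL:
 assumes g: "L-lipschitz_on UNIV (g :: real=>real)" and u: "u\<in>LL"
 shows "(%t x. g (u t x))\<in>LL"
proof -
 have "(%t x. g (u t x)) - (%t x. g 0)\<in>LL"
 proof (rule LL_dominated[OF u])
  show "case_prod ((%t x. g (u t x)) - (%t x. g 0))\<in>meas MC"
   using borel_measurable_diff[OF comp_meas[OF lipschitz_borel[OF g] LL_meas[OF u]], of "%p. g 0"] by (simp add: case_prod_unfold)
  show "AE p in MC. \<bar>case_prod ((%t x. g (u t x)) - (%t x. g 0)) p\<bar>\<le>L * \<bar>case_prod u p\<bar>"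
   using lipschitz_onD[OF g, of _ 0] by (auto simp: dist_real_def)
 qed
 from LL.add_mem[OF this const_fun_LL[of "g 0"]] show ?thesis by simp
qed

lemma nrw_mono:
 assumes u: "u\<in>LL" and v: "v\<in>LL" and C: "C\<ge>0" and le: "AE p in MC. \<bar>case_prod u p\<bar>\<le>C * \<bar>case_prod v p\<bar>"
 shows "nrw k u\<le>C * nrw k v"
 unfolding nrw_def
proof (rule LL_nr_mono[OF wt_LL[OF u] wt_LL[OF v] C])
 show "AE p in MC. \<bar>case_prod (wt k u) p\<bar>\<le>C * \<bar>case_prod (wt k v) p\<bar>"
  using le
 proof eventually_elim
  case (elim p)
  obtain t x where p: "p = (t, x)" by (cases p)
  show ?case using mult_left_mono[OF elim, of "exp (- (k * t) / 2)"]
   by (simp add: p wt_def scaleR_fun_def abs_mult algebra_simps)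
 qed
qed

text \<open>Only the values of the difference quotients along the fixed direction \<open>h\<close> matter, because
 the Lipschitz bound controls the deviation of \<open>yt s\<close> from \<open>y + s h\<close>.\<close>

lemma superposition_dir_deriv:
 assumes L: "L-lipschitz_on UNIV (g :: real=>real)" and y: "y\<in>LL" and h: "h\<in>LL"
  and yt: "\<And>s::real. s > 0 ==> yt s\<in>LL"
  and lim: "((%s. LL.nr ((1 / s) *\<^sub>R (yt s - y) - h)) \<longlongrightarrow> 0) (at_right 0)"
  and d: "case_prod d\<in>meas MC"
  and dd: "AE p in MC. ((%s. (g (case_prod y p + s * case_prod h p) - g (case_prod y p)) / s) \<longlongrightarrow> case_prod d p) (at_right 0)"
 shows "d\<in>LL"
  and "((%s. LL.nr ((1 / s) *\<^sub>R ((%t x. g (yt s t x)) - (%t x. g (y t x))) - d)) \<longlongrightarrow> 0) (at_right 0)"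
proof -
 have L0: "L\<ge>0" by (rule lipschitz_on_nonneg[OF L])
 have gd: "\<bar>g a - g b\<bar>\<le>L * \<bar>a - b\<bar>" for a b using lipschitz_onD[OF L, of a b] by (simp add: dist_real_def)
 have gd': "\<bar>(g (a + s * b) - g a) / s\<bar>\<le>L * \<bar>b\<bar>" if "s > 0" for s a b :: real
  using gd[of "a + s * b" a] that by (simp add: abs_mult field_simps)
 have db: "AE p in MC. \<bar>case_prod d p\<bar>\<le>L * \<bar>case_prod h p\<bar>"
  using dd
 proof eventually_elim
  case (elim p)
  have ev: "\<forall>\<^sub>F s::real in at_right 0. s > 0" by (simp add: eventually_at_filter)
  from ev have ev': "\<forall>\<^sub>F s in at_right 0. \<bar>(g (case_prod y p + s * case_prod h p) - g (case_prod y p)) / s\<bar>\<le>L * \<bar>case_prod h p\<bar>"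
   by eventually_elim (rule gd')
  show ?case by (rule tendsto_le[OF _ tendsto_const tendsto_rabs[OF elim] ev']) simp
 qed
 show dL: "d\<in>LL" by (rule LL_dominated[OF h d db])
 \<comment> \<open>The superposition along the straight line y + s h. Pointwise difference quotients
   converge here, while the deviation of \<open>yt s\<close> from the line is absorbed by the
   Lipschitz constant.\<close>
 define q where "q s = (%t x. g (y t x + s * h t x))" for s :: real
 have qL: "q s\<in>LL" for s
  using lipschitz_comp_LL[OF L LL.add_mem[OF y LL.scale_mem[OF h, of s]]] by (simp add: q_def scaleR_fun_def)
 have gyL: "(%t x. g (y t x))\<in>LL" by (rule lipschitz_comp_LL[OF L y])
 define D where "D s = (1 / s) *\<^sub>R (q s - (%t x. g (y t x))) - d" for s :: real
 have DL: "D s\<in>LL" for s unfolding D_def by (intro LL.diff_mem LL.scale_mem qL gyL dL)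
 have Dlim: "((%s. LL.nr (D s)) \<longlongrightarrow> 0) (at_right 0)"
  unfolding tendsto_at_iff_sequentially
 proof (intro allI impI)
  fix S :: "nat=>real" assume S: "\<forall>i. S i\<in>{0<..} - {0}" "nullseq S"
  have Sp: "S i > 0" for i using S(1) by auto
  have fS: "filterlim S (at_right 0) sequentially"
   using S(2) Sp less_imp_neq[OF Sp] by (simp add: filterlim_at)
  have "(%i. \<integral>p. case_prod (D (S i)) p * case_prod (D (S i)) p\<partial>MC) \<longlonglongrightarrow> (\<integral>p. 0\<partial>MC)"
  \<comment> \<open>L |h| bounds both the quotients and their limit, whence the factor 2 L.\<close>
  proof (rule integral_dominated_convergence[where w = "%p. (2 * L)^2 * (case_prod h p)^2"])
   show "(%p. case_prod (D (S i)) p * case_prod (D (S i)) p)\<in>meas MC" for i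
    using LL_meas[OF DL] by simp
   show "integrable MC (%p. (2 * L)^2 * (case_prod h p)^2)"
    using sqi_int[OF LL_D[OF h]] by simp
   show "AE p in MC. nullseq (%i. case_prod (D (S i)) p * case_prod (D (S i)) p)"
    using dd
   proof eventually_elim
    case (elim p)
    have "nullseq (%i. case_prod (D (S i)) p)"
     using tendsto_diff[OF filterlim_compose[OF elim fS] tendsto_const[of "case_prod d p"]]
     by (simp add: D_def q_def scaleR_fun_def case_prod_unfold divide_inverse mult.commute)
    from tendsto_mult[OF this this] show ?case by simp
   qed
   show "AE p in MC. norm (case_prod (D (S i)) p * case_prod (D (S i)) p)\<le>(2 * L)^2 * (case_prod h p)^2" for i
    using db
   proof eventually_elim
    case (elim p)
    obtain t x where p: "p = (t, x)" by (cases p)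
    have "\<bar>case_prod (D (S i)) p\<bar>\<le>2 * L * \<bar>case_prod h p\<bar>"
    proof -
     have "case_prod (D (S i)) p = (g (y t x + S i * h t x) - g (y t x)) / S i - d t x"
      by (simp add: D_def q_def scaleR_fun_def p)
     then show ?thesis
      using gd'[OF Sp, of "y t x" i "h t x"] elim
       abs_triangle_ineq4[of "(g (y t x + S i * h t x) - g (y t x)) / S i" "d t x"] by (simp add: p)
    qed
    then have "\<bar>case_prod (D (S i)) p\<bar>\<^sup>2\<le>(2 * L * \<bar>case_prod h p\<bar>)^2" by (rule power_mono) simp
    then show ?case by (simp add: power_mult_distrib power2_eq_square mult_ac)
   qed
  qed auto
  then have "(%i. sqrt (lip (D (S i)) (D (S i)))) \<longlonglongrightarrow> sqrt 0"
   unfolding lip_def by (intro tendsto_real_sqrt) simp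
  then show "nullseq ((%s. LL.nr (D s))\<circ>S)" by (simp add: LL.nr_def o_def)
 qed
 define E where "E s = (1 / s) *\<^sub>R (yt s - y) - h" for s :: real
 show "((%s. LL.nr ((1 / s) *\<^sub>R ((%t x. g (yt s t x)) - (%t x. g (y t x))) - d)) \<longlongrightarrow> 0) (at_right 0)"
 proof (rule Lim_null_comparison)
  show "\<forall>\<^sub>F s in at_right 0. norm (LL.nr ((1 / s) *\<^sub>R ((%t x. g (yt s t x)) - (%t x. g (y t x))) - d))
   \<le>L * LL.nr (E s) + LL.nr (D s)"
   unfolding eventually_at_filter
  proof (intro always_eventually allI impI)
   fix s :: real assume t: "s\<in>{0<..}" "s\<noteq>0"
   then have tp: "s > 0" by simp
   let ?g = "%t x. g (yt s t x)"
   have gL: "?g\<in>LL" by (rule lipschitz_comp_LL[OF L yt[OF tp]])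
   have EL: "E s\<in>LL" unfolding E_def by (intro LL.diff_mem LL.scale_mem yt[OF tp] y h)
   let ?F = "(1 / s) *\<^sub>R (?g - q s)"
   have FL: "?F\<in>LL" by (intro LL.scale_mem LL.diff_mem gL qL)
   have eq: "(1 / s) *\<^sub>R (?g - (%t x. g (y t x))) - d = ?F + D s"
    by (simp add: D_def scaleR_right_diff_distrib)
   have "LL.nr ?F\<le>L * LL.nr (E s)"
   proof (rule LL_nr_mono[OF FL EL L0], rule AE_I2)
    fix p :: "real\<times>(real^'n)"
    obtain t x where p: "p = (t, x)" by (cases p)
    have "\<bar>g (yt s t x) - g (y t x + s * h t x)\<bar>\<le>L * \<bar>yt s t x - (y t x + s * h t x)\<bar>" by (rule gd)
    also have "yt s t x - (y t x + s * h t x) = s * E s t x"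
     using tp by (simp add: E_def scaleR_fun_def field_simps)
    finally show "\<bar>case_prod ?F p\<bar>\<le>L * \<bar>case_prod (E s) p\<bar>"
     using tp by (simp add: p scaleR_fun_def q_def abs_mult field_simps)
   qed
   then show "norm (LL.nr ((1 / s) *\<^sub>R (?g - (%t x. g (y t x))) - d))\<le>L * LL.nr (E s) + LL.nr (D s)"
    unfolding eq using LL.nr_triangle[OF FL DL[of s]] LL.nr_nonneg[OF LL.add_mem[OF FL DL[of s]]] by simp
  qed
  have "((%s. L * LL.nr (E s) + LL.nr (D s)) \<longlongrightarrow> L * 0 + 0) (at_right 0)"
   using lim unfolding E_def[symmetric] by (intro tendsto_intros Dlim)
  then show "((%s. L * LL.nr (E s) + LL.nr (D s)) \<longlongrightarrow> 0) (at_right 0)" by simp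
 qed
qed

end

text \<open>The directional derivative of max(., 0) at z. It is nonlinear in h exactly for z = 0,
  and there the multiplier is only confined to an interval.\<close>

definition max_dir :: "real=>real=>real" where
 "max_dir z h = (if z > 0 then h else if z = 0 then max h 0 else 0)"

lemma max_dir_deriv: "((%s. (max (z + s * h) 0 - max z 0) / s) \<longlongrightarrow> max_dir z h) (at_right 0)"
proof -
 have pos: "\<forall>\<^sub>F s::real in at_right 0. s > 0" by (simp add: eventually_at_filter)
 have lim: "((%s. z + s * h) \<longlongrightarrow> z + 0 * h) (at_right 0)" by (intro tendsto_intros)
 have "\<forall>\<^sub>F s in at_right 0. (max (z + s * h) 0 - max z 0) / s = max_dir z h"
 proof -
  consider "z > 0" | "z = 0" | "z < 0" by linarith
  then show ?thesis
  proof cases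
   case 1
   then have "\<forall>\<^sub>F s in at_right 0. z + s * h > 0" using order_tendstoD(1)[OF lim, of 0] by simp
   with pos show ?thesis by eventually_elim (use 1 in \<open>simp add: max_dir_def\<close>)
  next
   case 2
   from pos show ?thesis
    by eventually_elim (use 2 in \<open>auto simp: max_dir_def max_def mult_le_0_iff zero_le_mult_iff\<close>)
  next
   case 3
   then have "\<forall>\<^sub>F s in at_right 0. z + s * h < 0" using order_tendstoD(2)[OF lim, of 0] by simp
   then show ?thesis by eventually_elim (use 3 in \<open>simp add: max_dir_def\<close>)
  qed
 qed
 then show ?thesis by (rule tendsto_eventually)
qed

lemma max_dir_lipschitz: "\<bar>max_dir z h - max_dir z h'\<bar>\<le>\<bar>h - h'\<bar>"
 by (auto simp: max_dir_def)

lemma max_lipschitz: "1-lipschitz_on UNIV (%z::real. max z 0)"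
 by (auto intro!: lipschitz_onI simp: dist_real_def)

lemma (in bounded_cylinder) max_dir_LL:
 assumes z: "z\<in>LL" and h: "h\<in>LL"
 shows "(%t x. max_dir (z t x) (h t x))\<in>LL"
proof (rule LL_dominated[OF h])
 have "case_prod (%t x. max_dir (z t x) (h t x)) = (%p. if case_prod z p > 0 then case_prod h p else if case_prod z p = 0 then max (case_prod h p) 0 else 0)"
  by (auto simp: max_dir_def)
 also have "\<dots>\<in>meas MC"
  using LL_meas[OF z] LL_meas[OF h] by measurable
 finally show "case_prod (%t x. max_dir (z t x) (h t x))\<in>meas MC" .
 show "AE p in MC. \<bar>case_prod (%t x. max_dir (z t x) (h t x)) p\<bar>\<le>1 * \<bar>case_prod h p\<bar>"
  by (auto simp: max_dir_def case_prod_unfold)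
qed

context
 fixes L n :: real and f :: "real=>real"
 assumes f: "nonsmooth_function L n f"
begin

lemma nonsmooth_lipschitz: "L-lipschitz_on UNIV f" and nonsmooth_DERIV: "x\<noteq>n ==> (f has_real_derivative deriv f x) (at x)"
proof -
 show "L-lipschitz_on UNIV f" using f by (simp add: nonsmooth_function_def)
 assume "x\<noteq>n"
 then have "f differentiable (at x)" using f unfolding nonsmooth_function_def by blast
 then show "(f has_real_derivative deriv f x) (at x)" using DERIV_deriv_iff_real_differentiable by blast
qed

lemma nonsmooth_deriv_borel: "deriv f\<in>meas borel"
proof -
 \<comment> \<open>At the point n the difference quotients have no reason to converge to
   \<open>deriv f n\<close>, so this value is inserted by hand.\<close>
 define F where "F i x = (if x = n then deriv f n else (f (x + 1 / real (Suc i)) - f x) / (1 / real (Suc i)))" for i x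
 have fb: "f\<in>meas borel"
  by (intro borel_measurable_continuous_onI lipschitz_on_continuous_on[OF nonsmooth_lipschitz])
 show ?thesis
 proof (rule borel_measurable_LIMSEQ_metric[of F])
  show "F i\<in>meas borel" for i unfolding F_def using fb by measurable
  fix x
  show "(%i. F i x) \<longlonglongrightarrow> deriv f x"
  proof (cases "x = n")
   case False
   have "((%h. (f (x + h) - f x) / h) \<longlongrightarrow> deriv f x) (at 0)"
    using nonsmooth_DERIV[OF False] by (simp add: DERIV_def)
   moreover have "filterlim (%i. 1 / real (Suc i)) (at 0) sequentially"
    using LIMSEQ_inverse_real_of_nat by (simp add: filterlim_at divide_inverse)
   ultimately show ?thesis using False filterlim_compose by (fastforce simp: F_def)
  qed (simp add: F_def)
 qed
qed

lemma nonsmooth_dir_deriv: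
 assumes "y\<noteq>n"
 shows "((%s. (f (y + s * h) - f y) / s) \<longlongrightarrow> deriv f y * h) (at_right 0)"
proof -
 have "((%s. f (y + s * h)) has_real_derivative deriv f y * h) (at 0)"
 proof (rule DERIV_chain'[where g = f, of "%s. y + s * h"])
  show "((%s. y + s * h) has_real_derivative h) (at 0)" by (auto intro!: derivative_eq_intros)
  show "(f has_real_derivative deriv f y) (at (y + 0 * h))" using nonsmooth_DERIV[OF assms] by simp
 qed
 then have "((%s. (f (y + s * h) - f y) / s) \<longlongrightarrow> deriv f y * h) (at 0)" by (simp add: DERIV_def)
 then show ?thesis by (rule tendsto_within_subset) auto
qed

lemma nonsmooth_deriv_bound: "x\<noteq>n ==> \<bar>deriv f x\<bar>\<le>L"
proof -
 assume x: "x\<noteq>n"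
 have "\<forall>\<^sub>F h in at 0. \<bar>(f (x + h) - f x) / h\<bar>\<le>L"
 proof (simp add: eventually_at_filter, intro always_eventually allI impI)
  fix h :: real assume "h\<noteq>0"
  then show "\<bar>f (x + h) - f x\<bar> / \<bar>h\<bar>\<le>L"
   using lipschitz_onD[OF nonsmooth_lipschitz, of "x + h" x] by (simp add: dist_real_def field_simps)
 qed
 then show ?thesis
  by (intro tendsto_le[OF _ tendsto_const tendsto_rabs[OF nonsmooth_DERIV[OF x, unfolded DERIV_def]]]) auto
qed

end

section \<open>Existence and stability for equations \<open>g = N (vint g)\<close>, and history
  operators as an instance\<close>

section \<open>Volterra equations\<close>

context bounded_cylinder
begin

lemma nrw_diff_vint:
 assumes u: "u\<in>LL" and v: "v\<in>LL" and k: "k > 0"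
 shows "nrw k (vint u - vint v)\<le>sqrt (T / k) * nrw k (u - v)"
proof -
 have m: "vint (u - v)\<in>LL" "vint u - vint v\<in>LL" by (intro vint_LL LL.diff_mem u v)+
 have "nrw k (vint (u - v) - (vint u - vint v)) = 0"
  using nrw_le[OF LL.diff_mem[OF m], of k] vint_diff[OF u v] k LL.nr_nonneg[OF wt_LL[OF LL.diff_mem[OF m], of k]]
  by (simp add: nrw_def)
 then have "nrw k (vint u - vint v) = nrw k (vint (u - v))"
  unfolding nrw_def wt_diff[of k "vint (u - v)"] by (rule LL.nr_cong[OF wt_LL[OF m(1)] wt_LL[OF m(2)], symmetric])
 also have "\<dots>\<le>sqrt (T / k) * nrw k (u - v)" by (rule vint_weighted[OF LL.diff_mem[OF u v] k])
 finally show ?thesis .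
qed

text \<open>One Lipschitz constant for all weights k \<ge> 1. Independence of k is a quantitative
  form of causality: the contraction argument may choose k after the constant is known.\<close>

definition wlip :: "real=>('n evol=>'n evol)=>bool" where
 "wlip C N \<longleftrightarrow> C\<ge>0\<and>(\<forall>u\<in>LL. N u\<in>LL) \<and>
  (\<forall>k\<ge>1. \<forall>u\<in>LL. \<forall>v\<in>LL. nrw k (N u - N v)\<le>C * nrw k (u - v))"

text \<open>A weight k for which C sqrt(T/k) is at most 1/2.\<close>

definition vrate :: "real=>real" where
 "vrate C = max 1 (4 * C\<^sup>2 * T)"

lemma volterra_step:
 assumes N: "wlip C N" and u: "u\<in>LL" and v: "v\<in>LL"
 shows "nrw (vrate C) (N (vint u) - N (vint v))\<le>1/2 * nrw (vrate C) (u - v)"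
proof -
 let ?k = "vrate C"
 have k: "?k\<ge>1" "4 * C\<^sup>2 * T\<le>?k" by (auto simp: vrate_def)
 have C: "C\<ge>0" using N by (simp add: wlip_def)
 have "(C * sqrt (T / ?k))^2\<le>(1/2)^2"
  using k T_pos by (simp add: power_mult_distrib field_simps power2_eq_square)
 then have le: "C * sqrt (T / ?k)\<le>1/2" by (rule power2_le_imp_le) simp
 have "nrw ?k (N (vint u) - N (vint v))\<le>C * nrw ?k (vint u - vint v)"
  using N k(1) vint_LL[OF u] vint_LL[OF v] by (simp add: wlip_def)
 also have "\<dots>\<le>C * (sqrt (T / ?k) * nrw ?k (u - v))"
  using C k(1) by (intro mult_left_mono nrw_diff_vint u v) auto
 also have "\<dots>\<le>1/2 * nrw ?k (u - v)"
  using mult_right_mono[OF le, of "nrw ?k (u - v)"] LL.nr_nonneg[OF wt_LL[OF LL.diff_mem[OF u v], of ?k]]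
  by (simp add: nrw_def mult.assoc)
 finally show ?thesis .
qed

lemma wlip_LL: "wlip C N ==> u\<in>LL ==> N u\<in>LL"
 by (simp add: wlip_def)

lemma volterra_exists:
 assumes N: "wlip C N"
 obtains g where "g\<in>LL" "LL.nr (g - N (vint g)) = 0"
proof -
 let ?k = "vrate C"
 interpret K: semi_hilbert LL "lipw ?k" by (rule semi_hilbert_lipw)
 have K: "K.nr = nrw ?k" by (simp add: fun_eq_iff K.nr_def nrw_def LL.nr_def lipw_def)
 have m: "N (vint u)\<in>LL" if "u\<in>LL" for u by (rule wlip_LL[OF N vint_LL[OF that]])
 obtain g where g: "g\<in>LL" "K.nr (N (vint g) - g) = 0"
  by (rule K.contraction_fixed_point[of "%u. N (vint u)"]) (auto simp: m K intro!: volterra_step[OF N, simplified])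
 have d: "N (vint g) - g\<in>LL" by (intro LL.diff_mem m g)
 have "LL.nr (N (vint g) - g) = 0"
  using LL_nr_le_nrw[OF d, of ?k] g(2) LL.nr_nonneg[OF d] by (simp add: K)
 then show ?thesis using that[OF g(1)] LL.nr_diff_commute[OF g(1) m[OF g(1)]] by simp
qed

text \<open>Neither function has to be a solution: their distance is bounded by the difference of
  their residuals, because \<open>volterra_step\<close> absorbs half of the weighted distance. The
  Lipschitz estimates for the linearized equation and the convergence of difference quotients both
  rest on this.\<close>

lemma volterra_stable:
 assumes N: "wlip C N" and u: "u\<in>LL" and v: "v\<in>LL"
 shows "LL.nr (u - v)\<le>2 * exp (vrate C * T / 2) * LL.nr ((u - N (vint u)) - (v - N (vint v)))"
proof -
 let ?k = "vrate C"
 have k: "?k\<ge>1" by (auto simp: vrate_def)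
 have m: "N (vint u)\<in>LL" "N (vint v)\<in>LL" by (intro wlip_LL[OF N vint_LL] u v)+
 let ?d = "(u - N (vint u)) - (v - N (vint v))"
 have d: "?d\<in>LL" by (intro LL.diff_mem m u v)
 have "nrw ?k (u - v)\<le>nrw ?k (N (vint u) - N (vint v)) + nrw ?k ?d"
  unfolding nrw_def
  using LL.nr_triangle[OF wt_LL[OF LL.diff_mem[OF m]] wt_LL[OF d], of ?k ?k] by (simp add: wt_add[symmetric] algebra_simps)
 then have "nrw ?k (u - v)\<le>2 * nrw ?k ?d" using volterra_step[OF N u v] by simp
 also have "\<dots>\<le>2 * LL.nr ?d" using nrw_le[OF d, of ?k] k by simp
 finally have le: "nrw ?k (u - v)\<le>2 * LL.nr ?d" .
 have "LL.nr (u - v)\<le>exp (?k * T / 2) * nrw ?k (u - v)"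
  using LL_nr_le_nrw[OF LL.diff_mem[OF u v], of ?k] k by simp
 also have "\<dots>\<le>exp (?k * T / 2) * (2 * LL.nr ?d)" by (rule mult_left_mono[OF le]) simp
 finally show ?thesis by (simp add: mult.assoc mult.left_commute)
qed

lemma wlip_cong:
 assumes N: "wlip C N" and u: "u\<in>LL" and v: "v\<in>LL" and z: "LL.nr (u - v) = 0"
 shows "LL.nr (N u - N v) = 0"
proof -
 have d: "N u - N v\<in>LL" by (intro LL.diff_mem wlip_LL[OF N] u v)
 have "nrw 1 (N u - N v)\<le>C * nrw 1 (u - v)" using N u v by (simp add: wlip_def)
 also have "nrw 1 (u - v) = 0"
  using nrw_le[OF LL.diff_mem[OF u v], of 1] z LL.nr_nonneg[OF wt_LL[OF LL.diff_mem[OF u v], of 1]] by (simp add: nrw_def)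
 finally show ?thesis using LL_nr_le_nrw[OF d, of 1] LL.nr_nonneg[OF d]
  by (smt (z3) exp_ge_zero mult_nonneg_nonpos mult_zero_right)
qed

lemma volterra_sq_le:
 assumes v: "v\<in>LL"
 shows "(\<integral>s. indicator {..<t} s * X.nr (v s)\<partial>MT)^2\<le>T * (\<integral>s. indicator {..<t} s * (X.nr (v s))^2\<partial>MT)"
proof -
 interpret S: semi_inner "sqi MT" "%u v. \<integral>x. u x * v x\<partial>MT" by (rule semi_inner_sqi)
 have vs: "AE s in MT. 0\<le>X.nr (v s)"
  using LL_slice[OF v] by eventually_elim (rule X.nr_nonneg)
 have m2: "(%s. (X.nr (v s))^2)\<in>meas MT" by (rule borel_measurable_integrable[OF slice_integrable[OF v]])
 have eq: "X.nr (v s) = sqrt ((X.nr (v s))^2)" for s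
  by (simp add: X.nr_def integral_nonneg_AE)
 have m: "(%s. X.nr (v s))\<in>meas MT" by (subst eq) (use m2 in measurable)
 have i: "(indicator {..<t} :: real=>real)\<in>sqi MT" by (rule ind_sqi) simp
 have b: "(%s. indicator {..<t} s * X.nr (v s))\<in>sqi MT"
 proof (rule sqi_bounded[of "%s. X.nr (v s)" _ _ 1])
  show "(%s. X.nr (v s))\<in>sqi MT" using m slice_integrable[OF v] by (simp add: sqi_def)
  show "(%s. indicator {..<t} s * X.nr (v s))\<in>meas MT"
   by (intro borel_measurable_times m sqi_meas[OF i])
 qed (auto simp: indicator_def)
 let ?b = "%s. indicator {..<t} s * X.nr (v s)" and ?i = "%s. indicator {..<t} s :: real"
 have e1: "(\<integral>s. ?i s * ?b s\<partial>MT) = (\<integral>s. ?b s\<partial>MT)"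
  by (intro integral_cong') (auto simp: indicator_def)
 have e2: "(\<integral>s. ?i s * ?i s\<partial>MT) = (\<integral>s. ?i s\<partial>MT)"
  by (intro integral_cong') (auto simp: indicator_def)
 have e3: "(\<integral>s. ?b s * ?b s\<partial>MT) = (\<integral>s. indicator {..<t} s * (X.nr (v s))^2\<partial>MT)"
  by (intro integral_cong') (auto simp: indicator_def power2_eq_square)
 have "(\<integral>s. ?b s\<partial>MT)^2\<le>(\<integral>s. ?i s\<partial>MT) * (\<integral>s. indicator {..<t} s * (X.nr (v s))^2\<partial>MT)"
  using S.cauchy_schwarz_sq[OF i b] unfolding e1 e2 e3 .
 moreover have "\<dots>\<le>T * (\<integral>s. indicator {..<t} s * (X.nr (v s))^2\<partial>MT)"
  by (intro mult_right_mono ind_le_T) (auto intro!: integral_nonneg_AE)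
 ultimately show ?thesis by (rule order_trans)
qed

lemma integral_upto_eq:
 assumes t: "t\<in>{0<..<T}"
 shows "(\<integral>s. g s\<partial>leb {0<..<t}) = (\<integral>s. indicator {..<t} s * (g s :: real)\<partial>MT)"
proof -
 have "(\<integral>s. g s\<partial>leb {0<..<t}) = (\<integral>s. indicator {0<..<t} s * g s\<partial>lebesgue)"
  by (subst integral_restrict_space) auto
 also have "\<dots> = (\<integral>s. indicator {0<..<T} s * (indicator {..<t} s * g s)\<partial>lebesgue)"
  by (intro integral_cong') (use t in \<open>auto simp: indicator_def\<close>)
 also have "\<dots> = (\<integral>s. indicator {..<t} s * g s\<partial>MT)"
  by (subst integral_restrict_space) auto
 finally show ?thesis .
qed

end

subsection \<open>History operators\<close>

locale history = bounded_cylinder T \<Omega> for T and \<Omega> :: "(real^'n) set" +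
 fixes H :: "'n evol=>'n evol" and LH LH' :: real
 assumes hist: "history_operator T \<Omega> LH LH' H"
begin

lemma hist_LL: "q\<in>LL ==> H q\<in>LL"
 using hist by (simp add: history_operator_def LL_elems)

lemma LH_pos: "LH > 0" using hist by (simp add: history_operator_def)

text \<open>The pointwise-in-time bound is squared by Cauchy-Schwarz in time and inserted into
  \<open>volterra\<close>; the resulting factor 1/k is at most 1.\<close>

lemma hist_lipschitz: "wlip (LH * sqrt T) H"
 unfolding wlip_def
proof (intro conjI ballI allI impI)
 show "0\<le>LH * sqrt T" using LH_pos T_pos by simp
 fix u v assume u: "u\<in>LL" and v: "v\<in>LL"
 fix k :: real assume k: "k\<ge>1"
 have uv: "u - v\<in>LL" and Huv: "H u - H v\<in>LL" by (intro LL.diff_mem hist_LL u v)+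
 have tT: "AE t in MT. t\<in>{0<..<T}" by (rule AE_I2) simp
 have "AE t in MT. X.nr (H u t - H v t)\<le>LH * (LINT s|leb {0<..<t}. X.nr (u s - v s))"
  using hist u v unfolding history_operator_def LL_elems nrm_L2_X by blast
 then have "AE t in MT. (X.nr ((H u - H v) t))^2\<le>LH\<^sup>2 * T * (\<integral>s. indicator {..<t} s * (X.nr ((u - v) s))^2\<partial>MT)"
  using tT LL_slice[OF Huv]
 proof eventually_elim
  case (elim t)
  have "X.nr ((H u - H v) t)\<le>LH * (\<integral>s. indicator {..<t} s * X.nr ((u - v) s)\<partial>MT)"
   using elim(1) integral_upto_eq[OF elim(2)] by simp
  then have "(X.nr ((H u - H v) t))^2\<le>(LH * (\<integral>s. indicator {..<t} s * X.nr ((u - v) s)\<partial>MT))^2"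
   using X.nr_nonneg[OF elim(3)] by (rule power_mono)
  also have "\<dots>\<le>LH\<^sup>2 * (T * (\<integral>s. indicator {..<t} s * (X.nr ((u - v) s))^2\<partial>MT))"
   unfolding power_mult_distrib by (intro mult_left_mono volterra_sq_le uv) simp
  finally show ?case by (simp add: mult.assoc)
 qed
 then have "(nrw k (H u - H v))^2\<le>LH\<^sup>2 * T / k * (nrw k (u - v))^2"
  by (intro volterra Huv uv) (use k T_pos in auto)
 also have "\<dots>\<le>LH\<^sup>2 * T * (nrw k (u - v))^2"
  using divide_left_mono[of 1 k "LH\<^sup>2 * T"] k T_pos by (intro mult_right_mono) auto
 also have "\<dots> = (LH * sqrt T * nrw k (u - v))^2" using T_pos by (simp add: power_mult_distrib)
 finally show "nrw k (H u - H v)\<le>LH * sqrt T * nrw k (u - v)"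
  by (rule power2_le_imp_le) (use LH_pos T_pos LL.nr_nonneg[OF wt_LL[OF uv]] in \<open>simp add: nrw_def\<close>)
qed (rule hist_LL)

abbreviation "H' \<equiv> gateaux_deriv (L2L2 T \<Omega>) (L2L2 T \<Omega>) H"

lemma hist_gateaux: "q\<in>LL ==> has_gateaux_deriv (L2L2 T \<Omega>) (L2L2 T \<Omega>) H q (H' q)"
proof -
 assume q: "q\<in>LL"
 have "\<exists>D. has_gateaux_deriv (L2L2 T \<Omega>) (L2L2 T \<Omega>) H q D"
  using hist q unfolding history_operator_def LL_elems by blast
 then show ?thesis unfolding gateaux_deriv_def by (rule someI_ex)
qed

lemma hist_deriv_LL: "q\<in>LL ==> h\<in>LL ==> H' q h\<in>LL"
 using hist_gateaux unfolding has_gateaux_deriv_def bounded_linear_op_def LL_elems by blast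

lemma hist_deriv_tendsto:
 assumes q: "q\<in>LL" and h: "h\<in>LL"
 shows "((%s. LL.nr ((1 / s) *\<^sub>R (H (q + s *\<^sub>R h) - H q) - H' q h)) \<longlongrightarrow> 0) (at 0)"
proof -
 have m: "(1 / s) *\<^sub>R (H (q + s *\<^sub>R h) - H q) - H' q h\<in>LL" for s
  by (intro LL.diff_mem LL.scale_mem hist_LL LL.add_mem hist_deriv_LL q h)
 show ?thesis
  using hist_gateaux[OF q] h unfolding has_gateaux_deriv_def LL_elems LL_nrm[OF m, symmetric] by blast
qed

lemma hist_deriv_linear:
 assumes q: "q\<in>LL" and u: "u\<in>LL" and v: "v\<in>LL"
 shows "LL.nr (H' q (u + v) - (H' q u + H' q v)) = 0" "LL.nr (H' q (c *\<^sub>R u) - c *\<^sub>R H' q u) = 0"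
proof -
 have m: "H' q (u + v) - (H' q u + H' q v)\<in>LL" "H' q (c *\<^sub>R u) - c *\<^sub>R H' q u\<in>LL"
  by (intro LL.diff_mem LL.add_mem hist_deriv_LL LL.scale_mem q u v)+
 show "LL.nr (H' q (u + v) - (H' q u + H' q v)) = 0" "LL.nr (H' q (c *\<^sub>R u) - c *\<^sub>R H' q u) = 0"
  using hist_gateaux[OF q] u v unfolding has_gateaux_deriv_def bounded_linear_op_def LL_elems
  by (auto simp: LL_nrm[OF m(1), symmetric] LL_nrm[OF m(2), symmetric])
qed

text \<open>Difference quotients of the history operator satisfy the bound of
  \<open>hist_lipschitz\<close> in every weighted norm, and the bound survives the limit. A mere
  operator norm of the derivative would not show that it is causal.\<close>

lemma hist_deriv_lipschitz:
 assumes q: "q\<in>LL" shows "wlip (LH * sqrt T) (H' q)"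
 unfolding wlip_def
proof (intro conjI ballI allI impI)
 show "0\<le>LH * sqrt T" using LH_pos T_pos by simp
 fix u v assume u: "u\<in>LL" and v: "v\<in>LL"
 fix k :: real assume k: "k\<ge>1"
 let ?D = "%h s. (1 / s) *\<^sub>R (H (q + s *\<^sub>R h) - H q)"
 have DL: "?D h s\<in>LL" if "h\<in>LL" for h s
  by (intro LL.scale_mem LL.diff_mem hist_LL LL.add_mem q that)
 have ev: "\<forall>\<^sub>F s in at 0. nrw k (H' q u - H' q v)\<le>LH * sqrt T * nrw k (u - v) + LL.nr (?D u s - H' q u) + LL.nr (?D v s - H' q v)"
  unfolding eventually_at_filter
 proof (intro always_eventually allI impI)
  fix s :: real assume t: "s\<noteq>0"
  let ?a = "?D u s" and ?b = "?D v s"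
  note a = DL[OF u, of s] and b = DL[OF v, of s] and au = hist_deriv_LL[OF q u] and bv = hist_deriv_LL[OF q v]
  have "nrw k (H' q u - H' q v)\<le>nrw k (?a - ?b) + nrw k (H' q u - H' q v - (?a - ?b))"
   unfolding nrw_def wt_diff[of k _ "?a - ?b"]
   by (intro LL.nr_le_add_diff wt_LL LL.diff_mem au bv a b)
  moreover have "H' q u - H' q v - (?a - ?b) = (?b - H' q v) - (?a - H' q u)" by (simp add: algebra_simps)
  moreover have "nrw k ((?b - H' q v) - (?a - H' q u))\<le>nrw k (?b - H' q v) + nrw k (?a - H' q u)"
   unfolding nrw_def wt_diff[of k "?b - H' q v"] by (intro LL.nr_triangle_diff wt_LL LL.diff_mem au bv a b)
  moreover have "nrw k (?b - H' q v)\<le>LL.nr (?b - H' q v)" "nrw k (?a - H' q u)\<le>LL.nr (?a - H' q u)"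
   using k by (auto intro!: nrw_le LL.diff_mem au bv a b)
  moreover have "nrw k (?a - ?b)\<le>LH * sqrt T * nrw k (u - v)"
  proof -
   have hL: "q + s *\<^sub>R u\<in>LL" "q + s *\<^sub>R v\<in>LL" by (intro LL.add_mem LL.scale_mem q u v)+
   let ?u = "q + s *\<^sub>R u" and ?v = "q + s *\<^sub>R v"
   have d: "?u - ?v = s *\<^sub>R (u - v)" by (simp add: scaleR_right_diff_distrib)
   have e: "?a - ?b = (1 / s) *\<^sub>R (H ?u - H ?v)" by (simp only: scaleR_right_diff_distrib) simp
   have HL: "H ?u - H ?v\<in>LL" by (intro LL.diff_mem hist_LL hL)
   have "nrw k (?a - ?b) = \<bar>1 / s\<bar> * nrw k (H ?u - H ?v)"
    unfolding e nrw_def wt_scale by (rule LL.nr_scale[OF wt_LL[OF HL]])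
   moreover have "nrw k (H ?u - H ?v)\<le>LH * sqrt T * nrw k (s *\<^sub>R (u - v))"
    using hist_lipschitz k hL unfolding wlip_def d[symmetric] by blast
   moreover have "nrw k (s *\<^sub>R (u - v)) = \<bar>s\<bar> * nrw k (u - v)"
    unfolding nrw_def wt_scale by (rule LL.nr_scale[OF wt_LL[OF LL.diff_mem[OF u v]]])
   ultimately have "nrw k (?a - ?b)\<le>\<bar>1 / s\<bar> * (LH * sqrt T * (\<bar>s\<bar> * nrw k (u - v)))"
    by (metis abs_ge_zero mult_left_mono)
   then show ?thesis using t by simp
  qed
  ultimately show "nrw k (H' q u - H' q v)\<le>LH * sqrt T * nrw k (u - v) + LL.nr (?a - H' q u) + LL.nr (?b - H' q v)"
   by simp
 qed
 have "((%s. LH * sqrt T * nrw k (u - v) + LL.nr (?D u s - H' q u) + LL.nr (?D v s - H' q v))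
   \<longlongrightarrow> LH * sqrt T * nrw k (u - v) + 0 + 0) (at 0)"
  by (intro tendsto_add tendsto_const hist_deriv_tendsto q u v)
 from tendsto_le[OF _ this tendsto_const ev] show "nrw k (H' q u - H' q v)\<le>LH * sqrt T * nrw k (u - v)" by simp
qed (rule hist_deriv_LL[OF q])

end

section \<open>The state system and its linearization as Volterra equations\<close>

section \<open>The state equation\<close>

context bounded_cylinder
begin

lemma LL_nr_zero_iff:
 assumes "u\<in>LL" "v\<in>LL"
 shows "LL.nr (u - v) = 0 \<longleftrightarrow> (AE p in MC. case_prod u p = case_prod v p)"
 using nr_eq_zero_iff[OF LL.diff_mem[OF assms]] by (simp add: case_prod_unfold)

lemma LL_eq_trans:
 assumes "u\<in>LL" "v\<in>LL" "w\<in>LL" "LL.nr (u - v) = 0" "LL.nr (v - w) = 0"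
 shows "LL.nr (u - w) = 0"
 using LL.nr_diff_triangle[OF assms(1-3)] assms(4,5) LL.nr_nonneg[OF LL.diff_mem[OF assms(1,3)]] by simp

lemma LL_eq_sym: "u\<in>LL ==> v\<in>LL ==> LL.nr (u - v) = 0 ==> LL.nr (v - u) = 0"
 using LL.nr_diff_commute[of u v] by simp

lemma nrw_scale: "a\<in>LL ==> nrw k (c *\<^sub>R a) = \<bar>c\<bar> * nrw k a"
 by (simp add: nrw_def wt_scale LL.nr_scale wt_LL)

lemma wlip_id: "wlip 1 (%u. u)" by (simp add: wlip_def)

lemma wlip_const: "\<psi>\<in>LL ==> wlip 0 (%u. \<psi>)"
 by (auto simp: wlip_def nrw_def wt_diff[of _ \<psi> \<psi>, simplified] LL.nr_zero)

lemma wlip_scale: "wlip C N ==> wlip (\<bar>c\<bar> * C) (%u. c *\<^sub>R N u)"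
 by (auto simp: wlip_def LL.scale_mem LL.diff_mem nrw_scale mult.assoc intro!: mult_left_mono simp flip: scaleR_right_diff_distrib)

lemma wlip_diff:
 assumes A: "wlip C A" and F: "wlip D F" shows "wlip (C + D) (%u. A u - F u)"
 unfolding wlip_def
proof (intro conjI ballI allI impI)
 show "0\<le>C + D" using A F by (simp add: wlip_def)
 show "A u - F u\<in>LL" if "u\<in>LL" for u by (intro LL.diff_mem wlip_LL[OF A] wlip_LL[OF F] that)
 fix k :: real and u v assume k: "1\<le>k" and u: "u\<in>LL" and v: "v\<in>LL"
 have m: "A u - A v\<in>LL" "F u - F v\<in>LL" by (intro LL.diff_mem wlip_LL[OF A] wlip_LL[OF F] u v)+
 have e: "A u - F u - (A v - F v) = (A u - A v) - (F u - F v)" by simp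
 have "nrw k (A u - F u - (A v - F v))\<le>nrw k (A u - A v) + nrw k (F u - F v)"
  unfolding e nrw_def wt_diff[of k "A u - A v"] by (intro LL.nr_triangle_diff wt_LL m)
 moreover have "nrw k (A u - A v)\<le>C * nrw k (u - v)" "nrw k (F u - F v)\<le>D * nrw k (u - v)"
  using A F k u v by (auto simp: wlip_def)
 ultimately show "nrw k (A u - F u - (A v - F v))\<le>(C + D) * nrw k (u - v)" by (simp add: distrib_right)
qed

lemma wlip_comp:
 assumes Z: "wlip C Z" and M: "\<And>u. u\<in>LL ==> M u\<in>LL" and c: "c\<ge>0"
  and le: "\<And>u v. u\<in>LL ==> v\<in>LL ==> AE p in MC. \<bar>case_prod (M u) p - case_prod (M v) p\<bar>\<le>c * \<bar>case_prod u p - case_prod v p\<bar>"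
 shows "wlip (c * C) (%u. M (Z u))"
 unfolding wlip_def
proof (intro conjI ballI allI impI)
 show "0\<le>c * C" using Z c by (simp add: wlip_def)
 show "M (Z u)\<in>LL" if "u\<in>LL" for u by (rule M[OF wlip_LL[OF Z that]])
 fix k :: real and u v assume k: "1\<le>k" and u: "u\<in>LL" and v: "v\<in>LL"
 note m = wlip_LL[OF Z u] wlip_LL[OF Z v]
 have "nrw k (M (Z u) - M (Z v))\<le>c * nrw k (Z u - Z v)"
  by (rule nrw_mono[OF LL.diff_mem[OF M M] LL.diff_mem c]) (use m le[OF m] in \<open>auto simp: case_prod_unfold\<close>)
 also have "\<dots>\<le>c * (C * nrw k (u - v))"
  using Z k u v c by (intro mult_left_mono) (auto simp: wlip_def)
 finally show "nrw k (M (Z u) - M (Z v))\<le>c * C * nrw k (u - v)" by (simp add: mult.assoc)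
qed

text \<open>u solves the equation with N, while v equals some other right-hand side w; only the
  defect between w and \<open>N (vint v)\<close> enters.\<close>

lemma volterra_perturb:
 assumes N: "wlip C N" and u: "u\<in>LL" and v: "v\<in>LL" and w: "w\<in>LL"
  and eu: "LL.nr (u - N (vint u)) = 0" and ev: "LL.nr (v - w) = 0"
 shows "LL.nr (u - v)\<le>2 * exp (vrate C * T / 2) * LL.nr (w - N (vint v))"
proof -
 have m: "N (vint u)\<in>LL" "N (vint v)\<in>LL" by (intro wlip_LL[OF N] vint_LL u v)+
 have "LL.nr ((u - N (vint u)) - (v - N (vint v)))\<le>LL.nr (u - N (vint u)) + LL.nr (v - N (vint v))"
  by (intro LL.nr_triangle_diff LL.diff_mem m u v)
 moreover have "LL.nr (v - N (vint v))\<le>LL.nr (v - w) + LL.nr (w - N (vint v))" by (rule LL.nr_diff_triangle[OF v w m(2)])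
 ultimately have "LL.nr ((u - N (vint u)) - (v - N (vint v)))\<le>LL.nr (w - N (vint v))" using eu ev by simp
 from mult_left_mono[OF this, of "2 * exp (vrate C * T / 2)"] show ?thesis
  by (intro order_trans[OF volterra_stable[OF N u v]]) simp
qed

lemma vint_bound:
 assumes z: "z\<in>LL" shows "LL.nr (vint z)\<le>exp (T / 2) * sqrt T * LL.nr z"
proof -
 have "LL.nr (vint z)\<le>exp (T / 2) * nrw 1 (vint z)" using LL_nr_le_nrw[OF vint_LL[OF z], of 1] by simp
 also have "\<dots>\<le>exp (T / 2) * (sqrt T * nrw 1 z)" using vint_weighted[OF z, of 1] by simp
 also have "\<dots>\<le>exp (T / 2) * (sqrt T * LL.nr z)" using nrw_le[OF z, of 1] T_pos by (intro mult_left_mono) auto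
 finally show ?thesis by (simp add: mult.assoc)
qed

end

context elliptic
begin

definition Ao :: "'n evol=>'n evol" where
 "Ao g = (SOME \<phi>. ell \<phi> g)"

lemma ell_Ao: "g\<in>LL ==> ell (Ao g) g"
 unfolding Ao_def by (rule someI_ex[of "%\<phi>. ell \<phi> g"]) (blast intro: ell_exists)

lemma ell_weighted:
 assumes e: "ell \<phi> g" shows "\<beta> * nrw k \<phi>\<le>nrw k g"
proof -
 have "ell (%t x. exp (- (k * t) / 2) * \<phi> t x) (%t x. exp (- (k * t) / 2) * g t x)"
  by (rule ell_time_mult[OF wt_meas wt_bound e])
 then have "ell (wt k \<phi>) (wt k g)" by (simp add: wt_def[abs_def] scaleR_fun_def)
 then show ?thesis unfolding nrw_def by (rule ell_bound(1))
qed

text \<open>\<beta> times the elliptic solution operator has norm at most 1 in every weighted norm,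
  since the weight depends on time only.\<close>

lemma wlip_Ao:
 assumes d: "\<delta>\<in>LL" shows "wlip 1 (%u. Ao (\<beta> *\<^sub>R u + \<delta>))"
 unfolding wlip_def
proof (intro conjI ballI allI impI)
 have e: "ell (Ao (\<beta> *\<^sub>R u + \<delta>)) (\<beta> *\<^sub>R u + \<delta>)" if "u\<in>LL" for u
  by (intro ell_Ao LL.add_mem LL.scale_mem d that)
 show "Ao (\<beta> *\<^sub>R u + \<delta>)\<in>LL" if "u\<in>LL" for u by (rule ell_LL'[OF e[OF that]])
 fix k :: real and u v assume u: "u\<in>LL" and v: "v\<in>LL"
 have "ell (Ao (\<beta> *\<^sub>R u + \<delta>) - Ao (\<beta> *\<^sub>R v + \<delta>)) (\<beta> *\<^sub>R (u - v))"
  using ell_diff[OF e[OF u] e[OF v]] by (simp add: scaleR_right_diff_distrib)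
 from ell_weighted[OF this, of k] show "nrw k (Ao (\<beta> *\<^sub>R u + \<delta>) - Ao (\<beta> *\<^sub>R v + \<delta>))\<le>1 * nrw k (u - v)"
  using \<beta>_pos nrw_scale[OF LL.diff_mem[OF u v], of k \<beta>] by simp
qed simp

lemma wlip_affine:
 assumes "wlip C F" "\<delta>\<in>LL"
 shows "wlip (2 * \<beta> + C) (%u. (- \<beta>) *\<^sub>R (u - Ao (\<beta> *\<^sub>R u + \<delta>)) - F u)"
 using wlip_diff[OF wlip_scale[OF wlip_diff[OF wlip_id wlip_Ao[OF assms(2)]], of "- \<beta>"] assms(1)] \<beta>_pos by (simp add: mult.commute)

lemma wlip_affine':
 assumes "wlip C F" "\<psi>\<in>LL"
 shows "wlip (\<beta> + C) (%u. (- \<beta>) *\<^sub>R (u - \<psi>) - F u)"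
 using wlip_diff[OF wlip_scale[OF wlip_diff[OF wlip_id wlip_const[OF assms(2)]], of "- \<beta>"] assms(1)] \<beta>_pos by simp

end

locale control = elliptic T \<Omega> \<alpha> \<beta> + history T \<Omega> H LH LH'
 for T and \<Omega> :: "(real^'n) set" and \<alpha> \<beta> H LH LH' +
 fixes \<epsilon> :: real and f :: "real=>real" and Lf nf :: real
 assumes \<epsilon>_pos: "\<epsilon> > 0" and f: "nonsmooth_function Lf nf f"
begin

abbreviation "zf \<equiv> z_of \<beta> f H"
abbreviation "nullc \<equiv> null_contact T \<Omega> H nf"

definition mx :: "'n evol=>'n evol" where
 "mx u = (%t x. (1 / \<epsilon>) * max (u t x) 0)"

lemma Lf_nonneg: "Lf\<ge>0" by (rule lipschitz_on_nonneg[OF nonsmooth_lipschitz[OF f]])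

lemma fcomp_LL: "u\<in>LL ==> (%t x. f (u t x))\<in>LL"
 by (rule lipschitz_comp_LL[OF nonsmooth_lipschitz[OF f]])

lemma zf_eq: "zf q \<phi> = (- \<beta>) *\<^sub>R (q - \<phi>) - (%t x. f (H q t x))"
 by (simp add: z_of_def fun_eq_iff scaleR_fun_def)

lemma zf_LL: "q\<in>LL ==> \<phi>\<in>LL ==> zf q \<phi>\<in>LL"
 unfolding zf_eq by (intro LL.diff_mem LL.scale_mem fcomp_LL hist_LL)

lemma max_LL: "u\<in>LL ==> (%t x. max (u t x) 0)\<in>LL"
 by (rule lipschitz_comp_LL[OF max_lipschitz])

lemma mx_LL: "u\<in>LL ==> mx u\<in>LL"
 using LL.scale_mem[OF max_LL, of u "1 / \<epsilon>"] by (simp add: mx_def scaleR_fun_def)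

lemma mx_diff: "\<bar>mx u t x - mx v t x\<bar>\<le>1 / \<epsilon> * \<bar>u t x - v t x\<bar>"
proof -
 have "\<bar>mx u t x - mx v t x\<bar> = 1 / \<epsilon> * \<bar>max (u t x) 0 - max (v t x) 0\<bar>"
  using \<epsilon>_pos by (simp add: mx_def abs_mult flip: right_diff_distrib diff_divide_distrib)
 also have "\<dots>\<le>1 / \<epsilon> * \<bar>u t x - v t x\<bar>" using \<epsilon>_pos by (intro mult_left_mono) auto
 finally show ?thesis .
qed

text \<open>The right-hand side of the equation for q with \<phi> eliminated; the state equation
  becomes \<open>g = G l (vint g)\<close> for the time derivative g.\<close>

definition G :: "'n evol=>'n evol=>'n evol" where
 "G l q = mx (zf q (Ao (\<beta> *\<^sub>R q + l)))"

definition CF :: real where "CF = Lf * (LH * sqrt T)"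
definition CG :: real where "CG = 1 / \<epsilon> * (2 * \<beta> + CF)"

lemma G_lipschitz:
 assumes l: "l\<in>LL" shows "wlip CG (G l)"
proof -
 have "wlip CF (%u. (%t x. f (H u t x)))"
  unfolding CF_def
  by (rule wlip_comp[OF hist_lipschitz, of "%u t x. f (u t x)"])
   (use lipschitz_onD[OF nonsmooth_lipschitz[OF f]] in \<open>auto simp: fcomp_LL Lf_nonneg dist_real_def\<close>)
 note Z = wlip_affine[OF this l]
 have "wlip (1 / \<epsilon> * (2 * \<beta> + CF))
   (%u. mx ((- \<beta>) *\<^sub>R (u - Ao (\<beta> *\<^sub>R u + l)) - (%t x. f (H u t x))))"
  by (rule wlip_comp[OF Z mx_LL])
   (use \<epsilon>_pos mx_diff in \<open>auto simp: case_prod_unfold\<close>)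
 then show ?thesis unfolding CG_def G_def[abs_def] zf_eq .
qed

text \<open>\<open>Ao\<close> picks some solution of the elliptic equation; up to null functions
  \<open>G\<close> depends neither on this choice nor on the representative of q.\<close>

lemma G_rep:
 assumes q: "q\<in>LL" "q'\<in>LL" and e: "ell \<phi> (\<beta> *\<^sub>R q + l)" and l: "l\<in>LL" and eq: "LL.nr (q' - q) = 0"
 shows "LL.nr (G l q' - mx (zf q \<phi>)) = 0"
proof -
 have p: "\<phi>\<in>LL" by (rule ell_LL'[OF e])
 have a: "ell (Ao (\<beta> *\<^sub>R q + l)) (\<beta> *\<^sub>R q + l)" by (intro ell_Ao LL.add_mem LL.scale_mem q l)
 note m = wlip_LL[OF G_lipschitz[OF l]]
 have "LL.nr (Ao (\<beta> *\<^sub>R q + l) - \<phi>) = 0"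
  by (rule ell_unique(1)[OF a e]) (simp add: LL.nr_zero)
 then have ae: "AE p in MC. case_prod (Ao (\<beta> *\<^sub>R q + l)) p = case_prod \<phi> p"
  using LL_nr_zero_iff[OF ell_LL'[OF a] p] by simp
 have "LL.nr (G l q - mx (zf q \<phi>)) = 0"
  unfolding LL_nr_zero_iff[OF m[OF q(1)] mx_LL[OF zf_LL[OF q(1) p]]]
  using ae by eventually_elim (auto simp: G_def mx_def z_of_def case_prod_unfold)
 then show ?thesis
  by (rule LL_eq_trans[OF m[OF q(2)] m[OF q(1)] mx_LL[OF zf_LL[OF q(1) p]] wlip_cong[OF G_lipschitz[OF l] q(2,1) eq]])
qed

text \<open>The state system with the time derivative g carried along explicitly, in place of the
  representative chosen by \<open>time_deriv\<close>.\<close>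

definition state :: "'n evol=>'n evol=>'n evol
 =>'n evol=>bool" where
 "state l q \<phi> g \<longleftrightarrow> trel q g\<and>vanishes_at T (L2 \<Omega>) q 0\<and>ell \<phi> (\<beta> *\<^sub>R q + l)\<and>LL.nr (g - mx (zf q \<phi>)) = 0"

lemma stateD:
 assumes "state l q \<phi> g"
 shows "trel q g" "vanishes_at T (L2 \<Omega>) q 0" "ell \<phi> (\<beta> *\<^sub>R q + l)" "LL.nr (g - mx (zf q \<phi>)) = 0"
  "q\<in>LL" "\<phi>\<in>J.gdom" "\<phi>\<in>LL" "g\<in>LL" "LL.nr (q - vint g) = 0"
 using assms trel_LL[of q g] ell_LL'[of \<phi>] ell_J[of \<phi>] vanishing_zero[of q g] by (auto simp: state_def)

lemma state_exists:
 assumes l: "l\<in>LL" obtains q \<phi> g where "state l q \<phi> g"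
proof -
 obtain g where g: "g\<in>LL" "LL.nr (g - G l (vint g)) = 0" by (rule volterra_exists[OF G_lipschitz[OF l]])
 have "state l (vint g) (Ao (\<beta> *\<^sub>R vint g + l)) g"
  unfolding state_def using vint_trel[OF g(1)] vint_vanishing[OF g(1)] g(2)
  by (auto simp: elems_vanishing G_def intro!: ell_Ao LL.add_mem LL.scale_mem vint_LL g l)
 then show ?thesis by (rule that)
qed

lemma state_fixed_point:
 assumes s: "state l q \<phi> g" and l: "l\<in>LL"
 shows "LL.nr (g - G l (vint g)) = 0"
proof -
 note d = stateD[OF s]
 note Gm = wlip_LL[OF G_lipschitz[OF l] vint_LL[OF d(8)]] and xm = mx_LL[OF zf_LL[OF d(5,7)]]
 have "LL.nr (G l (vint g) - mx (zf q \<phi>)) = 0"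
  by (rule G_rep[OF d(5) vint_LL[OF d(8)] d(3) l LL_eq_sym[OF d(5) vint_LL[OF d(8)] d(9)]])
 from LL_eq_sym[OF Gm xm this] show ?thesis by (rule LL_eq_trans[OF d(8) xm Gm d(4)])
qed

text \<open>The functional \<open>fl\<close> is required to be represented by l on almost every
  slice only, so that linear combinations of embedded controls are covered as well.\<close>

lemma solves_state_iff:
 assumes l: "l\<in>LL" and fl: "AE t in MT. \<forall>v\<in>W.gdom. fl t v = ipX (l t) v"
 shows "solves_state T \<Omega> \<alpha> \<beta> \<epsilon> f H fl (q, \<phi>) \<longleftrightarrow> (\<exists>g. state l q \<phi> g)"
proof -
 have E: "(AE t in MT. \<forall>v\<in>W.gdom. - \<alpha> * Laplace \<Omega> (\<phi> t) v + \<beta> * L2_inner \<Omega> (\<phi> t) v = \<beta> * L2_inner \<Omega> (q t) v + fl t v)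
   \<longleftrightarrow> ell \<phi> (\<beta> *\<^sub>R q + l)" if q: "q\<in>LL" and p: "\<phi>\<in>J.gdom"
 proof -
  have qs: "\<beta> *\<^sub>R q + l\<in>LL" by (intro LL.add_mem LL.scale_mem q l)
  have "AE t in MT. (\<forall>v\<in>W.gdom. - \<alpha> * Laplace \<Omega> (\<phi> t) v + \<beta> * L2_inner \<Omega> (\<phi> t) v = \<beta> * L2_inner \<Omega> (q t) v + fl t v)
   \<longleftrightarrow> (\<forall>v\<in>W.gdom. ipA (\<phi> t) v = ipX ((\<beta> *\<^sub>R q + l) t) v)"
   using fl J_slice[OF p] LL_slice[OF q] LL_slice[OF l]
  proof eventually_elim
   case (elim t)
   have "\<beta> * L2_inner \<Omega> (q t) v + fl t v = ipX ((\<beta> *\<^sub>R q + l) t) v" if v: "v\<in>W.gdom" for v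
   proof -
    have v': "v\<in>sqi MX" by (rule W.gdom_V[OF v])
    have "(\<beta> *\<^sub>R q + l) t = \<beta> *\<^sub>R q t + l t" by (simp add: scaleR_fun_def)
    then show ?thesis
     using elim(1) v X.B_add[OF X.scale_mem[OF elim(3)] elim(4) v', of \<beta>] X.B_scale[OF elim(3) v', of \<beta>]
     by (simp add: L2_inner_def)
   qed
   then show ?case using gip_Laplace[OF elim(2), of _ \<alpha> \<beta>] by simp
  qed
  then have "(AE t in MT. \<forall>v\<in>W.gdom. - \<alpha> * Laplace \<Omega> (\<phi> t) v + \<beta> * L2_inner \<Omega> (\<phi> t) v = \<beta> * L2_inner \<Omega> (q t) v + fl t v)
   \<longleftrightarrow> (AE t in MT. \<forall>v\<in>W.gdom. ipA (\<phi> t) v = ipX ((\<beta> *\<^sub>R q + l) t) v)"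
   by (rule eventually_subst)
  then show ?thesis using p qs by (simp add: ell_def)
 qed
 \<comment> \<open>The state system says almost every t, then almost every x. Joint measurability
   turns this into almost everywhere on the cylinder.\<close>
 have D: "(AE t in MT. AE x in MX. g t x = (1 / \<epsilon>) * max (zf q \<phi> t x) 0) \<longleftrightarrow> LL.nr (g - mx (zf q \<phi>)) = 0"
  if g: "g\<in>LL" and q: "q\<in>LL" and p: "\<phi>\<in>LL" for g
 proof -
  have m: "mx (zf q \<phi>)\<in>LL" by (intro mx_LL zf_LL q p)
  have "{p\<in>space MC. case_prod g p = case_prod (mx (zf q \<phi>)) p}\<in>sets MC"
   by (rule borel_measurable_eq[OF LL_meas[OF g] LL_meas[OF m]])
  then have S: "{p\<in>{0<..<T}\<times>\<Omega>. g (fst p) (snd p) = mx (zf q \<phi>) (fst p) (snd p)}\<in>sets MC"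
   by (simp add: case_prod_unfold space_restrict_space)
  have "(AE t in MT. AE x in MX. g t x = mx (zf q \<phi>) t x) \<longleftrightarrow> (AE p in MC. g (fst p) (snd p) = mx (zf q \<phi>) (fst p) (snd p))"
   using AE_leb_TimesI[OF IT OX S] AE_leb_Times(1)[OF IT OX, of "%t x. g t x = mx (zf q \<phi>) t x"] by blast
  then show ?thesis unfolding LL_nr_zero_iff[OF g m] by (simp add: mx_def case_prod_unfold)
 qed
 show ?thesis
 proof
  assume "solves_state T \<Omega> \<alpha> \<beta> \<epsilon> f H fl (q, \<phi>)"
  then have s: "q\<in>Tr.gdom" "vanishes_at T (L2 \<Omega>) q 0" "\<phi>\<in>J.gdom"
   "AE t in MT. AE x in MX. time_deriv T \<Omega> q t x = (1 / \<epsilon>) * max (zf q \<phi> t x) 0"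
   "AE t in MT. \<forall>v\<in>W.gdom. - \<alpha> * Laplace \<Omega> (\<phi> t) v + \<beta> * L2_inner \<Omega> (\<phi> t) v = \<beta> * L2_inner \<Omega> (q t) v + fl t v"
   by (auto simp: solves_state_def elems_vanishing elems_L2H1 elems_H1)
  note t = trel_time_deriv[OF s(1)]
  have "state l q \<phi> (time_deriv T \<Omega> q)"
   unfolding state_def using t s(2,4,5) D[OF trel_LL(2)[OF t] trel_LL(1)[OF t] J.gdom_V[OF s(3)]] E[OF trel_LL(1)[OF t] s(3)] by blast
  then show "\<exists>g. state l q \<phi> g" by blast
 next
  assume "\<exists>g. state l q \<phi> g"
  then obtain g where g: "state l q \<phi> g" by blast
  note d = stateD[OF g]
  have qT: "q\<in>Tr.gdom" by (rule Tr_gdomI[OF d(1)])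
  note t = trel_time_deriv[OF qT]
  have "LL.nr (time_deriv T \<Omega> q - mx (zf q \<phi>)) = 0"
   by (rule LL_eq_trans[OF trel_LL(2)[OF t] d(8) mx_LL[OF zf_LL[OF d(5,7)]] trel_unique[OF t d(1)] d(4)])
  then show "solves_state T \<Omega> \<alpha> \<beta> \<epsilon> f H fl (q, \<phi>)"
   unfolding solves_state_def using D[OF trel_LL(2)[OF t] d(5,7)] E[OF d(5,6)] d(2,3,6) qT
   by (simp add: elems_vanishing elems_L2H1 elems_H1)
 qed
qed

subsection \<open>The linearized equation\<close>

abbreviation "dF \<equiv> deriv_f_hist T \<Omega> f H"

lemma null_contact_AE:
 assumes "nullc q" shows "AE p in MC. case_prod (H q) p\<noteq>nf"
proof -
 have "AE p in lebesgue. p\<notin>{(t, x). (t, x)\<in>cylinder T \<Omega>\<and>H q t x = nf}"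
  using assms unfolding null_contact_def by (rule AE_not_in)
 then have "AE p in lebesgue. p\<in>{0<..<T}\<times>\<Omega>\<longrightarrow>case_prod (H q) p\<noteq>nf"
  by eventually_elim (auto simp: cylinder_def)
 then show ?thesis using CX by (subst AE_restrict_space_iff) auto
qed

text \<open>Off the contact set the derivative of f is bounded by its Lipschitz constant, and the
  contact set is null.\<close>

lemma dF_lipschitz:
 assumes q: "q\<in>LL" and nc: "nullc q"
 shows "wlip CF (dF q)"
proof -
 let ?M = "%u t x. deriv f (H q t x) * u t x"
 have b: "AE p in MC. \<bar>deriv f (case_prod (H q) p)\<bar>\<le>Lf"
  using null_contact_AE[OF nc] by eventually_elim (rule nonsmooth_deriv_bound[OF f])
 have M: "?M u\<in>LL" if u: "u\<in>LL" for u
  by (rule LL_bounded_mult[OF u _, of "%t x. deriv f (H q t x)" Lf])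
   (use comp_meas[OF nonsmooth_deriv_borel[OF f] LL_meas[OF hist_LL[OF q]]] b in \<open>auto simp: case_prod_unfold\<close>)
 have "wlip (Lf * (LH * sqrt T)) (%u. ?M (H' q u))"
 proof (rule wlip_comp[OF hist_deriv_lipschitz[OF q] M Lf_nonneg])
  fix u v :: "'n evol"
  show "AE p in MC. \<bar>case_prod (?M u) p - case_prod (?M v) p\<bar>\<le>Lf * \<bar>case_prod u p - case_prod v p\<bar>"
   using b by eventually_elim (auto simp: case_prod_unfold abs_mult mult_right_mono simp flip: right_diff_distrib)
 qed
 moreover have "dF q = (%u. ?M (H' q u))" by (simp add: fun_eq_iff deriv_f_hist_def)
 ultimately show ?thesis by (simp add: CF_def)
qed

lemma dF_linear:
 assumes q: "q\<in>LL" and nc: "nullc q" and u: "u\<in>LL" and v: "v\<in>LL"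
 shows "LL.nr (dF q (u + v) - (dF q u + dF q v)) = 0" "LL.nr (dF q (c *\<^sub>R u) - c *\<^sub>R dF q u) = 0"
proof -
 note m = wlip_LL[OF dF_lipschitz[OF q nc]]
 have "AE p in MC. case_prod (H' q (u + v)) p = case_prod (H' q u + H' q v) p"
  using hist_deriv_linear(1)[OF q u v] LL_nr_zero_iff[OF hist_deriv_LL[OF q LL.add_mem[OF u v]] LL.add_mem[OF hist_deriv_LL[OF q u] hist_deriv_LL[OF q v]]] by simp
 then show "LL.nr (dF q (u + v) - (dF q u + dF q v)) = 0"
  unfolding LL_nr_zero_iff[OF m[OF LL.add_mem[OF u v]] LL.add_mem[OF m[OF u] m[OF v]]]
  by eventually_elim (auto simp: deriv_f_hist_def algebra_simps)
 have "AE p in MC. case_prod (H' q (c *\<^sub>R u)) p = case_prod (c *\<^sub>R H' q u) p"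
  using hist_deriv_linear(2)[OF q u u] LL_nr_zero_iff[OF hist_deriv_LL[OF q LL.scale_mem[OF u]] LL.scale_mem[OF hist_deriv_LL[OF q u]]] by simp
 then show "LL.nr (dF q (c *\<^sub>R u) - c *\<^sub>R dF q u) = 0"
  unfolding LL_nr_zero_iff[OF m[OF LL.scale_mem[OF u]] LL.scale_mem[OF m[OF u]]]
  by eventually_elim (auto simp: deriv_f_hist_def scaleR_fun_def)
qed

definition mxd :: "'n evol=>'n evol=>'n evol" where
 "mxd z h = (%t x. (1 / \<epsilon>) * max_dir (z t x) (h t x))"

lemma mxd_LL: "z\<in>LL ==> h\<in>LL ==> mxd z h\<in>LL"
 using LL.scale_mem[OF max_dir_LL, of z h "1 / \<epsilon>"] by (simp add: mxd_def scaleR_fun_def)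

lemma mxd_diff: "\<bar>mxd z u t x - mxd z v t x\<bar>\<le>1 / \<epsilon> * \<bar>u t x - v t x\<bar>"
proof -
 have "\<bar>mxd z u t x - mxd z v t x\<bar> = 1 / \<epsilon> * \<bar>max_dir (z t x) (u t x) - max_dir (z t x) (v t x)\<bar>"
  using \<epsilon>_pos by (simp add: mxd_def abs_mult flip: right_diff_distrib diff_divide_distrib)
 also have "\<dots>\<le>1 / \<epsilon> * \<bar>u t x - v t x\<bar>" using \<epsilon>_pos by (intro mult_left_mono max_dir_lipschitz) auto
 finally show ?thesis .
qed

lemma mxd_nr:
 assumes "z\<in>LL" "u\<in>LL" "v\<in>LL"
 shows "LL.nr (mxd z u - mxd z v)\<le>1 / \<epsilon> * LL.nr (u - v)"
 by (rule LL_nr_mono[OF LL.diff_mem[OF mxd_LL mxd_LL] LL.diff_mem]) (use assms \<epsilon>_pos mxd_diff in \<open>auto simp: case_prod_unfold\<close>)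

text \<open>The linearized evolution equation for g, the derivative of \<eta>, with \<psi> as a free
  input. The coupling to \<psi> through the elliptic equation is a separate condition, so that
  \<psi> can later range over all of L^2(0,T;L^2(\<Omega>)).\<close>

definition lin :: "'n evol=>'n evol=>'n evol
 =>'n evol=>bool" where
 "lin z q \<psi> g \<longleftrightarrow> g\<in>LL\<and>LL.nr (g - mxd z ((- \<beta>) *\<^sub>R (vint g - \<psi>) - dF q (vint g))) = 0"

context
 fixes z q :: "'n evol"
 assumes z: "z\<in>LL" and q: "q\<in>LL" and nc: "nullc q"
begin

lemma dF_LL: "u\<in>LL ==> dF q u\<in>LL"
 by (rule wlip_LL[OF dF_lipschitz[OF q nc]])

lemma lin_arg_LL: "g\<in>LL ==> \<psi>\<in>LL ==> (- \<beta>) *\<^sub>R (vint g - \<psi>) - dF q (vint g)\<in>LL"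
 by (intro LL.diff_mem LL.scale_mem dF_LL vint_LL)

lemma lin_op_lipschitz:
 "\<psi>\<in>LL ==> wlip (1 / \<epsilon> * (\<beta> + CF)) (%u. mxd z ((- \<beta>) *\<^sub>R (u - \<psi>) - dF q u))"
 by (rule wlip_comp[OF wlip_affine'[OF dF_lipschitz[OF q nc]], of \<psi> "mxd z"])
  (use \<epsilon>_pos mxd_diff in \<open>auto simp: mxd_LL z\<close>)

lemma lin_ell_op_lipschitz:
 "\<delta>\<in>LL ==> wlip (1 / \<epsilon> * (2 * \<beta> + CF)) (%u. mxd z ((- \<beta>) *\<^sub>R (u - Ao (\<beta> *\<^sub>R u + \<delta>)) - dF q u))"
 by (rule wlip_comp[OF wlip_affine[OF dF_lipschitz[OF q nc]], of \<delta> "mxd z"])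
  (use \<epsilon>_pos mxd_diff in \<open>auto simp: mxd_LL z\<close>)

lemma lin_exists:
 assumes "\<psi>\<in>LL" obtains g where "lin z q \<psi> g"
 using volterra_exists[OF lin_op_lipschitz[OF assms]] unfolding lin_def by blast

lemma lin_ell_exists:
 assumes d: "\<delta>\<in>LL" obtains g \<psi> where "lin z q \<psi> g" "ell \<psi> (\<beta> *\<^sub>R vint g + \<delta>)"
proof -
 obtain g where g: "g\<in>LL" "LL.nr (g - mxd z ((- \<beta>) *\<^sub>R (vint g - Ao (\<beta> *\<^sub>R vint g + \<delta>)) - dF q (vint g))) = 0"
  by (rule volterra_exists[OF lin_ell_op_lipschitz[OF d]])
 show ?thesis
 proof (rule that)
  show "lin z q (Ao (\<beta> *\<^sub>R vint g + \<delta>)) g" using g unfolding lin_def by blast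
  show "ell (Ao (\<beta> *\<^sub>R vint g + \<delta>)) (\<beta> *\<^sub>R vint g + \<delta>)" by (intro ell_Ao LL.add_mem LL.scale_mem vint_LL g(1) d)
 qed
qed

lemma lin_stable:
 assumes a: "lin z q \<psi> g" "\<psi>\<in>LL" and b: "lin z q \<psi>' g'" "\<psi>'\<in>LL"
 shows "LL.nr (g - g')\<le>2 * exp (vrate (1 / \<epsilon> * (\<beta> + CF)) * T / 2) * (1 / \<epsilon> * (\<beta> * LL.nr (\<psi>' - \<psi>)))"
proof -
 have g: "g\<in>LL" "g'\<in>LL" using a(1) b(1) by (auto simp: lin_def)
 let ?a = "(- \<beta>) *\<^sub>R (vint g' - \<psi>') - dF q (vint g')" and ?b = "(- \<beta>) *\<^sub>R (vint g' - \<psi>) - dF q (vint g')"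
 have m: "?a\<in>LL" "?b\<in>LL" by (intro lin_arg_LL g a b)+
 have "LL.nr (g - g')\<le>2 * exp (vrate (1 / \<epsilon> * (\<beta> + CF)) * T / 2) * LL.nr (mxd z ?a - mxd z ?b)"
  using a(1) b(1) by (intro volterra_perturb[OF lin_op_lipschitz[OF a(2)] g mxd_LL[OF z m(1)]]) (auto simp: lin_def)
 also have "\<dots>\<le>2 * exp (vrate (1 / \<epsilon> * (\<beta> + CF)) * T / 2) * (1 / \<epsilon> * LL.nr (?a - ?b))"
  by (intro mult_left_mono mxd_nr z m) simp
 also have "?a - ?b = \<beta> *\<^sub>R (\<psi>' - \<psi>)" by (simp add: scaleR_right_diff_distrib)
 also have "LL.nr \<dots> = \<beta> * LL.nr (\<psi>' - \<psi>)" using LL.nr_scale[OF LL.diff_mem[OF b(2) a(2)], of \<beta>] \<beta>_pos by simp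
 finally show ?thesis .
qed

text \<open>With both \<psi> and \<psi>' replaced by elliptic solutions for the same \<delta>, g is
  a fixed point and g' is one up to a defect of size |\<delta>' - \<delta>|.\<close>

lemma lin_ell_stable:
 assumes a: "lin z q \<psi> g" "ell \<psi> (\<beta> *\<^sub>R vint g + \<delta>)" "\<delta>\<in>LL" and b: "lin z q \<psi>' g'" "ell \<psi>' (\<beta> *\<^sub>R vint g' + \<delta>')" "\<delta>'\<in>LL"
 shows "LL.nr (g - g')\<le>2 * exp (vrate CG * T / 2) * (1 / \<epsilon> * LL.nr (\<delta>' - \<delta>))"
proof -
 have g: "g\<in>LL" "g'\<in>LL" using a(1) b(1) by (auto simp: lin_def)
 have p: "\<psi>\<in>LL" "\<psi>'\<in>LL" using ell_LL' a(2) b(2) by auto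
 let ?A = "Ao (\<beta> *\<^sub>R vint g + \<delta>)" and ?A' = "Ao (\<beta> *\<^sub>R vint g' + \<delta>)"
 have e: "ell ?A (\<beta> *\<^sub>R vint g + \<delta>)" "ell ?A' (\<beta> *\<^sub>R vint g' + \<delta>)"
  by (intro ell_Ao LL.add_mem LL.scale_mem vint_LL g a)+
 let ?a = "(- \<beta>) *\<^sub>R (vint g' - \<psi>') - dF q (vint g')" and ?b = "(- \<beta>) *\<^sub>R (vint g' - ?A') - dF q (vint g')"
 let ?c = "(- \<beta>) *\<^sub>R (vint g - \<psi>) - dF q (vint g)" and ?d = "(- \<beta>) *\<^sub>R (vint g - ?A) - dF q (vint g)"
 have m: "?a\<in>LL" "?b\<in>LL" "?c\<in>LL" "?d\<in>LL" by (intro lin_arg_LL g p ell_LL'[OF e(1)] ell_LL'[OF e(2)])+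
 have cd: "LL.nr (mxd z ?c - mxd z ?d) = 0"
 proof -
  have "LL.nr (\<psi> - ?A) = 0" by (rule ell_unique(1)[OF a(2) e(1)]) (simp add: LL.nr_zero)
  moreover have "?c - ?d = \<beta> *\<^sub>R (\<psi> - ?A)" by (simp add: scaleR_right_diff_distrib)
  ultimately have "LL.nr (?c - ?d) = 0" using LL.nr_scale[OF LL.diff_mem[OF p(1) ell_LL'[OF e(1)]], of \<beta>] by simp
  then show ?thesis using mxd_nr[OF z m(3,4)] LL.nr_nonneg[OF LL.diff_mem[OF mxd_LL[OF z m(3)] mxd_LL[OF z m(4)]]] by simp
 qed
 have u: "LL.nr (g - mxd z ?d) = 0"
  using a(1) by (intro LL_eq_trans[OF g(1) mxd_LL[OF z m(3)] mxd_LL[OF z m(4)] _ cd]) (simp add: lin_def)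
 have "LL.nr (g - g')\<le>2 * exp (vrate CG * T / 2) * LL.nr (mxd z ?a - mxd z ?b)"
  unfolding CG_def
  using b(1) u by (intro volterra_perturb[OF lin_ell_op_lipschitz[OF a(3)] g mxd_LL[OF z m(1)]]) (auto simp: lin_def)
 also have "\<dots>\<le>2 * exp (vrate CG * T / 2) * (1 / \<epsilon> * LL.nr (?a - ?b))"
  by (intro mult_left_mono mxd_nr z m) simp
 also have "\<dots>\<le>2 * exp (vrate CG * T / 2) * (1 / \<epsilon> * LL.nr (\<delta>' - \<delta>))"
 proof (intro mult_left_mono)
  show "LL.nr (?a - ?b)\<le>LL.nr (\<delta>' - \<delta>)"
 proof -
  have "ell (\<psi>' - ?A') (\<delta>' - \<delta>)" using ell_diff[OF b(2) e(2)] by simp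
  from ell_bound(1)[OF this] have "\<beta> * LL.nr (\<psi>' - ?A')\<le>LL.nr (\<delta>' - \<delta>)" .
  moreover have "?a - ?b = \<beta> *\<^sub>R (\<psi>' - ?A')" by (simp add: scaleR_right_diff_distrib)
  ultimately show ?thesis using LL.nr_scale[OF LL.diff_mem[OF p(2) ell_LL'[OF e(2)]], of \<beta>] \<beta>_pos by simp
 qed
 qed (use \<epsilon>_pos in auto)
 finally show ?thesis .
qed

end

end

section \<open>The directional derivative of the solution map and the chain rule for the
  objective\<close>

section \<open>Directional differentiability\<close>

lemma ev_right_pos: "\<forall>\<^sub>F s::real in at_right 0. s > 0"
 by (simp add: eventually_at_filter)

lemma (in semi_inner) nr_limit_unique:
 assumes Q: "\<And>s::real. Q s\<in>V" and a: "a\<in>V" and b: "b\<in>V"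
  and R: "(R \<longlongrightarrow> 0) (at_right 0)" and Qb: "((%s. nr (Q s - b)) \<longlongrightarrow> 0) (at_right 0)" and le: "\<And>s. nr (Q s - a)\<le>R s"
 shows "nr (a - b) = 0"
proof -
 have "nr (a - b)\<le>0"
 proof (rule tendsto_le[OF _ _ tendsto_const])
  show "((%s. R s + nr (Q s - b)) \<longlongrightarrow> 0) (at_right 0)" using tendsto_add[OF R Qb] by simp
  show "\<forall>\<^sub>F s in at_right 0. nr (a - b)\<le>R s + nr (Q s - b)"
   using nr_diff_triangle[OF a Q b] nr_diff_commute[OF a Q] le by (intro always_eventually allI) (metis add_right_mono order_trans)
 qed simp
 then show ?thesis using nr_nonneg[OF diff_mem[OF a b]] by simp
qed

text \<open>Chain rule along a curve with a one-sided derivative d. The difference quotients k of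
  the curve stay bounded, so the Frechet remainder is o(s), and D k tends to D d.\<close>

lemma (in semi_inner) frechet_imp_dir_deriv:
 assumes x: "x\<in>V" and d: "d\<in>V" and y: "\<And>s::real. s > 0 ==> y s\<in>V"
  and conv: "((%s. nr ((1 / s) *\<^sub>R (y s - x) - d)) \<longlongrightarrow> 0) (at_right 0)"
  and add: "\<And>u v. u\<in>V ==> v\<in>V ==> D (u + v) = D u + D v"
  and scale: "\<And>c u. u\<in>V ==> D (c *\<^sub>R u) = c * D u"
  and bound: "\<And>u. u\<in>V ==> \<bar>D u\<bar>\<le>C * nr u"
  and fr: "\<And>e. e > 0 ==> \<exists>r>0. \<forall>h\<in>V. nr h < r\<longrightarrow>\<bar>F (x + h) - F x - D h\<bar>\<le>e * nr h"
 shows "((%s. (F (y s) - F x) / s) \<longlongrightarrow> (D d :: real)) (at_right (0::real))"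
proof (rule tendstoI)
 fix e :: real assume e: "e > 0"
 have nd: "nr d\<ge>0" by (rule nr_nonneg[OF d])
 \<comment> \<open>Chosen so that the remainder contributes at most e/2 for difference quotients of
   norm at most |d| + 1.\<close>
 define e' where "e' = e / (2 * (nr d + 1))"
 have e': "e' > 0" using e nd by (simp add: e'_def)
 obtain r where r: "r > 0" "\<And>h. h\<in>V ==> nr h < r ==> \<bar>F (x + h) - F x - D h\<bar>\<le>e' * nr h" using fr[OF e'] by blast
 have "\<forall>\<^sub>F s in at_right 0. nr ((1 / s) *\<^sub>R (y s - x) - d) < min 1 (e / (2 * (\<bar>C\<bar> + 1)))"
  using e by (intro order_tendstoD(2)[OF conv]) auto
 moreover have "\<forall>\<^sub>F s in at_right 0. s * (nr d + 1) < r"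
 proof -
  have "((%s. s * (nr d + 1)) \<longlongrightarrow> 0 * (nr d + 1)) (at_right 0)" by (intro tendsto_intros)
  then show ?thesis using r(1) by (intro order_tendstoD(2)) auto
 qed
 ultimately show "\<forall>\<^sub>F s in at_right 0. dist ((F (y s) - F x) / s) (D d) < e"
  using ev_right_pos
 proof eventually_elim
  case (elim s)
  define k where "k = (1 / s) *\<^sub>R (y s - x)"
  have k: "k\<in>V" unfolding k_def by (intro scale_mem diff_mem y x elim(3))
  have h: "y s - x = s *\<^sub>R k" using elim(3) by (simp add: k_def)
  have kd: "nr (k - d) < 1" "nr (k - d) < e / (2 * (\<bar>C\<bar> + 1))" using elim(1) by (auto simp: k_def)
  have nk: "nr k\<le>nr d + 1" using nr_le_add_diff[OF k d] kd by simp
  have "nr (s *\<^sub>R k) = s * nr k" using nr_scale[OF k, of s] elim(3) by simp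
  moreover have "s * nr k\<le>s * (nr d + 1)" using nk elim(3) by simp
  ultimately have "\<bar>F (x + s *\<^sub>R k) - F x - D (s *\<^sub>R k)\<bar>\<le>e' * (s * nr k)"
   using r(2)[OF scale_mem[OF k, of s]] elim(2) by simp
  moreover have "x + s *\<^sub>R k = y s" by (simp flip: h)
  ultimately have "\<bar>F (y s) - F x - s * D k\<bar>\<le>s * (e' * nr k)" using scale[OF k] by (simp add: mult_ac)
  moreover have "F (y s) - F x - s * D k = s * ((F (y s) - F x) / s - D k)" using elim(3) by (simp add: field_simps)
  ultimately have "\<bar>(F (y s) - F x) / s - D k\<bar>\<le>e' * nr k" using elim(3) by (simp add: abs_mult)
  also have "\<dots>\<le>e' * (nr d + 1)" using nk e' by simp
  also have "\<dots> = e / 2" using nd by (simp add: e'_def field_simps)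
  finally have 1: "\<bar>(F (y s) - F x) / s - D k\<bar>\<le>e / 2" .
  have kdV: "k - d\<in>V" by (rule diff_mem[OF k d])
  have "D k = D (k - d) + D d" using add[OF kdV d] by simp
  then have "\<bar>D k - D d\<bar>\<le>C * nr (k - d)" using bound[OF kdV] by simp
  also have "\<dots>\<le>(\<bar>C\<bar> + 1) * nr (k - d)" using nr_nonneg[OF kdV] by (intro mult_right_mono) auto
  also have "\<dots> < (\<bar>C\<bar> + 1) * (e / (2 * (\<bar>C\<bar> + 1)))" by (rule mult_strict_left_mono[OF kd(2)]) auto
  also have "\<dots> = e / 2" by (simp add: field_simps)
  finally show ?case using 1 unfolding dist_real_def by linarith
 qed
qed

context bounded_cylinder
begin

definition ipP where "ipP p p' = lip (fst p) (fst p') + J.gip 1 1 (snd p) (snd p')"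

sublocale P: semi_inner "LL\<times>J.gdom" ipP
proof
 fix u v :: "'n evol\<times>'n evol"
 assume "u\<in>LL\<times>J.gdom" "v\<in>LL\<times>J.gdom"
 then show "ipP u v = ipP v u" using LL.B_sym[of "fst u" "fst v"] J1.B_sym[of "snd u" "snd v"] by (auto simp: ipP_def)
qed (auto simp: ipP_def zero_prod_def LL.zero_mem J1.zero_mem LL.add_mem J1.add_mem LL.scale_mem J1.scale_mem LL.B_add J1.B_add
   LL.B_scale J1.B_scale distrib_left intro!: add_nonneg_nonneg LL.B_pos J1.B_pos)

lemma P_nr: "u\<in>LL ==> v\<in>J.gdom ==> P.nr (u, v) = sqrt ((LL.nr u)^2 + (J1.nr v)^2)"
 by (simp add: P.nr_def ipP_def LL.nr_sq J1.nr_sq)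

lemma P_nr_le: "u\<in>LL ==> v\<in>J.gdom ==> P.nr (u, v)\<le>LL.nr u + J1.nr v"
 using sqrt_sum_squares_le_sum[OF LL.nr_nonneg J1.nr_nonneg, of u v] by (simp add: P_nr)

lemma T1_nr_le: "trel y z ==> T1.nr y\<le>LL.nr z + LL.nr y"
proof -
 assume t: "trel y z"
 note m = trel_LL[OF t]
 have "T1.nr y = sqrt ((LL.nr z)^2 + (LL.nr y)^2)"
  using Tr_nr_sq[OF t] T1.nr_nonneg[OF Tr_gdomI[OF t]] by (metis real_sqrt_abs abs_of_nonneg)
 then show ?thesis using sqrt_sum_squares_le_sum[OF LL.nr_nonneg[OF m(2)] LL.nr_nonneg[OF m(1)]] by simp
qed

lemma LL_nr_le_T1: "y\<in>Tr.gdom ==> LL.nr y\<le>T1.nr y"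
proof -
 assume y: "y\<in>Tr.gdom"
 show ?thesis
  by (rule power2_le_imp_le) (use Tr_nr_sq[OF trel_time_deriv[OF y]] T1.nr_nonneg[OF y] in auto)
qed

text \<open>\<open>vint\<close> is additive only up to null functions, and u, v are primitives only
  up to null functions; the identity is the sum of four such null terms.\<close>

lemma vint_quotient:
 assumes a: "a\<in>LL" and b: "b\<in>LL" and c: "c\<in>LL"
  and u: "u\<in>LL" "LL.nr (u - vint a) = 0" and v: "v\<in>LL" "LL.nr (v - vint b) = 0"
 shows "LL.nr (r *\<^sub>R (u - v) - vint c - vint (r *\<^sub>R (a - b) - c)) = 0"
proof -
 have ab: "r *\<^sub>R (a - b)\<in>LL" by (intro LL.scale_mem LL.diff_mem a b)
 let ?A = "r *\<^sub>R (u - vint a)" and ?B = "r *\<^sub>R (v - vint b)" and ?C = "r *\<^sub>R (vint (a - b) - (vint a - vint b))"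
  and ?D = "vint (r *\<^sub>R (a - b) - c) - (vint (r *\<^sub>R (a - b)) - vint c)"
 have m: "?A\<in>LL" "?B\<in>LL" "?C\<in>LL" "?D\<in>LL"
  by (intro LL.scale_mem LL.diff_mem vint_LL a b c u v)+
 have z: "LL.nr ?A = 0" "LL.nr ?B = 0" "LL.nr ?C = 0" "LL.nr ?D = 0"
  using LL.nr_scale[of "u - vint a" r] LL.nr_scale[of "v - vint b" r] LL.nr_scale[of "vint (a - b) - (vint a - vint b)" r]
   u v vint_diff[OF a b] vint_diff[OF ab c] by (auto intro!: LL.diff_mem vint_LL a b)
 have "LL.nr (?A - ?B - (?C + ?D))\<le>LL.nr (?A - ?B) + LL.nr (?C + ?D)" by (intro LL.nr_triangle_diff LL.diff_mem LL.add_mem m)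
 moreover have "LL.nr (?A - ?B)\<le>LL.nr ?A + LL.nr ?B" by (intro LL.nr_triangle_diff m)
 moreover have "LL.nr (?C + ?D)\<le>LL.nr ?C + LL.nr ?D" by (intro LL.nr_triangle m)
 moreover have "LL.nr (?A - ?B - (?C + ?D))\<ge>0" by (intro LL.nr_nonneg LL.diff_mem LL.add_mem m)
 ultimately have "LL.nr (?A - ?B - (?C + ?D)) = 0" using z by linarith
 moreover have "?A - ?B - (?C + ?D) = r *\<^sub>R (u - v) - vint c - vint (r *\<^sub>R (a - b) - c)"
  using vint_scale[of r "a - b"] by (simp add: scaleR_right_diff_distrib)
 ultimately show ?thesis by simp
qed

end

context control
begin

text \<open>The linear prediction g + s g' is inserted into the fixed point equation for l + s
  \<delta>. Its residual is o(s) because the superposition operators are directionally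
  differentiable, and \<open>volterra_stable\<close> bounds the distance to the true solution by
  this residual.\<close>

lemma state_dir_deriv:
 assumes l: "l\<in>LL" and \<delta>: "\<delta>\<in>LL" and s: "state l q \<phi> g" and nc: "nullc q"
  and li: "lin (zf q \<phi>) q \<psi> g'" and e: "ell \<psi> (\<beta> *\<^sub>R vint g' + \<delta>)"
  and st: "\<And>s::real. s > 0 ==> state (l + s *\<^sub>R \<delta>) (qq s) (ff s) (gg s)"
 shows "((%s. T1.nr ((1 / s) *\<^sub>R (qq s - q) - vint g')) \<longlongrightarrow> 0) (at_right 0)"
  "((%s. J1.nr ((1 / s) *\<^sub>R (ff s - \<phi>) - \<psi>)) \<longlongrightarrow> 0) (at_right 0)"
proof -
 let ?G = "%s. (1 / s) *\<^sub>R (gg s - g) - g'"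
 note d = stateD[OF s]
 note dt = stateD[OF st]
 have g': "g'\<in>LL" and \<psi>: "\<psi>\<in>LL" using li ell_LL'[OF e] by (auto simp: lin_def)
 define \<eta> where "\<eta> = vint g'"
 have \<eta>: "\<eta>\<in>LL" unfolding \<eta>_def by (rule vint_LL[OF g'])
 let ?z = "zf q \<phi>"
 have z: "?z\<in>LL" by (rule zf_LL[OF d(5,7)])
 define h where "h = (- \<beta>) *\<^sub>R (\<eta> - \<psi>) - dF q \<eta>"
 have h: "h\<in>LL" unfolding h_def \<eta>_def by (rule lin_arg_LL[OF d(5) d(5) nc g' \<psi>])
 \<comment> \<open>The argument of the maximum along the predicted line, not along the true
   states.\<close>
 define y where "y s = zf (q + s *\<^sub>R \<eta>) (\<phi> + s *\<^sub>R \<psi>)" for s :: real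
 have ql: "q + s *\<^sub>R \<eta>\<in>LL" and pl: "\<phi> + s *\<^sub>R \<psi>\<in>LL" for s
  by (intro LL.add_mem LL.scale_mem d(5,7) \<eta> \<psi>)+
 have y: "y s\<in>LL" for s unfolding y_def by (rule zf_LL[OF ql pl])
 have Hd: "((%s. LL.nr ((1 / s) *\<^sub>R (H (q + s *\<^sub>R \<eta>) - H q) - H' q \<eta>)) \<longlongrightarrow> 0) (at_right 0)"
  by (rule tendsto_within_subset[OF hist_deriv_tendsto[OF d(5) \<eta>]]) auto
 have Fd: "((%s. LL.nr ((1 / s) *\<^sub>R ((%t x. f (H (q + s *\<^sub>R \<eta>) t x)) - (%t x. f (H q t x))) - dF q \<eta>)) \<longlongrightarrow> 0) (at_right 0)"
 proof (rule superposition_dir_deriv(2)[OF nonsmooth_lipschitz[OF f] hist_LL[OF d(5)] hist_deriv_LL[OF d(5) \<eta>] hist_LL[OF ql] Hd])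
  show "case_prod (dF q \<eta>)\<in>meas MC" by (rule LL_meas[OF dF_LL[OF d(5) d(5) nc \<eta>]])
  show "AE p in MC. ((%s. (f (case_prod (H q) p + s * case_prod (H' q \<eta>) p) - f (case_prod (H q) p)) / s) \<longlongrightarrow> case_prod (dF q \<eta>) p) (at_right 0)"
   using null_contact_AE[OF nc]
  proof eventually_elim
   case (elim p)
   then show ?case using nonsmooth_dir_deriv[OF f elim] by (simp add: deriv_f_hist_def case_prod_unfold)
  qed
 qed
 have yd: "((%s. LL.nr ((1 / s) *\<^sub>R (y s - ?z) - h)) \<longlongrightarrow> 0) (at_right 0)"
 proof (rule Lim_transform_eventually[OF Fd])
  show "\<forall>\<^sub>F s in at_right 0. LL.nr ((1 / s) *\<^sub>R ((%t x. f (H (q + s *\<^sub>R \<eta>) t x)) - (%t x. f (H q t x))) - dF q \<eta>)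
    = LL.nr ((1 / s) *\<^sub>R (y s - ?z) - h)"
   using ev_right_pos
  proof eventually_elim
   case (elim s)
   let ?F = "(1 / s) *\<^sub>R ((%t x. f (H (q + s *\<^sub>R \<eta>) t x)) - (%t x. f (H q t x))) - dF q \<eta>"
   have F: "?F\<in>LL" by (intro LL.diff_mem LL.scale_mem fcomp_LL hist_LL ql d(5) dF_LL[OF d(5) d(5) nc] \<eta>)
   have "(1 / s) *\<^sub>R (y s - ?z) - h = - ?F"
    using elim by (simp add: fun_eq_iff y_def z_of_def h_def scaleR_fun_def field_simps)
   then show ?case using LL.nr_minus[OF F] by simp
  qed
 qed
 let ?m = "%u t x. max (u t x) (0::real)" and ?md = "%t x. max_dir (?z t x) (h t x)"
 have md: "?md\<in>LL" by (rule max_dir_LL[OF z h])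
 have Md: "((%s. LL.nr ((1 / s) *\<^sub>R (?m (y s) - ?m ?z) - ?md)) \<longlongrightarrow> 0) (at_right 0)"
  by (rule superposition_dir_deriv(2)[OF max_lipschitz z h y yd])
   (use LL_meas[OF md] in \<open>auto simp: case_prod_unfold intro!: max_dir_deriv\<close>)
 define K where "K = 2 * exp (vrate CG * T / 2)"
 have K: "K > 0" by (simp add: K_def)
 \<comment> \<open>Up to null functions, the residual of g + s g' is s/\<epsilon> times the
   remainder of the maximum; dividing by s bounds the error of the difference quotient.\<close>
 have gb: "LL.nr (?G s)\<le>K * (1 / \<epsilon> * LL.nr ((1 / s) *\<^sub>R (?m (y s) - ?m ?z) - ?md))"
  if t: "s > 0" for s
 proof -
  let ?l = "l + s *\<^sub>R \<delta>" and ?g = "g + s *\<^sub>R g'"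
  have lL: "?l\<in>LL" and gL: "?g\<in>LL" by (intro LL.add_mem LL.scale_mem l \<delta> d(8) g')+
  have ey: "ell (\<phi> + s *\<^sub>R \<psi>) (\<beta> *\<^sub>R (q + s *\<^sub>R \<eta>) + ?l)"
   using ell_add[OF d(3) ell_scale[OF e, of s]] by (simp add: \<eta>_def scaleR_right_distrib algebra_simps)
  have "LL.nr (vint ?g - (vint g + s *\<^sub>R \<eta>)) = 0"
   using vint_add[OF d(8) LL.scale_mem[OF g', of s]] by (simp add: vint_scale \<eta>_def)
  moreover have "LL.nr (vint g + s *\<^sub>R \<eta> - (q + s *\<^sub>R \<eta>)) = 0"
   using LL_eq_sym[OF d(5) vint_LL[OF d(8)] d(9)] by simp
  ultimately have qe: "LL.nr (vint ?g - (q + s *\<^sub>R \<eta>)) = 0"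
   by (rule LL_eq_trans[OF vint_LL[OF gL] LL.add_mem[OF vint_LL[OF d(8)] LL.scale_mem[OF \<eta>]] ql])
  note Gz = G_rep[OF ql vint_LL[OF gL] ey lL qe, folded y_def]
  have GL: "G ?l (vint ?g)\<in>LL" by (rule wlip_LL[OF G_lipschitz[OF lL] vint_LL[OF gL]])
  let ?R = "(1 / s) *\<^sub>R (?m (y s) - ?m ?z) - ?md"
  have RL: "?R\<in>LL" by (intro LL.diff_mem LL.scale_mem max_LL y z md)
  let ?a = "g - mx ?z" and ?b = "g' - mxd ?z h" and ?c = "(s / \<epsilon>) *\<^sub>R ?R"
  have abc: "?a\<in>LL" "?b\<in>LL" "?c\<in>LL" by (intro LL.diff_mem LL.scale_mem mx_LL mxd_LL y z h RL d(8) g')+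
  have az: "LL.nr ?a = 0" "LL.nr ?b = 0" using d(4) li by (auto simp: lin_def h_def \<eta>_def)
  \<comment> \<open>The equations for g and g', valid up to the null functions \<open>?a\<close> and
    \<open>?b\<close>, cancel the terms of order 0 and 1 in s; only the remainder \<open>?R\<close>
    is left.\<close>
  have de: "?g - mx (y s) = ?a + s *\<^sub>R ?b - ?c"
   using t \<epsilon>_pos by (simp add: fun_eq_iff mx_def mxd_def scaleR_fun_def field_simps)
  have "LL.nr (?g - mx (y s))\<le>LL.nr (?a + s *\<^sub>R ?b) + LL.nr ?c"
   unfolding de by (intro LL.nr_triangle_diff LL.add_mem LL.scale_mem abc)
  moreover have "LL.nr (?a + s *\<^sub>R ?b)\<le>LL.nr ?a + LL.nr (s *\<^sub>R ?b)" by (intro LL.nr_triangle LL.scale_mem abc)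
  moreover have "LL.nr (s *\<^sub>R ?b) = 0" using LL.nr_scale[OF abc(2), of s] az by simp
  moreover have "LL.nr ?c = s / \<epsilon> * LL.nr ?R" using LL.nr_scale[OF RL, of "s / \<epsilon>"] t \<epsilon>_pos by simp
  ultimately have 1: "LL.nr (?g - mx (y s))\<le>s / \<epsilon> * LL.nr ?R" using az by linarith
  have "LL.nr (?g - G ?l (vint ?g))\<le>LL.nr (?g - mx (y s)) + LL.nr (mx (y s) - G ?l (vint ?g))"
   by (rule LL.nr_diff_triangle[OF gL mx_LL[OF y] GL])
  with 1 have 2: "LL.nr (?g - G ?l (vint ?g))\<le>s / \<epsilon> * LL.nr ?R"
   using LL_eq_sym[OF GL mx_LL[OF y] Gz] by linarith
  note tg = dt(8)[OF t]
  have GtL: "G ?l (vint (gg s))\<in>LL" by (rule wlip_LL[OF G_lipschitz[OF lL] vint_LL[OF tg]])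
  have "LL.nr ((gg s - G ?l (vint (gg s))) - (?g - G ?l (vint ?g)))\<le>LL.nr (gg s - G ?l (vint (gg s))) + LL.nr (?g - G ?l (vint ?g))"
   by (intro LL.nr_triangle_diff LL.diff_mem tg GtL gL GL)
  with 2 have 3: "LL.nr ((gg s - G ?l (vint (gg s))) - (?g - G ?l (vint ?g)))\<le>s / \<epsilon> * LL.nr ?R"
   using state_fixed_point[OF st[OF t] lL] by linarith
  have 4: "LL.nr (gg s - ?g)\<le>K * (s / \<epsilon> * LL.nr ?R)"
   using volterra_stable[OF G_lipschitz[OF lL] tg gL] mult_left_mono[OF 3, of K] K unfolding K_def by linarith
  have "(1 / s) *\<^sub>R (gg s - g) - g' = (1 / s) *\<^sub>R (gg s - ?g)"
   using t by (simp add: fun_eq_iff scaleR_fun_def field_simps)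
  then have "LL.nr (?G s) = (1 / s) * LL.nr (gg s - ?g)"
   using LL.nr_scale[OF LL.diff_mem[OF tg gL], of "1 / s"] t by simp
  also have "\<dots>\<le>(1 / s) * (K * (s / \<epsilon> * LL.nr ?R))" using 4 t by (intro mult_left_mono) auto
  also have "\<dots> = K * (1 / \<epsilon> * LL.nr ?R)" using t by simp
  finally show ?thesis .
 qed
 have gL: "(1 / s) *\<^sub>R (gg s - g) - g'\<in>LL" if "s > 0" for s
  by (intro LL.diff_mem LL.scale_mem dt(8)[OF that] d(8) g')
 have glim: "((%s. LL.nr (?G s)) \<longlongrightarrow> 0) (at_right 0)"
 proof (rule Lim_null_comparison)
  show "\<forall>\<^sub>F s in at_right 0. norm (LL.nr (?G s))\<le>K * (1 / \<epsilon> * LL.nr ((1 / s) *\<^sub>R (?m (y s) - ?m ?z) - ?md))"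
   using ev_right_pos
  proof eventually_elim
   case (elim s)
   show ?case using gb[OF elim] LL.nr_nonneg[OF gL[OF elim]] by simp
  qed
  have "((%s. K * (1 / \<epsilon> * LL.nr ((1 / s) *\<^sub>R (?m (y s) - ?m ?z) - ?md))) \<longlongrightarrow> K * (1 / \<epsilon> * 0)) (at_right 0)"
   by (intro tendsto_mult tendsto_const Md)
  then show "((%s. K * (1 / \<epsilon> * LL.nr ((1 / s) *\<^sub>R (?m (y s) - ?m ?z) - ?md))) \<longlongrightarrow> 0) (at_right 0)" by simp
 qed
 define Cv where "Cv = exp (T / 2) * sqrt T"
 have qL: "(1 / s) *\<^sub>R (qq s - q) - \<eta>\<in>LL" if "s > 0" for s
  by (intro LL.diff_mem LL.scale_mem dt(5)[OF that] d(5) \<eta>)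
 have qb: "LL.nr ((1 / s) *\<^sub>R (qq s - q) - \<eta>)\<le>Cv * LL.nr (?G s)" if t: "s > 0" for s
 proof -
  have "LL.nr ((1 / s) *\<^sub>R (qq s - q) - \<eta> - vint (?G s)) = 0"
   unfolding \<eta>_def by (rule vint_quotient[OF dt(8)[OF t] d(8) g' dt(5,9)[OF t] d(5,9)])
  then have "LL.nr ((1 / s) *\<^sub>R (qq s - q) - \<eta>) = LL.nr (vint (?G s))"
   by (rule LL.nr_cong[OF qL[OF t] vint_LL[OF gL[OF t]]])
  then show ?thesis using vint_bound[OF gL[OF t]] by (simp add: Cv_def)
 qed
 show "((%s. T1.nr ((1 / s) *\<^sub>R (qq s - q) - vint g')) \<longlongrightarrow> 0) (at_right 0)"
 proof (rule Lim_null_comparison)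
  show "\<forall>\<^sub>F s in at_right 0. norm (T1.nr ((1 / s) *\<^sub>R (qq s - q) - vint g'))\<le>(1 + Cv) * LL.nr (?G s)"
   using ev_right_pos
  proof eventually_elim
   case (elim s)
   have t: "trel ((1 / s) *\<^sub>R (qq s - q) - vint g') (?G s)"
    by (intro trel_diff trel_scale dt(1)[OF elim] d(1) vint_trel g')
   show ?case using T1_nr_le[OF t] qb[OF elim] T1.nr_nonneg[OF Tr_gdomI[OF t]] by (simp add: \<eta>_def algebra_simps)
  qed
  have "((%s. (1 + Cv) * LL.nr (?G s)) \<longlongrightarrow> (1 + Cv) * 0) (at_right 0)"
   by (intro tendsto_mult tendsto_const glim)
  then show "((%s. (1 + Cv) * LL.nr (?G s)) \<longlongrightarrow> 0) (at_right 0)" by simp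
 qed
 obtain C where C: "C > 0" "\<And>u. u\<in>J.gdom ==> J1.nr u\<le>C * JA.nr u"
  "\<And>u. u\<in>J.gdom ==> JA.nr u\<le>C * J1.nr u" by (rule J1_JA_const) (rule that)
 \<comment> \<open>By linearity of the elliptic equation, the error in \<phi> solves it with \<beta>
   times the error in q on the right.\<close>
 show "((%s. J1.nr ((1 / s) *\<^sub>R (ff s - \<phi>) - \<psi>)) \<longlongrightarrow> 0) (at_right 0)"
 proof (rule Lim_null_comparison)
  show "\<forall>\<^sub>F s in at_right 0. norm (J1.nr ((1 / s) *\<^sub>R (ff s - \<phi>) - \<psi>))\<le>C * (sqrt \<beta> * (Cv * LL.nr (?G s)))"
   using ev_right_pos
  proof eventually_elim
   case (elim s)
   let ?u = "(1 / s) *\<^sub>R (ff s - \<phi>) - \<psi>" and ?v = "(1 / s) *\<^sub>R (qq s - q) - \<eta>"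
   have "ell ?u ((1 / s) *\<^sub>R ((\<beta> *\<^sub>R qq s + (l + s *\<^sub>R \<delta>)) - (\<beta> *\<^sub>R q + l)) - (\<beta> *\<^sub>R vint g' + \<delta>))"
    by (intro ell_diff ell_scale dt(3)[OF elim] d(3) e)
   moreover have "(1 / s) *\<^sub>R ((\<beta> *\<^sub>R qq s + (l + s *\<^sub>R \<delta>)) - (\<beta> *\<^sub>R q + l)) - (\<beta> *\<^sub>R vint g' + \<delta>) = \<beta> *\<^sub>R ?v"
    using elim by (simp add: fun_eq_iff scaleR_fun_def \<eta>_def field_simps)
   ultimately have E: "ell ?u (\<beta> *\<^sub>R ?v)" by simp
   have "sqrt \<beta> * JA.nr ?u\<le>\<beta> * LL.nr ?v"
    using ell_bound(2)[OF E] LL.nr_scale[OF qL[OF elim], of \<beta>] \<beta>_pos by simp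
   also have "\<dots> = sqrt \<beta> * (sqrt \<beta> * LL.nr ?v)" using \<beta>_pos by simp
   finally have "JA.nr ?u\<le>sqrt \<beta> * LL.nr ?v" using \<beta>_pos by simp
   also have "\<dots>\<le>sqrt \<beta> * (Cv * LL.nr (?G s))" using qb[OF elim] \<beta>_pos by (intro mult_left_mono) auto
   finally have "C * JA.nr ?u\<le>C * (sqrt \<beta> * (Cv * LL.nr (?G s)))" using C(1) by (intro mult_left_mono) auto
   then show ?case using C(2)[OF ell_J[OF E]] J1.nr_nonneg[OF ell_J[OF E]] by simp
  qed
  have "((%s. C * (sqrt \<beta> * (Cv * LL.nr (?G s)))) \<longlongrightarrow> C * (sqrt \<beta> * (Cv * 0))) (at_right 0)"
   by (intro tendsto_mult tendsto_const glim)
  then show "((%s. C * (sqrt \<beta> * (Cv * LL.nr (?G s)))) \<longlongrightarrow> 0) (at_right 0)" by simp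
 qed
qed

lemma embed_dual_line:
 assumes "l\<in>LL" "\<delta>\<in>LL"
 shows "AE t in MT. \<forall>v\<in>W.gdom. (embed_dual \<Omega> l + s *\<^sub>R embed_dual \<Omega> \<delta>) t v = ipX ((l + s *\<^sub>R \<delta>) t) v"
 using LL_slice[OF assms(1)] LL_slice[OF assms(2)]
proof eventually_elim
 case (elim t)
 show ?case
 proof
  fix v assume "v\<in>W.gdom"
  then have v: "v\<in>sqi MX" by (rule W.gdom_V)
  have "(l + s *\<^sub>R \<delta>) t = l t + s *\<^sub>R \<delta> t" by (simp add: scaleR_fun_def)
  then show "(embed_dual \<Omega> l + s *\<^sub>R embed_dual \<Omega> \<delta>) t v = ipX ((l + s *\<^sub>R \<delta>) t) v"
   using X.B_add[OF elim(1) X.scale_mem[OF elim(2)] v, of s] X.B_scale[OF elim(2) v, of s]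
   by (simp add: embed_dual_def L2_inner_def scaleR_fun_def)
 qed
qed

abbreviation "S \<equiv> solution_map T \<Omega> \<alpha> \<beta> \<epsilon> f H"

lemma solution_state:
 assumes l: "l\<in>LL" and fl: "AE t in MT. \<forall>v\<in>W.gdom. fl t v = ipX (l t) v"
 shows "\<exists>g. state l (fst (S fl)) (snd (S fl)) g"
proof -
 have "\<exists>p. solves_state T \<Omega> \<alpha> \<beta> \<epsilon> f H fl p"
  using state_exists[OF l] solves_state_iff[OF l fl] by metis
 from someI_ex[OF this] have "solves_state T \<Omega> \<alpha> \<beta> \<epsilon> f H fl (fst (S fl), snd (S fl))" by (simp add: solution_map_def)
 then show ?thesis using solves_state_iff[OF l fl] by blast
qed

lemma solution_state_embed: "l\<in>LL ==> \<exists>g. state l (fst (S (embed_dual \<Omega> l))) (snd (S (embed_dual \<Omega> l))) g"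
 by (rule solution_state) (auto simp: embed_dual_def L2_inner_def)

text \<open>\<open>dir_deriv\<close> selects some limit of the difference quotients. The linearized
  state is one, and limits are unique up to seminorm zero.\<close>

lemma dir_deriv_solution:
 assumes l: "l\<in>LL" and \<delta>: "\<delta>\<in>LL" and qp: "(q, \<phi>) = S (embed_dual \<Omega> l)" and nc: "nullc q"
  and li: "lin (zf q \<phi>) q \<psi> g'" and e: "ell \<psi> (\<beta> *\<^sub>R vint g' + \<delta>)"
 defines "d \<equiv> dir_deriv (prod_space (H1L2_vanishing T \<Omega> 0) (L2H1 T \<Omega>)) S (embed_dual \<Omega> l) (embed_dual \<Omega> \<delta>)"
 shows "fst d\<in>Tr.gdom" "snd d\<in>J.gdom" "T1.nr (fst d - vint g') = 0" "J1.nr (snd d - \<psi>) = 0"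
proof -
 let ?Y = "prod_space (H1L2_vanishing T \<Omega> 0) (L2H1 T \<Omega>)"
 let ?S = "%s. S (embed_dual \<Omega> l + s *\<^sub>R embed_dual \<Omega> \<delta>)"
 have g': "g'\<in>LL" using li by (simp add: lin_def)
 obtain g where s: "state l q \<phi> g" using solution_state_embed[OF l] qp by (metis fst_conv snd_conv)
 have "\<exists>g. state (l + s *\<^sub>R \<delta>) (fst (?S s)) (snd (?S s)) g" for s
  by (intro solution_state LL.add_mem LL.scale_mem l \<delta> embed_dual_line)
 then obtain gg where st: "\<And>s. state (l + s *\<^sub>R \<delta>) (fst (?S s)) (snd (?S s)) (gg s)" by metis
 note lim = state_dir_deriv[OF l \<delta> s nc li e st]
 have qT: "q\<in>Tr.gdom" "fst (?S s)\<in>Tr.gdom" and pJ: "\<phi>\<in>J.gdom" "snd (?S s)\<in>J.gdom" for s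
  using Tr_gdomI[OF stateD(1)[OF s]] Tr_gdomI[OF stateD(1)[OF st]] stateD(6)[OF s] stateD(6)[OF st] by auto
 let ?Q = "%s u. (1 / s) *\<^sub>R (fst (?S s) - q) - u" and ?P = "%s u. (1 / s) *\<^sub>R (snd (?S s) - \<phi>) - u"
 have Q: "?Q s u\<in>Tr.gdom" if "u\<in>Tr.gdom" for s u by (intro T1.diff_mem T1.scale_mem qT that)
 have P: "?P s u\<in>J.gdom" if "u\<in>J.gdom" for s u by (intro J1.diff_mem J1.scale_mem pJ that)
 have el: "elems ?Y = {p. fst p\<in>Tr.gdom\<and>vanishes_at T (L2 \<Omega>) (fst p) 0\<and>snd p\<in>J.gdom}"
  by (auto simp: prod_space_def elems_vanishing elems_L2H1)
 have nY: "nrm ?Y ((1 / s) *\<^sub>R (?S s - S (embed_dual \<Omega> l)) - p) = sqrt ((T1.nr (?Q s (fst p)))^2 + (J1.nr (?P s (snd p)))^2)"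
  if "fst p\<in>Tr.gdom" "snd p\<in>J.gdom" for s p
  using nrm_H1L2[OF Q[OF that(1)]] nrm_L2H1[OF P[OF that(2)]]
  by (simp add: prod_space_def H1L2_vanishing_def flip: qp)
 let ?ok = "%d. d\<in>elems ?Y\<and>((%s. nrm ?Y ((1 / s) *\<^sub>R (?S s - S (embed_dual \<Omega> l)) - d)) \<longlongrightarrow> 0) (at_right (0::real))"
 have vT: "vint g'\<in>Tr.gdom" and \<psi>J: "\<psi>\<in>J.gdom" using vint_vanishing[OF g'] ell_J[OF e] by (auto simp: elems_vanishing)
 have "?ok (vint g', \<psi>)"
 proof
  show "(vint g', \<psi>)\<in>elems ?Y" unfolding el using vint_vanishing[OF g'] \<psi>J by (simp add: elems_vanishing)
  have "((%s. sqrt ((T1.nr (?Q s (vint g')))^2 + (J1.nr (?P s \<psi>))^2)) \<longlongrightarrow> sqrt (0\<^sup>2 + 0\<^sup>2)) (at_right 0)"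
   by (intro tendsto_intros lim)
  then show "((%s. nrm ?Y ((1 / s) *\<^sub>R (?S s - S (embed_dual \<Omega> l)) - (vint g', \<psi>))) \<longlongrightarrow> 0) (at_right 0)"
   using nY[of "(vint g', \<psi>)"] vT \<psi>J by simp
 qed
 then have ok: "?ok d" unfolding d_def dir_deriv_def by (rule someI[of ?ok])
 show dT: "fst d\<in>Tr.gdom" and dJ: "snd d\<in>J.gdom" using ok unfolding el by auto
 have dl: "((%s. sqrt ((T1.nr (?Q s (fst d)))^2 + (J1.nr (?P s (snd d)))^2)) \<longlongrightarrow> 0) (at_right 0)"
  using ok nY[OF dT dJ] by simp
 have sq: "T1.nr (?Q s (fst d))\<le>sqrt ((T1.nr (?Q s (fst d)))^2 + (J1.nr (?P s (snd d)))^2)"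
  "J1.nr (?P s (snd d))\<le>sqrt ((T1.nr (?Q s (fst d)))^2 + (J1.nr (?P s (snd d)))^2)" for s
  by (rule real_sqrt_sum_squares_ge1 real_sqrt_sum_squares_ge2)+
 show "T1.nr (fst d - vint g') = 0"
  by (rule T1.nr_limit_unique[OF _ dT vT dl lim(1) sq(1)]) (intro T1.scale_mem T1.diff_mem qT)
 show "J1.nr (snd d - \<psi>) = 0"
  by (rule J1.nr_limit_unique[OF _ dJ \<psi>J dl lim(2) sq(2)]) (intro J1.scale_mem J1.diff_mem pJ)
qed

end

section \<open>The dual of the energy space\<close>

context elliptic
begin

lemma WA_nr_le: "u\<in>W.gdom ==> WA.nr u\<le>sqrt (max \<alpha> \<beta>) * W1.nr u"
proof -
 assume u: "u\<in>W.gdom"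
 have s: "0\<le>(\<Sum>i\<in>UNIV. ipX (W.op u i) (W.op u i))" "0\<le>ipX u u"
  using W.rel_mem[OF W.op_rel[OF u]] by (auto intro!: sum_nonneg integral_nonneg_AE)
 have "ipA u u\<le>max \<alpha> \<beta> * W.gip 1 1 u u"
  using mult_right_mono[OF max.cobounded1 s(1), of \<alpha> \<beta>] mult_right_mono[OF max.cobounded2 s(2), of \<beta> \<alpha>]
  by (simp add: W.gip_def distrib_left)
 then show ?thesis by (simp add: WA.nr_def W1.nr_def flip: real_sqrt_mult)
qed

lemma W_gip_le:
 assumes "u\<in>W.gdom" "v\<in>W.gdom"
 shows "\<bar>ipA u v\<bar>\<le>max \<alpha> \<beta> * W1.nr u * W1.nr v"
proof -
 have "\<bar>ipA u v\<bar>\<le>WA.nr u * WA.nr v" by (rule WA.cauchy_schwarz[OF assms])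
 also have "\<dots>\<le>(sqrt (max \<alpha> \<beta>) * W1.nr u) * (sqrt (max \<alpha> \<beta>) * W1.nr v)"
  using \<alpha>_pos W1.nr_nonneg[OF assms(1)] by (intro mult_mono WA_nr_le WA.nr_nonneg assms mult_nonneg_nonneg) auto
 also have "\<dots> = max \<alpha> \<beta> * W1.nr u * W1.nr v" using \<alpha>_pos by simp
 finally show ?thesis .
qed

abbreviation "dn \<equiv> op_norm (H1 \<Omega>) real_space"

definition functional :: "((real^'n=>real)=>real)=>bool" where
 "functional g \<longleftrightarrow> bounded_linear_op (H1 \<Omega>) real_space g"

lemma functionalI:
 assumes "\<And>u v. u\<in>W.gdom ==> v\<in>W.gdom ==> g (u + v) = g u + g v"
  "\<And>c u. u\<in>W.gdom ==> g (c *\<^sub>R u) = c * g u" "\<And>u. u\<in>W.gdom ==> \<bar>g u\<bar>\<le>C * W1.nr u"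
 shows "functional g"
 unfolding functional_def bounded_linear_op_def elems_H1
proof (intro conjI exI[of _ C])
 show "\<forall>v\<in>W.gdom. nrm real_space (g v)\<le>C * nrm (H1 \<Omega>) v" using assms(3) by (simp add: real_space_def nrm_H1_W1)
qed (use assms(1,2) in \<open>auto simp: real_space_def\<close>)

lemma functional_bound:
 assumes "functional g"
 obtains C where "C\<ge>0" "\<And>u. u\<in>W.gdom ==> \<bar>g u\<bar>\<le>C * W1.nr u"
proof -
 have "\<exists>C. \<forall>u\<in>W.gdom. \<bar>g u\<bar>\<le>C * W1.nr u"
  using assms unfolding functional_def bounded_linear_op_def elems_H1 by (simp add: real_space_def nrm_H1_W1)
 then obtain C where C: "\<And>u. u\<in>W.gdom ==> \<bar>g u\<bar>\<le>C * W1.nr u" by blast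
 show ?thesis
 proof (rule that[of "max 0 C"])
  show "\<bar>g u\<bar>\<le>max 0 C * W1.nr u" if u: "u\<in>W.gdom" for u
   by (rule order_trans[OF C[OF u]]) (intro mult_right_mono W1.nr_nonneg u, simp)
 qed simp
qed

lemma dn_eq: "dn g = Sup {\<bar>g v\<bar> |v. v\<in>W.gdom\<and>W1.nr v\<le>1}"
proof -
 have "{nrm real_space (g v) |v. v\<in>elems (H1 \<Omega>)\<and>nrm (H1 \<Omega>) v\<le>1} = {\<bar>g v\<bar> |v. v\<in>W.gdom\<and>W1.nr v\<le>1}"
  by (auto simp: real_space_def elems_H1 nrm_H1_W1)
 then show ?thesis by (simp add: op_norm_def)
qed

lemma dn_le:
 assumes "C\<ge>0" "\<And>u. u\<in>W.gdom ==> W1.nr u\<le>1 ==> \<bar>g u\<bar>\<le>C"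
 shows "dn g\<le>C"
 unfolding dn_eq by (rule cSup_least) (use assms W1.zero_mem W1.nr_zero in \<open>auto intro!: exI[of _ 0]\<close>)

lemma dn_ge:
 assumes g: "functional g" and v: "v\<in>W.gdom" "W1.nr v\<le>1"
 shows "\<bar>g v\<bar>\<le>dn g"
 unfolding dn_eq
proof (rule cSup_upper)
 show "\<bar>g v\<bar>\<in>{\<bar>g v\<bar> |v. v\<in>W.gdom\<and>W1.nr v\<le>1}" using v by blast
 obtain C where C: "C\<ge>0" "\<And>u. u\<in>W.gdom ==> \<bar>g u\<bar>\<le>C * W1.nr u" by (rule functional_bound[OF g]) (rule that)
 have "\<bar>g u\<bar>\<le>C" if "u\<in>W.gdom" "W1.nr u\<le>1" for u
  using C(2)[OF that(1)] mult_left_mono[OF that(2) C(1)] by simp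
 then show "bdd_above {\<bar>g v\<bar> |v. v\<in>W.gdom\<and>W1.nr v\<le>1}" by (auto intro!: bdd_aboveI[of _ C])
qed

lemma dn_nonneg: "functional g ==> dn g\<ge>0"
 using dn_ge[OF _ W1.zero_mem] W1.nr_zero abs_ge_zero[of "g 0"] by (metis order_trans zero_le_one)

lemma functional_diff:
 assumes g: "functional g" and h: "functional h" shows "functional (g - h)"
proof -
 obtain C where C: "C\<ge>0" "\<And>u. u\<in>W.gdom ==> \<bar>g u\<bar>\<le>C * W1.nr u" by (rule functional_bound[OF g]) (rule that)
 obtain C' where C': "C'\<ge>0" "\<And>u. u\<in>W.gdom ==> \<bar>h u\<bar>\<le>C' * W1.nr u" by (rule functional_bound[OF h]) (rule that)
 show ?thesis
 proof (rule functionalI[of _ "C + C'"])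
  show "(g - h) (u + v) = (g - h) u + (g - h) v" if "u\<in>W.gdom" "v\<in>W.gdom" for u v
   using g h that unfolding functional_def bounded_linear_op_def elems_H1 by (simp add: real_space_def)
  show "(g - h) (c *\<^sub>R u) = c * (g - h) u" if "u\<in>W.gdom" for c u
   using g h that unfolding functional_def bounded_linear_op_def elems_H1 by (simp add: real_space_def right_diff_distrib)
  show "\<bar>(g - h) u\<bar>\<le>(C + C') * W1.nr u" if "u\<in>W.gdom" for u
   using C(2)[OF that] C'(2)[OF that] by (simp add: distrib_right)
 qed
qed

lemma dn_diff:
 assumes g: "functional g" and h: "functional h" shows "\<bar>dn g - dn h\<bar>\<le>dn (g - h)"
proof -
 have A: "dn g\<le>dn h + dn (g - h)" if g: "functional g" and h: "functional h" for g h
 proof (rule dn_le)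
  show "0\<le>dn h + dn (g - h)" by (intro add_nonneg_nonneg dn_nonneg h functional_diff g)
  show "\<bar>g u\<bar>\<le>dn h + dn (g - h)" if "u\<in>W.gdom" "W1.nr u\<le>1" for u
   using dn_ge[OF h that] dn_ge[OF functional_diff[OF g h] that] by simp
 qed
 have "{\<bar>(g - h) v\<bar> |v. v\<in>W.gdom\<and>W1.nr v\<le>1} = {\<bar>(h - g) v\<bar> |v. v\<in>W.gdom\<and>W1.nr v\<le>1}"
  by (simp add: abs_minus_commute)
 then have "dn (g - h) = dn (h - g)" unfolding dn_eq by simp
 then show ?thesis using A[OF g h] A[OF h g] by simp
qed

text \<open>With a = w(t) and b = \<mu>(t) this is the left-hand side of the adjoint elliptic
  equation at time t.\<close>

definition energy :: "(real^'n=>real)=>(real^'n=>real)=>(real^'n=>real)=>real" where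
 "energy a b v = - \<alpha> * Laplace \<Omega> a v + \<beta> * L2_inner \<Omega> (a - b) v"

lemma energy_eq:
 assumes a: "a\<in>W.gdom" and b: "b\<in>sqi MX" and v: "v\<in>W.gdom"
 shows "energy a b v = ipA a v - \<beta> * ipX b v"
proof -
 have "L2_inner \<Omega> (a - b) v = L2_inner \<Omega> a v - ipX b v"
  using X.B_diff[OF W.gdom_V[OF a] b W.gdom_V[OF v]] by (simp add: L2_inner_def)
 then show ?thesis
  using gip_Laplace[OF a v, of \<alpha> \<beta>] by (simp add: energy_def right_diff_distrib)
qed

lemma energy_functional:
 assumes a: "a\<in>W.gdom" and b: "b\<in>sqi MX"
 shows "functional (energy a b)" "dn (energy a b)\<le>max \<alpha> \<beta> * W1.nr a + \<beta> * X.nr b"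
proof -
 have bd: "\<bar>energy a b u\<bar>\<le>(max \<alpha> \<beta> * W1.nr a + \<beta> * X.nr b) * W1.nr u" if u: "u\<in>W.gdom" for u
 proof -
  have "\<bar>ipX b u\<bar>\<le>X.nr b * W1.nr u"
   using X.cauchy_schwarz[OF b W.gdom_V[OF u]] mult_left_mono[OF X_nr_le_W1[OF u] X.nr_nonneg[OF b]] by simp
  then have "\<bar>\<beta> * ipX b u\<bar>\<le>\<beta> * X.nr b * W1.nr u" using \<beta>_pos by (simp add: abs_mult mult.assoc)
  then show ?thesis unfolding energy_eq[OF a b u] using W_gip_le[OF a u] by (simp add: distrib_right)
 qed
 have p: "max \<alpha> \<beta> * W1.nr a + \<beta> * X.nr b\<ge>0"
  using \<alpha>_pos \<beta>_pos W1.nr_nonneg[OF a] X.nr_nonneg[OF b] by (intro add_nonneg_nonneg mult_nonneg_nonneg) auto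
 show "functional (energy a b)"
 proof (rule functionalI[OF _ _ bd])
  show "energy a b (u + v) = energy a b u + energy a b v" if "u\<in>W.gdom" "v\<in>W.gdom" for u v
   using energy_eq[OF a b that(1)] energy_eq[OF a b that(2)] energy_eq[OF a b W1.add_mem[OF that]]
    WA.B_add_right[OF that a] X.B_add_right[OF W.gdom_V[OF that(1)] W.gdom_V[OF that(2)] b] by (simp add: algebra_simps)
  show "energy a b (c *\<^sub>R u) = c * energy a b u" if "u\<in>W.gdom" for c u
   unfolding energy_eq[OF a b that] energy_eq[OF a b W1.scale_mem[OF that]]
    WA.B_scale_right[OF that a] X.B_scale_right[OF W.gdom_V[OF that] b] by (simp add: right_diff_distrib)
 qed
 show "dn (energy a b)\<le>max \<alpha> \<beta> * W1.nr a + \<beta> * X.nr b"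
 proof (rule dn_le[OF p])
  show "\<bar>energy a b u\<bar>\<le>max \<alpha> \<beta> * W1.nr a + \<beta> * X.nr b" if "u\<in>W.gdom" "W1.nr u\<le>1" for u
   using bd[OF that(1)] mult_left_mono[OF that(2) p] by simp
 qed
qed

lemma dn_energy_diff:
 assumes a: "a\<in>W.gdom" "a'\<in>W.gdom" and b: "b\<in>sqi MX" "b'\<in>sqi MX"
 shows "dn (energy a b - energy a' b')\<le>max \<alpha> \<beta> * W1.nr (a - a') + \<beta> * X.nr (b - b')"
proof -
 have "(energy a b - energy a' b') v = energy (a - a') (b - b') v" if v: "v\<in>W.gdom" for v
  unfolding minus_apply[of "energy a b"] energy_eq[OF a(1) b(1) v] energy_eq[OF a(2) b(2) v] energy_eq[OF W1.diff_mem[OF a] X.diff_mem[OF b] v]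
   WA.B_diff[OF a v] X.B_diff[OF b W.gdom_V[OF v]] right_diff_distrib by linarith
 then have "{\<bar>(energy a b - energy a' b') v\<bar> |v. v\<in>W.gdom\<and>W1.nr v\<le>1} = {\<bar>energy (a - a') (b - b') v\<bar> |v. v\<in>W.gdom\<and>W1.nr v\<le>1}"
  by force
 then have "dn (energy a b - energy a' b') = dn (energy (a - a') (b - b'))" unfolding dn_eq by presburger
 then show ?thesis using energy_functional(2)[OF W1.diff_mem[OF a] X.diff_mem[OF b]] by simp
qed

text \<open>Composing simple approximations of w in H^1 and of \<mu> in L^2 gives simple functions
  with values in the dual. They converge in the dual norm by \<open>dn_energy_diff\<close>, which
  yields strong measurability; the bound on \<open>energy\<close> gives square
  integrability.\<close>

lemma energy_L2_dual:
 assumes w: "w\<in>J.gdom" and m: "\<mu>\<in>LL"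
 shows "(%t. energy (w t) (\<mu> t))\<in>elems (L2_time T (dual_space (H1 \<Omega>)))"
proof -
 obtain p where p: "\<And>n::nat. p n\<in>simple_H1" "AE t in MT. nullseq (%n. W1.nr (p n t - w t))" by (rule simple_H1_approx[OF w]) (rule that)
 obtain y0 where y0: "\<And>n::nat. y0 n\<in>simple_L2" "nullseq (%n. LL.nr (y0 n - \<mu>))" by (rule simple_L2_dense[OF m]) (rule that)
 obtain r :: "nat=>nat" where r: "strict_mono r" "AE t in MT. nullseq (%n. nrm (L2 \<Omega>) (y0 (r n) t - \<mu> t))"
  by (rule LL_tendsto_slices[OF simple_L2_LL[OF y0(1)] m y0(2)])
 define s where "s n t = energy (p n t) (y0 (r n) t)" for n t
 have pw: "p n t\<in>W.gdom" and yx: "y0 (r n) t\<in>sqi MX" if "t\<in>{0<..<T}" for n t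
  using p(1)[of n] y0(1)[of "r n"] that unfolding simple_H1_def simple_L2_def by blast+
 have ss: "simple_function MT (s n)" for n
 proof -
  have "simple_function MT (p n)" "simple_function MT (y0 (r n))"
   using p(1)[of n] y0(1)[of "r n"] by (simp_all add: simple_H1_def simple_L2_def)
  then show ?thesis unfolding s_def by (rule simple_function_compose2)
 qed
 have fs: "functional (s n t)" if "t\<in>{0<..<T}" for n t
  unfolding s_def by (rule energy_functional(1)[OF pw[OF that] yx[OF that]])
 have tT: "AE t in MT. t\<in>{0<..<T}" by (rule AE_I2) simp
 have fG: "AE t in MT. functional (energy (w t) (\<mu> t))"
  using J_slice[OF w] LL_slice[OF m] by eventually_elim (rule energy_functional(1))
 have lim: "AE t in MT. nullseq (%n. dn (energy (w t) (\<mu> t) - s n t))"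
  using p(2) r(2) J_slice[OF w] LL_slice[OF m] tT
 proof eventually_elim
  case (elim t)
  show ?case
  proof (rule Lim_null_comparison)
   show "\<forall>\<^sub>F n in sequentially. norm (dn (energy (w t) (\<mu> t) - s n t))\<le>max \<alpha> \<beta> * W1.nr (p n t - w t) + \<beta> * X.nr (y0 (r n) t - \<mu> t)"
   proof (intro always_eventually allI)
    fix n
    show "norm (dn (energy (w t) (\<mu> t) - s n t))\<le>max \<alpha> \<beta> * W1.nr (p n t - w t) + \<beta> * X.nr (y0 (r n) t - \<mu> t)"
     using dn_energy_diff[OF elim(3) pw[OF elim(5)] elim(4) yx[OF elim(5)], of n n]
      W1.nr_diff_commute[OF elim(3) pw[OF elim(5)], of n] X.nr_diff_commute[OF elim(4) yx[OF elim(5)], of n]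
      dn_nonneg[OF functional_diff[OF energy_functional(1)[OF elim(3,4)] fs[OF elim(5)]], of n]
     by (simp add: s_def)
   qed
   have "(%n. max \<alpha> \<beta> * W1.nr (p n t - w t) + \<beta> * X.nr (y0 (r n) t - \<mu> t)) \<longlonglongrightarrow> max \<alpha> \<beta> * 0 + \<beta> * 0"
    using elim(1) elim(2)[unfolded nrm_L2_X] by (intro tendsto_intros)
   then show "nullseq (%n. max \<alpha> \<beta> * W1.nr (p n t - w t) + \<beta> * X.nr (y0 (r n) t - \<mu> t))" by simp
  qed
 qed
 have dual: "elems (dual_space (H1 \<Omega>)) = Collect functional" "nrm (dual_space (H1 \<Omega>)) = dn"
  by (auto simp: dual_space_def functional_def)
 have sm: "strongly_measurable T (dual_space (H1 \<Omega>)) (%t. energy (w t) (\<mu> t))"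
  unfolding strongly_measurable_def dual using fG lim fs ss by (intro conjI exI[of _ s]) auto
 have meas: "(%t. dn (energy (w t) (\<mu> t)))\<in>meas MT"
 proof (rule leb_measurable_AE[OF IT, where u = "%t. lim (%n. dn (s n t))"])
  show "(%t. lim (%n. dn (s n t)))\<in>meas MT"
   by (intro borel_measurable_lim_metric) (use simple_function_compose1[OF ss, of dn] in \<open>auto intro: borel_measurable_simple_function\<close>)
  show "AE t in MT. lim (%n. dn (s n t)) = dn (energy (w t) (\<mu> t))"
   using lim fG tT
  proof eventually_elim
   case (elim t)
   have "nullseq (%n. dn (s n t) - dn (energy (w t) (\<mu> t)))"
   proof (rule Lim_null_comparison[OF _ elim(1)])
    show "\<forall>\<^sub>F n in sequentially. norm (dn (s n t) - dn (energy (w t) (\<mu> t)))\<le>dn (energy (w t) (\<mu> t) - s n t)"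
     using dn_diff[OF elim(2) fs[OF elim(3)]] by (simp add: abs_minus_commute)
   qed
   then show ?case using limI LIM_zero_iff by metis
  qed
 qed
 have "integrable MT (%t. (dn (energy (w t) (\<mu> t)))^2)"
 proof (rule Bochner_Integration.integrable_bound)
  show "integrable MT (%t. 2 * (max \<alpha> \<beta>)^2 * (nrm (H1 \<Omega>) (w t))^2 + 2 * \<beta>\<^sup>2 * (X.nr (\<mu> t))^2)"
   using J_nrm_sq(1)[OF w] slice_integrable[OF m] by simp
  show "(%t. (dn (energy (w t) (\<mu> t)))^2)\<in>meas MT" using meas by measurable
  show "AE t in MT. norm ((dn (energy (w t) (\<mu> t)))^2)\<le>norm (2 * (max \<alpha> \<beta>)^2 * (nrm (H1 \<Omega>) (w t))^2 + 2 * \<beta>\<^sup>2 * (X.nr (\<mu> t))^2)"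
   using J_slice[OF w] LL_slice[OF m]
  proof eventually_elim
   case (elim t)
   let ?a = "max \<alpha> \<beta> * W1.nr (w t)" and ?b = "\<beta> * X.nr (\<mu> t)"
   have "(dn (energy (w t) (\<mu> t)))^2\<le>(?a + ?b)^2"
    by (intro power_mono energy_functional(2) dn_nonneg energy_functional(1) elim)
   also have "\<dots>\<le>2 * ?a\<^sup>2 + 2 * ?b\<^sup>2" using sum_squares_bound[of ?a ?b] by (simp add: power2_sum)
   finally show ?case by (simp add: power_mult_distrib nrm_H1_W1[OF elim(1)])
  qed
 qed
 then show ?thesis using sm by (simp add: L2_time_def dual)
qed

lemma energy_integral:
 assumes w: "w\<in>J.gdom" and m: "\<mu>\<in>LL" and p: "\<psi>\<in>J.gdom"
 shows "(\<integral>t. energy (w t) (\<mu> t) (\<psi> t)\<partial>MT) = ipE w \<psi> - \<beta> * lip \<mu> \<psi>"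
proof -
 note pL = J.gdom_V[OF p]
 have "(\<integral>t. energy (w t) (\<mu> t) (\<psi> t)\<partial>MT) = (\<integral>t. ipA (w t) (\<psi> t) - \<beta> * ipX (\<mu> t) (\<psi> t)\<partial>MT)"
 proof (rule integral_cong_AE)
  show ae: "AE t in MT. energy (w t) (\<mu> t) (\<psi> t) = ipA (w t) (\<psi> t) - \<beta> * ipX (\<mu> t) (\<psi> t)"
   using J_slice[OF w] LL_slice[OF m] J_slice[OF p] by eventually_elim (rule energy_eq)
  show M: "(%t. ipA (w t) (\<psi> t) - \<beta> * ipX (\<mu> t) (\<psi> t))\<in>meas MT"
   using J_gip_slice(1)[OF w p] lip_iterated(2)[OF m pL] by (intro borel_measurable_diff borel_measurable_times) auto
  show "(%t. energy (w t) (\<mu> t) (\<psi> t))\<in>meas MT" by (rule leb_measurable_AE[OF IT M]) (use ae in \<open>simp add: eq_commute\<close>)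
 qed
 also have "\<dots> = ipE w \<psi> - \<beta> * lip \<mu> \<psi>"
  using J_gip_slice[OF w p, of \<alpha> \<beta>] lip_iterated[OF m pL] by simp
 finally show ?thesis .
qed

end

section \<open>The optimality system: derivation, uniqueness, and sufficiency for the variational
  inequality\<close>

section \<open>Necessary and sufficient optimality conditions\<close>

context bounded_cylinder
begin

text \<open>H^1(0,T;L^2(\<Omega>)) contains all primitives \<open>vint z\<close>. Orthogonality to
  them makes the backward primitive of v null by \<open>vint_adjoint\<close>, and -v is its weak
  derivative.\<close>

lemma Tr_gdom_orthogonal:
 assumes v: "v\<in>LL" and orth: "\<And>\<delta>. \<delta>\<in>Tr.gdom ==> lip v \<delta> = 0"
 shows "LL.nr v = 0"
proof -
 have R: "lip (vintR v) z = 0" if z: "z\<in>LL" for z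
  using vint_adjoint[OF z v] orth[OF Tr_gdomI[OF vint_trel[OF z]]] LL.B_sym[OF z vintR_LL[OF v]] by simp
 show ?thesis
 proof (rule LL_eqI_test[OF v])
  fix \<theta> b assume t: "\<theta>\<in>DT" "b\<in>DX"
  have "lip (vintR v) (%t x. deriv \<theta> t * b x) = - lip (- v) (%t x. \<theta> t * b x)"
   using vintR_trel[OF v] t unfolding trel_def by blast
  then show "lip v (%t x. \<theta> t * b x) = 0"
   using R[OF test_LL(2)[OF t]] LL.B_minus[OF v test_LL(1)[OF t]] by simp
 qed
qed

lemma Tr_gdom_dense:
 assumes u: "u\<in>LL"
 obtains s where "\<And>n::nat. s n\<in>Tr.gdom" "nullseq (%n. LL.nr (s n - u))"
 by (rule LL.dense_subspace[OF _ T1.zero_mem T1.add_mem T1.scale_mem Tr_gdom_orthogonal u])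
  (auto simp: Tr.gdom_V intro: that)

lemma wlip_nr:
 assumes N: "wlip C N" and u: "u\<in>LL" and v: "v\<in>LL"
 shows "LL.nr (N u - N v)\<le>exp (T / 2) * (C * LL.nr (u - v))"
proof -
 have C: "C\<ge>0" using N by (simp add: wlip_def)
 have "LL.nr (N u - N v)\<le>exp (T / 2) * nrw 1 (N u - N v)"
  using LL_nr_le_nrw[OF LL.diff_mem[OF wlip_LL[OF N u] wlip_LL[OF N v]], of 1] by simp
 also have "\<dots>\<le>exp (T / 2) * (C * nrw 1 (u - v))" using N u v by (simp add: wlip_def)
 also have "\<dots>\<le>exp (T / 2) * (C * LL.nr (u - v))"
  using nrw_le[OF LL.diff_mem[OF u v], of 1] C by (intro mult_left_mono) auto
 finally show ?thesis .
qed

lemma slice_nr_mono: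
 assumes u: "u\<in>LL" and v: "v\<in>LL" and c: "c\<ge>0" and le: "AE p in MC. \<bar>case_prod u p\<bar>\<le>c * \<bar>case_prod v p\<bar>"
 shows "AE t in MT. X.nr (u t)\<le>c * X.nr (v t)"
proof -
 have "AE p in MC. \<bar>u (fst p) (snd p)\<bar>\<le>c * \<bar>v (fst p) (snd p)\<bar>" using le by (simp add: case_prod_unfold)
 from AE_leb_Times(1)[OF IT OX this] LL_slice[OF u] LL_slice[OF v] show ?thesis
 proof eventually_elim
  case (elim t)
  have "ipX (u t) (u t)\<le>(\<integral>x. c\<^sup>2 * (v t x * v t x)\<partial>MX)"
  proof (rule integral_mono_AE)
   show "integrable MX (%x. u t x * u t x)" "integrable MX (%x. c\<^sup>2 * (v t x * v t x))"
    using sqi_mult[OF elim(2,2)] sqi_mult[OF elim(3,3)] by auto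
   show "AE x in MX. u t x * u t x\<le>c\<^sup>2 * (v t x * v t x)"
    using elim(1)
   proof eventually_elim
    case (elim x)
    have "\<bar>u t x\<bar>\<^sup>2\<le>(c * \<bar>v t x\<bar>)^2" by (rule power_mono[OF elim]) simp
    then have "(u t x)^2\<le>c\<^sup>2 * (v t x)^2" by (simp add: power_mult_distrib)
    then show ?case by (simp add: power2_eq_square)
   qed
  qed
  then have "(X.nr (u t))^2\<le>(c * X.nr (v t))^2" by (simp add: X.nr_sq elim power_mult_distrib)
  then show ?case by (rule power2_le_imp_le) (intro mult_nonneg_nonneg c X.nr_nonneg elim)
 qed
qed

end

context control
begin

text \<open>The adjoint is defined by choice. Riesz representation supplies a candidate, since
  \<open>dF q\<close> is bounded and linear up to null functions.\<close>

lemma hilbert_adjoint_dF: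
 assumes q: "q\<in>LL" and nc: "nullc q" and m: "\<mu>\<in>LL"
 shows "hilbert_adjoint T \<Omega> (dF q) \<mu>\<in>LL"
  "\<And>\<eta>. \<eta>\<in>LL ==> lip (hilbert_adjoint T \<Omega> (dF q) \<mu>) \<eta> = lip \<mu> (dF q \<eta>)"
proof -
 note dm = dF_LL[OF q q nc]
 note lin0 = dF_linear[OF q nc]
 have z: "LL.nr (dF q 0) = 0" using lin0(2)[OF LL.zero_mem LL.zero_mem, of 0] by simp
 obtain \<nu> where n: "\<nu>\<in>LL" "\<And>\<eta>. \<eta>\<in>LL ==> lip \<nu> \<eta> = lip \<mu> (dF q \<eta>)"
 proof (rule LL.riesz_functional[of "%\<eta>. lip \<mu> (dF q \<eta>)" "LL.nr \<mu> * (exp (T / 2) * CF)"])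
  fix u v assume u: "u\<in>LL" and v: "v\<in>LL"
  show "lip \<mu> (dF q (u + v)) = lip \<mu> (dF q u) + lip \<mu> (dF q v)"
   using LL.B_cong_left[OF dm[OF LL.add_mem[OF u v]] LL.add_mem[OF dm[OF u] dm[OF v]] m lin0(1)[OF u v]]
    LL.B_sym[OF m dm[OF LL.add_mem[OF u v]]] LL.B_sym[OF m LL.add_mem[OF dm[OF u] dm[OF v]]] LL.B_add_right[OF dm[OF u] dm[OF v] m] by simp
 next
  fix c u assume u: "u\<in>LL"
  show "lip \<mu> (dF q (c *\<^sub>R u)) = c * lip \<mu> (dF q u)"
   using LL.B_cong_left[OF dm[OF LL.scale_mem[OF u]] LL.scale_mem[OF dm[OF u]] m lin0(2)[OF u u, of c]]
    LL.B_sym[OF m dm[OF LL.scale_mem[OF u, of c]]] LL.B_sym[OF m LL.scale_mem[OF dm[OF u], of c]] LL.B_scale_right[OF dm[OF u] m, of c] by simp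
 next
  fix u assume u: "u\<in>LL"
  have "LL.nr (dF q u)\<le>LL.nr (dF q 0) + LL.nr (dF q u - dF q 0)" by (rule LL.nr_le_add_diff[OF dm[OF u] dm[OF LL.zero_mem]])
  then have "LL.nr (dF q u)\<le>exp (T / 2) * CF * LL.nr u"
   using wlip_nr[OF dF_lipschitz[OF q nc] u LL.zero_mem] z by simp
  then have "LL.nr \<mu> * LL.nr (dF q u)\<le>LL.nr \<mu> * (exp (T / 2) * CF * LL.nr u)" by (rule mult_left_mono) (rule LL.nr_nonneg[OF m])
  then show "\<bar>lip \<mu> (dF q u)\<bar>\<le>LL.nr \<mu> * (exp (T / 2) * CF) * LL.nr u"
   using LL.cauchy_schwarz[OF m dm[OF u]] by (simp add: mult.assoc)
 qed (rule that)
 let ?P = "%\<nu>. \<nu>\<in>LL\<and>(\<forall>\<eta>\<in>LL. L2L2_inner T \<Omega> \<nu> \<eta> = L2L2_inner T \<Omega> \<mu> (dF q \<eta>))"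
 have "?P \<nu>" using n by (simp add: L2L2_inner_eq m dm)
 then have "?P (hilbert_adjoint T \<Omega> (dF q) \<mu>)" unfolding hilbert_adjoint_def LL_elems by (rule someI[of ?P])
 then show "hilbert_adjoint T \<Omega> (dF q) \<mu>\<in>LL"
  "\<And>\<eta>. \<eta>\<in>LL ==> lip (hilbert_adjoint T \<Omega> (dF q) \<mu>) \<eta> = lip \<mu> (dF q \<eta>)"
  by (auto simp: L2L2_inner_eq m dm)
qed

definition compl :: "'n evol=>'n evol=>'n evol=>bool" where
 "compl z \<xi> \<mu> \<longleftrightarrow> (AE p in MC.
  (case_prod z p > 0\<longrightarrow>case_prod \<mu> p = 1 / \<epsilon> * case_prod \<xi> p)\<and>(case_prod z p < 0\<longrightarrow>case_prod \<mu> p = 0) \<and>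
  (case_prod z p = 0\<longrightarrow>0\<le>case_prod \<mu> p\<and>case_prod \<mu> p\<le>1 / \<epsilon> * case_prod \<xi> p))"

text \<open>The inequality holds pointwise. Where z = 0, the upper bound on \<mu> is used for h
  \<ge> 0 and the lower bound for h < 0; elsewhere there is equality.\<close>

lemma compl_imp_ineq:
 assumes c: "compl z \<xi> \<mu>" and m: "z\<in>LL" "\<xi>\<in>LL" "\<mu>\<in>LL" "h\<in>LL"
 shows "lip \<mu> h\<le>lip (mxd z h) \<xi>"
 unfolding lip_def
proof (rule integral_mono_AE)
 show "integrable MC (%p. case_prod \<mu> p * case_prod h p)"
  "integrable MC (%p. case_prod (mxd z h) p * case_prod \<xi> p)"
  using sqi_mult[OF LL_D LL_D] m mxd_LL by blast+
 show "AE p in MC. case_prod \<mu> p * case_prod h p\<le>case_prod (mxd z h) p * case_prod \<xi> p"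
  using c unfolding compl_def
 proof eventually_elim
  case (elim p)
  obtain t x where p: "p = (t, x)" by (cases p)
  consider "z t x > 0" | "z t x < 0" | "z t x = 0" "h t x\<ge>0" | "z t x = 0" "h t x < 0" by linarith
  then show ?case
  proof cases
   case 3
   then have "\<mu> t x * h t x\<le>1 / \<epsilon> * \<xi> t x * h t x" using elim by (intro mult_right_mono) (auto simp: p)
   then show ?thesis using 3 by (simp add: p mxd_def max_dir_def mult_ac)
  next
   case 4
   then have "\<mu> t x * h t x\<le>0" using elim by (intro mult_nonneg_nonpos) (auto simp: p)
   then show ?thesis using 4 by (simp add: p mxd_def max_dir_def)
  qed (use elim in \<open>auto simp: p mxd_def max_dir_def mult_ac\<close>)
 qed
qed

text \<open>With this test function the two sides of the inequality differ by the square of its norm,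
 so that it vanishes; on each of the sets \<open>z > 0\<close>, \<open>z < 0\<close>, \<open>z = 0\<close> it measures the violation of
 the sign conditions.\<close>

lemma ineq_imp_compl:
 assumes m: "z\<in>LL" "\<xi>\<in>LL" "\<mu>\<in>LL" and le: "\<And>h. h\<in>LL ==> lip \<mu> h\<le>lip (mxd z h) \<xi>"
 shows "compl z \<xi> \<mu>"
proof -
 define h where "h t x = (let P = 1 / \<epsilon> * \<xi> t x - \<mu> t x in
  if z t x > 0 then - P else if z t x < 0 then \<mu> t x else if P < 0 then - P else if \<mu> t x < 0 then \<mu> t x else 0)" for t x
 have h: "h\<in>LL"
 proof -
  let ?P = "%t x. 1 / \<epsilon> * \<xi> t x - \<mu> t x"
  have PL: "?P\<in>LL" using LL.diff_mem[OF LL.scale_mem[OF m(2), of "1 / \<epsilon>"] m(3)] by (simp add: scaleR_fun_def fun_diff_def)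
  have b: "(%t x. \<bar>?P t x\<bar> + \<bar>\<mu> t x\<bar>)\<in>LL"
  proof -
   have "1-lipschitz_on UNIV (abs :: real=>real)" by (auto intro!: lipschitz_onI simp: dist_real_def)
   from LL.add_mem[OF lipschitz_comp_LL[OF this PL] lipschitz_comp_LL[OF this m(3)]]
   show ?thesis by (simp add: plus_fun_def)
  qed
  show ?thesis
  proof (rule LL_dominated[OF b, of _ 1])
   have "case_prod h = (%p. if case_prod z p > 0 then - case_prod ?P p else if case_prod z p < 0 then case_prod \<mu> p
     else if case_prod ?P p < 0 then - case_prod ?P p else if case_prod \<mu> p < 0 then case_prod \<mu> p else 0)"
    by (auto simp: h_def Let_def)
   also have "\<dots>\<in>meas MC"
    using LL_meas[OF m(1)] LL_meas[OF m(3)] LL_meas[OF PL] by measurable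
   finally show "case_prod h\<in>meas MC" .
   show "AE p in MC. \<bar>case_prod h p\<bar>\<le>1 * \<bar>case_prod (%t x. \<bar>?P t x\<bar> + \<bar>\<mu> t x\<bar>) p\<bar>"
    by (rule AE_I2) (auto simp: h_def Let_def case_prod_unfold)
  qed
 qed
 have eq: "mxd z h t x * \<xi> t x - \<mu> t x * h t x = - (h t x * h t x)" for t x
  by (auto simp: h_def Let_def mxd_def max_dir_def algebra_simps diff_divide_distrib)
 have i: "integrable MC (%p. case_prod u p * case_prod v p)" if "u\<in>LL" "v\<in>LL" for u v
  by (rule sqi_mult[OF LL_D[OF that(1)] LL_D[OF that(2)]])
 have "lip (mxd z h) \<xi> - lip \<mu> h = - lip h h"
  unfolding lip_def
  using Bochner_Integration.integral_diff[OF i[OF mxd_LL[OF m(1) h] m(2)] i[OF m(3) h]] eq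
  by (simp add: case_prod_unfold)
 then have "lip h h\<le>0" using le[OF h] by simp
 then have "LL.nr h = 0" using LL.B_pos[OF h] by (simp add: LL.nr_def)
 then have "AE p in MC. case_prod h p = 0" by (simp add: nr_eq_zero_iff[OF h])
 then show ?thesis
  unfolding compl_def
 proof eventually_elim
  case (elim p)
  then show ?case by (auto simp: h_def Let_def case_prod_unfold split: if_splits)
 qed
qed

end

locale problem = control T \<Omega> \<alpha> \<beta> H LH LH' \<epsilon> f Lf nf
 for T and \<Omega> :: "(real^'n) set" and \<alpha> \<beta> H LH LH' \<epsilon> f Lf nf +
 fixes j :: "'n evol\<times>'n evol=>real"
 assumes j_diff: "continuously_frechet_differentiable (prod_space (L2L2 T \<Omega>) (L2H1 T \<Omega>)) real_space j"
begin

abbreviation "Dj \<equiv> deriv_j T \<Omega> j"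
abbreviation "PY \<equiv> prod_space (L2L2 T \<Omega>) (L2H1 T \<Omega>)"

lemma prod_elems: "elems PY = LL\<times>J.gdom"
 by (simp add: prod_space_def LL_elems elems_L2H1)

lemma prod_nrm: "p\<in>LL\<times>J.gdom ==> nrm PY p = P.nr p"
 by (cases p) (simp add: prod_space_def P_nr LL_nrm nrm_L2H1)

lemma Dj_frechet:
 assumes p: "p\<in>LL\<times>J.gdom"
 shows "\<And>u v. u\<in>LL\<times>J.gdom ==> v\<in>LL\<times>J.gdom ==> Dj p (u + v) = Dj p u + Dj p v"
  "\<And>c u. u\<in>LL\<times>J.gdom ==> Dj p (c *\<^sub>R u) = c * Dj p u"
  "\<exists>C\<ge>0. \<forall>u\<in>LL\<times>J.gdom. \<bar>Dj p u\<bar>\<le>C * P.nr u"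
  "\<And>e. e > 0 ==> \<exists>r>0. \<forall>h\<in>LL\<times>J.gdom. P.nr h < r\<longrightarrow>\<bar>j (p + h) - j p - Dj p h\<bar>\<le>e * P.nr h"
proof -
 have "\<exists>D. has_frechet_deriv PY real_space j p D"
  using j_diff p unfolding continuously_frechet_differentiable_def prod_elems by blast
 then have F: "has_frechet_deriv PY real_space j p (Dj p)"
  unfolding deriv_j_def frechet_deriv_def by (rule someI_ex)
 then have b: "bounded_linear_op PY real_space (Dj p)"
  by (simp add: has_frechet_deriv_def)
 show "Dj p (u + v) = Dj p u + Dj p v" if "u\<in>LL\<times>J.gdom" "v\<in>LL\<times>J.gdom" for u v
 proof -
  have "nrm real_space (Dj p (u + v) - (Dj p u + Dj p v)) = 0"
   using b that unfolding bounded_linear_op_def prod_elems by blast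
  then show ?thesis by (simp add: real_space_def)
 qed
 show "Dj p (c *\<^sub>R u) = c * Dj p u" if "u\<in>LL\<times>J.gdom" for c u
 proof -
  have "nrm real_space (Dj p (c *\<^sub>R u) - c *\<^sub>R Dj p u) = 0"
   using b that unfolding bounded_linear_op_def prod_elems by blast
  then show ?thesis by (simp add: real_space_def)
 qed
 obtain C where C: "\<forall>u\<in>LL\<times>J.gdom. \<bar>Dj p u\<bar>\<le>C * P.nr u"
  using b unfolding bounded_linear_op_def prod_elems by (auto simp: real_space_def prod_nrm)
 show "\<exists>C\<ge>0. \<forall>u\<in>LL\<times>J.gdom. \<bar>Dj p u\<bar>\<le>C * P.nr u"
 proof (intro exI[of _ "max 0 C"] conjI ballI)
  fix u assume u: "u\<in>LL\<times>J.gdom"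
  have "C * P.nr u\<le>max 0 C * P.nr u" by (intro mult_right_mono P.nr_nonneg u) simp
  with C u show "\<bar>Dj p u\<bar>\<le>max 0 C * P.nr u" by force
 qed simp
 show "\<exists>r>0. \<forall>h\<in>LL\<times>J.gdom. P.nr h < r\<longrightarrow>\<bar>j (p + h) - j p - Dj p h\<bar>\<le>e * P.nr h" if e: "e > 0" for e
 proof -
  obtain r where "r > 0" "\<forall>h\<in>LL\<times>J.gdom. nrm PY h < r \<longrightarrow>
    nrm real_space (j (p + h) - j p - Dj p h)\<le>e * nrm PY h"
   using F e unfolding has_frechet_deriv_def prod_elems by blast
  then show ?thesis by (intro exI[of _ r]) (simp add: real_space_def prod_nrm)
 qed
qed

lemma Dj_split:
 assumes "p\<in>LL\<times>J.gdom" "u\<in>LL" "v\<in>J.gdom"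
 shows "Dj p (u, v) = Dj p (u, 0) + Dj p (0, v)"
 using Dj_frechet(1)[OF assms(1), of "(u, 0)" "(0, v)"] assms J1.zero_mem LL.zero_mem by simp

lemma Dj_cong:
 assumes p: "p\<in>LL\<times>J.gdom" and u: "u\<in>LL" "u'\<in>LL" and v: "v\<in>J.gdom" "v'\<in>J.gdom"
  and z: "LL.nr (u - u') = 0" "J1.nr (v - v') = 0"
 shows "Dj p (u, v) = Dj p (u', v')"
proof -
 have m: "(u - u', v - v')\<in>LL\<times>J.gdom" using LL.diff_mem[OF u] J1.diff_mem[OF v] by simp
 obtain C where C: "\<forall>u\<in>LL\<times>J.gdom. \<bar>Dj p u\<bar>\<le>C * P.nr u" using Dj_frechet(3)[OF p] by blast
 have "Dj p (u - u', v - v') = 0"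
  using bspec[OF C m] P_nr[OF LL.diff_mem[OF u] J1.diff_mem[OF v]] z by simp
 moreover have "(u, v) = (u - u', v - v') + (u', v')" by simp
 ultimately show ?thesis using Dj_frechet(1)[OF p m, of "(u', v')"] u v by simp
qed

text \<open>The derivative in \<phi> is represented in the energy inner product: r solves -\<alpha>
  Laplace r + \<beta> r = \<partial>_\<phi> j, so it can be tested with linearized states through
  the elliptic equation.\<close>

lemma Dj_riesz:
 assumes p: "p\<in>LL\<times>J.gdom"
 obtains jq r where "jq\<in>LL" "r\<in>J.gdom" "\<And>\<eta>. \<eta>\<in>LL ==> Dj p (\<eta>, 0) = lip jq \<eta>"
  "\<And>\<psi>. \<psi>\<in>J.gdom ==> Dj p (0, \<psi>) = ipE r \<psi>"
proof -
 obtain C where C: "C\<ge>0" "\<And>u. u\<in>LL\<times>J.gdom ==> \<bar>Dj p u\<bar>\<le>C * P.nr u" using Dj_frechet(3)[OF p] by blast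
 note D = Dj_frechet(1,2)[OF p]
 obtain jq where jq: "jq\<in>LL" "\<And>\<eta>. \<eta>\<in>LL ==> lip jq \<eta> = Dj p (\<eta>, 0)"
 proof (rule LL.riesz_functional[of "%\<eta>. Dj p (\<eta>, 0)" C])
  fix u v :: "'n evol" assume u: "u\<in>LL"
  show "Dj p (u + v, 0) = Dj p (u, 0) + Dj p (v, 0)" if "v\<in>LL"
   using D(1)[of "(u, 0)" "(v, 0)"] u that J1.zero_mem by simp
  show "Dj p (c *\<^sub>R u, 0) = c * Dj p (u, 0)" for c
   using D(2)[of "(u, 0)" c] u J1.zero_mem by simp
  show "\<bar>Dj p (u, 0)\<bar>\<le>C * LL.nr u"
   using C(2)[of "(u, 0)"] u J1.zero_mem P_nr[OF u J1.zero_mem] LL.nr_nonneg[OF u] by (simp add: J1.nr_zero)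
 qed (rule that)
 obtain c where c: "c > 0" "\<And>u. u\<in>J.gdom ==> J1.nr u\<le>c * JA.nr u" "\<And>u. u\<in>J.gdom ==> JA.nr u\<le>c * J1.nr u"
  by (rule J1_JA_const) (rule that)
 obtain r where r: "r\<in>J.gdom" "\<And>\<psi>. \<psi>\<in>J.gdom ==> ipE r \<psi> = Dj p (0, \<psi>)"
 proof (rule JA.riesz_functional[of "%\<psi>. Dj p (0, \<psi>)" "C * c"])
  fix u v :: "'n evol" assume u: "u\<in>J.gdom"
  show "Dj p (0, u + v) = Dj p (0, u) + Dj p (0, v)" if "v\<in>J.gdom"
   using D(1)[of "(0, u)" "(0, v)"] u that LL.zero_mem by simp
  show "Dj p (0, c *\<^sub>R u) = c * Dj p (0, u)" for c
   using D(2)[of "(0, u)" c] u LL.zero_mem by simp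
  show "\<bar>Dj p (0, u)\<bar>\<le>C * c * JA.nr u"
   using C(2)[of "(0, u)"] u LL.zero_mem P_nr[OF LL.zero_mem u] J1.nr_nonneg[OF u] mult_left_mono[OF c(2)[OF u] C(1)]
   by (simp add: LL.nr_zero mult.assoc)
 qed (rule that)
 show ?thesis by (rule that[OF jq(1) r(1)]) (use jq(2) r(2) in auto)
qed

text \<open>The one-sided derivative at s = 0 of the objective at l + s \<delta> is nonnegative. The
  quadratic term contributes s/2 times the square of the norm of \<delta>, which disappears in the
  limit.\<close>

lemma optimality_inequality:
 assumes lo: "locally_optimal T \<Omega> S j l" and qp: "(q, \<phi>) = S (embed_dual \<Omega> l)" and nc: "nullc q"
  and d: "\<delta>\<in>Tr.gdom" and li: "lin (zf q \<phi>) q \<psi> g'" and e: "ell \<psi> (\<beta> *\<^sub>R vint g' + \<delta>)"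
 shows "0\<le>Dj (q, \<phi>) (vint g', \<psi>) + Tr.gip 1 1 l \<delta>"
proof -
 have lT: "l\<in>Tr.gdom" using lo by (simp add: locally_optimal_def elems_H1L2)
 note lL = Tr.gdom_V[OF lT] and dL = Tr.gdom_V[OF d]
 have g': "g'\<in>LL" using li by (simp add: lin_def)
 obtain g where s: "state l q \<phi> g" using solution_state_embed[OF lL] qp by (metis fst_conv snd_conv)
 let ?S = "%s. S (embed_dual \<Omega> (l + s *\<^sub>R \<delta>))"
 have lt: "l + s *\<^sub>R \<delta>\<in>Tr.gdom" for s by (intro T1.add_mem T1.scale_mem lT d)
 have "\<exists>g. state (l + s *\<^sub>R \<delta>) (fst (?S s)) (snd (?S s)) g" for s
  by (rule solution_state_embed[OF Tr.gdom_V[OF lt]])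
 then obtain gg where st: "\<And>s. state (l + s *\<^sub>R \<delta>) (fst (?S s)) (snd (?S s)) (gg s)" by metis
 note lim = state_dir_deriv[OF lL dL s nc li e st]
 have pV: "(q, \<phi>)\<in>LL\<times>J.gdom" using stateD(5,6)[OF s] by simp
 have SV: "?S s\<in>LL\<times>J.gdom" for s using stateD(5,6)[OF st[of s]] by (simp add: mem_Times_iff)
 have vT: "vint g'\<in>Tr.gdom" and \<psi>J: "\<psi>\<in>J.gdom" using Tr_gdomI[OF vint_trel[OF g']] ell_J[OF e] by auto
 have dV: "(vint g', \<psi>)\<in>LL\<times>J.gdom" using vint_LL[OF g'] \<psi>J by simp
 have Plim: "((%s. P.nr ((1 / s) *\<^sub>R (?S s - (q, \<phi>)) - (vint g', \<psi>))) \<longlongrightarrow> 0) (at_right 0)"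
 proof (rule Lim_null_comparison)
  let ?q = "%s. (1 / s) *\<^sub>R (fst (?S s) - q) - vint g'" and ?p = "%s. (1 / s) *\<^sub>R (snd (?S s) - \<phi>) - \<psi>"
  show "\<forall>\<^sub>F s in at_right 0. norm (P.nr ((1 / s) *\<^sub>R (?S s - (q, \<phi>)) - (vint g', \<psi>)))\<le>T1.nr (?q s) + J1.nr (?p s)"
  proof (intro always_eventually allI)
   fix s
   have qT: "?q s\<in>Tr.gdom" by (intro T1.diff_mem T1.scale_mem Tr_gdomI[OF stateD(1)[OF st]] Tr_gdomI[OF stateD(1)[OF s]] vT)
   have pJ: "?p s\<in>J.gdom" by (intro J1.diff_mem J1.scale_mem stateD(6)[OF st] stateD(6)[OF s] \<psi>J)
   have eq: "(1 / s) *\<^sub>R (?S s - (q, \<phi>)) - (vint g', \<psi>) = (?q s, ?p s)" by (simp add: prod_eq_iff)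
   show "norm (P.nr ((1 / s) *\<^sub>R (?S s - (q, \<phi>)) - (vint g', \<psi>)))\<le>T1.nr (?q s) + J1.nr (?p s)"
    unfolding eq using P_nr_le[OF Tr.gdom_V[OF qT] pJ] LL_nr_le_T1[OF qT] P.nr_nonneg[of "(?q s, ?p s)"] Tr.gdom_V[OF qT] pJ by simp
  qed
  show "((%s. T1.nr (?q s) + J1.nr (?p s)) \<longlongrightarrow> 0) (at_right 0)" using tendsto_add[OF lim] by simp
 qed
 obtain C where C: "\<forall>u\<in>LL\<times>J.gdom. \<bar>Dj (q, \<phi>) u\<bar>\<le>C * P.nr u" using Dj_frechet(3)[OF pV] by blast
 have jl: "((%s. (j (?S s) - j (q, \<phi>)) / s) \<longlongrightarrow> Dj (q, \<phi>) (vint g', \<psi>)) (at_right 0)"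
  by (rule P.frechet_imp_dir_deriv[OF pV dV SV Plim Dj_frechet(1,2)[OF pV] _ Dj_frechet(4)[OF pV]]) (use C in auto)
 obtain r where r: "r > 0" "\<And>l'. l'\<in>Tr.gdom ==> T1.nr (l' - l) < r ==>
   objective T \<Omega> j (S (embed_dual \<Omega> l)) l\<le>objective T \<Omega> j (S (embed_dual \<Omega> l')) l'"
  using lo unfolding locally_optimal_def elems_H1L2 by (metis nrm_H1L2 T1.diff_mem)
 have "\<forall>\<^sub>F s in at_right 0. s * T1.nr \<delta> < r"
 proof -
  have "((%s. s * T1.nr \<delta>) \<longlongrightarrow> 0 * T1.nr \<delta>) (at_right 0)" by (intro tendsto_intros)
  then show ?thesis using r(1) by (intro order_tendstoD(2)) auto
 qed
 then have ev: "\<forall>\<^sub>F s in at_right 0. 0\<le>(j (?S s) - j (q, \<phi>)) / s + (Tr.gip 1 1 l \<delta> + s / 2 * Tr.gip 1 1 \<delta> \<delta>)"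
  using ev_right_pos
 proof eventually_elim
  case (elim s)
  have "l + s *\<^sub>R \<delta> - l = s *\<^sub>R \<delta>" by simp
  then have "T1.nr (l + s *\<^sub>R \<delta> - l) < r" using T1.nr_scale[OF d, of s] elim by simp
  from r(2)[OF lt this] have "j (q, \<phi>) + 1 / 2 * (T1.nr l)^2\<le>j (?S s) + 1 / 2 * (T1.nr (l + s *\<^sub>R \<delta>))^2"
   by (simp add: objective_def nrm_H1L2[OF lT] nrm_H1L2[OF lt] flip: qp)
  then have "j (q, \<phi>) + 1 / 2 * Tr.gip 1 1 l l\<le>j (?S s) + 1 / 2 * (Tr.gip 1 1 l l + 2 * s * Tr.gip 1 1 l \<delta> + s\<^sup>2 * Tr.gip 1 1 \<delta> \<delta>)"
   unfolding T1.nr_sq[OF lT] T1.nr_sq[OF lt] T1.B_expand[OF lT d, of s] .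
  then have "0\<le>(j (?S s) - j (q, \<phi>)) + s * (Tr.gip 1 1 l \<delta> + s / 2 * Tr.gip 1 1 \<delta> \<delta>)"
   by (simp add: algebra_simps power2_eq_square)
  then have "0\<le>((j (?S s) - j (q, \<phi>)) + s * (Tr.gip 1 1 l \<delta> + s / 2 * Tr.gip 1 1 \<delta> \<delta>)) / s"
   using elim(2) by simp
  then show ?case using elim(2) by (simp add: add_divide_distrib)
 qed
 have "((%s. (j (?S s) - j (q, \<phi>)) / s + (Tr.gip 1 1 l \<delta> + s / 2 * Tr.gip 1 1 \<delta> \<delta>)) \<longlongrightarrow>
   Dj (q, \<phi>) (vint g', \<psi>) + (Tr.gip 1 1 l \<delta> + 0 / 2 * Tr.gip 1 1 \<delta> \<delta>)) (at_right 0)"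
  by (intro tendsto_intros jl) auto
 from tendsto_le[OF _ this tendsto_const ev] show ?thesis by simp
qed

end

context bounded_cylinder
begin

lemma Linf_fun_LL:
 assumes u: "u\<in>Linf_fun T \<Omega> (L2 \<Omega>)" shows "u\<in>LL"
proof -
 obtain C where C: "AE t in MT. nrm (L2 \<Omega>) (u t)\<le>C" using u by (auto simp: Linf_fun_def)
 have m: "case_prod u\<in>meas MC" using u by (simp add: Linf_fun_def jointly_measurable_def cylinder_def)
 have sl: "AE t in MT. u t\<in>sqi MX" using u by (simp add: Linf_fun_def strongly_measurable_def elems_L2)
 show ?thesis
 proof (rule LL_slicesI[OF m sl])
  show "AE t in MT. (nrm (L2 \<Omega>) (u t))^2\<le>C^2"
   using C sl by eventually_elim (auto simp: nrm_L2_X intro!: power_mono X.nr_nonneg)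
  show "integrable MT (%t. C^2)" using finite_measure.integrable_const[OF fin_MT] by blast
 qed
qed

end

context problem
begin

abbreviation "os \<equiv> optimality_system T \<Omega> \<alpha> \<beta> \<epsilon> f H j"

lemma compl_iff:
 "compl (zf q \<phi>) \<xi> \<mu> \<longleftrightarrow>
  (AE (t, x) in leb (cylinder T \<Omega>). zf q \<phi> t x\<noteq>0 \<longrightarrow>
   \<mu> t x = (1 / \<epsilon>) * indicator {(t, x). zf q \<phi> t x > 0} (t, x) * \<xi> t x) \<and>
  (AE (t, x) in leb (cylinder T \<Omega>). zf q \<phi> t x = 0 \<longrightarrow>
   0\<le>\<mu> t x\<and>\<mu> t x\<le>(1 / \<epsilon>) * \<xi> t x)" (is "_ \<longleftrightarrow> ?A\<and>?B")
proof
 assume c: "compl (zf q \<phi>) \<xi> \<mu>"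
 show "?A\<and>?B"
  unfolding cylinder_def
 proof
  show "AE (t, x) in MC. zf q \<phi> t x\<noteq>0\<longrightarrow>\<mu> t x = (1 / \<epsilon>) * indicator {(t, x). zf q \<phi> t x > 0} (t, x) * \<xi> t x"
   using c unfolding compl_def by eventually_elim (auto simp: indicator_def)
  show "AE (t, x) in MC. zf q \<phi> t x = 0\<longrightarrow>0\<le>\<mu> t x\<and>\<mu> t x\<le>(1 / \<epsilon>) * \<xi> t x"
   using c unfolding compl_def by eventually_elim auto
 qed
next
 assume "?A\<and>?B"
 then have A: ?A and B: ?B by auto
 show "compl (zf q \<phi>) \<xi> \<mu>"
  unfolding compl_def using A[unfolded cylinder_def] B[unfolded cylinder_def] by eventually_elim auto
qed

lemma energy_fun: "(%t. - (\<alpha> *\<^sub>R Laplace \<Omega> (w t)) + \<beta> *\<^sub>R embed_dual \<Omega> (w - \<mu>) t) = (%t. energy (w t) (\<mu> t))"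
 by (auto simp: fun_eq_iff scaleR_fun_def energy_def embed_dual_def)

text \<open>The optimality system, tested with the solutions of the linearized state equation.\<close>

definition adj :: "'n evol=>'n evol=>'n evol
 =>'n evol=>'n evol=>'n evol=>bool" where
 "adj l q \<phi> \<xi> w \<mu> \<longleftrightarrow> \<xi>\<in>LL\<and>w\<in>J.gdom\<and>\<mu>\<in>LL \<and>
  (\<forall>g\<in>LL. Dj (q, \<phi>) (vint g, 0) = lip g \<xi> - \<beta> * lip (w - \<mu>) (vint g) + lip \<mu> (dF q (vint g))) \<and>
  (\<forall>\<psi>\<in>J.gdom. Dj (q, \<phi>) (0, \<psi>) = ipE w \<psi> - \<beta> * lip \<mu> \<psi>) \<and>
  compl (zf q \<phi>) \<xi> \<mu>\<and>(\<forall>\<delta>\<in>Tr.gdom. lip w \<delta> + Tr.gip 1 1 l \<delta> = 0)"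

lemma adjD:
 assumes "adj l q \<phi> \<xi> w \<mu>"
 shows "\<xi>\<in>LL" "w\<in>J.gdom" "\<mu>\<in>LL"
  "\<And>g. g\<in>LL ==> Dj (q, \<phi>) (vint g, 0) = lip g \<xi> - \<beta> * lip (w - \<mu>) (vint g) + lip \<mu> (dF q (vint g))"
  "\<And>\<psi>. \<psi>\<in>J.gdom ==> Dj (q, \<phi>) (0, \<psi>) = ipE w \<psi> - \<beta> * lip \<mu> \<psi>"
  "compl (zf q \<phi>) \<xi> \<mu>" "\<And>\<delta>. \<delta>\<in>Tr.gdom ==> lip w \<delta> + Tr.gip 1 1 l \<delta> = 0"
 using assms unfolding adj_def by blast+

text \<open>Testing the first adjoint equation with a primitive \<open>vint g\<close> moves the time
  derivative from \<xi> to g: by the terminal condition \<xi> is minus the backward primitive of its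
  derivative, and \<open>vint_adjoint\<close> applies.\<close>

lemma optimality_system_adj:
 assumes o: "os l q \<phi> \<xi> w \<mu>" and q: "q\<in>LL" and nc: "nullc q" and l: "l\<in>Tr.gdom"
 shows "adj l q \<phi> \<xi> w \<mu>"
 unfolding adj_def
proof (intro conjI ballI)
 have o': "\<xi>\<in>elems (H1L2_vanishing T \<Omega> T)" "w\<in>elems (L2H1 T \<Omega>)" "\<mu>\<in>Linf_fun T \<Omega> (L2 \<Omega>)"
  "eq_in_L2L2 T \<Omega> (- time_deriv T \<Omega> \<xi> - \<beta> *\<^sub>R (w - \<mu>) + hilbert_adjoint T \<Omega> (dF q) \<mu>) (%\<eta>. Dj (q, \<phi>) (\<eta>, 0))"
  "eq_in_L2H1dual T \<Omega> (%t. energy (w t) (\<mu> t)) (%\<psi>. Dj (q, \<phi>) (0, \<psi>))"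
  "compl (zf q \<phi>) \<xi> \<mu>" "\<forall>\<delta>\<in>elems (H1L2 T \<Omega>). L2L2_inner T \<Omega> w \<delta> + H1L2_inner T \<Omega> l \<delta> = 0"
  using o unfolding optimality_system_def energy_fun compl_iff by blast+
 have xT: "\<xi>\<in>Tr.gdom" "vanishes_at T (L2 \<Omega>) \<xi> T" using o'(1) by (auto simp: elems_vanishing)
 show x: "\<xi>\<in>LL" by (rule Tr.gdom_V[OF xT(1)])
 show w: "w\<in>J.gdom" using o'(2) by (simp add: elems_L2H1)
 show m: "\<mu>\<in>LL" by (rule Linf_fun_LL[OF o'(3)])
 note wL = J.gdom_V[OF w]
 note ha = hilbert_adjoint_dF[OF q nc m]
 let ?x = "time_deriv T \<Omega> \<xi>"
 note t = trel_time_deriv[OF xT(1)]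
 have dx: "?x\<in>LL" by (rule trel_LL(2)[OF t])
 show "Dj (q, \<phi>) (vint g, 0) = lip g \<xi> - \<beta> * lip (w - \<mu>) (vint g) + lip \<mu> (dF q (vint g))" if g: "g\<in>LL" for g
 proof -
  let ?v = "vint g"
  note v = vint_LL[OF g]
  have m1: "- ?x - \<beta> *\<^sub>R (w - \<mu>)\<in>LL" "- ?x\<in>LL" "\<beta> *\<^sub>R (w - \<mu>)\<in>LL" "w - \<mu>\<in>LL"
   by (intro LL.diff_mem LL.scale_mem LL.minus_mem dx wL m)+
  have "Dj (q, \<phi>) (?v, 0) = lip (- ?x - \<beta> *\<^sub>R (w - \<mu>) + hilbert_adjoint T \<Omega> (dF q) \<mu>) ?v"
   using o'(4) v LL.add_mem[OF m1(1) ha(1)] unfolding eq_in_L2L2_def LL_elems by (simp add: L2L2_inner_eq)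
  also have "\<dots> = - lip ?x ?v - \<beta> * lip (w - \<mu>) ?v + lip \<mu> (dF q ?v)"
   unfolding LL.B_add[OF m1(1) ha(1) v] LL.B_diff[OF m1(2,3) v] LL.B_minus[OF dx v] LL.B_scale[OF m1(4) v] ha(2)[OF v] ..
  finally have 1: "Dj (q, \<phi>) (?v, 0) = - lip ?x ?v - \<beta> * lip (w - \<mu>) ?v + lip \<mu> (dF q ?v)" .
  have "lip ?x ?v = - lip g \<xi>"
  proof -
   have "LL.nr (\<xi> - (- vintR ?x)) = 0" using vanishing_T[OF t xT(2)] by simp
   then have "lip \<xi> g = lip (- vintR ?x) g" by (rule LL.B_cong_left[OF x LL.minus_mem[OF vintR_LL[OF dx]] g])
   then show ?thesis
    using vint_adjoint[OF g dx] LL.B_minus[OF vintR_LL[OF dx] g] LL.B_sym[OF x g] LL.B_sym[OF vintR_LL[OF dx] g] by simp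
  qed
  with 1 show ?thesis by simp
 qed
 show "Dj (q, \<phi>) (0, \<psi>) = ipE w \<psi> - \<beta> * lip \<mu> \<psi>" if p: "\<psi>\<in>J.gdom" for \<psi>
  using o'(5) p energy_integral[OF w m p] unfolding eq_in_L2H1dual_def elems_L2H1 by simp
 show "compl (zf q \<phi>) \<xi> \<mu>" by (rule o'(6))
 show "lip w \<delta> + Tr.gip 1 1 l \<delta> = 0" if d: "\<delta>\<in>Tr.gdom" for \<delta>
 proof -
  have "L2L2_inner T \<Omega> w \<delta> + H1L2_inner T \<Omega> l \<delta> = 0" using o'(7) d unfolding elems_H1L2 by blast
  then show ?thesis using L2L2_inner_eq[OF wL Tr.gdom_V[OF d]] H1L2_inner_eq[OF l d] by simp
 qed
qed

text \<open>The gradient equation determines w on the dense space H^1(0,T;L^2(\<Omega>)). The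
  elliptic equation then determines \<mu> against all elliptic solutions, which are dense, and the
  first equation determines \<xi> against every g.\<close>

lemma adj_unique:
 assumes a: "adj l q \<phi> \<xi> w \<mu>" and b: "adj l q \<phi> \<xi>' w' \<mu>'" and q: "q\<in>LL" and nc: "nullc q"
 shows "LL.nr (\<xi>' - \<xi>) = 0" "LL.nr (w' - w) = 0" "LL.nr (\<mu>' - \<mu>) = 0"
proof -
 note A = adjD[OF a] and B = adjD[OF b]
 note wL = J.gdom_V[OF A(2)] J.gdom_V[OF B(2)]
 show w: "LL.nr (w' - w) = 0"
 proof (rule Tr_gdom_orthogonal[OF LL.diff_mem[OF wL(2,1)]])
  fix \<delta> assume d: "\<delta>\<in>Tr.gdom"
  show "lip (w' - w) \<delta> = 0" using A(7)[OF d] B(7)[OF d] LL.B_diff[OF wL(2,1) Tr.gdom_V[OF d]] by simp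
 qed
 show m: "LL.nr (\<mu>' - \<mu>) = 0"
 proof (rule LL.nr_eq_zeroI[OF LL.diff_mem[OF B(3) A(3)]])
  fix v assume v: "v\<in>LL"
  obtain s where s: "\<And>n::nat. \<exists>g. ell (s n) g" "nullseq (%n. LL.nr (s n - v))" by (rule ell_range_dense[OF v]) (rule that)
  have z: "lip (s n) (\<mu>' - \<mu>) = 0" for n
  proof -
   obtain g where g: "ell (s n) g" using s(1) by blast
   note sJ = ell_J[OF g] and sL = ell_LL'[OF g] and gL = ell_LL[OF g]
   have "ipE w' (s n) = lip g w'" "ipE w (s n) = lip g w"
    using ell_test[OF g B(2)] ell_test[OF g A(2)] JA.B_sym[OF B(2) sJ] JA.B_sym[OF A(2) sJ] by simp_all
   moreover have "lip g w' = lip g w"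
    using LL.B_cong_left[OF wL(2,1) gL w] LL.B_sym[OF wL(1) gL] LL.B_sym[OF wL(2) gL] by simp
   ultimately have "\<beta> * lip \<mu>' (s n) = \<beta> * lip \<mu> (s n)" using A(5)[OF sJ] B(5)[OF sJ] by simp
   then have "lip (\<mu>' - \<mu>) (s n) = 0" using LL.B_diff[OF B(3) A(3) sL] \<beta>_pos by simp
   then show ?thesis using LL.B_sym[OF LL.diff_mem[OF B(3) A(3)] sL] by simp
  qed
  have sL: "s n\<in>LL" for n using s(1) ell_LL' by blast
  have "(%n. lip (s n) (\<mu>' - \<mu>)) \<longlonglongrightarrow> lip v (\<mu>' - \<mu>)" by (rule LL.B_tendsto[OF sL v LL.diff_mem[OF B(3) A(3)] s(2)])
  then have "lip v (\<mu>' - \<mu>) = 0" using z LIMSEQ_unique[OF _ tendsto_const] by simp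
  then show "lip (\<mu>' - \<mu>) v = 0" using LL.B_sym[OF v LL.diff_mem[OF B(3) A(3)]] by simp
 qed
 show "LL.nr (\<xi>' - \<xi>) = 0"
 proof (rule LL.nr_eq_zeroI[OF LL.diff_mem[OF B(1) A(1)]])
  fix g assume g: "g\<in>LL"
  note v = vint_LL[OF g]
  have "LL.nr ((w' - \<mu>') - (w - \<mu>))\<le>LL.nr (w' - w) + LL.nr (\<mu>' - \<mu>)"
   using LL.nr_triangle_diff[OF LL.diff_mem[OF wL(2,1)] LL.diff_mem[OF B(3) A(3)]] by (simp add: algebra_simps)
  then have "LL.nr ((w' - \<mu>') - (w - \<mu>)) = 0"
   using w m LL.nr_nonneg[OF LL.diff_mem[OF LL.diff_mem[OF wL(2) B(3)] LL.diff_mem[OF wL(1) A(3)]]] by simp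
  then have "lip (w' - \<mu>') (vint g) = lip (w - \<mu>) (vint g)"
   by (rule LL.B_cong_left[OF LL.diff_mem[OF wL(2) B(3)] LL.diff_mem[OF wL(1) A(3)] v])
  moreover have "lip \<mu>' (dF q (vint g)) = lip \<mu> (dF q (vint g))"
   by (rule LL.B_cong_left[OF B(3) A(3) dF_LL[OF q q nc v] m])
  ultimately have "lip g \<xi>' = lip g \<xi>" using A(4)[OF g] B(4)[OF g] by simp
  then show "lip (\<xi>' - \<xi>) g = 0"
   using LL.B_diff[OF B(1) A(1) g] LL.B_sym[OF B(1) g] LL.B_sym[OF A(1) g] by simp
 qed
qed

text \<open>The system tested with the linearized state reduces the left-hand side to (g, \<xi>) -
  (\<mu>, h), where h is the argument of the directional derivative and g = (1/\<epsilon>) max'(z;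
  h). This is nonnegative by the pointwise conditions.\<close>

lemma adj_sufficient:
 assumes a: "adj l q \<phi> \<xi> w \<mu>" and q: "q\<in>LL" and p: "\<phi>\<in>J.gdom" and nc: "nullc q"
  and d: "\<delta>\<in>Tr.gdom" and li: "lin (zf q \<phi>) q \<psi> g" and e: "ell \<psi> (\<beta> *\<^sub>R vint g + \<delta>)"
 shows "0\<le>Dj (q, \<phi>) (vint g, \<psi>) + Tr.gip 1 1 l \<delta>"
proof -
 note A = adjD[OF a]
 note wL = J.gdom_V[OF A(2)] and pL = J.gdom_V[OF p] and dL = Tr.gdom_V[OF d]
 note z = zf_LL[OF q pL]
 have g: "g\<in>LL" using li by (simp add: lin_def)
 note v = vint_LL[OF g] and psi = ell_LL'[OF e] and psiJ = ell_J[OF e]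
 note dv = dF_LL[OF q q nc v]
 let ?h = "(- \<beta>) *\<^sub>R (vint g - \<psi>) - dF q (vint g)"
 have h: "?h\<in>LL" by (rule lin_arg_LL[OF q q nc g psi])
 have gz: "lip g \<xi> = lip (mxd (zf q \<phi>) ?h) \<xi>"
  using li by (intro LL.B_cong_left[OF g mxd_LL[OF z h] A(1)]) (simp add: lin_def)
 have hm: "lip \<mu> ?h = - \<beta> * lip \<mu> (vint g) + \<beta> * lip \<mu> \<psi> - lip \<mu> (dF q (vint g))"
  using LL.B_diff_right[OF LL.scale_mem[OF LL.diff_mem[OF v psi], of "- \<beta>"] dv A(3)]
   LL.B_scale_right[OF LL.diff_mem[OF v psi] A(3), of "- \<beta>"] LL.B_diff_right[OF v psi A(3)]
  by (simp add: right_diff_distrib)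
 have "ipE w \<psi> = lip (\<beta> *\<^sub>R vint g + \<delta>) w"
  using ell_test[OF e A(2)] JA.B_sym[OF A(2) psiJ] by simp
 also have "\<dots> = \<beta> * lip w (vint g) + lip w \<delta>"
  using LL.B_add[OF LL.scale_mem[OF v, of \<beta>] dL wL] LL.B_scale[OF v wL, of \<beta>] LL.B_sym[OF v wL] LL.B_sym[OF dL wL] by simp
 finally have "Dj (q, \<phi>) (0, \<psi>) = \<beta> * lip w (vint g) + lip w \<delta> - \<beta> * lip \<mu> \<psi>" using A(5)[OF psiJ] by simp
 moreover have "Dj (q, \<phi>) (vint g, 0) = lip g \<xi> - \<beta> * lip w (vint g) + \<beta> * lip \<mu> (vint g) + lip \<mu> (dF q (vint g))"
  using A(4)[OF g] LL.B_diff[OF wL A(3) v] by (simp add: right_diff_distrib)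
 moreover have "Dj (q, \<phi>) (vint g, \<psi>) = Dj (q, \<phi>) (vint g, 0) + Dj (q, \<phi>) (0, \<psi>)"
  by (rule Dj_split[OF _ v psiJ]) (use q p in simp)
 ultimately have "Dj (q, \<phi>) (vint g, \<psi>) + Tr.gip 1 1 l \<delta> = lip g \<xi> - lip \<mu> ?h"
  using hm A(7)[OF d] by simp
 then show ?thesis using compl_imp_ineq[OF A(6) z A(1,3) h] gz by simp
qed

text \<open>Comparison with this solution turns the stability estimates into bounds for g.\<close>

lemma lin_zero:
 assumes q: "q\<in>LL" and nc: "nullc q" and z: "z\<in>LL"
 shows "lin z q 0 0" "vint 0 = 0"
proof -
 show v0: "vint 0 = 0" using vint_scale[of 0 0] by simp
 have d: "dF q 0\<in>LL" by (rule dF_LL[OF q q nc LL.zero_mem])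
 have "LL.nr (dF q 0 - 0) = 0" using dF_linear(2)[OF q nc LL.zero_mem LL.zero_mem, of 0] by simp
 then have ae: "AE p in MC. case_prod (dF q 0) p = 0" using LL_nr_zero_iff[OF d LL.zero_mem] by (simp add: case_prod_unfold)
 have m: "mxd z ((- \<beta>) *\<^sub>R (vint 0 - 0) - dF q (vint 0))\<in>LL" by (intro mxd_LL z lin_arg_LL[OF z q nc] LL.zero_mem)
 have "LL.nr (0 - mxd z ((- \<beta>) *\<^sub>R (vint 0 - 0) - dF q (vint 0))) = 0"
  unfolding LL_nr_zero_iff[OF LL.zero_mem m]
  using ae by eventually_elim (auto simp: v0 mxd_def max_dir_def case_prod_unfold scaleR_fun_def)
 then show "lin z q 0 0" by (simp add: lin_def LL.zero_mem)
qed

lemma lip_vint_le: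
 assumes a: "a\<in>LL" and g: "g\<in>LL" and le: "LL.nr g\<le>K * r"
 shows "\<bar>lip a (vint g)\<bar>\<le>LL.nr a * (exp (T / 2) * sqrt T * K) * r"
proof -
 have "LL.nr (vint g)\<le>exp (T / 2) * sqrt T * (K * r)"
  by (rule order_trans[OF vint_bound[OF g] mult_left_mono[OF le]]) (use T_pos in simp)
 then have "LL.nr a * LL.nr (vint g)\<le>LL.nr a * (exp (T / 2) * sqrt T * (K * r))"
  by (rule mult_left_mono) (rule LL.nr_nonneg[OF a])
 then show ?thesis using LL.cauchy_schwarz[OF a vint_LL[OF g]] by (simp add: mult.assoc)
qed

lemma lip_vint_tendsto:
 assumes a: "a\<in>LL" and s: "\<And>n::nat. s n\<in>LL" and g: "g\<in>LL" and lim: "nullseq (%n. LL.nr (s n - g))"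
 shows "(%n. lip a (vint (s n))) \<longlonglongrightarrow> lip a (vint g)"
 unfolding vint_adjoint[OF s a] vint_adjoint[OF g a] by (rule LL.B_tendsto[OF s g vintR_LL[OF a] lim])

lemma tendsto_zero_le:
 assumes "\<And>n::nat. (0::real)\<le>a n" "\<And>n. a n\<le>C * b n" "nullseq b" shows "nullseq a"
proof (rule Lim_null_comparison)
 show "\<forall>\<^sub>F n in sequentially. norm (a n)\<le>C * b n" using assms(1,2) by simp
 show "nullseq (%n. C * b n)" using tendsto_mult_right_zero[OF assms(3), of C] by simp
qed

text \<open>Extracts the system from the variational inequality alone, by enlarging its set of
  directions three times: from \<delta> in H^1 to \<delta> in L^2, from elliptic solutions \<psi> to
  \<psi> in L^2, and finally to an arbitrary argument h of the directional derivative.\<close>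

lemma necessary:
 assumes lT: "l\<in>Tr.gdom" and q: "q\<in>LL" and p: "\<phi>\<in>J.gdom" and nc: "nullc q"
  and vi: "\<And>\<delta> \<psi> g. \<delta>\<in>Tr.gdom ==> lin (zf q \<phi>) q \<psi> g ==> ell \<psi> (\<beta> *\<^sub>R vint g + \<delta>) ==>
   0\<le>Dj (q, \<phi>) (vint g, \<psi>) + Tr.gip 1 1 l \<delta>"
 obtains \<xi> w \<mu> where "os l q \<phi> \<xi> w \<mu>"
proof -
 define z where "z = zf q \<phi>"
 have z: "z\<in>LL" unfolding z_def by (rule zf_LL[OF q J.gdom_V[OF p]])
 have pV: "(q, \<phi>)\<in>LL\<times>J.gdom" using q p by simp
 obtain jq r where jq: "jq\<in>LL" and r: "r\<in>J.gdom" and Dq: "\<And>\<eta>. \<eta>\<in>LL ==> Dj (q, \<phi>) (\<eta>, 0) = lip jq \<eta>"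
  and Dr: "\<And>\<psi>. \<psi>\<in>J.gdom ==> Dj (q, \<phi>) (0, \<psi>) = ipE r \<psi>" by (rule Dj_riesz[OF pV]) (rule that)
 note rL = J.gdom_V[OF r]
 note l0 = lin_zero[OF q nc z]
 have linL: "g\<in>LL" if "lin z q \<psi> g" for \<psi> g using that by (simp add: lin_def)
 \<comment> \<open>The elliptic equation tested with r turns the \<psi>-part of the derivative into
   \<beta> (r, \<eta>) + (r, \<delta>); a collects the terms acting on \<eta>.\<close>
 define a where "a = jq + \<beta> *\<^sub>R r"
 have a: "a\<in>LL" unfolding a_def by (intro LL.add_mem LL.scale_mem jq rL)
 have I0: "0\<le>lip a (vint g) + lip r \<delta> + Tr.gip 1 1 l \<delta>"
  if d: "\<delta>\<in>Tr.gdom" and li: "lin z q \<psi> g" and e: "ell \<psi> (\<beta> *\<^sub>R vint g + \<delta>)" for \<delta> \<psi> g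
 proof -
  note v = vint_LL[OF linL[OF li]] and dL = Tr.gdom_V[OF d]
  have "ipE r \<psi> = lip (\<beta> *\<^sub>R vint g + \<delta>) r" using ell_test[OF e r] JA.B_sym[OF r ell_J[OF e]] by simp
  also have "\<dots> = \<beta> * lip r (vint g) + lip r \<delta>"
   using LL.B_add[OF LL.scale_mem[OF v, of \<beta>] dL rL] LL.B_scale[OF v rL, of \<beta>] LL.B_sym[OF v rL] LL.B_sym[OF dL rL] by simp
  finally have "Dj (q, \<phi>) (vint g, \<psi>) = lip a (vint g) + lip r \<delta>"
   using Dj_split[OF pV v ell_J[OF e]] Dq[OF v] Dr[OF ell_J[OF e]] LL.B_add[OF jq LL.scale_mem[OF rL, of \<beta>] v] LL.B_scale[OF rL v, of \<beta>]
   by (simp add: a_def)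
  then show ?thesis using vi[OF d li[unfolded z_def] e] by simp
 qed
 define K1 where "K1 = 2 * exp (vrate CG * T / 2) * (1 / \<epsilon>)"
 define K2 where "K2 = 2 * exp (vrate (1 / \<epsilon> * (\<beta> + CF)) * T / 2) * (1 / \<epsilon> * \<beta>)"
 have st1: "LL.nr (g - g')\<le>K1 * LL.nr (\<delta>' - \<delta>)" if "lin z q \<psi> g" "ell \<psi> (\<beta> *\<^sub>R vint g + \<delta>)" "\<delta>\<in>LL"
  "lin z q \<psi>' g'" "ell \<psi>' (\<beta> *\<^sub>R vint g' + \<delta>')" "\<delta>'\<in>LL" for \<psi> g \<delta> \<psi>' g' \<delta>'
  using lin_ell_stable[OF z q nc that] by (simp add: K1_def mult.assoc)
 have st2: "LL.nr (g - g')\<le>K2 * LL.nr (\<psi>' - \<psi>)" if "lin z q \<psi> g" "\<psi>\<in>LL" "lin z q \<psi>' g'" "\<psi>'\<in>LL" for \<psi> g \<psi>' g'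
  using lin_stable[OF z q nc that] by (simp add: K2_def mult.assoc)
 have b1: "LL.nr g\<le>K1 * LL.nr \<delta>" if "lin z q \<psi> g" "ell \<psi> (\<beta> *\<^sub>R vint g + \<delta>)" "\<delta>\<in>LL" for \<psi> g \<delta>
  using st1[OF that l0(1) _ LL.zero_mem] ell_zero LL.nr_minus[OF that(3)] by (simp add: l0(2))
 have b2: "LL.nr g\<le>K2 * LL.nr \<psi>" if "lin z q \<psi> g" "\<psi>\<in>LL" for \<psi> g
  using st2[OF that l0(1) LL.zero_mem] LL.nr_minus[OF that(2)] by simp
 define C1 where "C1 = LL.nr a * (exp (T / 2) * sqrt T * K1) + LL.nr r"
 \<comment> \<open>Although \<open>vint g\<close> depends nonlinearly on \<delta>, it is bounded by
   its L^2 norm. Applied to \<delta> and -\<delta>, this makes the H^1 product with l an L^2-bounded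
   functional.\<close>
 have low: "- Tr.gip 1 1 l \<delta>\<le>C1 * LL.nr \<delta>" if d: "\<delta>\<in>Tr.gdom" for \<delta>
 proof -
  note dL = Tr.gdom_V[OF d]
  obtain g \<psi> where g: "lin z q \<psi> g" "ell \<psi> (\<beta> *\<^sub>R vint g + \<delta>)" by (rule lin_ell_exists[OF z q nc dL]) (rule that)
  have "lip a (vint g)\<le>LL.nr a * (exp (T / 2) * sqrt T * K1) * LL.nr \<delta>"
   using lip_vint_le[OF a linL[OF g(1)] b1[OF g dL]] by simp
  moreover have "lip r \<delta>\<le>LL.nr r * LL.nr \<delta>" using LL.cauchy_schwarz[OF rL dL] by simp
  ultimately show ?thesis using I0[OF d g] by (simp add: C1_def distrib_right)
 qed
 let ?R1 = "(%\<delta>. (\<delta>, - Tr.gip 1 1 l \<delta>)) ` Tr.gdom"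
 obtain w0 s0 where w0: "w0\<in>LL" "\<And>d r. (d, r)\<in>?R1 ==> lip w0 d = r" and "\<And>n::nat. s0 n\<in>fst ` ?R1" "nullseq (%n. LL.nr (s0 n - w0))"
 proof (rule LL.riesz_relation[of ?R1 C1])
  show "(0, 0)\<in>?R1" using T1.zero_mem T1.B_zero_right[OF lT] by (auto simp: image_iff intro!: bexI[of _ 0])
  show "d\<in>LL" if "(d, r)\<in>?R1" for d r using that Tr.gdom_V by auto
  show "(d + d', r + r')\<in>?R1" if "(d, r)\<in>?R1" "(d', r')\<in>?R1" for d r d' r'
   using that T1.add_mem T1.B_add_right[OF _ _ lT] by (auto simp: image_iff)
  show "(c *\<^sub>R d, c * r)\<in>?R1" if "(d, r)\<in>?R1" for c d r
   using that T1.scale_mem T1.B_scale_right[OF _ lT] by (auto simp: image_iff)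
  show "\<bar>r\<bar>\<le>C1 * LL.nr d" if "(d, r)\<in>?R1" for d r
  proof -
   have d: "d\<in>Tr.gdom" and r: "r = - Tr.gip 1 1 l d" using that by auto
   show ?thesis
    using low[OF d] low[OF T1.minus_mem[OF d]] T1.B_minus_right[OF d lT] LL.nr_minus[OF Tr.gdom_V[OF d]] r by simp
  qed
 qed (rule that)
 have w0l: "lip w0 \<delta> = - Tr.gip 1 1 l \<delta>" if "\<delta>\<in>Tr.gdom" for \<delta> using w0(2) that by blast
 \<comment> \<open>Density of H^1(0,T;L^2(\<Omega>)) in L^2 and the Lipschitz dependence of g on
   \<delta> extend the inequality.\<close>
 have I1: "0\<le>lip a (vint g) + lip (r - w0) \<delta>" if d: "\<delta>\<in>LL" and li: "lin z q \<psi> g" and e: "ell \<psi> (\<beta> *\<^sub>R vint g + \<delta>)" for \<delta> \<psi> g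
 proof -
  have rw: "r - w0\<in>LL" by (intro LL.diff_mem rL w0)
  obtain s where s: "\<And>n::nat. s n\<in>Tr.gdom" "nullseq (%n. LL.nr (s n - \<delta>))" by (rule Tr_gdom_dense[OF d]) (rule that)
  note sL = Tr.gdom_V[OF s(1)]
  have "\<exists>g \<psi>. lin z q \<psi> g\<and>ell \<psi> (\<beta> *\<^sub>R vint g + s n)" for n using lin_ell_exists[OF z q nc sL] by metis
  then obtain gs ps where gs: "\<And>n. lin z q (ps n) (gs n)" "\<And>n. ell (ps n) (\<beta> *\<^sub>R vint (gs n) + s n)" by metis
  have gl: "nullseq (%n. LL.nr (gs n - g))"
  proof (rule tendsto_zero_le[OF _ _ s(2)])
   show "0\<le>LL.nr (gs n - g)" for n by (intro LL.nr_nonneg LL.diff_mem linL[OF gs(1)] linL[OF li])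
   show "LL.nr (gs n - g)\<le>K1 * LL.nr (s n - \<delta>)" for n
    using st1[OF gs(1) gs(2) sL li e d] LL.nr_diff_commute[OF d sL] by simp
  qed
  have "(%n. lip a (vint (gs n)) + lip (s n) (r - w0)) \<longlonglongrightarrow> lip a (vint g) + lip \<delta> (r - w0)"
   by (intro tendsto_add lip_vint_tendsto[OF a linL[OF gs(1)] linL[OF li] gl] LL.B_tendsto[OF sL d rw s(2)])
  moreover have "0\<le>lip a (vint (gs n)) + lip (s n) (r - w0)" for n
   using I0[OF s(1)[of n] gs(1)[of n] gs(2)[of n]] w0l[OF s(1)[of n]] LL.B_diff[OF rL w0(1) sL[of n]] LL.B_sym[OF sL[of n] rw] by simp
  ultimately have "0\<le>lip a (vint g) + lip \<delta> (r - w0)" by (intro LIMSEQ_le_const) auto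
  then show ?thesis using LL.B_sym[OF d rw] by simp
 qed
 \<comment> \<open>The part of the adjoint state that is so far only in L^2; r already lies in
   L^2(0,T;H^1(\<Omega>)).\<close>
 define m where "m = w0 - r"
 define b where "b = jq + \<beta> *\<^sub>R w0"
 have m: "m\<in>LL" and b: "b\<in>LL" unfolding m_def b_def by (intro LL.diff_mem LL.add_mem LL.scale_mem w0 rL jq)+
 \<comment> \<open>Change of variable: \<psi> with elliptic right-hand side g0 is prescribed and
   \<delta> = g0 - \<beta> \<eta> is chosen accordingly. Such a \<delta> is merely in L^2, which the
   previous extension permits.\<close>
 have I2: "lip m g0\<le>lip b (vint g)" if li: "lin z q \<psi> g" and e: "ell \<psi> g0" for \<psi> g g0
 proof -
  note v = vint_LL[OF linL[OF li]] and gL = ell_LL[OF e]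
  have "0\<le>lip a (vint g) + lip (r - w0) (g0 - \<beta> *\<^sub>R vint g)"
   by (rule I1[OF LL.diff_mem[OF gL LL.scale_mem[OF v]] li]) (use e in simp)
  moreover have "lip (r - w0) (g0 - \<beta> *\<^sub>R vint g) = - lip m g0 + \<beta> * lip m (vint g)"
  proof -
   have "r - w0 = - m" by (simp add: m_def)
   then show ?thesis
    using LL.B_minus[OF m LL.diff_mem[OF gL LL.scale_mem[OF v, of \<beta>]]] LL.B_diff_right[OF gL LL.scale_mem[OF v, of \<beta>] m] LL.B_scale_right[OF v m, of \<beta>] by simp
  qed
  moreover have "lip a (vint g) + \<beta> * lip m (vint g) = lip b (vint g)"
  proof -
   have "b = a + \<beta> *\<^sub>R m" by (simp add: a_def b_def m_def scaleR_right_diff_distrib)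
   then show ?thesis using LL.B_add[OF a LL.scale_mem[OF m, of \<beta>] v] LL.B_scale[OF m v, of \<beta>] by simp
  qed
  ultimately show ?thesis by simp
 qed
 define C2 where "C2 = LL.nr b * (exp (T / 2) * sqrt T * K2)"
 \<comment> \<open>g depends on \<psi> only through \<open>lin\<close>, so it is bounded by the L^2
   norm of \<psi>, not by that of g0. The pairing of m with g0 is therefore an L^2-bounded
   functional of \<psi>.\<close>
 have low2: "lip m g0\<le>C2 * LL.nr \<psi>" if e: "ell \<psi> g0" for \<psi> g0
 proof -
  obtain g where g: "lin z q \<psi> g" by (rule lin_exists[OF z q nc ell_LL'[OF e]]) (rule that)
  show ?thesis using I2[OF g e] lip_vint_le[OF b linL[OF g] b2[OF g ell_LL'[OF e]]] by (simp add: C2_def)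
 qed
 let ?R2 = "{(\<psi>, lip m g0) |\<psi> g0. ell \<psi> g0}"
 obtain \<nu> s1 where nu: "\<nu>\<in>LL" "\<And>d r. (d, r)\<in>?R2 ==> lip \<nu> d = r" and "\<And>n::nat. s1 n\<in>fst ` ?R2" "nullseq (%n. LL.nr (s1 n - \<nu>))"
 proof (rule LL.riesz_relation[of ?R2 C2])
  show "(0, 0)\<in>?R2" using ell_zero LL.B_zero_right[OF m] by force
  show "d\<in>LL" if "(d, r)\<in>?R2" for d r using that ell_LL' by auto
  show "(d + d', r + r')\<in>?R2" if R: "(d, r)\<in>?R2" "(d', r')\<in>?R2" for d r d' r'
  proof -
   obtain g g' where g: "ell d g" "r = lip m g" "ell d' g'" "r' = lip m g'" using R by blast
   then have "ell (d + d') (g + g')" "r + r' = lip m (g + g')"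
    using ell_add LL.B_add_right[OF ell_LL[OF g(1)] ell_LL[OF g(3)] m] by auto
   then show ?thesis by blast
  qed
  show "(c *\<^sub>R d, c * r)\<in>?R2" if R: "(d, r)\<in>?R2" for c d r
  proof -
   obtain g where g: "ell d g" "r = lip m g" using R by blast
   then have "ell (c *\<^sub>R d) (c *\<^sub>R g)" "c * r = lip m (c *\<^sub>R g)"
    using ell_scale LL.B_scale_right[OF ell_LL[OF g(1)] m] by auto
   then show ?thesis by blast
  qed
  show "\<bar>r\<bar>\<le>C2 * LL.nr d" if R: "(d, r)\<in>?R2" for d r
  proof -
   obtain g where g: "ell d g" "r = lip m g" using R by blast
   have "ell (- d) (- g)" using ell_scale[OF g(1), of "-1"] by simp
   from low2[OF this] low2[OF g(1)] show ?thesis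
    using LL.nr_minus[OF ell_LL'[OF g(1)]] LL.B_minus_right[OF ell_LL[OF g(1)] m] g(2) by simp
  qed
 qed (rule that)
 have nul: "lip \<nu> \<psi> = lip m g0" if "ell \<psi> g0" for \<psi> g0 using nu(2) that by blast
 \<comment> \<open>Elliptic solutions are dense in L^2 and g depends continuously on \<psi>, so
   \<psi> is now arbitrary and no longer tied to an elliptic equation.\<close>
 have I3: "lip \<nu> \<psi>\<le>lip b (vint g)" if ps: "\<psi>\<in>LL" and li: "lin z q \<psi> g" for \<psi> g
 proof -
  obtain s where s: "\<And>n::nat. \<exists>g. ell (s n) g" "nullseq (%n. LL.nr (s n - \<psi>))" by (rule ell_range_dense[OF ps]) (rule that)
  have sL: "s n\<in>LL" for n using s(1) ell_LL' by blast
  obtain hs where hs: "\<And>n. ell (s n) (hs n)" using s(1) by metis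
  have "\<exists>g. lin z q (s n) g" for n using lin_exists[OF z q nc sL] by metis
  then obtain gs where gs: "\<And>n. lin z q (s n) (gs n)" by metis
  have gl: "nullseq (%n. LL.nr (gs n - g))"
  proof (rule tendsto_zero_le[OF _ _ s(2)])
   show "0\<le>LL.nr (gs n - g)" for n by (intro LL.nr_nonneg LL.diff_mem linL[OF gs(1)] linL[OF li])
   show "LL.nr (gs n - g)\<le>K2 * LL.nr (s n - \<psi>)" for n
    using st2[OF gs sL li ps] LL.nr_diff_commute[OF ps sL] by simp
  qed
  have "(%n. lip b (vint (gs n)) - lip (s n) \<nu>) \<longlonglongrightarrow> lip b (vint g) - lip \<psi> \<nu>"
   by (intro tendsto_diff lip_vint_tendsto[OF b linL[OF gs(1)] linL[OF li] gl] LL.B_tendsto[OF sL ps nu(1) s(2)])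
  moreover have "0\<le>lip b (vint (gs n)) - lip (s n) \<nu>" for n
   using I2[OF gs hs] nul[OF hs] LL.B_sym[OF sL nu(1)] by simp
  ultimately have "0\<le>lip b (vint g) - lip \<psi> \<nu>" by (intro LIMSEQ_le_const) auto
  then show ?thesis using LL.B_sym[OF ps nu(1)] by simp
 qed
 obtain an where an: "ell an \<nu>" by (rule ell_exists[OF nu(1)]) (rule that)
 note anJ = ell_J[OF an] and anL = ell_LL'[OF an]
 define w where "w = r + an"
 have w: "w\<in>J.gdom" unfolding w_def by (intro J1.add_mem r anJ)
 note wL = J.gdom_V[OF w]
 \<comment> \<open>The representer \<nu> says that m is the elliptic solution with right-hand side
   \<nu>, by symmetry of the solution operator; hence the L^2 representer \<open>w0\<close> equals w
   = r + \<open>an\<close>, which lies in L^2(0,T;H^1(\<Omega>)).\<close>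
 have ww: "LL.nr (w0 - w) = 0"
 proof (rule LL.nr_eq_zeroI[OF LL.diff_mem[OF w0(1) wL]])
  fix g0 assume g0: "g0\<in>LL"
  obtain \<psi> where e: "ell \<psi> g0" by (rule ell_exists[OF g0]) (rule that)
  have "lip m g0 = lip an g0" using nul[OF e] ell_sym[OF e an] LL.B_sym[OF g0 anL] by simp
  moreover have "w0 - w = m - an" by (simp add: m_def w_def)
  ultimately show "lip (w0 - w) g0 = 0" using LL.B_diff[OF m anL g0] by simp
 qed
 define \<mu> where "\<mu> = (1 / \<beta>) *\<^sub>R \<nu>"
 have mu: "\<mu>\<in>LL" unfolding \<mu>_def by (intro LL.scale_mem nu)
 have numu: "\<nu> = \<beta> *\<^sub>R \<mu>" using \<beta>_pos by (simp add: \<mu>_def)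
 define F where "F = hilbert_adjoint T \<Omega> (dF q) \<mu>"
 note F = hilbert_adjoint_dF[OF q nc mu, folded F_def]
 \<comment> \<open>The residual of the first adjoint equation without the time derivative of \<xi>.
   Its backward primitive \<xi> satisfies that equation and the terminal condition at once.\<close>
 define \<rho> where "\<rho> = jq + \<beta> *\<^sub>R (w - \<mu>) - F"
 have rho: "\<rho>\<in>LL" unfolding \<rho>_def by (intro LL.diff_mem LL.add_mem LL.scale_mem jq wL mu F(1))
 define \<xi> where "\<xi> = vintR \<rho>"
 have xi: "\<xi>\<in>LL" unfolding \<xi>_def by (rule vintR_LL[OF rho])
 have ineq: "lip \<mu> h\<le>lip (mxd z h) \<xi>" if h: "h\<in>LL" for h
 proof -
  let ?g = "mxd z h"
  have g: "?g\<in>LL" by (rule mxd_LL[OF z h])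
  note v = vint_LL[OF g]
  note dv = dF_LL[OF q q nc v]
  \<comment> \<open>Given h, the rate g is \<open>mxd z h\<close> and \<psi> is solved from h =
    -\<beta>(\<eta> - \<psi>) - \<open>dF q\<close> \<eta>; this division is where \<beta> > 0 makes
    the argument of the maximum fully controllable.\<close>
  define \<psi> where "\<psi> = (1 / \<beta>) *\<^sub>R (h + \<beta> *\<^sub>R vint ?g + dF q (vint ?g))"
  have hs: "h + \<beta> *\<^sub>R vint ?g + dF q (vint ?g)\<in>LL" by (intro LL.add_mem LL.scale_mem h v dv)
  have ps: "\<psi>\<in>LL" unfolding \<psi>_def by (intro LL.scale_mem hs)
  have bp: "\<beta> *\<^sub>R \<psi> = h + \<beta> *\<^sub>R vint ?g + dF q (vint ?g)" using \<beta>_pos by (simp add: \<psi>_def)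
  have "(- \<beta>) *\<^sub>R (vint ?g - \<psi>) - dF q (vint ?g) = \<beta> *\<^sub>R \<psi> - \<beta> *\<^sub>R vint ?g - dF q (vint ?g)" by (simp add: scaleR_right_diff_distrib)
  also have "\<dots> = h" unfolding bp by simp
  finally have arg: "(- \<beta>) *\<^sub>R (vint ?g - \<psi>) - dF q (vint ?g) = h" .
  have "lin z q \<psi> ?g" unfolding lin_def arg using g by (simp add: LL.nr_zero)
  from I3[OF ps this] have 1: "lip \<nu> \<psi>\<le>lip b (vint ?g)" .
  have "lip \<nu> \<psi> = lip \<mu> (\<beta> *\<^sub>R \<psi>)" unfolding numu using LL.B_scale[OF mu ps, of \<beta>] LL.B_scale_right[OF ps mu, of \<beta>] by simp
  also have "\<dots> = lip \<mu> h + \<beta> * lip \<mu> (vint ?g) + lip \<mu> (dF q (vint ?g))"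
   unfolding bp using LL.B_add_right[OF LL.add_mem[OF h LL.scale_mem[OF v, of \<beta>]] dv mu] LL.B_add_right[OF h LL.scale_mem[OF v, of \<beta>] mu]
    LL.B_scale_right[OF v mu, of \<beta>] by simp
  finally have 2: "lip \<nu> \<psi> = lip \<mu> h + \<beta> * lip \<mu> (vint ?g) + lip \<mu> (dF q (vint ?g))" .
  have 3: "lip b (vint ?g) = lip jq (vint ?g) + \<beta> * lip w (vint ?g)"
   unfolding b_def using LL.B_add[OF jq LL.scale_mem[OF w0(1), of \<beta>] v] LL.B_scale[OF w0(1) v, of \<beta>] LL.B_cong_left[OF w0(1) wL v ww] by simp
  have wm: "w - \<mu>\<in>LL" by (intro LL.diff_mem wL mu)
  have "lip \<rho> (vint ?g) = lip jq (vint ?g) + \<beta> * lip (w - \<mu>) (vint ?g) - lip F (vint ?g)"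
   unfolding \<rho>_def using LL.B_diff[OF LL.add_mem[OF jq LL.scale_mem[OF wm, of \<beta>]] F(1) v] LL.B_add[OF jq LL.scale_mem[OF wm, of \<beta>] v] LL.B_scale[OF wm v, of \<beta>] by simp
  then have "lip \<rho> (vint ?g) = lip jq (vint ?g) + \<beta> * lip w (vint ?g) - \<beta> * lip \<mu> (vint ?g) - lip \<mu> (dF q (vint ?g))"
   using LL.B_diff[OF wL mu v] F(2)[OF v] by (simp add: right_diff_distrib)
  then have "lip \<mu> h\<le>lip \<rho> (vint ?g)" using 1 2 3 by simp
  then show ?thesis using vint_adjoint[OF g rho] by (simp add: \<xi>_def)
 qed
 have cp: "compl z \<xi> \<mu>" by (rule ineq_imp_compl[OF z xi mu ineq])
 have "os l q \<phi> \<xi> w \<mu>"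
  unfolding optimality_system_def energy_fun
 proof (intro conjI)
  show "\<xi>\<in>elems (H1L2_vanishing T \<Omega> T)" unfolding \<xi>_def by (rule vintR_vanishing[OF rho])
  show "w\<in>elems (L2H1 T \<Omega>)" using w by (simp add: elems_L2H1)
  \<comment> \<open>\<mu> is constructed in L^2 only; the pointwise conditions dominate it by
    \<xi>/\<epsilon>, and \<xi> is bounded in time.\<close>
  have "AE p in MC. \<bar>case_prod \<mu> p\<bar>\<le>1 / \<epsilon> * \<bar>case_prod \<xi> p\<bar>"
   using cp unfolding compl_def
  proof eventually_elim
   case (elim p)
   consider "case_prod z p > 0" | "case_prod z p < 0" | "case_prod z p = 0" by linarith
   then show ?case
   proof cases
    case 1
    then show ?thesis using elim \<epsilon>_pos by (simp add: abs_mult)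
   next
    case 2
    then show ?thesis using elim \<epsilon>_pos by simp
   next
    case 3
    then have "0\<le>case_prod \<mu> p" "case_prod \<mu> p\<le>1 / \<epsilon> * case_prod \<xi> p" using elim by auto
    moreover have "1 / \<epsilon> * case_prod \<xi> p\<le>1 / \<epsilon> * \<bar>case_prod \<xi> p\<bar>" using \<epsilon>_pos by (intro mult_left_mono) auto
    ultimately show ?thesis by linarith
   qed
  qed
  then have "AE t in MT. X.nr (\<mu> t)\<le>1 / \<epsilon> * X.nr (\<xi> t)" using \<epsilon>_pos by (intro slice_nr_mono mu xi) auto
  then have "AE t in MT. X.nr (\<mu> t)\<le>1 / \<epsilon> * (2 * (sqrt T * LL.nr \<rho>))"
  proof eventually_elim
   case (elim t)
   have "1 / \<epsilon> * X.nr (\<xi> t)\<le>1 / \<epsilon> * (2 * (sqrt T * LL.nr \<rho>))"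
    unfolding \<xi>_def using \<epsilon>_pos by (intro mult_left_mono vintR_bounded rho) auto
   with elim show ?case by simp
  qed
  then show "\<mu>\<in>Linf_fun T \<Omega> (L2 \<Omega>)"
   unfolding Linf_fun_def using LL_strongly_measurable[OF mu] LL_meas[OF mu]
   by (auto simp: nrm_L2_X jointly_measurable_def cylinder_def)
  have xt: "trel \<xi> (- \<rho>)" unfolding \<xi>_def by (rule vintR_trel[OF rho])
  note td = trel_time_deriv[OF Tr_gdomI[OF xt]]
  let ?x = "time_deriv T \<Omega> \<xi>" and ?u = "- time_deriv T \<Omega> \<xi> - \<beta> *\<^sub>R (w - \<mu>) + F"
  note xL = trel_LL(2)[OF td]
  have uL: "?u\<in>LL" by (intro LL.add_mem LL.diff_mem LL.minus_mem LL.scale_mem xL wL mu F(1))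
  \<comment> \<open>\<open>time_deriv\<close> chooses its own representative, which agrees with the
    explicit derivative -\<rho> of \<xi> up to a null function.\<close>
  have "LL.nr (?u - jq) = 0"
  proof -
   have d: "?x - (- \<rho>)\<in>LL" by (intro LL.diff_mem LL.minus_mem xL rho)
   have e: "?u - jq = - (?x - (- \<rho>))" by (simp add: \<rho>_def)
   show ?thesis unfolding e LL.nr_minus[OF d] by (rule trel_unique[OF td xt])
  qed
  then have "lip ?u \<eta> = Dj (q, \<phi>) (\<eta>, 0)" if "\<eta>\<in>LL" for \<eta>
   using LL.B_cong_left[OF uL jq that] Dq[OF that] by simp
  then show "eq_in_L2L2 T \<Omega> (- time_deriv T \<Omega> \<xi> - \<beta> *\<^sub>R (w - \<mu>) + hilbert_adjoint T \<Omega> (dF q) \<mu>) (%\<eta>. Dj (q, \<phi>) (\<eta>, 0))"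
   unfolding eq_in_L2L2_def LL_elems F_def[symmetric] using uL by (simp add: L2L2_inner_eq[OF uL])
  have "ipE w \<psi> - \<beta> * lip \<mu> \<psi> = Dj (q, \<phi>) (0, \<psi>)" if ps: "\<psi>\<in>J.gdom" for \<psi>
  proof -
   have "ipE w \<psi> = ipE r \<psi> + lip \<nu> \<psi>"
    unfolding w_def using JA.B_add[OF r anJ ps] ell_test[OF an ps] by simp
   then show ?thesis using Dr[OF ps] LL.B_scale[OF mu J.gdom_V[OF ps], of \<beta>] by (simp add: numu)
  qed
  then show "eq_in_L2H1dual T \<Omega> (%t. energy (w t) (\<mu> t)) (%\<psi>. Dj (q, \<phi>) (0, \<psi>))"
   unfolding eq_in_L2H1dual_def elems_L2H1 using energy_L2_dual[OF w mu] energy_integral[OF w mu] by simp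
  show "\<forall>\<delta>l\<in>elems (H1L2 T \<Omega>). L2L2_inner T \<Omega> w \<delta>l + H1L2_inner T \<Omega> l \<delta>l = 0"
   unfolding elems_H1L2
  proof
   fix \<delta> assume d: "\<delta>\<in>Tr.gdom"
   note dL = Tr.gdom_V[OF d]
   show "L2L2_inner T \<Omega> w \<delta> + H1L2_inner T \<Omega> l \<delta> = 0"
    using L2L2_inner_eq[OF wL dL] H1L2_inner_eq[OF lT d] w0l[OF d] LL.B_cong_left[OF w0(1) wL dL ww] by simp
  qed
 qed (use cp in \<open>auto simp: compl_iff z_def\<close>)
 then show ?thesis by (rule that)
qed

end

theorem corollary3p16:
  fixes T \<alpha> \<beta> \<epsilon> :: real
    and \<Omega> :: "(real^'n) set"
    and \<H> :: "(real \<Rightarrow> real^'n \<Rightarrow> real) \<Rightarrow> (real \<Rightarrow> real^'n \<Rightarrow> real)"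
    and f :: "real \<Rightarrow> real"
    and L\<^sub>H L\<^sub>H' L\<^sub>f n\<^sub>f :: real
    and j :: "(real \<Rightarrow> real^'n \<Rightarrow> real) \<times> (real \<Rightarrow> real^'n \<Rightarrow> real) \<Rightarrow> real"
    and S :: "(real \<Rightarrow> (real^'n \<Rightarrow> real) \<Rightarrow> real)
      \<Rightarrow> (real \<Rightarrow> real^'n \<Rightarrow> real) \<times> (real \<Rightarrow> real^'n \<Rightarrow> real)"
  assumes "T > 0" and "\<alpha> > 0" and "\<beta> > 0" and "\<epsilon> > 0"
    and "CARD('n) = 2 \<or> CARD('n) = 3"
    and "bounded_lipschitz_domain \<Omega>"
    and "history_operator T \<Omega> L\<^sub>H L\<^sub>H' \<H>"
    and "nonsmooth_function L\<^sub>f n\<^sub>f f"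
    and "continuously_frechet_differentiable (prod_space (L2L2 T \<Omega>) (L2H1 T \<Omega>)) real_space j"
    and "S = solution_map T \<Omega> \<alpha> \<beta> \<epsilon> f \<H>"
  shows
    "(\<forall>l q \<phi>.
        locally_optimal T \<Omega> S j l \<and> (q, \<phi>) = S (embed_dual \<Omega> l) \<and> null_contact T \<Omega> \<H> n\<^sub>f q \<longrightarrow>
        (\<exists>\<xi> w \<mu>. optimality_system T \<Omega> \<alpha> \<beta> \<epsilon> f \<H> j l q \<phi> \<xi> w \<mu> \<and>
          (\<forall>\<xi>' w' \<mu>'. optimality_system T \<Omega> \<alpha> \<beta> \<epsilon> f \<H> j l q \<phi> \<xi>' w' \<mu>' \<longrightarrow>
            eq_ae T \<Omega> \<xi>' \<xi> \<and> eq_ae T \<Omega> w' w \<and> eq_ae T \<Omega> \<mu>' \<mu>))) \<and>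
     (\<forall>l q \<phi> \<xi> w \<mu>.
        l \<in> elems (H1L2 T \<Omega>) \<and> (q, \<phi>) = S (embed_dual \<Omega> l) \<and> null_contact T \<Omega> \<H> n\<^sub>f q \<and>
        optimality_system T \<Omega> \<alpha> \<beta> \<epsilon> f \<H> j l q \<phi> \<xi> w \<mu> \<longrightarrow>
        (\<forall>\<delta>l\<in>elems (H1L2 T \<Omega>).
          deriv_j T \<Omega> j (S (embed_dual \<Omega> l))
            (dir_deriv (prod_space (H1L2_vanishing T \<Omega> 0) (L2H1 T \<Omega>)) S
              (embed_dual \<Omega> l) (embed_dual \<Omega> \<delta>l)) +
          H1L2_inner T \<Omega> l \<delta>l \<ge> 0))"
proof -
 interpret problem T \<Omega> \<alpha> \<beta> \<H> L\<^sub>H L\<^sub>H' \<epsilon> f L\<^sub>f n\<^sub>f j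
  using assms by unfold_locales (auto simp: bounded_lipschitz_domain_def)
 have S: "S = solution_map T \<Omega> \<alpha> \<beta> \<epsilon> f \<H>" by (rule assms(10))
 have st: "q\<in>LL\<and>\<phi>\<in>J.gdom" if "l\<in>Tr.gdom" "(q, \<phi>) = S (embed_dual \<Omega> l)" for l q \<phi>
  using solution_state_embed[OF Tr.gdom_V[OF that(1)]] that(2) stateD(5,6) unfolding S by (metis fst_conv snd_conv)
 show ?thesis
 proof (intro conjI allI impI ballI; elim conjE)
  fix l q \<phi>
  assume lo: "locally_optimal T \<Omega> S j l" and qp: "(q, \<phi>) = S (embed_dual \<Omega> l)" and nc: "null_contact T \<Omega> \<H> n\<^sub>f q"
  have lT: "l\<in>Tr.gdom" using lo by (simp add: locally_optimal_def elems_H1L2)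
  have q: "q\<in>LL" and p: "\<phi>\<in>J.gdom" using st[OF lT qp] by auto
  obtain \<xi> w \<mu> where o: "optimality_system T \<Omega> \<alpha> \<beta> \<epsilon> f \<H> j l q \<phi> \<xi> w \<mu>"
   by (rule necessary[OF lT q p nc optimality_inequality[OF lo[unfolded S] qp[unfolded S] nc]]) (assumption | rule that)+
  note A = optimality_system_adj[OF o q nc lT]
  have "eq_ae T \<Omega> \<xi>' \<xi>\<and>eq_ae T \<Omega> w' w\<and>eq_ae T \<Omega> \<mu>' \<mu>"
   if o': "optimality_system T \<Omega> \<alpha> \<beta> \<epsilon> f \<H> j l q \<phi> \<xi>' w' \<mu>'" for \<xi>' w' \<mu>'
  proof -
   note B = optimality_system_adj[OF o' q nc lT]
   note mA = adjD(1-3)[OF A] and mB = adjD(1-3)[OF B]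
   show ?thesis
    using adj_unique[OF A B q nc] eq_ae_iff_nr[OF mB(1) mA(1)] eq_ae_iff_nr[OF J.gdom_V[OF mB(2)] J.gdom_V[OF mA(2)]]
     eq_ae_iff_nr[OF mB(3) mA(3)] by simp
  qed
  with o show "\<exists>\<xi> w \<mu>. optimality_system T \<Omega> \<alpha> \<beta> \<epsilon> f \<H> j l q \<phi> \<xi> w \<mu> \<and>
     (\<forall>\<xi>' w' \<mu>'. optimality_system T \<Omega> \<alpha> \<beta> \<epsilon> f \<H> j l q \<phi> \<xi>' w' \<mu>' \<longrightarrow>
      eq_ae T \<Omega> \<xi>' \<xi>\<and>eq_ae T \<Omega> w' w\<and>eq_ae T \<Omega> \<mu>' \<mu>)" by blast
 next
  fix l q \<phi> \<xi> w \<mu> \<delta>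
  assume "\<delta>\<in>elems (H1L2 T \<Omega>)" "l\<in>elems (H1L2 T \<Omega>)" and qp: "(q, \<phi>) = S (embed_dual \<Omega> l)"
   and nc: "null_contact T \<Omega> \<H> n\<^sub>f q" and o: "optimality_system T \<Omega> \<alpha> \<beta> \<epsilon> f \<H> j l q \<phi> \<xi> w \<mu>"
  then have d: "\<delta>\<in>Tr.gdom" and lT: "l\<in>Tr.gdom" by (auto simp: elems_H1L2)
  note dL = Tr.gdom_V[OF d] and lL = Tr.gdom_V[OF lT]
  have q: "q\<in>LL" and p: "\<phi>\<in>J.gdom" using st[OF lT qp] by auto
  have pV: "(q, \<phi>)\<in>LL\<times>J.gdom" using q p by simp
  note z = zf_LL[OF q J.gdom_V[OF p]]
  obtain g \<psi> where g: "lin (zf q \<phi>) q \<psi> g" "ell \<psi> (\<beta> *\<^sub>R vint g + \<delta>)" by (rule lin_ell_exists[OF z q nc dL]) (rule that)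
  have gL: "g\<in>LL" using g(1) by (simp add: lin_def)
  let ?d = "dir_deriv (prod_space (H1L2_vanishing T \<Omega> 0) (L2H1 T \<Omega>)) S (embed_dual \<Omega> l) (embed_dual \<Omega> \<delta>)"
  note D = dir_deriv_solution[OF lL dL qp[unfolded S] nc g, folded S]
  have vT: "vint g\<in>Tr.gdom" by (rule Tr_gdomI[OF vint_trel[OF gL]])
  \<comment> \<open>The chosen directional derivative and (\<open>vint g\<close>, \<psi>) differ by
    an element of seminorm zero, on which the derivative of j vanishes.\<close>
  have "LL.nr (fst ?d - vint g) = 0"
   using LL_nr_le_T1[OF T1.diff_mem[OF D(1) vT]] D(3) LL.nr_nonneg[OF LL.diff_mem[OF Tr.gdom_V[OF D(1)] Tr.gdom_V[OF vT]]] by simp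
  then have "Dj (q, \<phi>) (fst ?d, snd ?d) = Dj (q, \<phi>) (vint g, \<psi>)"
   by (rule Dj_cong[OF pV Tr.gdom_V[OF D(1)] Tr.gdom_V[OF vT] D(2) ell_J[OF g(2)] _ D(4)])
  then show "0\<le>deriv_j T \<Omega> j (S (embed_dual \<Omega> l)) ?d + H1L2_inner T \<Omega> l \<delta>"
   using adj_sufficient[OF optimality_system_adj[OF o q nc lT] q p nc d g] H1L2_inner_eq[OF lT d] by (simp flip: qp)
 qed
qed

end
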